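(* Let $d\ge1$, let $(k,\ell)$ be a pair of normalized diagonal holomorphic kernels on a domain $\Omega\subseteq\mathbb{C}^d$ with $\mathbf{0}\in\Omega$, and let $\vartheta$ denote the master certificate associated with $k$. If $(k,\ell)$ is a complete Pick pair, then $$\Omega\subseteq\Omega_\ell\subseteq\Omega_\vartheta^1\subseteq\Omega_k.$$ Moreover, the following are equivalent: (i) $(k,\ell)$ is a complete Pick pair on $\Omega$; (ii) $(k,\ell)$ has a Shimorin certificate on $\Omega$; (iii) $(k,\ell)$ has a strong Shimorin certificate on $\Omega$; (iv) $s(z,w)=\dfrac{1}{1-\vartheta(z\overline{w})}$ is a strong Shimorin certificate for $(k,\ell)$ on $\Omega$; (v) there exists a positive kernel $g$ on $\Omega$ such that $\ell(z,w)=\dfrac{g(z,w)}{1-\vartheta(z\overline{w})}$ on $\Omega$.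
   Context: A (positive) kernel on a non-empty set $X$ is a function $k:X\times X\to\mathbb{C}$ such that $[k(z_i,z_j)]_{i,j=1}^n$ is positive semi-definite for all finite choices of points; $k_1\succeq k_2$ (or $k_2\preceq k_1$) means $k_1-k_2$ is a kernel; $\mathcal{H}_k$ is the reproducing kernel Hilbert space. $\mathrm{Mult}(\mathcal{H}_k\otimes\mathbb{C}^N,\mathcal{H}_\ell\otimes\mathbb{C}^N)$ is the set of $\Phi:X\to\mathbb{M}_N$ (complex $N\times N$ matrices) with $\Phi f\in\mathcal{H}_\ell\otimes\mathbb{C}^N$ for all $f\in\mathcal{H}_k\otimes\mathbb{C}^N$, normed by the operator norm of $f\mapsto\Phi f$. $(k,\ell)$ is a complete Pick pair on $X$ if for all $n,N\ge1$, all $z_1,\dots,z_n\in X$ and all $W_1,\dots,W_n\in\mathbb{M}_N$ with $[\ell(z_i,z_j)I_{N\times N}-k(z_i,z_j)W_iW_j^*]_{i,j=1}^n$ positive semi-definite, there is $\Phi\in\mathrm{Mult}(\mathcal{H}_k\otimes\mathbb{C}^N,\mathcal{H}_\ell\otimes\mathbb{C}^N)$ of norm at most one with $\Phi(z_i)=W_i$ for all $i$. A kernel $s$ is a complete Pick kernel if $(s,s)$ is a complete Pick pair. For a kernel $k$ with $k(z,z)\ne0$, $k^z(w,v)=k(w,v)-\frac{k(w,z)k(z,v)}{k(z,z)}$. A Shimorin certificate for $(k,\ell)$ on $X$ is a family of kernels $\{p[z]\}_{z\in X}$ on $X$ such that $\ell^z\succeq p[z]\ell$ and $k^z\preceq p[z]k$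 for every $z\in X$ (pointwise products). A strong Shimorin certificate for $(k,\ell)$ on $X$ is a complete Pick kernel $s$ on $X$ for which there are kernels $h,g$ on $X$ with $k=(1-h)s$ and $\ell=sg$. A domain is open, connected and non-empty. $\mathbb{N}$ includes $0$; for $a\in\mathbb{N}^d$, $|a|=\sum a_j$; for $z,w\in\mathbb{C}^d$, $z\overline{w}=(z_1\overline{w_1},\dots,z_d\overline{w_d})$. A normalized diagonal holomorphic kernel on a domain $\Omega\ni\mathbf{0}$ is a kernel $f$ on $\Omega$, holomorphic in $z$ and conjugate holomorphic in $w$, whose power series at $\mathbf{0}$ has the form $f(z,w)=\sum_{a\in\mathbb{N}^d}f_az^a\overline{w}^a$ with all $f_a>0$ and $f_{\mathbf{0}}=1$. The master certificate associated with $k$ is the formal power series $\vartheta(x)=\sum_{b\in\mathbb{N}^d}\vartheta_bx^b$ with $\vartheta_{\mathbf{0}}=0$, $\vartheta_{e_j}=k_{e_j}$ for $1\le j\le d$, and, recursively for $|b|\ge2$, $$\vartheta_b=\max\Big\{0,\;k_b-\sum_{w+u=b,\;w,u\ne\mathbf{0}}\vartheta_wk_u\Big\}.$$ For $f=\sum_a f_a z^a\overline{w}^a$ (or $f(x)=\sum_af_ax^a$) with $f_a\ge0$, $\Omega_f=\bigcup_{r>0}\{x\in\mathbb{C}^d:\sum_af_a|y|^{2a}<\infty\text{ for all }y\text{ with }\|x-y\|<r\}$, where $|y|=(|y_1|,\dots,|y_d|)$. Also $\Omega_\vartheta^1=\{x\in\Omega_\vartheta:\sum_{a\ne\mathbf{0}}\vartheta_a|x|^{2a}<1\}$.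 Statements (iv) and (v) are understood to include that $1/(1-\vartheta(z\overline{w}))$ is defined for $z,w\in\Omega$. *)

theory Defs
  imports
    "HOL-Analysis.Analysis"
    "Jordan_Normal_Form.Matrix"
    "Jordan_Normal_Form.Schur_Decomposition"
begin

(* Points of C^d have type complex ^ 'n with d = CARD('n), and multi-indices have type nat ^ 'n.
   Matrices and vectors whose size N is quantified over are Jordan_Normal_Form matrices and
   vectors; $ is reserved for the former kind of vector. *)
no_notation vec_index (infixl \<open>$\<close> 100)
notation vec_index (infixl \<open>$v\<close> 100)
hide_const (open) Matrix.vec


section \<open>Positive kernels\<close>

(* The order on complex is that of HOL-Library.Complex_Order: 0 \<le> c means that c is real and
   nonnegative. In particular the condition forces A to be Hermitian. *)
definition positive_semidefinite :: "nat \<Rightarrow> complex mat \<Rightarrow> bool" where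
  "positive_semidefinite m A \<longleftrightarrow>
     A \<in> carrier_mat m m \<and> (\<forall>v\<in>carrier_vec m. 0 \<le> (A *\<^sub>v v) \<bullet>c v)"

(* Kernels on X are total functions; only their values on X \<times> X matter. *)
definition is_kernel :: "'x set \<Rightarrow> ('x \<Rightarrow> 'x \<Rightarrow> complex) \<Rightarrow> bool" where
  "is_kernel X k \<longleftrightarrow>
     (\<forall>n z. (\<forall>i<n. z i \<in> X) \<longrightarrow>
        positive_semidefinite n (mat n n (\<lambda>(i, j). k (z i) (z j))))"

definition kernel_le :: "'x set \<Rightarrow> ('x \<Rightarrow> 'x \<Rightarrow> complex) \<Rightarrow> ('x \<Rightarrow> 'x \<Rightarrow> complex) \<Rightarrow> bool" where
  "kernel_le X k1 k2 \<longleftrightarrow> is_kernel X (\<lambda>z w. k2 z w - k1 z w)"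


section \<open>Reproducing kernel Hilbert spaces\<close>

(* A complex Hilbert space of functions on X. A function on X is represented by its extension
   by 0, so that equality on X is equality of functions. *)
locale hilbert_function_space =
  fixes X :: "'x set"
    and H :: "('x \<Rightarrow> complex) set"
    and ip :: "('x \<Rightarrow> complex) \<Rightarrow> ('x \<Rightarrow> complex) \<Rightarrow> complex"
  assumes support: "f \<in> H \<Longrightarrow> x \<notin> X \<Longrightarrow> f x = 0"
    and zero_mem: "(\<lambda>x. 0) \<in> H"
    and add_mem: "f \<in> H \<Longrightarrow> g \<in> H \<Longrightarrow> (\<lambda>x. f x + g x) \<in> H"
    and scale_mem: "f \<in> H \<Longrightarrow> (\<lambda>x. c * f x) \<in> H"
    and ip_add: "f \<in> H \<Longrightarrow> g \<in> H \<Longrightarrow> h \<in> H \<Longrightarrow> ip (\<lambda>x. f x + g x) h = ip f h + ip g h"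
    and ip_scale: "f \<in> H \<Longrightarrow> g \<in> H \<Longrightarrow> ip (\<lambda>x. c * f x) g = c * ip f g"
    and ip_cnj: "f \<in> H \<Longrightarrow> g \<in> H \<Longrightarrow> ip g f = cnj (ip f g)"
    and ip_nonneg: "f \<in> H \<Longrightarrow> 0 \<le> ip f f"
    and ip_definite: "f \<in> H \<Longrightarrow> ip f f = 0 \<Longrightarrow> f = (\<lambda>x. 0)"
    and complete:
      "\<lbrakk>\<And>n::nat. F n \<in> H;
        \<And>e::real. 0 < e \<Longrightarrow> \<exists>M. \<forall>m\<ge>M. \<forall>n\<ge>M.
           sqrt (Re (ip (\<lambda>x. F m x - F n x) (\<lambda>x. F m x - F n x))) < e\<rbrakk>
       \<Longrightarrow> \<exists>f\<in>H. (\<lambda>n. sqrt (Re (ip (\<lambda>x. F n x - f x) (\<lambda>x. F n x - f x)))) \<longlonglongrightarrow> 0"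

definition is_rkhs ::
  "'x set \<Rightarrow> ('x \<Rightarrow> 'x \<Rightarrow> complex) \<Rightarrow>
   ('x \<Rightarrow> complex) set \<times> (('x \<Rightarrow> complex) \<Rightarrow> ('x \<Rightarrow> complex) \<Rightarrow> complex) \<Rightarrow> bool" where
  "is_rkhs X k \<HH> \<longleftrightarrow> (case \<HH> of (H, ip) \<Rightarrow>
     hilbert_function_space X H ip \<and>
     (\<forall>w\<in>X. (\<lambda>z. if z \<in> X then k z w else 0) \<in> H) \<and>
     (\<forall>w\<in>X. \<forall>f\<in>H. ip f (\<lambda>z. if z \<in> X then k z w else 0) = f w))"

(* By the Moore-Aronszajn theorem, for a kernel k the space and its inner product exist and are
   unique, up to the irrelevant values of the inner product outside the space; hence SOME. *)
definition rkhs ::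
  "'x set \<Rightarrow> ('x \<Rightarrow> 'x \<Rightarrow> complex) \<Rightarrow>
   ('x \<Rightarrow> complex) set \<times> (('x \<Rightarrow> complex) \<Rightarrow> ('x \<Rightarrow> complex) \<Rightarrow> complex)" where
  "rkhs X k = (SOME \<HH>. is_rkhs X k \<HH>)"

definition rkhs_carrier :: "'x set \<Rightarrow> ('x \<Rightarrow> 'x \<Rightarrow> complex) \<Rightarrow> ('x \<Rightarrow> complex) set" where
  "rkhs_carrier X k = fst (rkhs X k)"

definition rkhs_inner ::
  "'x set \<Rightarrow> ('x \<Rightarrow> 'x \<Rightarrow> complex) \<Rightarrow> ('x \<Rightarrow> complex) \<Rightarrow> ('x \<Rightarrow> complex) \<Rightarrow> complex" where
  "rkhs_inner X k = snd (rkhs X k)"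

(* The tensor product of the RKHS with C^N, identified as usual with the C^N-valued functions
   with components in the RKHS, the orthogonal direct sum of N copies of it. *)
definition rkhs_vec :: "'x set \<Rightarrow> ('x \<Rightarrow> 'x \<Rightarrow> complex) \<Rightarrow> nat \<Rightarrow> ('x \<Rightarrow> complex Matrix.vec) set" where
  "rkhs_vec X k N =
     {f. (\<forall>x. f x \<in> carrier_vec N) \<and> (\<forall>i<N. (\<lambda>x. f x $v i) \<in> rkhs_carrier X k)}"

definition rkhs_vec_norm ::
  "'x set \<Rightarrow> ('x \<Rightarrow> 'x \<Rightarrow> complex) \<Rightarrow> nat \<Rightarrow> ('x \<Rightarrow> complex Matrix.vec) \<Rightarrow> real" where
  "rkhs_vec_norm X k N f =
     sqrt (\<Sum>i<N. Re (rkhs_inner X k (\<lambda>x. f x $v i) (\<lambda>x. f x $v i)))"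


section \<open>Multipliers and complete Pick pairs\<close>

definition mult_op ::
  "'x set \<Rightarrow> nat \<Rightarrow> ('x \<Rightarrow> complex mat) \<Rightarrow> ('x \<Rightarrow> complex Matrix.vec) \<Rightarrow> 'x \<Rightarrow> complex Matrix.vec" where
  "mult_op X N \<Phi> f = (\<lambda>x. if x \<in> X then \<Phi> x *\<^sub>v f x else 0\<^sub>v N)"

definition multipliers ::
  "'x set \<Rightarrow> ('x \<Rightarrow> 'x \<Rightarrow> complex) \<Rightarrow> ('x \<Rightarrow> 'x \<Rightarrow> complex) \<Rightarrow> nat \<Rightarrow> ('x \<Rightarrow> complex mat) set" where
  "multipliers X k l N =
     {\<Phi>. (\<forall>x\<in>X. \<Phi> x \<in> carrier_mat N N) \<and>
          (\<forall>f\<in>rkhs_vec X k N. mult_op X N \<Phi> f \<in> rkhs_vec X l N)}"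

(* The operator norm, as a supremum in the extended reals so that it is meaningful without
   knowing beforehand that the multiplication operator is bounded. *)
definition multiplier_norm ::
  "'x set \<Rightarrow> ('x \<Rightarrow> 'x \<Rightarrow> complex) \<Rightarrow> ('x \<Rightarrow> 'x \<Rightarrow> complex) \<Rightarrow> nat \<Rightarrow> ('x \<Rightarrow> complex mat) \<Rightarrow> ereal" where
  "multiplier_norm X k l N \<Phi> =
     (SUP f \<in> {f \<in> rkhs_vec X k N. rkhs_vec_norm X k N f \<le> 1}.
        ereal (rkhs_vec_norm X l N (mult_op X N \<Phi> f)))"

(* The n N by n N matrix with the N by N block B i j in block row i and block column j. *)
definition block_matrix :: "nat \<Rightarrow> nat \<Rightarrow> (nat \<Rightarrow> nat \<Rightarrow> complex mat) \<Rightarrow> complex mat" where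
  "block_matrix n N B =
     mat (n * N) (n * N) (\<lambda>(p, q). B (p div N) (q div N) $$ (p mod N, q mod N))"

definition complete_Pick_pair ::
  "'x set \<Rightarrow> ('x \<Rightarrow> 'x \<Rightarrow> complex) \<Rightarrow> ('x \<Rightarrow> 'x \<Rightarrow> complex) \<Rightarrow> bool" where
  "complete_Pick_pair X k l \<longleftrightarrow>
     (\<forall>n\<ge>1. \<forall>N\<ge>1. \<forall>z W.
        (\<forall>i<n. z i \<in> X) \<longrightarrow>
        (\<forall>i<n. W i \<in> carrier_mat N N) \<longrightarrow>
        positive_semidefinite (n * N)
          (block_matrix n N
            (\<lambda>i j. l (z i) (z j) \<cdot>\<^sub>m 1\<^sub>m N - k (z i) (z j) \<cdot>\<^sub>m (W i * mat_adjoint (W j)))) \<longrightarrow>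
        (\<exists>\<Phi>\<in>multipliers X k l N. multiplier_norm X k l N \<Phi> \<le> 1 \<and> (\<forall>i<n. \<Phi> (z i) = W i)))"

definition complete_Pick_kernel :: "'x set \<Rightarrow> ('x \<Rightarrow> 'x \<Rightarrow> complex) \<Rightarrow> bool" where
  "complete_Pick_kernel X s \<longleftrightarrow> is_kernel X s \<and> complete_Pick_pair X s s"


section \<open>Shimorin certificates\<close>

(* Meant for k z z \<noteq> 0, which holds for normalized diagonal holomorphic kernels. *)
definition schur_kernel :: "('x \<Rightarrow> 'x \<Rightarrow> complex) \<Rightarrow> 'x \<Rightarrow> 'x \<Rightarrow> 'x \<Rightarrow> complex" where
  "schur_kernel k z w v = k w v - k w z * k z v / k z z"

definition Shimorin_certificate ::
  "'x set \<Rightarrow> ('x \<Rightarrow> 'x \<Rightarrow> complex) \<Rightarrow> ('x \<Rightarrow> 'x \<Rightarrow> complex) \<Rightarrow> ('x \<Rightarrow> 'x \<Rightarrow> 'x \<Rightarrow> complex) \<Rightarrow> bool" where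
  "Shimorin_certificate X k l p \<longleftrightarrow>
     (\<forall>z\<in>X. is_kernel X (p z) \<and>
        kernel_le X (\<lambda>w v. p z w v * l w v) (schur_kernel l z) \<and>
        kernel_le X (schur_kernel k z) (\<lambda>w v. p z w v * k w v))"

definition strong_Shimorin_certificate ::
  "'x set \<Rightarrow> ('x \<Rightarrow> 'x \<Rightarrow> complex) \<Rightarrow> ('x \<Rightarrow> 'x \<Rightarrow> complex) \<Rightarrow> ('x \<Rightarrow> 'x \<Rightarrow> complex) \<Rightarrow> bool" where
  "strong_Shimorin_certificate X k l s \<longleftrightarrow>
     complete_Pick_kernel X s \<and>
     (\<exists>h g. is_kernel X h \<and> is_kernel X g \<and>
        (\<forall>z\<in>X. \<forall>w\<in>X. k z w = (1 - h z w) * s z w \<and> l z w = s z w * g z w))"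


section \<open>Normalized diagonal holomorphic kernels\<close>

definition monom_eval :: "'a::comm_monoid_mult ^ 'n \<Rightarrow> nat ^ 'n \<Rightarrow> 'a" where
  "monom_eval z a = (\<Prod>j\<in>UNIV. (z $ j) ^ (a $ j))"

definition abs_vec :: "complex ^ 'n \<Rightarrow> real ^ 'n" where
  "abs_vec y = (\<chi> j. cmod (y $ j))"

definition mult_cnj :: "complex ^ 'n \<Rightarrow> complex ^ 'n \<Rightarrow> complex ^ 'n" where
  "mult_cnj z w = (\<chi> j. z $ j * cnj (w $ j))"

(* Frechet differentiability with complex linear derivative. *)
definition holomorphic_Cd :: "(complex ^ 'n \<Rightarrow> complex) \<Rightarrow> (complex ^ 'n) set \<Rightarrow> bool" where
  "holomorphic_Cd f U \<longleftrightarrow>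
     (\<forall>z\<in>U. \<exists>D. (f has_derivative D) (at z) \<and> (\<forall>c v. D (c *s v) = c * D v))"

(* The second argument of the predicate is the kernel, the third is its (uniquely determined)
   family of Taylor coefficients. *)
definition normalized_diagonal_holomorphic_kernel ::
  "(complex ^ 'n) set \<Rightarrow> (complex ^ 'n \<Rightarrow> complex ^ 'n \<Rightarrow> complex) \<Rightarrow> (nat ^ 'n \<Rightarrow> real) \<Rightarrow> bool" where
  "normalized_diagonal_holomorphic_kernel \<Omega> f c \<longleftrightarrow>
     is_kernel \<Omega> f \<and>
     (\<forall>w\<in>\<Omega>. holomorphic_Cd (\<lambda>z. f z w) \<Omega>) \<and>
     (\<forall>z\<in>\<Omega>. holomorphic_Cd (\<lambda>w. cnj (f z w)) \<Omega>) \<and>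
     (\<exists>r>0. \<forall>z w. norm z < r \<longrightarrow> norm w < r \<longrightarrow>
        ((\<lambda>a. complex_of_real (c a) * monom_eval z a * cnj (monom_eval w a)) has_sum f z w) UNIV) \<and>
     (\<forall>a. 0 < c a) \<and> c 0 = 1"


section \<open>The master certificate\<close>

definition mdeg :: "nat ^ 'n \<Rightarrow> nat" where
  "mdeg a = (\<Sum>j\<in>UNIV. a $ j)"

lemma mdeg_add: "mdeg (a + b) = mdeg a + mdeg b"
  by (simp add: mdeg_def sum.distrib)

lemma mdeg_eq_0_iff: "mdeg a = 0 \<longleftrightarrow> a = 0"
  by (simp add: mdeg_def Finite_Cartesian_Product.vec_eq_iff)

lemma finite_multi_index_splits: "finite {(w, u). w + u = (b :: nat ^ 'n)}"
proof (rule finite_subset)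
  let ?A = "vec_lambda ` (PiE UNIV (\<lambda>j. {..b $ j}))"
  show "{(w, u). w + u = b} \<subseteq> ?A \<times> ?A"
  proof
    fix p
    assume "p \<in> {(w, u). w + u = b}"
    then obtain w u where p: "p = (w, u)" and "w + u = b"
      by blast
    then have *: "w $ j \<le> b $ j" "u $ j \<le> b $ j" for j
      by (metis le_add1 le_add2 vector_add_component)+
    have "w = vec_lambda (vec_nth w)" "u = vec_lambda (vec_nth u)"
      by simp_all
    moreover have "vec_nth w \<in> PiE UNIV (\<lambda>j. {..b $ j})" "vec_nth u \<in> PiE UNIV (\<lambda>j. {..b $ j})"
      using * by auto
    ultimately show "p \<in> ?A \<times> ?A"
      unfolding p by blast
  qed
  show "finite (?A \<times> ?A)"
    by (intro finite_cartesian_product finite_imageI finite_PiE) auto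
qed

function master_certificate :: "(nat ^ 'n \<Rightarrow> real) \<Rightarrow> nat ^ 'n \<Rightarrow> real" where
  "master_certificate c b =
     (if b = 0 then 0
      else if \<exists>j. b = axis j 1 then c b
      else max 0 (c b - (\<Sum>(w, u) \<in> {(w, u). w + u = b \<and> w \<noteq> 0 \<and> u \<noteq> 0}.
                           master_certificate c w * c u)))"
  by auto
termination
  by (relation "Wellfounded.measure (\<lambda>(c, b). mdeg b)")
     (auto simp: mdeg_add mdeg_eq_0_iff intro!: Nat.gr0I)

declare master_certificate.simps [simp del]


section \<open>Domains of convergence\<close>

(* (|y|^a)^2 is |y|^(2a). *)
definition conv_domain :: "(nat ^ 'n \<Rightarrow> real) \<Rightarrow> (complex ^ 'n) set" where
  "conv_domain c =
     (\<Union>r\<in>{0<..}. {x. \<forall>y. norm (x - y) < r \<longrightarrow>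
        (\<lambda>a. c a * (monom_eval (abs_vec y) a)\<^sup>2) summable_on UNIV})"

definition conv_domain_lt1 :: "(nat ^ 'n \<Rightarrow> real) \<Rightarrow> (complex ^ 'n) set" where
  "conv_domain_lt1 c =
     {x \<in> conv_domain c. (\<Sum>\<^sub>\<infinity>a\<in>-{0}. c a * (monom_eval (abs_vec x) a)\<^sup>2) < 1}"

definition power_series :: "(nat ^ 'n \<Rightarrow> real) \<Rightarrow> complex ^ 'n \<Rightarrow> complex" where
  "power_series c x = (\<Sum>\<^sub>\<infinity>a. complex_of_real (c a) * monom_eval x a)"

definition one_minus_series_invertible :: "(complex ^ 'n) set \<Rightarrow> (nat ^ 'n \<Rightarrow> real) \<Rightarrow> bool" where
  "one_minus_series_invertible \<Omega> c \<longleftrightarrow>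
     (\<forall>z\<in>\<Omega>. \<forall>w\<in>\<Omega>.
        (\<lambda>a. complex_of_real (c a) * monom_eval (mult_cnj z w) a) summable_on UNIV \<and>
        1 - power_series c (mult_cnj z w) \<noteq> 0)"

end

theory Submission
  imports Defs "HOL-Library.Real_Mod" "HOL-Complex_Analysis.Complex_Analysis"
begin

text \<open>
  All statements (i)--(v) are linked through positivity of matrices. A contractive multiplier from
  \<open>H(k)\<close> to \<open>H(l)\<close> tensored with \<open>\<complex>\<^sup>N\<close> is a matrix function \<open>\<Phi>\<close> for which \<open>l I - k \<Phi> \<Phi>\<^sup>*\<close> is a
  positive kernel, and this description replaces operators by matrices throughout.

  A Shimorin certificate gives the Pick property because Pick data can be extended one value at a
  time: written as positivity of \<open>l \<langle>c, c'\<rangle> - k \<langle>a, a'\<rangle>\<close> on a set of triples \<open>(z, c, a)\<close>, where a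
  triple prescribes \<open>c \<Phi>(z) = a\<close>, the inequalities for \<open>p[z]\<close> say exactly that the Schur complement
  at \<open>z\<close> stays positive, and then a contraction can be extended by one dimension
  (\<open>contraction_extension\<close>). Zorn's lemma finishes (\<open>complete_Pick_pair_of_Shimorin\<close>).
  Conversely the Pick property yields certificates on finite sets (\<open>finite_Shimorin_of_Pick\<close>): the
  existence of \<open>p[z]\<close> is a linear matrix inequality, whose dual statement follows from the Pick
  property combined with the extension result on a set with one point less. A strong certificate
  \<open>s\<close> yields the certificate \<open>p[z] = s\<^sup>z / s\<close> by algebra once \<open>s\<^sup>z / s\<close> is known to be a kernel, and
  for \<open>s\<close> this is forced by its certificates on finite sets (\<open>Shimorin_of_strong\<close>).

  The analytic part turns certificates into coefficients. Certificates at \<open>0\<close> on grids of points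
  \<open>r \<omega>\<close>, where all components of \<open>\<omega>\<close> are \<open>m\<close>-th roots of unity, have nonnegative Fourier
  coefficients. For \<open>m \<rightarrow> \<infinity>\<close> these give a power series \<open>p\<close> with nonnegative coefficients such that
  \<open>l - 1 - p l\<close> and \<open>p k - (k - 1)\<close> have nonnegative coefficients. The master certificate \<open>\<theta>\<close> is the
  most economical such series, and therefore \<open>G = (1 - \<theta>) l\<close> has nonnegative coefficients, too
  (\<open>master_quotient_nonneg\<close>). Evaluating at \<open>|z|\<^sup>2\<close> shows \<open>\<theta> < 1\<close> wherever \<open>l\<close> converges, which makes
  \<open>G\<close> the kernel \<open>g\<close> of (v), and \<open>k \<le> 1 + \<theta> k\<close> for the coefficients bounds the partial sums of \<open>k\<close> by \<open>1 / (1 - \<theta>)\<close>.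
  Together these are the inclusions of domains.

  All of this needs the power series of \<open>k\<close> and \<open>l\<close> on the whole of \<open>\<Omega>\<close>, while they are given near
  \<open>0\<close> only. Nonnegativity of the coefficients allows the Landau--Pringsheim argument: the series
  converges as far in positive directions as its sum is holomorphic, so convergence propagates
  through the connected set \<open>\<Omega>\<close> (\<open>diagonal_kernel_series\<close>).

  Finally, in (v) the bound \<open>l(z, z) \<ge> 1\<close> and positivity of \<open>g\<close> force \<open>\<theta>(|z|\<^sup>2) < 1\<close>. Hence
  \<open>s = 1 / (1 - \<theta>)\<close> is a geometric series of a kernel with diagonal below one, which makes it a
  complete Pick kernel (\<open>geometric_complete_Pick_kernel\<close>), and \<open>h = 1 - (1 - \<theta>) k\<close> has nonnegative
  coefficients by the recursion that defines \<open>\<theta>\<close>.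
\<close>

(* Formal power series and vectors share this symbol; here it denotes components of vectors. *)
no_notation fps_nth (infixl "$" 75)

section \<open>Positive kernels as forms on finite sets of points\<close>

text \<open>Sums over finite sets of points instead of enumerations of points: the form of a kernel and
  its restrictions, pullbacks and sums are then easy to compare.\<close>

definition kform :: "'x set \<Rightarrow> ('x \<Rightarrow> 'x \<Rightarrow> complex) \<Rightarrow> ('x \<Rightarrow> complex) \<Rightarrow> complex" where
  "kform F k v = (\<Sum>x\<in>F. \<Sum>y\<in>F. cnj (v x) * v y * k x y)"

lemma positive_semidefinite_mat_iff:
  "positive_semidefinite n (mat n n (\<lambda>(i, j). m i j)) \<longleftrightarrow> (\<forall>v. 0 \<le> kform {..<n} m v)"
proof -
  have *: "(mat n n (\<lambda>(i, j). m i j) *\<^sub>v v) \<bullet>c v = kform {..<n} m (\<lambda>i. v $v i)"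
    if "v \<in> carrier_vec n" for v
    using that
    by (auto simp: scalar_prod_def kform_def sum_distrib_left sum_distrib_right lessThan_atLeast0 mult_ac
        intro!: sum.cong)
  show ?thesis
  proof
    assume L: "positive_semidefinite n (mat n n (\<lambda>(i, j). m i j))"
    show "\<forall>v. 0 \<le> kform {..<n} m v"
    proof
      fix v
      have "0 \<le> kform {..<n} m (\<lambda>i. Matrix.vec n v $v i)"
        using L unfolding positive_semidefinite_def
        by (metis "*" vec_carrier)
      then show "0 \<le> kform {..<n} m v"
        by (simp add: kform_def)
    qed
  qed (auto simp: positive_semidefinite_def *)
qed

text \<open>Repeated points merge when their coefficients are added. This is why positivity may be tested
  on sets of points instead of on lists.\<close>

lemma kform_image:
  assumes "finite I"
  shows "kform I (\<lambda>i j. k (z i) (z j)) v = kform (z ` I) k (\<lambda>x. \<Sum>i\<in>{i\<in>I. z i = x}. v i)"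
proof -
  have 1: "(\<Sum>j\<in>I. v j * f (z j)) = (\<Sum>x\<in>z ` I. (\<Sum>j\<in>{j\<in>I. z j = x}. v j) * f x)" for f and v :: "'a \<Rightarrow> complex"
    using assms by (subst sum.image_gen[where g = z]) (auto simp: sum_distrib_right intro!: sum.cong)
  have "kform I (\<lambda>i j. k (z i) (z j)) v = (\<Sum>i\<in>I. cnj (v i) * (\<Sum>j\<in>I. v j * k (z i) (z j)))"
    by (simp add: kform_def sum_distrib_left mult_ac)
  also have "\<dots> = (\<Sum>x\<in>z ` I. cnj (\<Sum>i\<in>{i\<in>I. z i = x}. v i) *
      (\<Sum>y\<in>z ` I. (\<Sum>j\<in>{j\<in>I. z j = y}. v j) * k x y))"
    unfolding 1 by (subst 1[of "\<lambda>i. cnj (v i)"]) simp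
  also have "\<dots> = kform (z ` I) k (\<lambda>x. \<Sum>i\<in>{i\<in>I. z i = x}. v i)"
    by (simp add: kform_def sum_distrib_left sum_distrib_right mult_ac)
      (auto intro!: sum.cong sum.swap)
  finally show ?thesis .
qed

lemma is_kernel_iff:
  "is_kernel X k \<longleftrightarrow> (\<forall>F v. finite F \<longrightarrow> F \<subseteq> X \<longrightarrow> 0 \<le> kform F k v)"
proof
  assume L: "is_kernel X k"
  show "\<forall>F v. finite F \<longrightarrow> F \<subseteq> X \<longrightarrow> 0 \<le> kform F k v"
  proof (intro allI impI)
    fix F :: "'a set" and v
    assume F: "finite F" "F \<subseteq> X"
    from ex_bij_betw_nat_finite[OF F(1)] obtain h where h: "bij_betw h {..<card F} F"
      by (auto simp: lessThan_atLeast0)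
    have hX: "\<forall>i<card F. h i \<in> X"
      using h F(2) by (auto simp: bij_betw_def)
    have "0 \<le> kform {..<card F} (\<lambda>i j. k (h i) (h j)) (\<lambda>i. v (h i))"
      using L hX unfolding is_kernel_def positive_semidefinite_mat_iff by blast
    also have "\<dots> = kform F k v"
      unfolding kform_def
      by (subst sum.reindex_bij_betw[OF h, symmetric], subst sum.reindex_bij_betw[OF h, symmetric]) simp
    finally show "0 \<le> kform F k v" .
  qed
next
  assume "\<forall>F v. finite F \<longrightarrow> F \<subseteq> X \<longrightarrow> 0 \<le> kform F k v"
  then show "is_kernel X k"
    unfolding is_kernel_def positive_semidefinite_mat_iff
    by (auto simp: kform_image)
qed

lemma is_kernelI:
  assumes "\<And>F v. finite F \<Longrightarrow> F \<subseteq> X \<Longrightarrow> 0 \<le> kform F k v"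
  shows "is_kernel X k"
  using assms is_kernel_iff by blast

lemma is_kernelD:
  assumes "is_kernel X k" "finite F" "F \<subseteq> X"
  shows "0 \<le> kform F k v"
  using assms is_kernel_iff by blast

lemma is_kernel_subset: "is_kernel X k \<Longrightarrow> Y \<subseteq> X \<Longrightarrow> is_kernel Y k"
  unfolding is_kernel_def by blast

lemma is_kernel_pullback:
  assumes "is_kernel X k" "\<And>i. i \<in> I \<Longrightarrow> z i \<in> X"
  shows "is_kernel I (\<lambda>i j. k (z i) (z j))"
  unfolding is_kernel_def
proof (intro allI impI)
  fix n :: nat and w :: "nat \<Rightarrow> 'b"
  assume "\<forall>i<n. w i \<in> I"
  then have "\<forall>i<n. z (w i) \<in> X"
    using assms(2) by auto
  then show "positive_semidefinite n (mat n n (\<lambda>(i, j). k (z (w i)) (z (w j))))"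
    using assms(1)[unfolded is_kernel_def, rule_format, of n "\<lambda>i. z (w i)"] by blast
qed

lemma is_kernel_pullback_form:
  assumes "is_kernel X k" "\<And>i. i \<in> I \<Longrightarrow> z i \<in> X" "finite I"
  shows "0 \<le> kform I (\<lambda>i j. k (z i) (z j)) v"
  by (rule is_kernelD[OF is_kernel_pullback[OF assms(1,2)] assms(3)]) auto

lemma kform_cong:
  assumes "\<And>x y. x \<in> F \<Longrightarrow> y \<in> F \<Longrightarrow> k x y = k' x y" "\<And>x. x \<in> F \<Longrightarrow> v x = v' x"
  shows "kform F k v = kform F k' v'"
  unfolding kform_def using assms by (intro sum.cong refl) auto

lemma is_kernel_cong:
  assumes "\<And>x y. x \<in> X \<Longrightarrow> y \<in> X \<Longrightarrow> k x y = k' x y"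
  shows "is_kernel X k \<longleftrightarrow> is_kernel X k'"
proof -
  have "kform F k v = kform F k' v" if "F \<subseteq> X" for F v
    using assms that by (intro kform_cong) auto
  then show ?thesis unfolding is_kernel_iff by auto
qed

lemma kform_add: "kform F (\<lambda>x y. k x y + k' x y) v = kform F k v + kform F k' v"
  by (simp add: kform_def distrib_left sum.distrib)

lemma kform_diff: "kform F (\<lambda>x y. k x y - k' x y) v = kform F k v - kform F k' v"
  by (simp add: kform_def right_diff_distrib sum_subtractf)

lemma kform_sum: "kform F (\<lambda>x y. \<Sum>m\<in>M. k m x y) v = (\<Sum>m\<in>M. kform F (k m) v)"
  by (induction M rule: infinite_finite_induct) (simp_all add: kform_add, simp_all add: kform_def)

lemma kform_rank_one:
  "kform F (\<lambda>x y. f x * cnj (f y) * k x y) v = kform F k (\<lambda>x. v x * cnj (f x))"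
  by (simp add: kform_def mult_ac)

lemma kform_one: "kform F (\<lambda>x y. 1) v = of_real ((cmod (\<Sum>x\<in>F. v x))\<^sup>2)"
proof -
  have "kform F (\<lambda>x y. 1) v = cnj (\<Sum>x\<in>F. v x) * (\<Sum>x\<in>F. v x)"
    by (simp add: kform_def sum_product)
  then show ?thesis
    by (metis complex_norm_square mult.commute)
qed

lemma kform_rank_one': "kform F (\<lambda>x y. f x * cnj (f y)) v = of_real ((cmod (\<Sum>x\<in>F. v x * cnj (f x)))\<^sup>2)"
  using kform_rank_one[of F f "\<lambda>x y. 1" v] by (simp add: kform_one)

lemma nonneg_of_real_complex: "0 \<le> complex_of_real r \<longleftrightarrow> 0 \<le> r"
  by (simp add: less_eq_complex_def)

lemma is_kernel_add: "is_kernel X k \<Longrightarrow> is_kernel X k' \<Longrightarrow> is_kernel X (\<lambda>x y. k x y + k' x y)"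
  by (simp add: is_kernel_iff kform_add)

lemma is_kernel_zero: "is_kernel X (\<lambda>x y. 0)"
  by (simp add: is_kernel_iff kform_def)

lemma is_kernel_sum: "(\<And>m. m \<in> M \<Longrightarrow> is_kernel X (k m)) \<Longrightarrow> is_kernel X (\<lambda>x y. \<Sum>m\<in>M. k m x y)"
  by (auto simp: is_kernel_iff kform_sum intro!: sum_nonneg)

lemma is_kernel_congruence: "is_kernel X k \<Longrightarrow> is_kernel X (\<lambda>x y. f x * cnj (f y) * k x y)"
  by (simp add: is_kernel_iff kform_rank_one)

lemma is_kernel_rank_one: "is_kernel X (\<lambda>x y. f x * cnj (f y))"
  unfolding is_kernel_iff kform_rank_one' nonneg_of_real_complex by simp

lemma is_kernel_scale: "is_kernel X k \<Longrightarrow> 0 \<le> c \<Longrightarrow> is_kernel X (\<lambda>x y. of_real c * k x y)"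
proof -
  have *: "kform F (\<lambda>x y. of_real c * k x y) v = of_real c * kform F k v" for F v
    by (simp add: kform_def sum_distrib_left mult_ac)
  show "is_kernel X k \<Longrightarrow> 0 \<le> c \<Longrightarrow> is_kernel X (\<lambda>x y. of_real c * k x y)"
    by (simp add: is_kernel_iff * nonneg_of_real_complex mult_nonneg_nonneg)
qed

lemma is_kernel_diag:
  assumes "is_kernel X k" "x \<in> X"
  shows "0 \<le> k x x"
  using is_kernelD[OF assms(1), of "{x}" "\<lambda>_. 1"] assms(2) by (simp add: kform_def)

lemma kform_two:
  "x \<noteq> y \<Longrightarrow> kform {x, y} k v =
     cnj (v x) * v x * k x x + cnj (v x) * v y * k x y + cnj (v y) * v x * k y x + cnj (v y) * v y * k y y"
  by (simp add: kform_def)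

lemma is_kernel_hermitian:
  assumes "is_kernel X k" "x \<in> X" "y \<in> X"
  shows "k y x = cnj (k x y)"
proof (cases "x = y")
  case True
  with is_kernel_diag[OF assms(1,2)] show ?thesis
    by (auto simp: less_eq_complex_def complex_eq_iff)
next
  case False
  have D: "0 \<le> k x x" "0 \<le> k y y" using assms is_kernel_diag by metis+
  have P: "0 \<le> kform {x, y} k v" for v using assms by (intro is_kernelD) auto
  from P[of "\<lambda>_. 1"] P[of "\<lambda>z. if z = x then 1 else \<i>"] D False
  show ?thesis
    by (auto simp: kform_two less_eq_complex_def complex_eq_iff)
qed

text \<open>Evaluation at \<open>r = 1 / q\<close>. The polynomial arises as the squared norm of a vector
  perturbed by the multiple \<open>- r \<cdot> cnj a\<close> of another one, where
  \<open>A\<close> is the squared modulus of the scalar \<open>a\<close> to be estimated; this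
  covers Cauchy--Schwarz as well as approximate Riesz representation.\<close>

lemma discriminant_bound:
  fixes A p q :: real
  assumes "\<And>r. 0 \<le> p - 2 * r * A + r\<^sup>2 * (A * q)" "0 \<le> p" "0 \<le> q" "0 \<le> A"
  shows "A \<le> p * q"
proof (cases "q = 0")
  case True
  then show ?thesis
    using assms(1)[of "(p + 1) / (2 * A)"] assms(4) by (cases "A = 0") (simp_all add: field_simps)
next
  case False
  then show ?thesis
    using assms(1)[of "1 / q"] assms(3) by (simp add: field_simps power2_eq_square)
qed

lemma is_kernel_Cauchy_Schwarz:
  assumes "is_kernel X k" "x \<in> X" "y \<in> X"
  shows "(cmod (k x y))\<^sup>2 \<le> Re (k x x) * Re (k y y)"
proof (cases "x = y")
  case True
  with is_kernel_diag[OF assms(1,2)] show ?thesis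
    by (simp add: less_eq_complex_def cmod_power2 flip: power2_eq_square)
next
  case False
  have D: "0 \<le> k x x" "0 \<le> k y y" using assms is_kernel_diag by metis+
  have P: "0 \<le> kform {x, y} k v" for v using assms by (intro is_kernelD) auto
  have H: "k y x = cnj (k x y)" using assms by (rule is_kernel_hermitian)
  define a where "a = k x y"
  define p where "p = Re (k x x)"
  define q where "q = Re (k y y)"
  have pq: "k x x = of_real p" "k y y = of_real q" "0 \<le> p" "0 \<le> q"
    using D by (auto simp: p_def q_def less_eq_complex_def complex_eq_iff)
  have sq: "of_real ((cmod w)\<^sup>2) = cnj w * w" for w
    by (metis complex_norm_square mult.commute)
  have Q: "0 \<le> (cmod s)\<^sup>2 * p + 2 * Re (cnj s * t * a) + (cmod t)\<^sup>2 * q" for s t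
  proof -
    have "kform {x, y} k (\<lambda>z. if z = x then s else t)
        = cnj s * s * of_real p + (cnj s * t * a + cnj (cnj s * t * a)) + cnj t * t * of_real q"
      using False by (simp add: kform_two H pq a_def)
    also have "\<dots> = of_real ((cmod s)\<^sup>2 * p + 2 * Re (cnj s * t * a) + (cmod t)\<^sup>2 * q)"
      unfolding complex_add_cnj sq[symmetric] by simp
    finally have "0 \<le> complex_of_real ((cmod s)\<^sup>2 * p + 2 * Re (cnj s * t * a) + (cmod t)\<^sup>2 * q)"
      using P[of "\<lambda>z. if z = x then s else t"] by (rule subst)
    then show ?thesis unfolding nonneg_of_real_complex .
  qed
  have Q': "0 \<le> r\<^sup>2 * p - 2 * r * u * (cmod a)\<^sup>2 + u\<^sup>2 * ((cmod a)\<^sup>2 * q)" for r u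
  proof -
    have "cnj (complex_of_real r) * (- of_real u * cnj a) * a = of_real (- (r * u * (cmod a)\<^sup>2))"
      using sq[of a] by simp
    then have "Re (cnj (complex_of_real r) * (- of_real u * cnj a) * a) = - (r * u * (cmod a)\<^sup>2)"
      by (metis Re_complex_of_real)
    then show ?thesis
      using Q[of "of_real r" "- of_real u * cnj a"] by (simp add: norm_mult power_mult_distrib)
  qed
  have "(cmod a)\<^sup>2 \<le> p * q"
    using Q'[of 1] pq by (intro discriminant_bound) (simp_all add: mult_ac)
  then show ?thesis by (simp add: a_def p_def q_def)
qed

text \<open>The coefficient at \<open>z\<close> is the one that minimises the form with the other
  coefficients given, and the minimum is the Schur complement.\<close>

lemma schur_kernel_form:
  assumes "finite F" "z \<notin> F" "k z z \<noteq> 0" "\<And>x. x \<in> F \<Longrightarrow> k z x = cnj (k x z)" "k z z = cnj (k z z)"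
  shows "kform (insert z F) k (v(z := - (\<Sum>x\<in>F. v x * k z x) / k z z)) = kform F (schur_kernel k z) v"
proof -
  define t where "t = - (\<Sum>x\<in>F. v x * k z x) / k z z"
  define A where "A = (\<Sum>x\<in>F. v x * k z x)"
  have eq: "(\<Sum>x\<in>F. g x ((v(z := t)) x)) = (\<Sum>x\<in>F. g x (v x))" for g :: "'a \<Rightarrow> complex \<Rightarrow> complex"
    using assms by (intro sum.cong) auto
  have cA: "cnj A = (\<Sum>x\<in>F. cnj (v x) * k x z)"
    unfolding A_def by (auto simp: assms(4) intro!: sum.cong)
  have kf: "kform F k (v(z := t)) = kform F k v"
    using assms by (intro kform_cong) auto
  have "kform (insert z F) k (v(z := t)) =
      cnj t * t * k z z + cnj t * A + cnj A * t + kform F k (v(z := t))"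
    unfolding kform_def using assms(1,2)
    by (simp add: sum.distrib eq[of "\<lambda>x w. cnj t * w * k z x", simplified]
        eq[of "\<lambda>x w. cnj w * t * k x z", simplified] cA)
      (simp add: A_def sum_distrib_left sum_distrib_right mult_ac)
  also have "\<dots> = kform F k v - cnj A * A / k z z"
    unfolding kf using assms(3,5) by (simp add: t_def flip: A_def)
  also have "cnj A * A / k z z = kform F (\<lambda>x y. k x z * k z y / k z z) v"
    unfolding cA unfolding A_def kform_def
    by (simp add: sum_product sum_divide_distrib sum_distrib_left mult_ac)
  also have "kform F k v - \<dots> = kform F (schur_kernel k z) v"
    unfolding kform_diff[symmetric] schur_kernel_def by simp
  finally show ?thesis unfolding t_def .
qed

lemma schur_kernel_zero: "k z z \<noteq> 0 \<Longrightarrow> schur_kernel k z z y = 0" "k z z \<noteq> 0 \<Longrightarrow> schur_kernel k z x z = 0"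
  by (simp_all add: schur_kernel_def)

lemma kform_supported:
  assumes "finite F" "F' \<subseteq> F" "\<And>x y. x \<in> F \<Longrightarrow> y \<in> F \<Longrightarrow> x \<notin> F' \<or> y \<notin> F' \<Longrightarrow> k x y = 0"
  shows "kform F k v = kform F' k v"
proof -
  have "kform F k v = (\<Sum>x\<in>F'. \<Sum>y\<in>F. cnj (v x) * v y * k x y)"
    unfolding kform_def using assms by (intro sum.mono_neutral_right) (auto intro!: sum.neutral)
  also have "\<dots> = kform F' k v"
    unfolding kform_def using assms by (intro sum.cong sum.mono_neutral_right) auto
  finally show ?thesis .
qed

text \<open>Schur complements vanish in the row and column of \<open>z\<close>, so their positivity need
  only be checked away from \<open>z\<close>.\<close>

lemma is_kernel_supported:
  assumes "is_kernel Y k" "\<And>x y. x \<in> X \<Longrightarrow> y \<in> X \<Longrightarrow> x \<notin> Y \<or> y \<notin> Y \<Longrightarrow> k x y = 0"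
  shows "is_kernel X k"
proof (rule is_kernelI)
  fix F v assume F: "finite F" "F \<subseteq> X"
  have "kform F k v = kform (F \<inter> Y) k v"
    using F assms(2) by (intro kform_supported) auto
  then show "0 \<le> kform F k v"
    using F assms(1) is_kernelD[of Y k "F \<inter> Y" v] by auto
qed

lemma is_kernel_schur_kernel:
  assumes "is_kernel X k" "z \<in> X" "k z z \<noteq> 0"
  shows "is_kernel X (schur_kernel k z)"
proof -
  have "is_kernel (X - {z}) (schur_kernel k z)"
  proof (rule is_kernelI)
    fix F v assume F: "finite F" "F \<subseteq> X - {z}"
    have herm: "k z x = cnj (k x z)" if "x \<in> X" for x
      using is_kernel_hermitian[OF assms(1) that assms(2)] .
    have "kform F (schur_kernel k z) v = kform (insert z F) k (v(z := - (\<Sum>x\<in>F. v x * k z x) / k z z))"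
      using F assms(2,3) herm by (intro schur_kernel_form[symmetric]) blast+
    also have "\<dots> \<ge> 0" using F assms by (intro is_kernelD) auto
    finally show "0 \<le> kform F (schur_kernel k z) v" .
  qed
  then show ?thesis
    by (rule is_kernel_supported) (use assms in \<open>auto simp: schur_kernel_zero\<close>)
qed

text \<open>One rank one term is split off per point: subtracting \<open>k(x, z) k(z, y) / k(z, z)\<close>
  leaves a kernel that vanishes at \<open>z\<close>. If \<open>k(z, z) = 0\<close>, then
  Cauchy--Schwarz shows that row and column of \<open>z\<close> are zero already.\<close>

lemma finite_kernel_Gram:
  assumes "finite F" "is_kernel F k"
  shows "\<exists>c. \<forall>x\<in>F. \<forall>y\<in>F. k x y = (\<Sum>m<card F. c m x * cnj (c m y))"
  using assms
proof (induction F arbitrary: k rule: finite_induct)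
  case empty
  show ?case by simp
next
  case (insert z F)
  have hz: "k z x = cnj (k x z)" if "x \<in> insert z F" for x
    using is_kernel_hermitian[OF insert.prems that] by blast
  have nz: "0 \<le> k z z" using is_kernel_diag[OF insert.prems] by blast
  define r where "r = sqrt (Re (k z z))"
  have r: "k z z = of_real r * of_real r"
    using nz by (auto simp: r_def less_eq_complex_def complex_eq_iff)
  have zero: "k x z = 0" if "x \<in> insert z F" "k z z = 0" for x
    using is_kernel_Cauchy_Schwarz[OF insert.prems that(1), of z] that(2) by auto
  define g where "g = (\<lambda>x. k x z / of_real r)"
  have K': "is_kernel (insert z F) (\<lambda>x y. k x y - g x * cnj (g y))"
  proof (cases "k z z = 0")
    case True
    then show ?thesis using r insert.prems by (simp add: g_def)
  next
    case False
    have "is_kernel (insert z F) (schur_kernel k z)"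
      using insert.prems False by (intro is_kernel_schur_kernel) auto
    then show ?thesis
      by (subst (asm) is_kernel_cong[where k' = "\<lambda>x y. k x y - g x * cnj (g y)"])
        (use False in \<open>auto simp: schur_kernel_def g_def r hz\<close>)
  qed
  then obtain c where c: "\<forall>x\<in>F. \<forall>y\<in>F. k x y - g x * cnj (g y) = (\<Sum>m<card F. c m x * cnj (c m y))"
    using insert.IH[of "\<lambda>x y. k x y - g x * cnj (g y)"] is_kernel_subset by blast
  have gz: "k x z = g x * cnj (g z)" if "x \<in> insert z F" for x
    using zero[OF that] r by (cases "r = 0") (auto simp: g_def)
  \<comment> \<open>The new vector comes last; the old ones are extended by zero to \<open>z\<close>.\<close>
  define c' where "c' = (\<lambda>m x. if m < card F then (if x = z then 0 else c m x) else g x)"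
  have "k x y = (\<Sum>m<card (insert z F). c' m x * cnj (c' m y))"
    if "x \<in> insert z F" "y \<in> insert z F" for x y
  proof -
    have "(\<Sum>m<card (insert z F). c' m x * cnj (c' m y))
       = (\<Sum>m<card F. c' m x * cnj (c' m y)) + g x * cnj (g y)"
      using insert.hyps by (simp add: c'_def)
    also have "(\<Sum>m<card F. c' m x * cnj (c' m y)) = k x y - g x * cnj (g y)"
    proof (cases "x = z \<or> y = z")
      case True
      then have "(\<Sum>m<card F. c' m x * cnj (c' m y)) = 0"
        by (intro sum.neutral) (auto simp: c'_def)
      moreover have "k x y = g x * cnj (g y)"
        using True that gz hz[of y] by auto
      ultimately show ?thesis by simp
    next
      case False
      then have "x \<in> F" "y \<in> F" using that by auto
      then show ?thesis using c False by (simp add: c'_def)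
    qed
    finally show ?thesis by simp
  qed
  then show ?case by blast
qed

text \<open>Schur's product theorem: a Gram representation writes the product as a sum of congruences of
  the second factor.\<close>

lemma is_kernel_mult:
  assumes "is_kernel X k" "is_kernel X k'"
  shows "is_kernel X (\<lambda>x y. k x y * k' x y)"
proof (rule is_kernelI)
  fix F v assume F: "finite F" "F \<subseteq> X"
  obtain c where c: "\<forall>x\<in>F. \<forall>y\<in>F. k x y = (\<Sum>m<card F. c m x * cnj (c m y))"
    using finite_kernel_Gram[OF F(1)] is_kernel_subset[OF assms(1) F(2)] by blast
  have "is_kernel F (\<lambda>x y. \<Sum>m<card F. c m x * cnj (c m y) * k' x y)"
    using is_kernel_subset[OF assms(2) F(2)] by (intro is_kernel_sum is_kernel_congruence)
  moreover have "(\<Sum>m<card F. c m x * cnj (c m y) * k' x y) = k x y * k' x y" if "x \<in> F" "y \<in> F" for x y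
    using c that by (simp add: sum_distrib_right)
  ultimately have "is_kernel F (\<lambda>x y. k x y * k' x y)"
    using is_kernel_cong[of F "\<lambda>x y. \<Sum>m<card F. c m x * cnj (c m y) * k' x y" "\<lambda>x y. k x y * k' x y"]
    by blast
  then show "0 \<le> kform F (\<lambda>x y. k x y * k' x y) v"
    using F is_kernelD by blast
qed

section \<open>Semi-inner products and finitely supported coefficients\<close>

text \<open>General enough to have the finitely supported functions with the form of an arbitrary,
  possibly degenerate, kernel as an instance.\<close>

locale semi_inner_product =
  fixes V :: "('x \<Rightarrow> complex) set"
    and ip :: "('x \<Rightarrow> complex) \<Rightarrow> ('x \<Rightarrow> complex) \<Rightarrow> complex"
  assumes zero_mem: "(\<lambda>x. 0) \<in> V"
    and add_mem: "f \<in> V \<Longrightarrow> g \<in> V \<Longrightarrow> (\<lambda>x. f x + g x) \<in> V"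
    and scale_mem: "f \<in> V \<Longrightarrow> (\<lambda>x. c * f x) \<in> V"
    and ip_add: "f \<in> V \<Longrightarrow> g \<in> V \<Longrightarrow> h \<in> V \<Longrightarrow> ip (\<lambda>x. f x + g x) h = ip f h + ip g h"
    and ip_scale: "f \<in> V \<Longrightarrow> g \<in> V \<Longrightarrow> ip (\<lambda>x. c * f x) g = c * ip f g"
    and ip_cnj: "f \<in> V \<Longrightarrow> g \<in> V \<Longrightarrow> ip g f = cnj (ip f g)"
    and ip_nonneg: "f \<in> V \<Longrightarrow> 0 \<le> ip f f"
begin

definition nrm :: "('x \<Rightarrow> complex) \<Rightarrow> real" where
  "nrm f = sqrt (Re (ip f f))"

lemma nrm_nonneg [simp]: "f \<in> V \<Longrightarrow> 0 \<le> nrm f"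
  using ip_nonneg by (auto simp: nrm_def less_eq_complex_def)

lemma nrm_sq: "f \<in> V \<Longrightarrow> (nrm f)\<^sup>2 = Re (ip f f)"
  using ip_nonneg by (auto simp: nrm_def less_eq_complex_def)

lemma ip_self: "f \<in> V \<Longrightarrow> ip f f = of_real ((nrm f)\<^sup>2)"
  using ip_nonneg[of f] by (simp add: nrm_sq complex_eq_iff less_eq_complex_def)

lemma diff_mem: "f \<in> V \<Longrightarrow> g \<in> V \<Longrightarrow> (\<lambda>x. f x - g x) \<in> V"
  using add_mem[OF _ scale_mem[of g "-1"], of f] by simp

lemma ip_diff: "f \<in> V \<Longrightarrow> g \<in> V \<Longrightarrow> h \<in> V \<Longrightarrow> ip (\<lambda>x. f x - g x) h = ip f h - ip g h"
  using ip_add[OF _ scale_mem[of g "-1"], of f h] ip_scale[of g h "-1"] by simp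

lemma ip_add_right: "f \<in> V \<Longrightarrow> g \<in> V \<Longrightarrow> h \<in> V \<Longrightarrow> ip h (\<lambda>x. f x + g x) = ip h f + ip h g"
  using ip_cnj[of "\<lambda>x. f x + g x" h] ip_add[of f g h] ip_cnj[of f h] ip_cnj[of g h] add_mem by simp

lemma ip_scale_right: "f \<in> V \<Longrightarrow> g \<in> V \<Longrightarrow> ip g (\<lambda>x. c * f x) = cnj c * ip g f"
  using ip_cnj[of "\<lambda>x. c * f x" g] ip_scale[of f g c] ip_cnj[of f g] scale_mem by simp

lemma ip_diff_right: "f \<in> V \<Longrightarrow> g \<in> V \<Longrightarrow> h \<in> V \<Longrightarrow> ip h (\<lambda>x. f x - g x) = ip h f - ip h g"
  using ip_add_right[OF _ scale_mem[of g "-1"], of f h] ip_scale_right[of g h "-1"] by simp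

lemma nrm_sq_add:
  assumes "f \<in> V" "g \<in> V"
  shows "(nrm (\<lambda>x. f x + c * g x))\<^sup>2 = (nrm f)\<^sup>2 + 2 * Re (c * ip g f) + (cmod c)\<^sup>2 * (nrm g)\<^sup>2"
proof -
  have cg: "(\<lambda>x. c * g x) \<in> V" using assms scale_mem by blast
  have m: "(\<lambda>x. f x + c * g x) \<in> V" using add_mem[OF assms(1) cg] .
  have "ip (\<lambda>x. f x + c * g x) (\<lambda>x. f x + c * g x) =
      ip f f + cnj (c * ip g f) + (c * ip g f + c * cnj c * ip g g)"
    using assms cg m
    by (simp add: ip_add[OF assms(1) cg] ip_add_right[OF assms(1) cg] ip_scale ip_scale_right distrib_left ip_cnj[of g f] mult_ac)
  also have "\<dots> = of_real ((nrm f)\<^sup>2 + 2 * Re (c * ip g f) + (cmod c)\<^sup>2 * (nrm g)\<^sup>2)"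
    using complex_add_cnj[of "c * ip g f"] complex_norm_square[of c]
    by (simp add: ip_self assms algebra_simps)
  finally show ?thesis
    unfolding nrm_sq[OF m] by (metis Re_complex_of_real)
qed

lemma Cauchy_Schwarz:
  assumes "f \<in> V" "g \<in> V"
  shows "cmod (ip f g) \<le> nrm f * nrm g"
proof -
  have "(cmod (ip f g))\<^sup>2 \<le> (nrm g)\<^sup>2 * (nrm f)\<^sup>2"
  proof (rule discriminant_bound)
    fix r :: real
    have *: "(- of_real r * cnj (ip f g)) * ip f g = of_real (- r * (cmod (ip f g))\<^sup>2)"
      using complex_norm_square[of "ip f g"] by (simp add: mult_ac)
    have "0 \<le> (nrm (\<lambda>x. g x + (- of_real r * cnj (ip f g)) * f x))\<^sup>2" by simp
    then show "0 \<le> (nrm g)\<^sup>2 - 2 * r * (cmod (ip f g))\<^sup>2 + r\<^sup>2 * ((cmod (ip f g))\<^sup>2 * (nrm f)\<^sup>2)"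
      unfolding nrm_sq_add[OF assms(2,1)] * Re_complex_of_real
      by (simp add: norm_mult power_mult_distrib mult_ac)
  qed auto
  then show ?thesis
    by (metis assms mult.commute mult_nonneg_nonneg nrm_nonneg power2_le_imp_le power_mult_distrib)
qed

lemma nrm_scale: "f \<in> V \<Longrightarrow> nrm (\<lambda>x. c * f x) = cmod c * nrm f"
  using nrm_sq_add[OF zero_mem, of f c] nrm_nonneg[of f] nrm_nonneg[of "\<lambda>x. c * f x"] scale_mem[of f c]
    ip_scale[OF zero_mem, of f 0] ip_scale[OF zero_mem zero_mem, of 0] ip_cnj[OF zero_mem, of f]
  by (simp add: nrm_def[of "\<lambda>x. 0"] power_mult_distrib[symmetric])

lemma nrm_triangle:
  assumes "f \<in> V" "g \<in> V"
  shows "nrm (\<lambda>x. f x + g x) \<le> nrm f + nrm g"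
proof -
  have "Re (ip g f) \<le> nrm f * nrm g"
    using Cauchy_Schwarz[OF assms(2,1)] complex_Re_le_cmod[of "ip g f"] by (simp add: mult.commute)
  then have "(nrm (\<lambda>x. f x + g x))\<^sup>2 \<le> (nrm f + nrm g)\<^sup>2"
    using nrm_sq_add[OF assms, of 1] by (simp add: power2_sum)
  then show ?thesis
    using assms by (auto intro: power2_le_imp_le)
qed

lemma nrm_triangle_diff:
  assumes "f \<in> V" "g \<in> V"
  shows "nrm (\<lambda>x. f x - g x) \<le> nrm f + nrm g"
  using nrm_triangle[OF assms(1) scale_mem[OF assms(2), of "-1"]] nrm_scale[OF assms(2), of "-1"] by simp

lemma nrm_diff_abs:
  assumes "f \<in> V" "g \<in> V"
  shows "\<bar>nrm f - nrm g\<bar> \<le> nrm (\<lambda>x. f x - g x)"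
proof -
  have "nrm f \<le> nrm (\<lambda>x. f x - g x) + nrm g"
    using nrm_triangle[OF diff_mem[OF assms] assms(2)] by simp
  moreover have "nrm g \<le> nrm (\<lambda>x. f x - g x) + nrm f"
    using nrm_triangle_diff[OF assms(1) diff_mem[OF assms]] by simp
  ultimately show ?thesis by simp
qed

text \<open>Without completeness a bounded functional need not be represented by a vector, but a
  minimising sequence \<open>w\<^sub>n\<close> of \<open>\<parallel>u\<parallel>\<^sup>2 - 2 Re
  \<phi>(u)\<close> represents it up to an error that tends to zero: the first variation at a
  near-minimiser is small.\<close>

lemma approx_Riesz:
  assumes add: "\<And>u v. u \<in> V \<Longrightarrow> v \<in> V \<Longrightarrow> \<phi> (\<lambda>x. u x + v x) = \<phi> u + \<phi> v"
    and scale: "\<And>c u. u \<in> V \<Longrightarrow> \<phi> (\<lambda>x. c * u x) = c * \<phi> u"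
    and bound: "\<And>u. u \<in> V \<Longrightarrow> cmod (\<phi> u) \<le> C * nrm u"
  obtains w :: "nat \<Rightarrow> 'x \<Rightarrow> complex" where "\<And>n. w n \<in> V"
    "\<And>n u. u \<in> V \<Longrightarrow> cmod (\<phi> u - ip u (w n)) \<le> nrm u / sqrt (real (Suc n))"
proof -
  define J where "J = (\<lambda>u. (nrm u)\<^sup>2 - 2 * Re (\<phi> u))"
  have Jlow: "- C\<^sup>2 \<le> J u" if "u \<in> V" for u
  proof -
    have "Re (\<phi> u) \<le> C * nrm u"
      using bound[OF that] complex_Re_le_cmod[of "\<phi> u"] by linarith
    moreover have "0 \<le> (nrm u - C)\<^sup>2" by simp
    ultimately show ?thesis unfolding J_def power2_diff by (simp add: mult_ac)
  qed
  define e where "e = Inf (J ` V)"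
  have bdd: "bdd_below (J ` V)" using Jlow by (auto intro!: bdd_belowI[of _ "- C\<^sup>2"])
  have elow: "e \<le> J u" if "u \<in> V" for u
    unfolding e_def using that bdd by (intro cInf_lower) auto
  have "\<exists>u\<in>V. J u < e + 1 / real (Suc n)" for n
    using cInf_lessD[of "J ` V" "e + 1 / real (Suc n)"] zero_mem by (auto simp: e_def)
  then obtain w where w: "\<And>n. w n \<in> V" "\<And>n. J (w n) < e + 1 / real (Suc n)" by metis
  have "cmod (\<phi> u - ip u (w n)) \<le> nrm u / sqrt (real (Suc n))" if u: "u \<in> V" for u n
  proof -
    define a where "a = ip u (w n) - \<phi> u"
    have "(cmod a)\<^sup>2 \<le> (1 / real (Suc n)) * (nrm u)\<^sup>2"
    proof (rule discriminant_bound)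
      fix r :: real
      \<comment> \<open>Among the scalars of the same modulus this one decreases the functional most.\<close>
      define c where "c = - of_real r * cnj a"
      have ca: "c * a = of_real (- r * (cmod a)\<^sup>2)"
        using complex_norm_square[of a] by (simp add: c_def mult_ac)
      have m: "(\<lambda>x. w n x + c * u x) \<in> V" using w(1) u add_mem scale_mem by blast
      have "J (\<lambda>x. w n x + c * u x) = J (w n) + 2 * Re (c * a) + (cmod c)\<^sup>2 * (nrm u)\<^sup>2"
        unfolding J_def nrm_sq_add[OF w(1) u] add[OF w(1) scale_mem[OF u]] scale[OF u] a_def
        by (simp add: algebra_simps)
      with elow[OF m] w(2)[of n]
      have "0 \<le> 1 / real (Suc n) + 2 * Re (c * a) + (cmod c)\<^sup>2 * (nrm u)\<^sup>2" by linarith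
      then show "0 \<le> 1 / real (Suc n) - 2 * r * (cmod a)\<^sup>2 + r\<^sup>2 * ((cmod a)\<^sup>2 * (nrm u)\<^sup>2)"
        unfolding ca Re_complex_of_real by (simp add: c_def norm_mult power_mult_distrib mult_ac)
    qed auto
    also have "\<dots> = (nrm u / sqrt (real (Suc n)))\<^sup>2"
      by (simp add: power_divide)
    finally show ?thesis
      using u by (auto simp: a_def norm_minus_commute intro: power2_le_imp_le)
  qed
  with w(1) show ?thesis by (rule that)
qed

text \<open>Uniqueness in the Riesz theorem, quantitatively: two approximate representatives of one
  functional are close.\<close>

lemma approx_Riesz_diff:
  assumes "u \<in> V" "u' \<in> V"
    and "\<And>v. v \<in> V \<Longrightarrow> cmod (\<phi> v - ip v u) \<le> a * nrm v"
    and "\<And>v. v \<in> V \<Longrightarrow> cmod (\<phi> v - ip v u') \<le> b * nrm v"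
    and "0 \<le> a" "0 \<le> b"
  shows "nrm (\<lambda>x. u x - u' x) \<le> a + b"
proof -
  define v where "v = (\<lambda>x. u x - u' x)"
  have v: "v \<in> V" unfolding v_def using assms diff_mem by blast
  have "ip v v = (\<phi> v - ip v u') - (\<phi> v - ip v u)"
    unfolding v_def by (simp add: ip_diff_right assms diff_mem)
  then have "cmod (ip v v) = cmod ((\<phi> v - ip v u') - (\<phi> v - ip v u))" by (rule arg_cong)
  then have "cmod (ip v v) \<le> (a + b) * nrm v"
    using norm_triangle_ineq4[of "\<phi> v - ip v u'" "\<phi> v - ip v u"] assms(3,4)[OF v]
    unfolding distrib_right by linarith
  then have "nrm v * nrm v \<le> (a + b) * nrm v"
    by (simp add: ip_self v power2_eq_square flip: of_real_mult)
  then show ?thesis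
    using nrm_nonneg[OF v] assms(5,6) unfolding v_def[symmetric]
    by (cases "nrm v = 0") auto
qed

end

sublocale hilbert_function_space \<subseteq> semi_inner_product H ip
  by unfold_locales (fact zero_mem add_mem scale_mem ip_add ip_scale ip_cnj ip_nonneg)+


definition finsupp :: "'x set \<Rightarrow> ('x \<Rightarrow> complex) set" where
  "finsupp X = {v. finite {x. v x \<noteq> 0} \<and> {x. v x \<noteq> 0} \<subseteq> X}"

text \<open>The inner product of the combinations \<open>\<Sum>x. u x \<cdot> k(\<cdot>, x)\<close> and
  \<open>\<Sum>y. v y \<cdot> k(\<cdot>, y)\<close> of kernel functions, which are represented
  by their coefficients.\<close>

definition kip :: "('x \<Rightarrow> 'x \<Rightarrow> complex) \<Rightarrow> ('x \<Rightarrow> complex) \<Rightarrow> ('x \<Rightarrow> complex) \<Rightarrow> complex" where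
  "kip k u v = (\<Sum>x | u x \<noteq> 0. \<Sum>y | v y \<noteq> 0. u x * cnj (v y) * k y x)"

text \<open>The inner product of \<open>\<Sum>x. u x \<cdot> k(\<cdot>, x)\<close> with \<open>f\<close>
  in a space with reproducing kernel \<open>k\<close>, written without reference to
  \<open>k\<close>.\<close>

definition pairing :: "('x \<Rightarrow> complex) \<Rightarrow> ('x \<Rightarrow> complex) \<Rightarrow> complex" where
  "pairing f u = (\<Sum>x | u x \<noteq> 0. u x * cnj (f x))"

lemma kip_eq:
  assumes "finite F" "{x. u x \<noteq> 0} \<subseteq> F" "{x. v x \<noteq> 0} \<subseteq> F"
  shows "kip k u v = (\<Sum>x\<in>F. \<Sum>y\<in>F. u x * cnj (v y) * k y x)"
proof -
  have "kip k u v = (\<Sum>x | u x \<noteq> 0. \<Sum>y\<in>F. u x * cnj (v y) * k y x)"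
    unfolding kip_def using assms by (intro sum.cong refl sum.mono_neutral_left) auto
  also have "\<dots> = (\<Sum>x\<in>F. \<Sum>y\<in>F. u x * cnj (v y) * k y x)"
    using assms by (intro sum.mono_neutral_left) auto
  finally show ?thesis .
qed

lemma pairing_eq:
  assumes "finite F" "{x. u x \<noteq> 0} \<subseteq> F"
  shows "pairing f u = (\<Sum>x\<in>F. u x * cnj (f x))"
  unfolding pairing_def using assms by (intro sum.mono_neutral_left) auto

lemma finsupp_common:
  assumes "u \<in> finsupp X" "v \<in> finsupp X" "w \<in> finsupp X"
  obtains F where "finite F" "F \<subseteq> X" "{x. u x \<noteq> 0} \<subseteq> F" "{x. v x \<noteq> 0} \<subseteq> F" "{x. w x \<noteq> 0} \<subseteq> F"
  using assms that[of "{x. u x \<noteq> 0} \<union> {x. v x \<noteq> 0} \<union> {x. w x \<noteq> 0}"] by (auto simp: finsupp_def)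

text \<open>The conjugation sits on the second argument of \<open>kip\<close> and on the first factor of
  \<open>kform\<close>; the two conventions agree on the diagonal.\<close>

lemma kform_eq_kip:
  assumes "finite F" "{x. v x \<noteq> 0} \<subseteq> F"
  shows "kform F k v = kip k v v"
  unfolding kip_eq[OF assms assms(2)] kform_def by (subst sum.swap) (simp add: mult_ac)

lemma finsupp_restrict: "finite F \<Longrightarrow> F \<subseteq> X \<Longrightarrow> (\<lambda>x. if x \<in> F then v x else 0) \<in> finsupp X"
  by (auto simp: finsupp_def)

lemma single_in_finsupp: "x \<in> X \<Longrightarrow> (\<lambda>y. if y = x then c else 0) \<in> finsupp X"
  by (auto simp: finsupp_def)

lemma pairing_single: "pairing f (\<lambda>y. if y = x then c else 0) = c * cnj (f x)"
  by (subst pairing_eq[of "{x}"]) auto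

lemma kip_single: 
  "kip k u (\<lambda>y. if y = x then 1 else 0) = (\<Sum>y | u y \<noteq> 0. u y * k x y)"
proof (cases "finite {y. u y \<noteq> 0}")
  case True
  have "{y. (if y = x then 1 else 0 :: complex) \<noteq> 0} = {x}" by auto
  then show ?thesis by (simp add: kip_def)
next
  case False
  then show ?thesis by (simp add: kip_def)
qed

lemma support_add_subset: "{x. f x + g x \<noteq> (0 :: complex)} \<subseteq> {x. f x \<noteq> 0} \<union> {x. g x \<noteq> 0}"
  by auto

lemma finsupp_add:
  assumes "f \<in> finsupp X" "g \<in> finsupp X"
  shows "(\<lambda>x. f x + g x) \<in> finsupp X"
proof -
  have "{x. f x + g x \<noteq> 0} \<subseteq> X" using assms support_add_subset[of f g] by (auto simp: finsupp_def)
  moreover have "finite {x. f x + g x \<noteq> 0}"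
    using assms finite_subset[OF support_add_subset[of f g]] by (auto simp: finsupp_def)
  ultimately show ?thesis by (simp add: finsupp_def)
qed

lemma finsupp_scale: "f \<in> finsupp X \<Longrightarrow> (\<lambda>x. c * f x) \<in> finsupp X"
  unfolding finsupp_def
proof (safe; goal_cases)
  case 1
  show ?case by (rule finite_subset[OF _ 1(1)]) auto
qed auto

lemma semi_inner_product_kip:
  assumes "is_kernel X k"
  shows "semi_inner_product (finsupp X) (kip k)"
proof
  show "(\<lambda>x. 0) \<in> finsupp X" by (simp add: finsupp_def)
next
  fix f g h assume fgh: "f \<in> finsupp X" "g \<in> finsupp X" "h \<in> finsupp X"
  then obtain F where F: "finite F" "{x. f x \<noteq> 0} \<subseteq> F" "{x. g x \<noteq> 0} \<subseteq> F" "{x. h x \<noteq> 0} \<subseteq> F"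
    using finsupp_common by metis
  have "{x. f x + g x \<noteq> 0} \<subseteq> F" using F support_add_subset[of f g] by blast
  then show "kip k (\<lambda>x. f x + g x) h = kip k f h + kip k g h"
    using F by (simp add: kip_eq[of F] algebra_simps sum.distrib)
next
  fix f g c assume fgh: "f \<in> finsupp X" "g \<in> finsupp X"
  then obtain F where F: "finite F" "F \<subseteq> X" "{x. f x \<noteq> 0} \<subseteq> F" "{x. g x \<noteq> 0} \<subseteq> F"
    using finsupp_common by metis
  have "{x. c * f x \<noteq> 0} \<subseteq> F" using F by auto
  then show "kip k (\<lambda>x. c * f x) g = c * kip k f g"
    using F by (simp add: kip_eq[of F] sum_distrib_left mult_ac)
  have k: "k y x = cnj (k x y)" if "x \<in> F" "y \<in> F" for x y
    using F that is_kernel_hermitian[OF assms] by blast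
  have "kip k g f = (\<Sum>y\<in>F. \<Sum>x\<in>F. g x * cnj (f y) * k y x)"
    unfolding kip_eq[OF F(1,4,3)] by (rule sum.swap)
  also have "\<dots> = (\<Sum>y\<in>F. \<Sum>x\<in>F. cnj (f y * cnj (g x) * k x y))"
    by (intro sum.cong refl) (subst k, simp_all)
  also have "\<dots> = cnj (kip k f g)"
    unfolding kip_eq[OF F(1,3,4)] by simp
  finally show "kip k g f = cnj (kip k f g)" .
  show "0 \<le> kip k f f"
    using is_kernelD[OF assms F(1,2), of f] kform_eq_kip[OF F(1,3)] by metis
qed (auto intro: finsupp_add finsupp_scale)

lemma pairing_add:
  assumes "u \<in> finsupp X" "v \<in> finsupp X"
  shows "pairing f (\<lambda>x. u x + v x) = pairing f u + pairing f v"
proof -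
  obtain F where F: "finite F" "F \<subseteq> X" "{x. u x \<noteq> 0} \<subseteq> F" "{x. v x \<noteq> 0} \<subseteq> F"
    using assms finsupp_common by metis
  have "{x. u x + v x \<noteq> 0} \<subseteq> F" using F support_add_subset[of u v] by blast
  then show ?thesis using F by (simp add: pairing_eq[of F] algebra_simps sum.distrib)
qed

lemma pairing_scale:
  assumes "u \<in> finsupp X"
  shows "pairing f (\<lambda>x. c * u x) = c * pairing f u"
proof -
  obtain F where F: "finite F" "F \<subseteq> X" "{x. u x \<noteq> 0} \<subseteq> F"
    using assms finsupp_common by metis
  have "{x. c * u x \<noteq> 0} \<subseteq> F" using F by auto
  then show ?thesis using F by (simp add: pairing_eq[of F] sum_distrib_left mult_ac)
qed

lemma pairing_diff:
  assumes "u \<in> finsupp X" "v \<in> finsupp X"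
  shows "pairing f (\<lambda>x. u x - v x) = pairing f u - pairing f v"
  using pairing_add[OF assms(1) finsupp_scale[OF assms(2), of "-1"]] pairing_scale[OF assms(2), of _ "-1"]
  by simp

lemma pairing_fun_add: "pairing (\<lambda>x. f x + g x) u = pairing f u + pairing g u"
  by (simp add: pairing_def algebra_simps sum.distrib)

lemma pairing_fun_diff: "pairing (\<lambda>x. f x - g x) u = pairing f u - pairing g u"
  by (simp add: pairing_def algebra_simps sum_subtractf)

lemma pairing_fun_scale: "pairing (\<lambda>x. c * f x) u = cnj c * pairing f u"
  by (simp add: pairing_def sum_distrib_left mult_ac)

section \<open>The theorem of Moore and Aronszajn\<close>

locale positive_kernel =
  fixes X :: "'x set" and k :: "'x \<Rightarrow> 'x \<Rightarrow> complex"
  assumes kernel: "is_kernel X k"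
begin

sublocale V: semi_inner_product "finsupp X" "kip k"
  using kernel by (rule semi_inner_product_kip)

text \<open>A function belongs to the space if it defines a bounded functional on combinations of kernel
  functions. Describing the space by functionals avoids completing a quotient.\<close>

definition rk_space :: "('x \<Rightarrow> complex) set" where
  "rk_space = {f. (\<forall>x. x \<notin> X \<longrightarrow> f x = 0) \<and>
     (\<exists>C. \<forall>u\<in>finsupp X. cmod (pairing f u) \<le> C * V.nrm u)}"

text \<open>The coefficients \<open>w n\<close> of combinations of kernel functions that converge to
  \<open>f\<close> in the space, expressed through the functional of \<open>f\<close> since the
  norm of the space is not available yet.\<close>

definition approximates :: "('x \<Rightarrow> complex) \<Rightarrow> (nat \<Rightarrow> 'x \<Rightarrow> complex) \<Rightarrow> bool" where
  "approximates f w \<longleftrightarrow> (\<forall>n. w n \<in> finsupp X) \<and>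
     (\<exists>e. e \<longlonglongrightarrow> 0 \<and> (\<forall>n. 0 \<le> e n) \<and>
       (\<forall>n. \<forall>u\<in>finsupp X. cmod (pairing f u - kip k u (w n)) \<le> e n * V.nrm u))"

text \<open>The inner product of \<open>f\<close> and \<open>g\<close> is the limit of
  \<open>\<langle>w\<^sub>n, g\<rangle>\<close> along approximations \<open>w\<^sub>n\<close> of
  \<open>f\<close>. The choice of the sequence is immaterial by
  \<open>approximates_pairing\<close>.\<close>

definition rk_inner :: "('x \<Rightarrow> complex) \<Rightarrow> ('x \<Rightarrow> complex) \<Rightarrow> complex" where
  "rk_inner f g = lim (\<lambda>n. pairing g ((SOME w. approximates f w) n))"

definition rk_norm :: "('x \<Rightarrow> complex) \<Rightarrow> real" where
  "rk_norm f = sqrt (Re (rk_inner f f))"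

lemma tendsto_inverse_sqrt: "(\<lambda>n. 1 / sqrt (real (Suc n))) \<longlonglongrightarrow> 0"
proof -
  have "(\<lambda>n. sqrt (inverse (real (Suc n)))) \<longlonglongrightarrow> sqrt 0"
    by (intro tendsto_real_sqrt LIMSEQ_inverse_real_of_nat)
  then show ?thesis by (simp add: real_sqrt_divide inverse_eq_divide)
qed

lemma bounded_approximates:
  assumes "\<And>u. u \<in> finsupp X \<Longrightarrow> cmod (pairing f u) \<le> C * V.nrm u"
  shows "\<exists>w. approximates f w"
proof -
  obtain w where w: "\<And>n. w n \<in> finsupp X"
    "\<And>n u. u \<in> finsupp X \<Longrightarrow> cmod (pairing f u - kip k u (w n)) \<le> V.nrm u / sqrt (real (Suc n))"
    using V.approx_Riesz[of "pairing f" C, OF pairing_add[of _ X] pairing_scale[of _ X] assms] by blast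
  have "approximates f w"
    unfolding approximates_def using w tendsto_inverse_sqrt
    by (intro conjI exI[of _ "\<lambda>n. 1 / sqrt (real (Suc n))"]) auto
  then show ?thesis by blast
qed

lemma rk_space_approximates: "f \<in> rk_space \<Longrightarrow> \<exists>w. approximates f w"
  unfolding rk_space_def using bounded_approximates by blast

lemma approximates_diff:
  assumes "approximates f w" "approximates f w'"
  obtains e e' where "e \<longlonglongrightarrow> 0" "e' \<longlonglongrightarrow> 0" "\<And>n m. V.nrm (\<lambda>x. w n x - w' m x) \<le> e n + e' m"
proof -
  from assms obtain e e' where *: "e \<longlonglongrightarrow> 0" "e' \<longlonglongrightarrow> 0" "\<And>n. 0 \<le> e n" "\<And>n. 0 \<le> e' n"
    "\<And>n u. u \<in> finsupp X \<Longrightarrow> cmod (pairing f u - kip k u (w n)) \<le> e n * V.nrm u"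
    "\<And>n u. u \<in> finsupp X \<Longrightarrow> cmod (pairing f u - kip k u (w' n)) \<le> e' n * V.nrm u"
    "\<And>n. w n \<in> finsupp X" "\<And>n. w' n \<in> finsupp X"
    unfolding approximates_def by blast
  show ?thesis
    by (rule that[OF *(1,2)], rule V.approx_Riesz_diff[where \<phi> = "pairing f"]) (use * in auto)
qed

text \<open>Two approximating sequences approach each other in the seminorm by
  \<open>approx_Riesz_diff\<close>, and \<open>pairing g\<close> is bounded. So the limit exists
  and does not depend on the sequence.\<close>

lemma approximates_pairing:
  assumes f: "approximates f w" and g: "g \<in> rk_space"
  shows "(\<lambda>n. pairing g (w n)) \<longlonglongrightarrow> rk_inner f g"
proof -
  define W where "W = (SOME w. approximates f w)"
  have W: "approximates f W" unfolding W_def using someI[of "approximates f", OF f] .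
  from g obtain C0 where C0: "\<And>u. u \<in> finsupp X \<Longrightarrow> cmod (pairing g u) \<le> C0 * V.nrm u"
    unfolding rk_space_def by blast
  define C where "C = \<bar>C0\<bar>"
  have C: "cmod (pairing g u) \<le> C * V.nrm u" "0 \<le> C" if "u \<in> finsupp X" for u
    using C0[OF that] mult_right_mono[OF abs_ge_self[of C0] V.nrm_nonneg[OF that]] by (auto simp: C_def)
  have mem: "w n \<in> finsupp X" "W n \<in> finsupp X" for n
    using f W by (auto simp: approximates_def)
  have dist: "cmod (pairing g (v n) - pairing g (v' m)) \<le> C * (e n + e' m)"
    if "\<And>n. v n \<in> finsupp X" "\<And>n. v' n \<in> finsupp X" "\<And>n m. V.nrm (\<lambda>x. v n x - v' m x) \<le> e n + e' m"
    for v v' :: "nat \<Rightarrow> 'x \<Rightarrow> complex" and e e' :: "nat \<Rightarrow> real" and n m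
    using C[OF V.diff_mem[OF that(1)[of n] that(2)[of m]]] mult_left_mono[OF that(3)[of n m], of C]
    by (simp add: pairing_diff[OF that(1)[of n] that(2)[of m]])
  obtain e e' where e: "e \<longlonglongrightarrow> 0" "e' \<longlonglongrightarrow> 0" "\<And>n m. V.nrm (\<lambda>x. W n x - W m x) \<le> e n + e' m"
    using approximates_diff[OF W W] by metis
  have "Cauchy (\<lambda>n. pairing g (W n))"
    unfolding Cauchy_def
  proof (intro allI impI)
    fix r :: real assume "0 < r"
    define s where "s = r / (2 * C + 1) / 2"
    have "0 \<le> C" by (simp add: C_def)
    then have s: "0 < s" using \<open>0 < r\<close> by (simp add: s_def)
    from LIMSEQ_D[OF e(1) s] LIMSEQ_D[OF e(2) s] obtain N M
      where NM: "\<And>n. n \<ge> N \<Longrightarrow> \<bar>e n\<bar> < s" "\<And>n. n \<ge> M \<Longrightarrow> \<bar>e' n\<bar> < s" by auto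
    have "dist (pairing g (W m)) (pairing g (W n)) < r" if "m \<ge> max N M" "n \<ge> max N M" for m n
    proof -
      have "e m + e' n \<le> 2 * s" using NM(1)[of m] NM(2)[of n] that by auto
      then have "C * (e m + e' n) \<le> C * (2 * s)" using \<open>0 \<le> C\<close> by (intro mult_left_mono)
      also have "\<dots> < r" using \<open>0 \<le> C\<close> \<open>0 < r\<close> by (simp add: s_def field_simps add_pos_nonneg)
      finally show ?thesis using dist[of W W e e' m n] mem e(3) by (simp add: dist_norm)
    qed
    then show "\<exists>M. \<forall>m\<ge>M. \<forall>n\<ge>M. dist (pairing g (W m)) (pairing g (W n)) < r" by blast
  qed
  then have lim: "(\<lambda>n. pairing g (W n)) \<longlonglongrightarrow> rk_inner f g"
    unfolding rk_inner_def W_def[symmetric] using Cauchy_convergent convergent_LIMSEQ_iff by blast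
  obtain d d' where d: "d \<longlonglongrightarrow> 0" "d' \<longlonglongrightarrow> 0" "\<And>n m. V.nrm (\<lambda>x. w n x - W m x) \<le> d n + d' m"
    using approximates_diff[OF f W] by metis
  have "(\<lambda>n. pairing g (w n) - pairing g (W n)) \<longlonglongrightarrow> 0"
  proof (rule Lim_null_comparison)
    show "\<forall>\<^sub>F n in sequentially. cmod (pairing g (w n) - pairing g (W n)) \<le> C * (d n + d' n)"
      using dist[of w W d d'] mem d(3) by simp
    show "(\<lambda>n. C * (d n + d' n)) \<longlonglongrightarrow> 0"
      using tendsto_mult[OF tendsto_const[of C] tendsto_add[OF d(1,2)]] by simp
  qed
  from tendsto_add[OF this lim] show ?thesis by simp
qed

text \<open>The error \<open>pairing g (w n) - kip k (w n) (w' n)\<close> is small relative to the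
  seminorm of \<open>w n\<close>, which stays bounded.\<close>

lemma approximates_kip:
  assumes f: "approximates f w" and g: "approximates g w'" "g \<in> rk_space"
  shows "(\<lambda>n. kip k (w n) (w' n)) \<longlonglongrightarrow> rk_inner f g"
proof -
  obtain e e' where e: "e \<longlonglongrightarrow> 0" "e' \<longlonglongrightarrow> 0" "\<And>n m. V.nrm (\<lambda>x. w n x - w m x) \<le> e n + e' m"
    using approximates_diff[OF f f] by metis
  from g(1) obtain d where d: "d \<longlonglongrightarrow> 0" "\<And>n. 0 \<le> d n"
    "\<And>n u. u \<in> finsupp X \<Longrightarrow> cmod (pairing g u - kip k u (w' n)) \<le> d n * V.nrm u"
    unfolding approximates_def by blast
  have mem: "w n \<in> finsupp X" for n using f by (auto simp: approximates_def)
  have "(\<lambda>n. pairing g (w n) - kip k (w n) (w' n)) \<longlonglongrightarrow> 0"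
  proof (rule Lim_null_comparison)
    have "cmod (pairing g (w n) - kip k (w n) (w' n)) \<le> d n * (e n + e' 0 + V.nrm (w 0))" for n
    proof -
      have "V.nrm (w n) \<le> e n + e' 0 + V.nrm (w 0)"
        using V.nrm_diff_abs[OF mem mem, of n 0] e(3)[of n 0] by linarith
      then show ?thesis
        using d(3)[OF mem, of n n] d(2)[of n] by (meson mult_left_mono order_trans)
    qed
    then show "\<forall>\<^sub>F n in sequentially. cmod (pairing g (w n) - kip k (w n) (w' n)) \<le> d n * (e n + e' 0 + V.nrm (w 0))"
      by simp
    show "(\<lambda>n. d n * (e n + e' 0 + V.nrm (w 0))) \<longlonglongrightarrow> 0"
      using tendsto_mult[OF d(1) tendsto_add[OF tendsto_add[OF e(1) tendsto_const[of "e' 0"]] tendsto_const[of "V.nrm (w 0)"]]]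
      by simp
  qed
  from tendsto_diff[OF approximates_pairing[OF f g(2)] this] show ?thesis by simp
qed

lemma approximates_add:
  assumes "approximates f w" "approximates g w'"
  shows "approximates (\<lambda>x. f x + g x) (\<lambda>n x. w n x + w' n x)"
proof -
  from assms obtain e e' where *: "e \<longlonglongrightarrow> 0" "e' \<longlonglongrightarrow> 0" "\<And>n. 0 \<le> e n" "\<And>n. 0 \<le> e' n"
    "\<And>n u. u \<in> finsupp X \<Longrightarrow> cmod (pairing f u - kip k u (w n)) \<le> e n * V.nrm u"
    "\<And>n u. u \<in> finsupp X \<Longrightarrow> cmod (pairing g u - kip k u (w' n)) \<le> e' n * V.nrm u"
    "\<And>n. w n \<in> finsupp X" "\<And>n. w' n \<in> finsupp X"
    unfolding approximates_def by blast
  have "cmod (pairing (\<lambda>x. f x + g x) u - kip k u (\<lambda>x. w n x + w' n x)) \<le> (e n + e' n) * V.nrm u"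
    if "u \<in> finsupp X" for n u
  proof -
    have "pairing (\<lambda>x. f x + g x) u - kip k u (\<lambda>x. w n x + w' n x)
        = (pairing f u - kip k u (w n)) + (pairing g u - kip k u (w' n))"
      by (simp add: pairing_fun_add V.ip_add_right that *)
    then show ?thesis
      using norm_triangle_ineq[of "pairing f u - kip k u (w n)" "pairing g u - kip k u (w' n)"]
        *(5)[OF that, of n] *(6)[OF that, of n] by (simp add: distrib_right)
  qed
  then show ?thesis
    unfolding approximates_def using * V.add_mem tendsto_add[OF *(1,2)]
    by (intro conjI exI[of _ "\<lambda>n. e n + e' n"]) auto
qed

lemma approximates_scale:
  assumes "approximates f w"
  shows "approximates (\<lambda>x. c * f x) (\<lambda>n x. c * w n x)"
proof -
  from assms obtain e where *: "e \<longlonglongrightarrow> 0" "\<And>n. 0 \<le> e n"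
    "\<And>n u. u \<in> finsupp X \<Longrightarrow> cmod (pairing f u - kip k u (w n)) \<le> e n * V.nrm u"
    "\<And>n. w n \<in> finsupp X"
    unfolding approximates_def by blast
  have "cmod (pairing (\<lambda>x. c * f x) u - kip k u (\<lambda>x. c * w n x)) \<le> (cmod c * e n) * V.nrm u"
    if "u \<in> finsupp X" for n u
  proof -
    have "pairing (\<lambda>x. c * f x) u - kip k u (\<lambda>x. c * w n x) = cnj c * (pairing f u - kip k u (w n))"
      by (simp add: pairing_fun_scale V.ip_scale_right that * right_diff_distrib)
    then show ?thesis
      using *(3)[OF that, of n] by (simp add: norm_mult mult.assoc mult_left_mono)
  qed
  then show ?thesis
    unfolding approximates_def using * V.scale_mem tendsto_mult[OF tendsto_const[of "cmod c"] *(1)]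
    by (intro conjI exI[of _ "\<lambda>n. cmod c * e n"]) auto
qed

lemma rk_space_add:
  assumes "f \<in> rk_space" "g \<in> rk_space"
  shows "(\<lambda>x. f x + g x) \<in> rk_space"
proof -
  from assms obtain C D where CD: "\<And>u. u \<in> finsupp X \<Longrightarrow> cmod (pairing f u) \<le> C * V.nrm u"
    "\<And>u. u \<in> finsupp X \<Longrightarrow> cmod (pairing g u) \<le> D * V.nrm u"
    unfolding rk_space_def by blast
  have "cmod (pairing (\<lambda>x. f x + g x) u) \<le> (C + D) * V.nrm u" if "u \<in> finsupp X" for u
    using CD(1)[OF that] CD(2)[OF that] norm_triangle_ineq[of "pairing f u" "pairing g u"]
    by (simp add: pairing_fun_add distrib_right)
  then show ?thesis using assms by (auto simp: rk_space_def)
qed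

lemma rk_space_scale:
  assumes "f \<in> rk_space"
  shows "(\<lambda>x. c * f x) \<in> rk_space"
proof -
  from assms obtain C where C: "\<And>u. u \<in> finsupp X \<Longrightarrow> cmod (pairing f u) \<le> C * V.nrm u"
    unfolding rk_space_def by blast
  have "cmod (pairing (\<lambda>x. c * f x) u) \<le> (cmod c * C) * V.nrm u" if "u \<in> finsupp X" for u
    using C[OF that] by (simp add: pairing_fun_scale norm_mult mult.assoc mult_left_mono)
  then show ?thesis using assms by (auto simp: rk_space_def)
qed

lemma rk_inner_nonneg:
  assumes "f \<in> rk_space"
  shows "0 \<le> rk_inner f f"
proof -
  from rk_space_approximates[OF assms] obtain w where w: "approximates f w" by blast
  have mem: "w n \<in> finsupp X" for n using w by (auto simp: approximates_def)
  have L: "(\<lambda>n. kip k (w n) (w n)) \<longlonglongrightarrow> rk_inner f f"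
    using approximates_kip[OF w w assms] .
  have "0 \<le> Re (kip k (w n) (w n))" "Im (kip k (w n) (w n)) = 0" for n
    using V.ip_nonneg[OF mem] by (auto simp: less_eq_complex_def)
  then have "0 \<le> Re (rk_inner f f)" "(\<lambda>n. 0) \<longlonglongrightarrow> Im (rk_inner f f)"
    using LIMSEQ_le_const[OF tendsto_Re[OF L]] tendsto_Im[OF L] by auto
  then have "0 \<le> Re (rk_inner f f)" "Im (rk_inner f f) = 0"
    using LIMSEQ_unique[OF tendsto_const[of "0 :: real"]] by auto
  then show ?thesis by (simp add: less_eq_complex_def)
qed

lemma approximates_nrm:
  assumes "approximates f w" "f \<in> rk_space"
  shows "(\<lambda>n. V.nrm (w n)) \<longlonglongrightarrow> rk_norm f"
  unfolding V.nrm_def rk_norm_def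
  by (intro tendsto_real_sqrt tendsto_Re approximates_kip assms)

text \<open>Together with \<open>rk_norm_le\<close> this identifies the norm of \<open>f\<close> with the
  norm of the functional that it defines.\<close>

lemma pairing_le_rk_norm:
  assumes "f \<in> rk_space" "u \<in> finsupp X"
  shows "cmod (pairing f u) \<le> rk_norm f * V.nrm u"
proof -
  from rk_space_approximates[OF assms(1)] obtain w where w: "approximates f w" by blast
  then obtain e where *: "e \<longlonglongrightarrow> 0" "\<And>n. 0 \<le> e n"
    "\<And>n u. u \<in> finsupp X \<Longrightarrow> cmod (pairing f u - kip k u (w n)) \<le> e n * V.nrm u"
    "\<And>n. w n \<in> finsupp X"
    unfolding approximates_def by blast
  have "cmod (pairing f u) \<le> (e n + V.nrm (w n)) * V.nrm u" for n
    using *(3)[OF assms(2), of n] V.Cauchy_Schwarz[OF assms(2) *(4)[of n]]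
      norm_triangle_ineq[of "pairing f u - kip k u (w n)" "kip k u (w n)"]
    by (simp add: algebra_simps)
  moreover have "(\<lambda>n. (e n + V.nrm (w n)) * V.nrm u) \<longlonglongrightarrow> (0 + rk_norm f) * V.nrm u"
    by (intro tendsto_intros *(1) approximates_nrm[OF w assms(1)])
  ultimately show ?thesis using LIMSEQ_le_const by fastforce
qed

lemma rk_norm_le:
  assumes "f \<in> rk_space" "0 \<le> c" "\<And>u. u \<in> finsupp X \<Longrightarrow> cmod (pairing f u) \<le> c * V.nrm u"
  shows "rk_norm f \<le> c"
proof -
  from rk_space_approximates[OF assms(1)] obtain w where w: "approximates f w" by blast
  have mem: "w n \<in> finsupp X" for n using w by (auto simp: approximates_def)
  have "cmod (rk_inner f f) \<le> c * rk_norm f"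
    by (rule LIMSEQ_le[OF tendsto_norm[OF approximates_pairing[OF w assms(1)]]
          tendsto_mult[OF tendsto_const approximates_nrm[OF w assms(1)]]])
      (use assms(3)[OF mem] in auto)
  moreover have "rk_norm f * rk_norm f = Re (rk_inner f f)" "0 \<le> rk_norm f"
    using rk_inner_nonneg[OF assms(1)] by (auto simp: rk_norm_def less_eq_complex_def)
  ultimately have "rk_norm f * rk_norm f \<le> c * rk_norm f"
    using complex_Re_le_cmod[of "rk_inner f f"] by linarith
  with \<open>0 \<le> rk_norm f\<close> assms(2) show ?thesis
    by (cases "rk_norm f = 0") auto
qed

text \<open>Every axiom passes to the limit from finitely supported coefficients. For completeness, a
  Cauchy sequence converges pointwise because evaluations are pairings, and the limit is again
  bounded because the Cauchy estimates pass to the limit inside each pairing.\<close>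

lemma hilbert_function_space_rk: "hilbert_function_space X rk_space rk_inner"
proof
  show "\<And>f x. f \<in> rk_space \<Longrightarrow> x \<notin> X \<Longrightarrow> f x = 0" by (auto simp: rk_space_def)
  show "(\<lambda>x. 0) \<in> rk_space" by (auto simp: rk_space_def pairing_def intro!: exI[of _ 0])
  show "\<And>f g. f \<in> rk_space \<Longrightarrow> g \<in> rk_space \<Longrightarrow> (\<lambda>x. f x + g x) \<in> rk_space" by (rule rk_space_add)
  show "\<And>f c. f \<in> rk_space \<Longrightarrow> (\<lambda>x. c * f x) \<in> rk_space" by (rule rk_space_scale)
next
  fix f g h assume *: "f \<in> rk_space" "g \<in> rk_space" "h \<in> rk_space"
  from rk_space_approximates *(1,2) obtain w w' where w: "approximates f w" "approximates g w'" by metis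
  have "(\<lambda>n. pairing h (\<lambda>x. w n x + w' n x)) \<longlonglongrightarrow> rk_inner (\<lambda>x. f x + g x) h"
    by (rule approximates_pairing[OF approximates_add[OF w] *(3)])
  moreover have "pairing h (\<lambda>x. w n x + w' n x) = pairing h (w n) + pairing h (w' n)" for n
    using w by (intro pairing_add) (auto simp: approximates_def)
  moreover have "(\<lambda>n. pairing h (w n) + pairing h (w' n)) \<longlonglongrightarrow> rk_inner f h + rk_inner g h"
    by (intro tendsto_add approximates_pairing w *)
  ultimately show "rk_inner (\<lambda>x. f x + g x) h = rk_inner f h + rk_inner g h"
    using LIMSEQ_unique by simp
next
  fix f g c assume *: "f \<in> rk_space" "g \<in> rk_space"
  from rk_space_approximates * obtain w w' where w: "approximates f w" "approximates g w'" by metis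
  have "(\<lambda>n. pairing g (\<lambda>x. c * w n x)) \<longlonglongrightarrow> rk_inner (\<lambda>x. c * f x) g"
    by (rule approximates_pairing[OF approximates_scale[OF w(1)] *(2)])
  moreover have "pairing g (\<lambda>x. c * w n x) = c * pairing g (w n)" for n
    using w by (intro pairing_scale) (auto simp: approximates_def)
  moreover have "(\<lambda>n. c * pairing g (w n)) \<longlonglongrightarrow> c * rk_inner f g"
    by (intro tendsto_mult tendsto_const approximates_pairing w *)
  ultimately show "rk_inner (\<lambda>x. c * f x) g = c * rk_inner f g"
    using LIMSEQ_unique by simp
  have "kip k (w' n) (w n) = cnj (kip k (w n) (w' n))" for n
    using w by (intro V.ip_cnj) (auto simp: approximates_def)
  then show "rk_inner g f = cnj (rk_inner f g)"
    using LIMSEQ_unique[OF approximates_kip[OF w(2,1) *(1)]] tendsto_cnj[OF approximates_kip[OF w *(2)]] by simp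
next
  show "\<And>f. f \<in> rk_space \<Longrightarrow> 0 \<le> rk_inner f f" by (rule rk_inner_nonneg)
next
  fix f assume f: "f \<in> rk_space" "rk_inner f f = 0"
  have "f x = 0" for x
  proof (cases "x \<in> X")
    case True
    have "cmod (pairing f (\<lambda>y. if y = x then 1 else 0)) \<le> 0"
      using pairing_le_rk_norm[OF f(1) single_in_finsupp[OF True, of 1]] f(2) by (simp add: rk_norm_def)
    then show ?thesis by (simp add: pairing_single)
  next
    case False
    then show ?thesis using f by (auto simp: rk_space_def)
  qed
  then show "f = (\<lambda>x. 0)" by auto
next
  fix F :: "nat \<Rightarrow> 'x \<Rightarrow> complex"
  assume F: "\<And>n. F n \<in> rk_space"
    and "\<And>e::real. 0 < e \<Longrightarrow> \<exists>M. \<forall>m\<ge>M. \<forall>n\<ge>M.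
      sqrt (Re (rk_inner (\<lambda>x. F m x - F n x) (\<lambda>x. F m x - F n x))) < e"
  then have cau: "\<And>e. 0 < e \<Longrightarrow> \<exists>M. \<forall>m\<ge>M. \<forall>n\<ge>M. rk_norm (\<lambda>x. F m x - F n x) < e"
    by (simp add: rk_norm_def)
  have diff: "(\<lambda>x. f x - g x) \<in> rk_space" if "f \<in> rk_space" "g \<in> rk_space" for f g
    using rk_space_add[OF that(1) rk_space_scale[OF that(2), of "-1"]] by simp
  have "convergent (\<lambda>n. F n x)" if x: "x \<in> X" for x
  proof (rule Cauchy_convergent, unfold Cauchy_def, intro allI impI)
    fix e :: real assume "0 < e"
    define s where "s = V.nrm (\<lambda>y. if y = x then 1 else 0)"
    have "0 \<le> s" unfolding s_def using single_in_finsupp[OF x] by simp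
    with \<open>0 < e\<close> have "0 < e / (s + 1)" by simp
    from cau[OF this] obtain M where M: "\<And>m n. m \<ge> M \<Longrightarrow> n \<ge> M \<Longrightarrow> rk_norm (\<lambda>x. F m x - F n x) < e / (s + 1)"
      by blast
    have "dist (F m x) (F n x) < e" if "m \<ge> M" "n \<ge> M" for m n
    proof -
      have "dist (F m x) (F n x) \<le> rk_norm (\<lambda>x. F m x - F n x) * s"
        using pairing_le_rk_norm[OF diff[OF F F] single_in_finsupp[OF x, of 1], of m n]
        unfolding s_def pairing_single by (simp add: dist_norm flip: complex_cnj_diff)
      also have "\<dots> \<le> e / (s + 1) * s" using M[OF that] \<open>0 \<le> s\<close> by (intro mult_right_mono) auto
      also have "\<dots> < e" using \<open>0 \<le> s\<close> \<open>0 < e\<close> by (simp add: field_simps)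
      finally show ?thesis .
    qed
    then show "\<exists>M. \<forall>m\<ge>M. \<forall>n\<ge>M. dist (F m x) (F n x) < e" by blast
  qed
  then have "\<forall>x\<in>X. \<exists>l. (\<lambda>n. F n x) \<longlonglongrightarrow> l" by (auto simp: convergent_def)
  then obtain f0 where f0: "\<And>x. x \<in> X \<Longrightarrow> (\<lambda>n. F n x) \<longlonglongrightarrow> f0 x" by metis
  define f where "f = (\<lambda>x. if x \<in> X then f0 x else 0)"
  have fl: "(\<lambda>n. pairing (F n) u) \<longlonglongrightarrow> pairing f u" if "u \<in> finsupp X" for u
    unfolding pairing_def using that f0
    by (intro tendsto_intros) (auto simp: f_def finsupp_def)
  have near: "(\<lambda>x. F n x - f x) \<in> rk_space \<and> rk_norm (\<lambda>x. F n x - f x) \<le> e"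
    if "0 < e" and close: "\<forall>m\<ge>M. \<forall>n\<ge>M. rk_norm (\<lambda>x. F m x - F n x) < e" and "n \<ge> M" for e M n
  proof -
    have b: "cmod (pairing (\<lambda>x. F n x - f x) u) \<le> e * V.nrm u" if u: "u \<in> finsupp X" for u
    proof (rule LIMSEQ_le_const2)
      show "(\<lambda>m. cmod (pairing (F n) u - pairing (F m) u)) \<longlonglongrightarrow> cmod (pairing (\<lambda>x. F n x - f x) u)"
        unfolding pairing_fun_diff by (intro tendsto_intros fl u)
      have "cmod (pairing (F n) u - pairing (F m) u) \<le> e * V.nrm u" if m: "m \<ge> M" for m
      proof -
        have "cmod (pairing (F n) u - pairing (F m) u) \<le> rk_norm (\<lambda>x. F n x - F m x) * V.nrm u"
          using pairing_le_rk_norm[OF diff[OF F F] u, of n m] by (simp add: pairing_fun_diff)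
        also have "\<dots> \<le> e * V.nrm u"
          using close \<open>n \<ge> M\<close> m u by (intro mult_right_mono) (auto intro: less_imp_le)
        finally show ?thesis .
      qed
      then show "\<exists>N. \<forall>m\<ge>N. cmod (pairing (F n) u - pairing (F m) u) \<le> e * V.nrm u" by blast
    qed
    have "(\<lambda>x. F n x - f x) \<in> rk_space"
      using b F by (auto simp: rk_space_def f_def)
    then show ?thesis using rk_norm_le b \<open>0 < e\<close> by auto
  qed
  from cau[of 1] obtain M where M: "\<forall>m\<ge>M. \<forall>n\<ge>M. rk_norm (\<lambda>x. F m x - F n x) < 1" by auto
  then have "(\<lambda>x. F M x - f x) \<in> rk_space" using near[of 1 M M] by simp
  then have "f \<in> rk_space" using diff[OF F[of M]] by fastforce
  moreover have "(\<lambda>n. rk_norm (\<lambda>x. F n x - f x)) \<longlonglongrightarrow> 0"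
  proof (rule LIMSEQ_I)
    fix r :: real assume "0 < r"
    then have r2: "0 < r / 2" by simp
    from cau[OF r2] obtain M where M: "\<forall>m\<ge>M. \<forall>n\<ge>M. rk_norm (\<lambda>x. F m x - F n x) < r / 2" by blast
    have "norm (rk_norm (\<lambda>x. F n x - f x) - 0) < r" if "n \<ge> M" for n
    proof -
      have "0 \<le> rk_norm (\<lambda>x. F n x - f x)"
        using rk_inner_nonneg near[of "r / 2" M n] r2 M that by (simp add: rk_norm_def less_eq_complex_def)
      then show ?thesis using near[of "r / 2" M n] r2 M that by auto
    qed
    then show "\<exists>no. \<forall>n\<ge>no. norm (rk_norm (\<lambda>x. F n x - f x) - 0) < r" by blast
  qed
  ultimately show "\<exists>f\<in>rk_space. (\<lambda>n. sqrt (Re (rk_inner (\<lambda>x. F n x - f x) (\<lambda>x. F n x - f x)))) \<longlonglongrightarrow> 0"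
    unfolding rk_norm_def by blast
qed

text \<open>Kernel functions are represented exactly by coefficients supported at a single point, which
  gives the reproducing property.\<close>

lemma Moore_Aronszajn: "is_rkhs X k (rk_space, rk_inner)"
proof -
  have kx: "pairing (\<lambda>z. if z \<in> X then k z w else 0) u = kip k u (\<lambda>y. if y = w then 1 else 0)"
    if w: "w \<in> X" and u: "u \<in> finsupp X" for w u
  proof -
    have "cnj (if x \<in> X then k x w else 0) = k w x" if "u x \<noteq> 0" for x
    proof -
      have "x \<in> X" using u that by (auto simp: finsupp_def)
      then show ?thesis using is_kernel_hermitian[OF kernel, of x w] w by simp
    qed
    then show ?thesis unfolding kip_single pairing_def by (intro sum.cong) auto
  qed
  have mem: "(\<lambda>z. if z \<in> X then k z w else 0) \<in> rk_space" if w: "w \<in> X" for w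
    unfolding rk_space_def
  proof (safe intro!: exI[of _ "V.nrm (\<lambda>y. if y = w then 1 else 0)"])
    fix u assume u: "u \<in> finsupp X"
    show "cmod (pairing (\<lambda>z. if z \<in> X then k z w else 0) u)
        \<le> V.nrm (\<lambda>y. if y = w then 1 else 0) * V.nrm u"
      using V.Cauchy_Schwarz[OF u single_in_finsupp[OF w, of 1]] by (simp add: kx[OF w u] mult.commute)
  qed auto
  have rep: "rk_inner f (\<lambda>z. if z \<in> X then k z w else 0) = f w" if w: "w \<in> X" and f: "f \<in> rk_space" for f w
  proof -
    from rk_space_approximates[OF f] obtain v where v: "approximates f v" by blast
    let ?d = "\<lambda>y. if y = w then 1 else 0 :: complex"
    have d: "?d \<in> finsupp X" using single_in_finsupp[OF w] .
    from v obtain e where *: "e \<longlonglongrightarrow> 0" 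
      "\<And>n u. u \<in> finsupp X \<Longrightarrow> cmod (pairing f u - kip k u (v n)) \<le> e n * V.nrm u"
      "\<And>n. v n \<in> finsupp X"
      unfolding approximates_def by blast
    have "(\<lambda>n. pairing f ?d - kip k ?d (v n)) \<longlonglongrightarrow> 0"
      by (rule Lim_null_comparison[of _ "\<lambda>n. e n * V.nrm ?d"])
        (use *(2)[OF d] tendsto_mult[OF *(1) tendsto_const[of "V.nrm ?d"]] in auto)
    from tendsto_diff[OF tendsto_const[of "pairing f ?d"] this]
    have 1: "(\<lambda>n. kip k ?d (v n)) \<longlonglongrightarrow> cnj (f w)" by (simp add: pairing_single)
    have "(\<lambda>n. cnj (kip k ?d (v n))) \<longlonglongrightarrow> f w" using tendsto_cnj[OF 1] by simp
    moreover have "pairing (\<lambda>z. if z \<in> X then k z w else 0) (v n) = cnj (kip k ?d (v n))" for n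
      unfolding kx[OF w *(3)] by (rule V.ip_cnj[OF d *(3)])
    ultimately show ?thesis
      using LIMSEQ_unique[OF approximates_pairing[OF v mem[OF w]]] by simp
  qed
  show ?thesis
    unfolding is_rkhs_def using hilbert_function_space_rk mem rep by auto
qed

end

section \<open>Contractive multipliers and positive kernels\<close>

lemma kform_extend:
  assumes "finite F" "G \<subseteq> F"
  shows "kform G k v = kform F k (\<lambda>x. if x \<in> G then v x else 0)"
proof -
  have "kform F k (\<lambda>x. if x \<in> G then v x else 0) = (\<Sum>x\<in>G. \<Sum>y\<in>F. cnj (v x) * (if y \<in> G then v y else 0) * k x y)"
    unfolding kform_def using assms by (intro sum.mono_neutral_cong_right) auto
  also have "\<dots> = kform G k v"
    unfolding kform_def using assms by (intro sum.cong refl sum.mono_neutral_cong_right) auto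
  finally show ?thesis by simp
qed

text \<open>The reproducing kernel Hilbert space enters the computations with multipliers through its
  defining property alone.\<close>

locale reproducing_space = positive_kernel X k + H: hilbert_function_space X H ip
  for X :: "'x set" and k H ip +
  assumes section_mem: "w \<in> X \<Longrightarrow> (\<lambda>z. if z \<in> X then k z w else 0) \<in> H"
    and reproducing: "w \<in> X \<Longrightarrow> f \<in> H \<Longrightarrow> ip f (\<lambda>z. if z \<in> X then k z w else 0) = f w"
begin

definition kernel_comb :: "('x \<Rightarrow> complex) \<Rightarrow> 'x \<Rightarrow> complex" where
  "kernel_comb u = (\<lambda>z. if z \<in> X then \<Sum>x | u x \<noteq> 0. u x * k z x else 0)"

lemma kernel_comb_aux:
  assumes "finite F" "F \<subseteq> X"
  shows "(\<lambda>z. if z \<in> X then \<Sum>x\<in>F. u x * k z x else 0) \<in> H \<and>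
    (\<forall>f\<in>H. ip f (\<lambda>z. if z \<in> X then \<Sum>x\<in>F. u x * k z x else 0) = (\<Sum>x\<in>F. cnj (u x) * f x))"
  using assms
proof (induction F rule: finite_induct)
  case empty
  have "ip f (\<lambda>x. 0) = 0" if "f \<in> H" for f
    using H.ip_scale_right[OF H.zero_mem that, of 0] by simp
  then show ?case using H.zero_mem by (simp cong: if_cong)
next
  case (insert w F)
  let ?g = "\<lambda>z. if z \<in> X then \<Sum>x\<in>F. u x * k z x else 0"
  let ?k = "\<lambda>z. if z \<in> X then k z w else 0"
  have w: "w \<in> X" using insert.prems by auto
  have IH: "?g \<in> H" "\<forall>f\<in>H. ip f ?g = (\<Sum>x\<in>F. cnj (u x) * f x)" using insert by auto
  have eq: "(\<lambda>z. if z \<in> X then \<Sum>x\<in>insert w F. u x * k z x else 0) = (\<lambda>z. u w * ?k z + ?g z)"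
    using insert.hyps by auto
  have s: "(\<lambda>z. u w * ?k z) \<in> H" using section_mem[OF w] H.scale_mem by blast
  have "ip f (\<lambda>z. u w * ?k z + ?g z) = cnj (u w) * f w + (\<Sum>x\<in>F. cnj (u x) * f x)" if f: "f \<in> H" for f
    using H.ip_add_right[OF s IH(1) f] H.ip_scale_right[OF section_mem[OF w] f, of "u w"] IH(2) f reproducing[OF w f]
    by simp
  then show ?case unfolding eq using H.add_mem[OF s IH(1)] insert.hyps by simp
qed

lemma kernel_comb_mem: "u \<in> finsupp X \<Longrightarrow> kernel_comb u \<in> H"
  using kernel_comb_aux[of "{x. u x \<noteq> 0}" u] by (simp add: kernel_comb_def finsupp_def)

lemma ip_kernel_comb: "u \<in> finsupp X \<Longrightarrow> f \<in> H \<Longrightarrow> ip f (kernel_comb u) = cnj (pairing f u)"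
  using kernel_comb_aux[of "{x. u x \<noteq> 0}" u] by (simp add: kernel_comb_def finsupp_def pairing_def)

lemma kernel_comb_apply: "z \<in> X \<Longrightarrow> kernel_comb u z = kip k u (\<lambda>y. if y = z then 1 else 0)"
  by (simp add: kernel_comb_def kip_single)

lemma ip_kernel_comb_kernel_comb:
  assumes "u \<in> finsupp X" "v \<in> finsupp X"
  shows "ip (kernel_comb u) (kernel_comb v) = kip k u v"
proof -
  have "ip (kernel_comb u) (kernel_comb v) = (\<Sum>y | v y \<noteq> 0. cnj (v y) * kernel_comb u y)"
    using ip_kernel_comb[OF assms(2) kernel_comb_mem[OF assms(1)]] by (simp add: pairing_def)
  also have "\<dots> = (\<Sum>y | v y \<noteq> 0. \<Sum>x | u x \<noteq> 0. u x * cnj (v y) * k y x)"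
    using assms by (intro sum.cong refl) (auto simp: kernel_comb_def finsupp_def sum_distrib_left mult_ac)
  also have "\<dots> = kip k u v" unfolding kip_def by (rule sum.swap)
  finally show ?thesis .
qed

lemma nrm_kernel_comb: "u \<in> finsupp X \<Longrightarrow> H.nrm (kernel_comb u) = V.nrm u"
  by (simp add: H.nrm_def V.nrm_def ip_kernel_comb_kernel_comb)

lemma kernel_comb_diff:
  assumes "u \<in> finsupp X" "v \<in> finsupp X"
  shows "kernel_comb (\<lambda>x. u x - v x) = (\<lambda>z. kernel_comb u z - kernel_comb v z)"
proof
  fix z
  show "kernel_comb (\<lambda>x. u x - v x) z = kernel_comb u z - kernel_comb v z"
  proof (cases "z \<in> X")
    case True
    show ?thesis
      unfolding kernel_comb_apply[OF True]
      by (rule V.ip_diff[OF assms single_in_finsupp[OF True]])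
  qed (simp add: kernel_comb_def)
qed

lemma pairing_le_nrm:
  assumes "f \<in> H" "u \<in> finsupp X"
  shows "cmod (pairing f u) \<le> H.nrm f * V.nrm u"
  using H.Cauchy_Schwarz[OF assms(1) kernel_comb_mem[OF assms(2)]]
  by (simp add: ip_kernel_comb[OF assms(2,1)] nrm_kernel_comb[OF assms(2)])

text \<open>A bounded functional on combinations of kernel functions is approximated by combinations that
  form a Cauchy sequence. Its limit in the space has the values \<open>f\<close>. So the first
  part produces members of the space from estimates, and the second is the density of
  combinations of kernel functions.\<close>

lemma bounded_mem_dense:
  assumes "\<And>x. x \<notin> X \<Longrightarrow> f x = 0"
    and bound: "\<And>u. u \<in> finsupp X \<Longrightarrow> cmod (pairing f u) \<le> C * V.nrm u"
  shows "f \<in> H" and "\<exists>w. (\<forall>n. w n \<in> finsupp X) \<and> (\<lambda>n. H.nrm (\<lambda>x. kernel_comb (w n) x - f x)) \<longlonglongrightarrow> 0"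
proof -
  obtain w where w: "approximates f w" using bounded_approximates[OF bound] by blast
  have mem: "w n \<in> finsupp X" for n using w by (auto simp: approximates_def)
  obtain e e' where e: "e \<longlonglongrightarrow> 0" "e' \<longlonglongrightarrow> 0" "\<And>n m. V.nrm (\<lambda>x. w n x - w m x) \<le> e n + e' m"
    using approximates_diff[OF w w] by metis
  have dist: "H.nrm (\<lambda>x. kernel_comb (w m) x - kernel_comb (w n) x) \<le> e m + e' n" for m n
    using e(3)[of m n] nrm_kernel_comb[OF V.diff_mem[OF mem[of m] mem[of n]]] by (simp add: kernel_comb_diff mem)
  have "\<exists>g\<in>H. (\<lambda>n. H.nrm (\<lambda>x. kernel_comb (w n) x - g x)) \<longlonglongrightarrow> 0"
    unfolding H.nrm_def
  proof (rule H.complete)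
    show "kernel_comb (w n) \<in> H" for n using mem kernel_comb_mem by blast
    fix r :: real assume "0 < r"
    then have r2: "r / 2 > 0" by simp
    from LIMSEQ_D[OF e(1) r2] LIMSEQ_D[OF e(2) r2] obtain N M
      where NM: "\<And>n. n \<ge> N \<Longrightarrow> \<bar>e n\<bar> < r / 2" "\<And>n. n \<ge> M \<Longrightarrow> \<bar>e' n\<bar> < r / 2" by auto
    have "H.nrm (\<lambda>x. kernel_comb (w m) x - kernel_comb (w n) x) < r" if "m \<ge> max N M" "n \<ge> max N M" for m n
      using dist[of m n] NM(1)[of m] NM(2)[of n] that by auto
    then show "\<exists>M. \<forall>m\<ge>M. \<forall>n\<ge>M. sqrt (Re (ip (\<lambda>x. kernel_comb (w m) x - kernel_comb (w n) x) (\<lambda>x. kernel_comb (w m) x - kernel_comb (w n) x))) < r"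
      unfolding H.nrm_def by blast
  qed
  then obtain g where g: "g \<in> H" "(\<lambda>n. H.nrm (\<lambda>x. kernel_comb (w n) x - g x)) \<longlonglongrightarrow> 0" by blast
  have "f = g"
  proof
    fix x
    show "f x = g x"
    proof (cases "x \<in> X")
      case False
      then show ?thesis using assms(1) H.support[OF g(1)] by simp
    next
      case True
      let ?d = "\<lambda>y. if y = x then 1 else 0 :: complex"
      have d: "?d \<in> finsupp X" using single_in_finsupp[OF True] .
      from w obtain e where *: "e \<longlonglongrightarrow> 0" 
        "\<And>n u. u \<in> finsupp X \<Longrightarrow> cmod (pairing f u - kip k u (w n)) \<le> e n * V.nrm u"
        unfolding approximates_def by blast
      have "(\<lambda>n. pairing f ?d - kip k ?d (w n)) \<longlonglongrightarrow> 0"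
        by (rule Lim_null_comparison[of _ "\<lambda>n. e n * V.nrm ?d"])
          (use *(2)[OF d] tendsto_mult[OF *(1) tendsto_const[of "V.nrm ?d"]] in auto)
      from tendsto_diff[OF tendsto_const[of "pairing f ?d"] this]
      have 1: "(\<lambda>n. kip k ?d (w n)) \<longlonglongrightarrow> cnj (f x)" by (simp add: pairing_single)
      have "kernel_comb (w n) x = cnj (kip k ?d (w n))" for n
        unfolding kernel_comb_apply[OF True] by (rule V.ip_cnj[OF d mem])
      with tendsto_cnj[OF 1] have L1: "(\<lambda>n. kernel_comb (w n) x) \<longlonglongrightarrow> f x" by simp
      have "(\<lambda>n. kernel_comb (w n) x - g x) \<longlonglongrightarrow> 0"
      proof (rule Lim_null_comparison)
        have "cmod (kernel_comb (w n) x - g x) \<le> H.nrm (\<lambda>x. kernel_comb (w n) x - g x) * V.nrm ?d" for n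
          using pairing_le_nrm[OF H.diff_mem[OF kernel_comb_mem[OF mem] g(1)] d, of n]
          unfolding pairing_single by (simp flip: complex_cnj_diff)
        then show "\<forall>\<^sub>F n in sequentially. cmod (kernel_comb (w n) x - g x) \<le> H.nrm (\<lambda>x. kernel_comb (w n) x - g x) * V.nrm ?d"
          by simp
        show "(\<lambda>n. H.nrm (\<lambda>x. kernel_comb (w n) x - g x) * V.nrm ?d) \<longlonglongrightarrow> 0"
          using tendsto_mult[OF g(2) tendsto_const] by simp
      qed
      from tendsto_diff[OF L1 this] have "(\<lambda>n. g x) \<longlonglongrightarrow> f x" by simp
      then show ?thesis using LIMSEQ_unique[OF tendsto_const] by metis
    qed
  qed
  then show "f \<in> H" "\<exists>w. (\<forall>n. w n \<in> finsupp X) \<and> (\<lambda>n. H.nrm (\<lambda>x. kernel_comb (w n) x - f x)) \<longlonglongrightarrow> 0"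
    using g mem by auto
qed

lemma mem_dense:
  assumes "f \<in> H"
  obtains w where "\<And>n. w n \<in> finsupp X" "(\<lambda>n. V.nrm (w n)) \<longlonglongrightarrow> H.nrm f"
    "(\<lambda>n. pairing f (w n)) \<longlonglongrightarrow> of_real ((H.nrm f)\<^sup>2)"
proof -
  obtain w where w: "\<And>n. w n \<in> finsupp X" "(\<lambda>n. H.nrm (\<lambda>x. kernel_comb (w n) x - f x)) \<longlonglongrightarrow> 0"
    using bounded_mem_dense(2)[OF H.support[OF assms] pairing_le_nrm[OF assms]] by blast
  have "(\<lambda>n. V.nrm (w n) - H.nrm f) \<longlonglongrightarrow> 0"
  proof (rule Lim_null_comparison[OF _ w(2)])
    show "\<forall>\<^sub>F n in sequentially. norm (V.nrm (w n) - H.nrm f) \<le> H.nrm (\<lambda>x. kernel_comb (w n) x - f x)"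
      using H.nrm_diff_abs[OF kernel_comb_mem[OF w(1)] assms] by (simp add: nrm_kernel_comb w(1))
  qed
  from tendsto_add[OF this tendsto_const[of "H.nrm f"]] have L1: "(\<lambda>n. V.nrm (w n)) \<longlonglongrightarrow> H.nrm f" by simp
  have "(\<lambda>n. pairing f (w n) - of_real ((H.nrm f)\<^sup>2)) \<longlonglongrightarrow> 0"
  proof (rule Lim_null_comparison)
    have "cmod (pairing f (w n) - of_real ((H.nrm f)\<^sup>2)) \<le> H.nrm (\<lambda>x. kernel_comb (w n) x - f x) * H.nrm f" for n
    proof -
      have "pairing f (w n) = ip (kernel_comb (w n)) f"
        using H.ip_cnj[OF assms kernel_comb_mem[OF w(1)]] ip_kernel_comb[OF w(1) assms] by simp
      then have "pairing f (w n) - of_real ((H.nrm f)\<^sup>2) = ip (\<lambda>x. kernel_comb (w n) x - f x) f"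
        by (simp add: H.ip_diff kernel_comb_mem w(1) assms H.ip_self)
      then show ?thesis
        using H.Cauchy_Schwarz[OF H.diff_mem[OF kernel_comb_mem[OF w(1)] assms] assms] by simp
    qed
    then show "\<forall>\<^sub>F n in sequentially. cmod (pairing f (w n) - of_real ((H.nrm f)\<^sup>2)) \<le> H.nrm (\<lambda>x. kernel_comb (w n) x - f x) * H.nrm f"
      by simp
    show "(\<lambda>n. H.nrm (\<lambda>x. kernel_comb (w n) x - f x) * H.nrm f) \<longlonglongrightarrow> 0"
      using tendsto_mult[OF w(2) tendsto_const] by simp
  qed
  from tendsto_add[OF this tendsto_const[of "of_real ((H.nrm f)\<^sup>2)"]]
  have "(\<lambda>n. pairing f (w n)) \<longlonglongrightarrow> of_real ((H.nrm f)\<^sup>2)" by simp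
  with w(1) L1 show ?thesis by (rule that)
qed

end

lemma reproducing_space_rkhs:
  assumes "is_kernel X k"
  shows "reproducing_space X k (rkhs_carrier X k) (rkhs_inner X k)"
proof -
  interpret positive_kernel X k by standard (fact assms)
  have "is_rkhs X k (rkhs X k)"
    unfolding rkhs_def using Moore_Aronszajn by (rule someI)
  then have *: "is_rkhs X k (rkhs_carrier X k, rkhs_inner X k)"
    by (simp add: rkhs_carrier_def rkhs_inner_def)
  then interpret H: hilbert_function_space X "rkhs_carrier X k" "rkhs_inner X k"
    by (simp add: is_rkhs_def)
  show ?thesis
    by unfold_locales (use * in \<open>auto simp: is_rkhs_def\<close>)
qed


text \<open>The kernel \<open>l I - k \<Phi> \<Phi>\<^sup>*\<close> on points with an index of a
  component; its positivity is contractivity of the adjoint of multiplication by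
  \<open>\<Phi>\<close> on kernel functions.\<close>

definition mult_kernel ::
  "('x \<Rightarrow> 'x \<Rightarrow> complex) \<Rightarrow> ('x \<Rightarrow> 'x \<Rightarrow> complex) \<Rightarrow> nat \<Rightarrow> ('x \<Rightarrow> nat \<Rightarrow> nat \<Rightarrow> complex)
     \<Rightarrow> 'x \<times> nat \<Rightarrow> 'x \<times> nat \<Rightarrow> complex" where
  "mult_kernel k l N \<Phi> = (\<lambda>(z, p) (w, q).
     (if p = q then l z w else 0) - k z w * (\<Sum>r<N. \<Phi> z p r * cnj (\<Phi> w q r)))"

lemma kform_mult_kernel:
  assumes "finite F"
  shows "kform (F \<times> {..<N}) (mult_kernel k l N \<Phi>) v =
    (\<Sum>p<N. kform F l (\<lambda>x. v (x, p))) - (\<Sum>r<N. kform F k (\<lambda>x. \<Sum>p<N. v (x, p) * cnj (\<Phi> x p r)))"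
proof -
  have "kform (F \<times> {..<N}) (mult_kernel k l N \<Phi>) v =
      (\<Sum>z\<in>F. \<Sum>p<N. \<Sum>w\<in>F. \<Sum>q<N. cnj (v (z, p)) * v (w, q) * (if p = q then l z w else 0)) -
      (\<Sum>z\<in>F. \<Sum>p<N. \<Sum>w\<in>F. \<Sum>q<N. \<Sum>r<N. cnj (v (z, p)) * v (w, q) * (k z w * (\<Phi> z p r * cnj (\<Phi> w q r))))"
    unfolding kform_def mult_kernel_def
    by (simp add: sum.cartesian_product' right_diff_distrib sum_subtractf sum_distrib_left)
  also have "(\<Sum>z\<in>F. \<Sum>p<N. \<Sum>w\<in>F. \<Sum>q<N. cnj (v (z, p)) * v (w, q) * (if p = q then l z w else 0))
     = (\<Sum>z\<in>F. \<Sum>p<N. \<Sum>w\<in>F. cnj (v (z, p)) * v (w, p) * l z w)"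
    by (intro sum.cong refl) (simp add: if_distrib[of "\<lambda>x. _ * x"] cong: if_cong)
  also have "\<dots> = (\<Sum>p<N. kform F l (\<lambda>x. v (x, p)))"
    unfolding kform_def by (rule sum.swap)
  also have "(\<Sum>z\<in>F. \<Sum>p<N. \<Sum>w\<in>F. \<Sum>q<N. \<Sum>r<N. cnj (v (z, p)) * v (w, q) * (k z w * (\<Phi> z p r * cnj (\<Phi> w q r))))
    = (\<Sum>z\<in>F. \<Sum>w\<in>F. \<Sum>p<N. \<Sum>q<N. \<Sum>r<N. cnj (v (z, p)) * v (w, q) * (k z w * (\<Phi> z p r * cnj (\<Phi> w q r))))"
    by (intro sum.cong refl sum.swap)
  also have "\<dots> = (\<Sum>z\<in>F. \<Sum>w\<in>F. \<Sum>r<N. cnj (\<Sum>p<N. v (z, p) * cnj (\<Phi> z p r)) * (\<Sum>p<N. v (w, p) * cnj (\<Phi> w p r)) * k z w)"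
  proof (rule sum.cong[OF refl], rule sum.cong[OF refl])
    fix z w
    have "(\<Sum>p<N. \<Sum>q<N. \<Sum>r<N. cnj (v (z, p)) * v (w, q) * (k z w * (\<Phi> z p r * cnj (\<Phi> w q r))))
      = (\<Sum>p<N. \<Sum>r<N. \<Sum>q<N. cnj (v (z, p)) * v (w, q) * (k z w * (\<Phi> z p r * cnj (\<Phi> w q r))))"
      by (intro sum.cong refl sum.swap)
    also have "\<dots> = (\<Sum>r<N. \<Sum>p<N. \<Sum>q<N. cnj (v (z, p)) * v (w, q) * (k z w * (\<Phi> z p r * cnj (\<Phi> w q r))))"
      by (rule sum.swap)
    also have "\<dots> = (\<Sum>r<N. cnj (\<Sum>p<N. v (z, p) * cnj (\<Phi> z p r)) * (\<Sum>p<N. v (w, p) * cnj (\<Phi> w p r)) * k z w)"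
      by (intro sum.cong refl) (simp add: sum_product, simp add: sum_distrib_left sum_distrib_right mult_ac)
    finally show "(\<Sum>p<N. \<Sum>q<N. \<Sum>r<N. cnj (v (z, p)) * v (w, q) * (k z w * (\<Phi> z p r * cnj (\<Phi> w q r))))
      = (\<Sum>r<N. cnj (\<Sum>p<N. v (z, p) * cnj (\<Phi> z p r)) * (\<Sum>p<N. v (w, p) * cnj (\<Phi> w p r)) * k z w)" .
  qed
  also have "\<dots> = (\<Sum>z\<in>F. \<Sum>r<N. \<Sum>w\<in>F. cnj (\<Sum>p<N. v (z, p) * cnj (\<Phi> z p r)) * (\<Sum>p<N. v (w, p) * cnj (\<Phi> w p r)) * k z w)"
    by (intro sum.cong refl sum.swap)
  also have "\<dots> = (\<Sum>r<N. kform F k (\<lambda>x. \<Sum>p<N. v (x, p) * cnj (\<Phi> x p r)))"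
    unfolding kform_def by (rule sum.swap)
  finally show ?thesis .
qed

lemma is_kernel_Times_iff:
  "is_kernel (X \<times> {..<N}) K \<longleftrightarrow> (\<forall>F v. finite F \<longrightarrow> F \<subseteq> X \<longrightarrow> 0 \<le> kform (F \<times> {..<N::nat}) K v)"
proof
  assume "is_kernel (X \<times> {..<N}) K"
  then show "\<forall>F v. finite F \<longrightarrow> F \<subseteq> X \<longrightarrow> 0 \<le> kform (F \<times> {..<N::nat}) K v"
    by (auto intro!: is_kernelD)
next
  assume R: "\<forall>F v. finite F \<longrightarrow> F \<subseteq> X \<longrightarrow> 0 \<le> kform (F \<times> {..<N::nat}) K v"
  show "is_kernel (X \<times> {..<N}) K"
  proof (rule is_kernelI)
    fix G v assume G: "finite G" "G \<subseteq> X \<times> {..<N}"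
    have "kform G K v = kform (fst ` G \<times> {..<N}) K (\<lambda>x. if x \<in> G then v x else 0)"
      using G by (intro kform_extend) force+
    moreover have "finite (fst ` G)" "fst ` G \<subseteq> X" using G by auto
    ultimately show "0 \<le> kform G K v" using R by simp
  qed
qed

lemma sum_mult_le_sqrt:
  fixes a b :: "'i \<Rightarrow> real"
  assumes "\<And>i. i \<in> A \<Longrightarrow> 0 \<le> a i" "\<And>i. i \<in> A \<Longrightarrow> 0 \<le> b i"
  shows "(\<Sum>i\<in>A. a i * b i) \<le> sqrt (\<Sum>i\<in>A. (a i)\<^sup>2) * sqrt (\<Sum>i\<in>A. (b i)\<^sup>2)"
  using L2_set_mult_ineq[where f = a and g = b and A = A] assms by (simp add: L2_set_def)

lemma kform_finsupp:
  assumes "finite F"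
  shows "kform F k v = kip k (\<lambda>x. if x \<in> F then v x else 0) (\<lambda>x. if x \<in> F then v x else 0)"
  unfolding kform_extend[OF assms order_refl, of k v] by (rule kform_eq_kip[OF assms]) auto

text \<open>For coefficients \<open>v\<close> the form is \<open>R - S\<close>, where \<open>R\<close> is
  the squared norm of the combination \<open>U\<close> of kernel functions of \<open>l\<close>,
  and \<open>S\<close> is that of its image \<open>G\<close> under the adjoint. Multiplying the
  normalised \<open>G\<close> by \<open>\<Phi>\<close> and pairing with \<open>U\<close> gives
  \<open>sqrt S \<le> sqrt R\<close>.\<close>

lemma kernel_of_contractive_multiplier:
  assumes k: "is_kernel X k" and l: "is_kernel X l"
    and \<Phi>: "\<Phi> \<in> multipliers X k l N" "multiplier_norm X k l N \<Phi> \<le> 1"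
  shows "is_kernel (X \<times> {..<N}) (mult_kernel k l N (\<lambda>z p r. \<Phi> z $$ (p, r)))"
  unfolding is_kernel_Times_iff
proof (intro allI impI)
  fix F :: "'a set" and v :: "'a \<times> nat \<Rightarrow> complex"
  assume F: "finite F" "F \<subseteq> X"
  interpret K: reproducing_space X k "rkhs_carrier X k" "rkhs_inner X k"
    by (rule reproducing_space_rkhs[OF k])
  interpret L: reproducing_space X l "rkhs_carrier X l" "rkhs_inner X l"
    by (rule reproducing_space_rkhs[OF l])
  define U where "U = (\<lambda>p x. if x \<in> F then v (x, p) else 0)"
  define G where "G = (\<lambda>r x. if x \<in> F then \<Sum>p<N. v (x, p) * cnj (\<Phi> x $$ (p, r)) else 0)"
  have U: "U p \<in> finsupp X" for p unfolding U_def by (rule finsupp_restrict[OF F])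
  have G: "G r \<in> finsupp X" for r unfolding G_def by (rule finsupp_restrict[OF F])
  define S where "S = (\<Sum>r<N. (K.V.nrm (G r))\<^sup>2)"
  define R where "R = (\<Sum>p<N. (L.V.nrm (U p))\<^sup>2)"
  have kf: "kform (F \<times> {..<N}) (mult_kernel k l N (\<lambda>z p r. \<Phi> z $$ (p, r))) v = of_real (R - S)"
  proof -
    have "kform F l (\<lambda>x. v (x, p)) = of_real ((L.V.nrm (U p))\<^sup>2)" for p
      unfolding L.V.ip_self[OF U, symmetric] by (simp add: kform_finsupp[OF F(1)] U_def)
    moreover have "kform F k (\<lambda>x. \<Sum>p<N. v (x, p) * cnj (\<Phi> x $$ (p, r))) = of_real ((K.V.nrm (G r))\<^sup>2)" for r
      unfolding K.V.ip_self[OF G, symmetric] by (simp add: kform_finsupp[OF F(1)] G_def)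
    ultimately show ?thesis by (simp add: kform_mult_kernel[OF F(1)] S_def R_def)
  qed
  have "S \<le> R"
  proof (cases "S = 0")
    case True
    then show ?thesis by (simp add: R_def sum_nonneg)
  next
    case False
    then have "S > 0" by (metis S_def less_eq_real_def sum_nonneg zero_le_power2)
    define c where "c = sqrt S"
    have c: "c > 0" "c * c = S" using \<open>S > 0\<close> by (auto simp: c_def)
    \<comment> \<open>A unit vector in the direction of the image under the adjoint.\<close>
    define G' where "G' = (\<lambda>r x. of_real (1 / c) * G r x)"
    have G': "G' r \<in> finsupp X" for r unfolding G'_def by (rule finsupp_scale[OF G])
    have nG': "K.V.nrm (G' r) = K.V.nrm (G r) / c" for r
      unfolding G'_def K.V.nrm_scale[OF G] using c by (simp add: norm_divide)
    define f where "f = (\<lambda>x. Matrix.vec N (\<lambda>r. K.kernel_comb (G' r) x))"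
    have fr: "(\<lambda>x. f x $v r) = K.kernel_comb (G' r)" if "r < N" for r using that by (simp add: f_def)
    have f: "f \<in> rkhs_vec X k N"
      unfolding rkhs_vec_def using K.kernel_comb_mem[OF G'] fr by (auto simp: f_def)
    have "(\<Sum>i<N. Re (rkhs_inner X k (\<lambda>x. f x $v i) (\<lambda>x. f x $v i))) = (\<Sum>i<N. (K.V.nrm (G i))\<^sup>2 / S)"
      using c K.V.nrm_sq[OF G']
      by (intro sum.cong refl) (simp add: fr K.ip_kernel_comb_kernel_comb[OF G' G'] nG' power_divide power2_eq_square)
    also have "\<dots> = 1" using \<open>S > 0\<close> by (simp add: S_def sum_divide_distrib[symmetric])
    finally have nf: "rkhs_vec_norm X k N f \<le> 1" by (simp add: rkhs_vec_norm_def)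
    define h where "h = mult_op X N \<Phi> f"
    have h: "h \<in> rkhs_vec X l N" unfolding h_def using \<Phi>(1) f by (auto simp: multipliers_def)
    have "ereal (rkhs_vec_norm X l N h) \<le> multiplier_norm X k l N \<Phi>"
      unfolding multiplier_norm_def h_def by (rule SUP_upper) (use f nf in auto)
    also have "\<dots> \<le> ereal 1" using \<Phi>(2) by (simp add: one_ereal_def)
    finally have nh: "rkhs_vec_norm X l N h \<le> 1" by simp
    define h' where "h' = (\<lambda>p x. h x $v p)"
    have h': "h' p \<in> rkhs_carrier X l" if "p < N" for p
      using h that by (auto simp: rkhs_vec_def h'_def)
    have h'v: "h' p x = (\<Sum>r<N. \<Phi> x $$ (p, r) * K.kernel_comb (G' r) x)" if "p < N" "x \<in> X" for p x
    proof -
      have "\<Phi> x \<in> carrier_mat N N" using \<Phi>(1) that by (auto simp: multipliers_def)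
      then show ?thesis using that
        by (simp add: h'_def h_def mult_op_def f_def scalar_prod_def lessThan_atLeast0)
    qed
    have "(\<Sum>p<N. cnj (pairing (h' p) (U p))) = (\<Sum>p<N. \<Sum>x\<in>F. cnj (U p x) * h' p x)"
      by (intro sum.cong refl, subst pairing_eq[OF F(1)]) (auto simp: U_def)
    also have "\<dots> = (\<Sum>p<N. \<Sum>x\<in>F. \<Sum>r<N. cnj (v (x, p)) * \<Phi> x $$ (p, r) * K.kernel_comb (G' r) x)"
      using F by (intro sum.cong refl) (auto simp: U_def h'v sum_distrib_left mult_ac)
    also have "\<dots> = (\<Sum>x\<in>F. \<Sum>p<N. \<Sum>r<N. cnj (v (x, p)) * \<Phi> x $$ (p, r) * K.kernel_comb (G' r) x)"
      by (rule sum.swap)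
    also have "\<dots> = (\<Sum>x\<in>F. \<Sum>r<N. \<Sum>p<N. cnj (v (x, p)) * \<Phi> x $$ (p, r) * K.kernel_comb (G' r) x)"
      by (intro sum.cong refl sum.swap)
    also have "\<dots> = (\<Sum>r<N. \<Sum>x\<in>F. \<Sum>p<N. cnj (v (x, p)) * \<Phi> x $$ (p, r) * K.kernel_comb (G' r) x)"
      by (rule sum.swap)
    also have "\<dots> = (\<Sum>r<N. cnj (pairing (K.kernel_comb (G' r)) (G r)))"
      by (intro sum.cong refl, subst pairing_eq[OF F(1)]) (auto simp: G_def sum_distrib_right intro!: sum.cong)
    also have "\<dots> = (\<Sum>r<N. of_real ((K.V.nrm (G r))\<^sup>2 / c))"
    proof (intro sum.cong refl)
      fix r
      have "cnj (pairing (K.kernel_comb (G' r)) (G r)) = kip k (G' r) (G r)"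
        using K.ip_kernel_comb[OF G K.kernel_comb_mem[OF G']] K.ip_kernel_comb_kernel_comb[OF G' G] by simp
      also have "\<dots> = of_real (1 / c) * kip k (G r) (G r)"
        unfolding G'_def by (rule K.V.ip_scale[OF G G])
      also have "\<dots> = of_real ((K.V.nrm (G r))\<^sup>2 / c)" by (simp add: K.V.ip_self[OF G])
      finally show "cnj (pairing (K.kernel_comb (G' r)) (G r)) = of_real ((K.V.nrm (G r))\<^sup>2 / c)" .
    qed
    also have "\<dots> = of_real (S / c)" by (simp add: S_def sum_divide_distrib)
    also have "S / c = c" using c by (simp add: field_simps)
    finally have "c = cmod (\<Sum>p<N. cnj (pairing (h' p) (U p)))" using c by simp
    also have "\<dots> \<le> (\<Sum>p<N. cmod (pairing (h' p) (U p)))"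
      using norm_sum[of "\<lambda>p. cnj (pairing (h' p) (U p))" "{..<N}"] by simp
    also have "\<dots> \<le> (\<Sum>p<N. L.H.nrm (h' p) * L.V.nrm (U p))"
      by (intro sum_mono L.pairing_le_nrm U h') auto
    also have "\<dots> \<le> sqrt (\<Sum>p<N. (L.H.nrm (h' p))\<^sup>2) * sqrt (\<Sum>p<N. (L.V.nrm (U p))\<^sup>2)"
      by (intro sum_mult_le_sqrt) (auto intro!: L.H.nrm_nonneg L.V.nrm_nonneg h' U)
    also have "sqrt (\<Sum>p<N. (L.H.nrm (h' p))\<^sup>2) = rkhs_vec_norm X l N h"
      unfolding rkhs_vec_norm_def
      by (intro arg_cong[of _ _ sqrt] sum.cong refl) (simp add: L.H.nrm_sq h', simp add: h'_def)
    also have "\<dots> * sqrt (\<Sum>p<N. (L.V.nrm (U p))\<^sup>2) \<le> 1 * sqrt R"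
      unfolding R_def using nh by (intro mult_right_mono) (auto intro!: sum_nonneg)
    finally have "c \<le> sqrt R" by simp
    then show ?thesis by (simp add: c_def)
  qed
  then show "0 \<le> kform (F \<times> {..<N}) (mult_kernel k l N (\<lambda>z p r. \<Phi> z $$ (p, r))) v"
    unfolding kf nonneg_of_real_complex by simp
qed

text \<open>Pairing \<open>\<Phi> f\<close> with combinations of kernel functions is bounded by the norm
  of \<open>f\<close>, by positivity of the kernel. So the components of \<open>\<Phi> f\<close>
  belong to \<open>H(l)\<close>, and density of the combinations gives the norm estimate.\<close>

lemma contractive_multiplier_of_kernel:
  assumes k: "is_kernel X k" and l: "is_kernel X l"
    and car: "\<And>x. x \<in> X \<Longrightarrow> \<Phi> x \<in> carrier_mat N N"
    and ker: "is_kernel (X \<times> {..<N}) (mult_kernel k l N (\<lambda>z p r. \<Phi> z $$ (p, r)))"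
  shows "\<Phi> \<in> multipliers X k l N" and "multiplier_norm X k l N \<Phi> \<le> 1"
proof -
  interpret K: reproducing_space X k "rkhs_carrier X k" "rkhs_inner X k"
    by (rule reproducing_space_rkhs[OF k])
  interpret L: reproducing_space X l "rkhs_carrier X l" "rkhs_inner X l"
    by (rule reproducing_space_rkhs[OF l])
  have main: "mult_op X N \<Phi> f \<in> rkhs_vec X l N \<and>
      rkhs_vec_norm X l N (mult_op X N \<Phi> f) \<le> rkhs_vec_norm X k N f" if f: "f \<in> rkhs_vec X k N" for f
  proof -
    define f' where "f' = (\<lambda>r x. f x $v r)"
    have f': "f' r \<in> rkhs_carrier X k" if "r < N" for r using f that by (auto simp: rkhs_vec_def f'_def)
    have fc: "f x \<in> carrier_vec N" for x using f by (auto simp: rkhs_vec_def)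
    define h where "h = mult_op X N \<Phi> f"
    define h' where "h' = (\<lambda>p x. h x $v p)"
    have hc: "h x \<in> carrier_vec N" for x
      using car[of x] fc[of x] by (auto simp: h_def mult_op_def)
    have h'v: "h' p x = (\<Sum>r<N. \<Phi> x $$ (p, r) * f' r x)" if "p < N" "x \<in> X" for p x
      using car[OF that(2)] fc[of x] that
      by (simp add: h'_def h_def mult_op_def f'_def scalar_prod_def lessThan_atLeast0)
    have h'0: "h' p x = 0" if "p < N" "x \<notin> X" for p x
      using that by (simp add: h'_def h_def mult_op_def)
    define nf where "nf = rkhs_vec_norm X k N f"
    have nf: "nf = sqrt (\<Sum>r<N. (K.H.nrm (f' r))\<^sup>2)"
      unfolding nf_def rkhs_vec_norm_def
      by (intro arg_cong[of _ _ sqrt] sum.cong refl) (simp add: K.H.nrm_sq f', simp add: f'_def)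
    have nf0: "0 \<le> nf" unfolding nf by (intro real_sqrt_ge_zero sum_nonneg) auto
    have bound: "cmod (\<Sum>p<N. pairing (h' p) (U p)) \<le> nf * sqrt (\<Sum>p<N. (L.V.nrm (U p))\<^sup>2)"
      if U: "\<And>p. p < N \<Longrightarrow> U p \<in> finsupp X" for U
    proof -
      define F where "F = (\<Union>p<N. {x. U p x \<noteq> 0})"
      have F: "finite F" "F \<subseteq> X" "\<And>p. p < N \<Longrightarrow> {x. U p x \<noteq> 0} \<subseteq> F"
        using U by (auto simp: F_def finsupp_def)
      define v where "v = (\<lambda>(x, p). U p x)"
      define G where "G = (\<lambda>r x. if x \<in> F then \<Sum>p<N. v (x, p) * cnj (\<Phi> x $$ (p, r)) else 0)"
      have G: "G r \<in> finsupp X" for r unfolding G_def by (rule finsupp_restrict[OF F(1,2)])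
      have "0 \<le> kform (F \<times> {..<N}) (mult_kernel k l N (\<lambda>z p r. \<Phi> z $$ (p, r))) v"
        using ker F unfolding is_kernel_Times_iff by blast
      moreover have "kform F l (\<lambda>x. v (x, p)) = of_real ((L.V.nrm (U p))\<^sup>2)" if "p < N" for p
        using kform_eq_kip[OF F(1) F(3)[OF that], of l] L.V.ip_self[OF U[OF that]] by (simp add: v_def)
      moreover have "kform F k (\<lambda>x. \<Sum>p<N. v (x, p) * cnj (\<Phi> x $$ (p, r))) = of_real ((K.V.nrm (G r))\<^sup>2)" for r
        unfolding K.V.ip_self[OF G, symmetric] by (simp add: kform_finsupp[OF F(1)] G_def)
      ultimately have "0 \<le> (\<Sum>p<N. complex_of_real ((L.V.nrm (U p))\<^sup>2)) - (\<Sum>r<N. of_real ((K.V.nrm (G r))\<^sup>2))"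
        by (simp add: kform_mult_kernel[OF F(1)])
      then have GU: "(\<Sum>r<N. (K.V.nrm (G r))\<^sup>2) \<le> (\<Sum>p<N. (L.V.nrm (U p))\<^sup>2)"
        unfolding of_real_sum[symmetric] of_real_diff[symmetric] nonneg_of_real_complex by simp
      have "(\<Sum>p<N. pairing (h' p) (U p)) = (\<Sum>p<N. \<Sum>x\<in>F. \<Sum>r<N. U p x * cnj (\<Phi> x $$ (p, r)) * cnj (f' r x))"
        using F by (intro sum.cong refl, subst pairing_eq[OF F(1,3)])
          (auto simp: h'v sum_distrib_left mult_ac intro!: sum.cong)
      also have "\<dots> = (\<Sum>x\<in>F. \<Sum>p<N. \<Sum>r<N. U p x * cnj (\<Phi> x $$ (p, r)) * cnj (f' r x))"
        by (rule sum.swap)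
      also have "\<dots> = (\<Sum>x\<in>F. \<Sum>r<N. \<Sum>p<N. U p x * cnj (\<Phi> x $$ (p, r)) * cnj (f' r x))"
        by (intro sum.cong refl sum.swap)
      also have "\<dots> = (\<Sum>r<N. \<Sum>x\<in>F. \<Sum>p<N. U p x * cnj (\<Phi> x $$ (p, r)) * cnj (f' r x))"
        by (rule sum.swap)
      also have "\<dots> = (\<Sum>r<N. pairing (f' r) (G r))"
        by (intro sum.cong refl, subst pairing_eq[OF F(1)])
          (auto simp: G_def v_def sum_distrib_right intro!: sum.cong)
      finally have "cmod (\<Sum>p<N. pairing (h' p) (U p)) = cmod (\<Sum>r<N. pairing (f' r) (G r))" by simp
      also have "\<dots> \<le> (\<Sum>r<N. K.H.nrm (f' r) * K.V.nrm (G r))"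
        by (intro sum_norm_le K.pairing_le_nrm f' G) auto
      also have "\<dots> \<le> nf * sqrt (\<Sum>r<N. (K.V.nrm (G r))\<^sup>2)"
        unfolding nf by (intro sum_mult_le_sqrt) (auto intro!: K.H.nrm_nonneg K.V.nrm_nonneg f' G)
      also have "\<dots> \<le> nf * sqrt (\<Sum>p<N. (L.V.nrm (U p))\<^sup>2)"
        using GU nf0 by (intro mult_left_mono) auto
      finally show ?thesis .
    qed
    have h': "h' p \<in> rkhs_carrier X l" if p: "p < N" for p
    proof (rule L.bounded_mem_dense(1))
      fix u assume u: "u \<in> finsupp X"
      define U where "U = (\<lambda>q. if q = p then u else (\<lambda>x. 0))"
      have U: "U q \<in> finsupp X" for q using u by (auto simp: U_def finsupp_def)
      have n0: "L.V.nrm (\<lambda>x. 0) = 0" by (simp add: L.V.nrm_def kip_def)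
      have "(\<Sum>q<N. pairing (h' q) (U q)) = (\<Sum>q<N. if q = p then pairing (h' q) u else 0)"
        by (intro sum.cong refl) (auto simp: U_def pairing_def)
      moreover have "(\<Sum>q<N. (L.V.nrm (U q))\<^sup>2) = (\<Sum>q<N. if q = p then (L.V.nrm u)\<^sup>2 else 0)"
        by (intro sum.cong refl) (auto simp: U_def n0)
      ultimately show "cmod (pairing (h' p) u) \<le> nf * L.V.nrm u"
        using bound[of U, OF U] p L.V.nrm_nonneg[OF u] by simp
    qed (use h'0 p in auto)
    then have hm: "h \<in> rkhs_vec X l N" using hc by (auto simp: rkhs_vec_def h'_def)
    define T where "T = (\<Sum>p<N. (L.H.nrm (h' p))\<^sup>2)"
    have nh: "rkhs_vec_norm X l N h = sqrt T"
      unfolding T_def rkhs_vec_norm_def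
      by (intro arg_cong[of _ _ sqrt] sum.cong refl) (simp add: L.H.nrm_sq h', simp add: h'_def)
    have "\<forall>p\<in>{..<N}. \<exists>w. (\<forall>n. w n \<in> finsupp X) \<and> (\<lambda>n. L.V.nrm (w n)) \<longlonglongrightarrow> L.H.nrm (h' p) \<and>
       (\<lambda>n. pairing (h' p) (w n)) \<longlonglongrightarrow> of_real ((L.H.nrm (h' p))\<^sup>2)"
      using L.mem_dense[OF h'] by (metis lessThan_iff)
    from bchoice[OF this] obtain w where w: "\<And>p n. p < N \<Longrightarrow> w p n \<in> finsupp X"
      "\<And>p. p < N \<Longrightarrow> (\<lambda>n. L.V.nrm (w p n)) \<longlonglongrightarrow> L.H.nrm (h' p)"
      "\<And>p. p < N \<Longrightarrow> (\<lambda>n. pairing (h' p) (w p n)) \<longlonglongrightarrow> of_real ((L.H.nrm (h' p))\<^sup>2)"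
      by auto
    have "cmod (\<Sum>p<N. of_real ((L.H.nrm (h' p))\<^sup>2)) \<le> nf * sqrt T"
      unfolding T_def
    proof (rule LIMSEQ_le)
      show "(\<lambda>n. cmod (\<Sum>p<N. pairing (h' p) (w p n))) \<longlonglongrightarrow> cmod (\<Sum>p<N. of_real ((L.H.nrm (h' p))\<^sup>2))"
        by (intro tendsto_norm tendsto_sum w(3)) auto
      show "(\<lambda>n. nf * sqrt (\<Sum>p<N. (L.V.nrm (w p n))\<^sup>2)) \<longlonglongrightarrow> nf * sqrt (\<Sum>p<N. (L.H.nrm (h' p))\<^sup>2)"
        by (intro tendsto_intros w(2)) auto
      show "\<exists>M. \<forall>n\<ge>M. cmod (\<Sum>p<N. pairing (h' p) (w p n)) \<le> nf * sqrt (\<Sum>p<N. (L.V.nrm (w p n))\<^sup>2)"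
        using bound[of "\<lambda>p. w p _"] w(1) by blast
    qed
    moreover have T0: "0 \<le> T" unfolding T_def by (intro sum_nonneg) auto
    moreover have "(\<Sum>p<N. complex_of_real ((L.H.nrm (h' p))\<^sup>2)) = of_real T" by (simp add: T_def)
    ultimately have "T \<le> nf * sqrt T" by simp
    then have "sqrt T * sqrt T \<le> nf * sqrt T" using T0 by simp
    then have "sqrt T \<le> nf" using T0 nf0 mult_right_le_imp_le[of "sqrt T" "sqrt T" nf] by (cases "T = 0") auto
    then show ?thesis using hm nh by (simp add: h_def nf_def)
  qed
  show "\<Phi> \<in> multipliers X k l N" using main car by (auto simp: multipliers_def)
  show "multiplier_norm X k l N \<Phi> \<le> 1"
    unfolding multiplier_norm_def
    by (rule SUP_least) (use main in \<open>auto simp: one_ereal_def intro: order_trans\<close>)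
qed

section \<open>Extending Pick data by means of a certificate\<close>

lemma finsupp_mono: "X \<subseteq> Y \<Longrightarrow> finsupp X \<subseteq> finsupp Y"
  by (auto simp: finsupp_def)

text \<open>A contraction from the span of \<open>S\<close> into \<open>\<complex>\<^sup>N\<close> extends
  to \<open>s\<close> as the composition with the orthogonal projection to the closed span of
  \<open>S\<close>. The projection of \<open>s\<close> need not lie in the span, so it is
  replaced by an approximating sequence \<open>w\<close>, and \<open>\<beta>\<close> is the
  limit of the values at \<open>w n\<close>.\<close>

lemma contraction_extension:
  fixes \<alpha> :: "nat \<Rightarrow> 'x \<Rightarrow> complex"
  assumes E: "is_kernel (insert s S) E" and s: "s \<notin> S"
    and M: "is_kernel S (\<lambda>x y. E x y - (\<Sum>m<N. \<alpha> m x * cnj (\<alpha> m y)))"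
  obtains \<beta> where
    "is_kernel (insert s S) (\<lambda>x y. E x y - (\<Sum>m<N. ((\<alpha> m)(s := \<beta> m)) x * cnj (((\<alpha> m)(s := \<beta> m)) y)))"
proof -
  interpret S: positive_kernel S E
    by standard (rule is_kernel_subset[OF E], auto)
  interpret T: positive_kernel "insert s S" E
    by standard (rule E)
  have ST: "u \<in> finsupp (insert s S)" if "u \<in> finsupp S" for u
    using that finsupp_mono[of S "insert s S"] by auto
  let ?d = "\<lambda>y. if y = s then 1 else 0 :: complex"
  have d: "?d \<in> finsupp (insert s S)" by (rule single_in_finsupp) simp
  \<comment> \<open>The functional \<open>\<langle>\<cdot>, s\<rangle>\<close> on the span of \<open>S\<close>, which \<open>w\<close> represents approximately.\<close>
  define f where "f = (\<lambda>x. if x \<in> S then E x s else 0)"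
  have pf: "pairing f u = kip E u ?d" if u: "u \<in> finsupp S" for u
  proof -
    have "u x * cnj (f x) = u x * E s x" if "u x \<noteq> 0" for x
    proof -
      have "x \<in> S" using u that by (auto simp: finsupp_def)
      then show ?thesis using is_kernel_hermitian[OF E, of x s] by (simp add: f_def)
    qed
    then show ?thesis unfolding kip_single pairing_def by (intro sum.cong) auto
  qed
  have fb: "cmod (pairing f u) \<le> T.V.nrm ?d * S.V.nrm u" if "u \<in> finsupp S" for u
    unfolding pf[OF that] using T.V.Cauchy_Schwarz[OF ST[OF that] d]
    by (simp add: mult.commute)
  have frk: "f \<in> S.rk_space" unfolding S.rk_space_def using fb by (auto simp: f_def)
  obtain w where w: "S.approximates f w" using S.rk_space_approximates[OF frk] by blast
  from w obtain e where e: "e \<longlonglongrightarrow> 0" "\<And>n. 0 \<le> e n"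
    "\<And>n u. u \<in> finsupp S \<Longrightarrow> cmod (pairing f u - kip E u (w n)) \<le> e n * S.V.nrm u"
    "\<And>n. w n \<in> finsupp S"
    unfolding S.approximates_def by blast
  define \<alpha>' where "\<alpha>' = (\<lambda>m x. if x \<in> S then \<alpha> m x else 0)"
  have \<alpha>b: "(\<Sum>m<N. (cmod (pairing (\<alpha>' m) u))\<^sup>2) \<le> (S.V.nrm u)\<^sup>2" if u: "u \<in> finsupp S" for u
  proof -
    obtain F where F: "finite F" "F \<subseteq> S" "{x. u x \<noteq> 0} \<subseteq> F" using u by (auto simp: finsupp_def)
    have p: "pairing (\<alpha>' m) u = (\<Sum>x\<in>F. u x * cnj (\<alpha> m x))" for m
      unfolding pairing_eq[OF F(1,3)] using F(2) by (intro sum.cong refl) (auto simp: \<alpha>'_def)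
    have "0 \<le> kform F (\<lambda>x y. E x y - (\<Sum>m<N. \<alpha> m x * cnj (\<alpha> m y))) u"
      by (rule is_kernelD[OF M F(1,2)])
    also have "\<dots> = of_real ((S.V.nrm u)\<^sup>2 - (\<Sum>m<N. (cmod (pairing (\<alpha>' m) u))\<^sup>2))"
      unfolding kform_diff kform_sum kform_rank_one' p kform_eq_kip[OF F(1,3)] S.V.ip_self[OF u] by simp
    finally show ?thesis unfolding nonneg_of_real_complex by simp
  qed
  have \<alpha>rk: "\<alpha>' m \<in> S.rk_space" if m: "m < N" for m
  proof -
    have "cmod (pairing (\<alpha>' m) u) \<le> 1 * S.V.nrm u" if u: "u \<in> finsupp S" for u
    proof -
      have "(cmod (pairing (\<alpha>' m) u))\<^sup>2 \<le> (\<Sum>m<N. (cmod (pairing (\<alpha>' m) u))\<^sup>2)"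
        using m by (intro member_le_sum) auto
      also have "\<dots> \<le> (S.V.nrm u)\<^sup>2" by (rule \<alpha>b[OF u])
      finally show ?thesis using u by (auto intro: power2_le_imp_le)
    qed
    then have "\<exists>C::real. \<forall>u\<in>finsupp S. cmod (pairing (\<alpha>' m) u) \<le> C * S.V.nrm u" by blast
    then show ?thesis unfolding S.rk_space_def by (auto simp: \<alpha>'_def)
  qed
  define \<beta> where "\<beta> = (\<lambda>m. cnj (S.rk_inner f (\<alpha>' m)))"
  have \<beta>: "(\<lambda>n. pairing (\<alpha>' m) (w n)) \<longlonglongrightarrow> cnj (\<beta> m)" if "m < N" for m
    using S.approximates_pairing[OF w \<alpha>rk[OF that]] by (simp add: \<beta>_def)
  have "is_kernel (insert s S) (\<lambda>x y. E x y - (\<Sum>m<N. ((\<alpha> m)(s := \<beta> m)) x * cnj (((\<alpha> m)(s := \<beta> m)) y)))"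
  proof (rule is_kernelI)
    fix G and v :: "'x \<Rightarrow> complex" assume G: "finite G" "G \<subseteq> insert s S"
    define F where "F = G - {s}"
    have F: "finite F" "F \<subseteq> S" "s \<notin> F" "insert s F \<subseteq> insert s S" "G \<subseteq> insert s F" using G s by (auto simp: F_def)
    define v' where "v' = (\<lambda>x. if x \<in> G then v x else 0)"
    define u where "u = (\<lambda>x. if x \<in> F then v' x else 0)"
    define t where "t = v' s"
    have u: "u \<in> finsupp S" unfolding u_def by (rule finsupp_restrict[OF F(1,2)])
    have v'eq: "v' = (\<lambda>x. u x + t * ?d x)"
      using F(3) by (auto simp: fun_eq_iff u_def t_def F_def v'_def)
    have v': "v' \<in> finsupp (insert s S)"
      unfolding v'eq by (intro finsupp_add finsupp_scale ST u d)
    have wd: "(\<lambda>x. ?d x - w n x) \<in> finsupp (insert s S)" for n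
      by (rule T.V.diff_mem[OF d ST[OF e(4)]])
    define a where "a = (\<lambda>n x. u x + t * w n x)"
    have a: "a n \<in> finsupp S" for n unfolding a_def by (intro finsupp_add finsupp_scale u e)
    \<comment> \<open>The part in the span of \<open>S\<close> and a part almost orthogonal to it.\<close>
    have va: "v' = (\<lambda>x. a n x + t * (?d x - w n x))" for n
      unfolding v'eq a_def by (auto simp: fun_eq_iff algebra_simps)
    have low: "(\<Sum>m<N. (cmod (pairing (\<alpha>' m) (a n)))\<^sup>2) - 2 * (cmod t * (e n * S.V.nrm (a n))) \<le> (T.V.nrm v')\<^sup>2" for n
    proof -
      have "cmod (kip E (\<lambda>x. ?d x - w n x) (a n)) \<le> e n * S.V.nrm (a n)"
      proof -
        have "kip E (\<lambda>x. ?d x - w n x) (a n) = cnj (kip E (a n) (\<lambda>x. ?d x - w n x))"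
          by (rule T.V.ip_cnj[OF ST[OF a] wd])
        also have "kip E (a n) (\<lambda>x. ?d x - w n x) = pairing f (a n) - kip E (a n) (w n)"
          unfolding pf[OF a] by (rule T.V.ip_diff_right[OF d ST[OF e(4)] ST[OF a]])
        finally have "cmod (kip E (\<lambda>x. ?d x - w n x) (a n)) = cmod (pairing f (a n) - kip E (a n) (w n))"
          by (simp only: complex_mod_cnj)
        then show ?thesis using e(3)[OF a, of n n] by simp
      qed
      then have "cmod (t * kip E (\<lambda>x. ?d x - w n x) (a n)) \<le> cmod t * (e n * S.V.nrm (a n))"
        by (simp add: norm_mult mult_left_mono)
      then have "- (cmod t * (e n * S.V.nrm (a n))) \<le> Re (t * kip E (\<lambda>x. ?d x - w n x) (a n))"
        using abs_Re_le_cmod[of "t * kip E (\<lambda>x. ?d x - w n x) (a n)"] by linarith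
      moreover have "(T.V.nrm v')\<^sup>2 = (T.V.nrm (a n))\<^sup>2 + 2 * Re (t * kip E (\<lambda>x. ?d x - w n x) (a n))
         + (cmod t)\<^sup>2 * (T.V.nrm (\<lambda>x. ?d x - w n x))\<^sup>2"
        by (subst va[of n], rule T.V.nrm_sq_add[OF ST[OF a] wd])
      moreover have "0 \<le> (cmod t)\<^sup>2 * (T.V.nrm (\<lambda>x. ?d x - w n x))\<^sup>2" by simp
      ultimately show ?thesis using \<alpha>b[OF a, of n] by linarith
    qed
    have na: "S.V.nrm (a n) \<le> S.V.nrm u + cmod t * S.V.nrm (w n)" for n
      using S.V.nrm_triangle[OF u finsupp_scale[OF e(4)], of t n] S.V.nrm_scale[OF e(4)] by (simp add: a_def)
    have 1: "(\<lambda>n. 2 * (cmod t * (e n * (S.V.nrm u + cmod t * S.V.nrm (w n))))) \<longlonglongrightarrow>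
        2 * (cmod t * (0 * (S.V.nrm u + cmod t * S.rk_norm f)))"
      by (intro tendsto_intros e(1) S.approximates_nrm w frk)
    have 2: "(\<lambda>n. \<Sum>m<N. (cmod (pairing (\<alpha>' m) (a n)))\<^sup>2) \<longlonglongrightarrow>
       (\<Sum>m<N. (cmod (pairing (\<alpha>' m) u + t * cnj (\<beta> m)))\<^sup>2)"
    proof (intro tendsto_sum tendsto_power tendsto_norm)
      fix m assume "m \<in> {..<N}"
      then have "(\<lambda>n. pairing (\<alpha>' m) u + t * pairing (\<alpha>' m) (w n)) \<longlonglongrightarrow> pairing (\<alpha>' m) u + t * cnj (\<beta> m)"
        by (intro tendsto_intros \<beta>) auto
      moreover have "pairing (\<alpha>' m) (a n) = pairing (\<alpha>' m) u + t * pairing (\<alpha>' m) (w n)" for n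
        unfolding a_def using pairing_add[OF u finsupp_scale[OF e(4)]] pairing_scale[OF e(4)] by metis
      ultimately show "(\<lambda>n. pairing (\<alpha>' m) (a n)) \<longlonglongrightarrow> pairing (\<alpha>' m) u + t * cnj (\<beta> m)" by simp
    qed
    have fin: "(\<Sum>m<N. (cmod (pairing (\<alpha>' m) u + t * cnj (\<beta> m)))\<^sup>2) \<le> (T.V.nrm v')\<^sup>2"
    proof (rule LIMSEQ_le_const2)
      show "(\<lambda>n. (\<Sum>m<N. (cmod (pairing (\<alpha>' m) (a n)))\<^sup>2) - 2 * (cmod t * (e n * (S.V.nrm u + cmod t * S.V.nrm (w n)))))
        \<longlonglongrightarrow> (\<Sum>m<N. (cmod (pairing (\<alpha>' m) u + t * cnj (\<beta> m)))\<^sup>2)"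
        using tendsto_diff[OF 2 1] by simp
      have "2 * (cmod t * (e n * S.V.nrm (a n))) \<le> 2 * (cmod t * (e n * (S.V.nrm u + cmod t * S.V.nrm (w n))))" for n
        using na[of n] e(2)[of n] by (intro mult_left_mono) auto
      then show "\<exists>M. \<forall>n\<ge>M. (\<Sum>m<N. (cmod (pairing (\<alpha>' m) (a n)))\<^sup>2) -
          2 * (cmod t * (e n * (S.V.nrm u + cmod t * S.V.nrm (w n)))) \<le> (T.V.nrm v')\<^sup>2"
        using low by (meson diff_left_mono order_trans)
    qed
    have p: "(\<Sum>x\<in>insert s F. v' x * cnj (((\<alpha> m)(s := \<beta> m)) x)) = pairing (\<alpha>' m) u + t * cnj (\<beta> m)" for m
    proof -
      have "pairing (\<alpha>' m) u = (\<Sum>x\<in>F. u x * cnj (\<alpha>' m x))"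
        by (rule pairing_eq[OF F(1)]) (auto simp: u_def)
      also have "\<dots> = (\<Sum>x\<in>F. v' x * cnj (((\<alpha> m)(s := \<beta> m)) x))"
        using F by (intro sum.cong refl) (auto simp: u_def \<alpha>'_def)
      finally show ?thesis using F(1,3) by (simp add: t_def)
    qed
    let ?K = "\<lambda>x y. E x y - (\<Sum>m<N. ((\<alpha> m)(s := \<beta> m)) x * cnj (((\<alpha> m)(s := \<beta> m)) y))"
    have "kform G ?K v = kform (insert s F) ?K v'"
      unfolding v'_def using F by (intro kform_extend) auto
    also have "\<dots> = of_real ((T.V.nrm v')\<^sup>2 - (\<Sum>m<N. (cmod (pairing (\<alpha>' m) u + t * cnj (\<beta> m)))\<^sup>2))"
    proof -
      have "kform (insert s F) E v' = of_real ((T.V.nrm v')\<^sup>2)"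
        unfolding T.V.ip_self[OF v', symmetric] using F by (intro kform_eq_kip) (auto simp: v'_def)
      then show ?thesis unfolding kform_diff kform_sum kform_rank_one' p by simp
    qed
    finally show "0 \<le> kform G ?K v" using fin by (simp only: nonneg_of_real_complex)
  qed
  then show ?thesis by (rule that)
qed

text \<open>A triple \<open>(z, c, a)\<close> encodes the prescription \<open>c \<Phi>(z) = a\<close> for
  row vectors \<open>c\<close> and \<open>a\<close>. Prescribing row by row makes it possible to
  add a single condition at a time.\<close>

type_synonym 'x triple = "'x \<times> (nat \<Rightarrow> complex) \<times> (nat \<Rightarrow> complex)"

definition triple_kernel ::
  "('x \<Rightarrow> 'x \<Rightarrow> complex) \<Rightarrow> ('x \<Rightarrow> 'x \<Rightarrow> complex) \<Rightarrow> nat \<Rightarrow> 'x triple \<Rightarrow> 'x triple \<Rightarrow> complex" where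
  "triple_kernel k l N = (\<lambda>(z, c, a) (w, c', a').
     l z w * (\<Sum>m<N. c m * cnj (c' m)) - k z w * (\<Sum>m<N. a m * cnj (a' m)))"

lemma is_kernel_diag_real:
  assumes "is_kernel X k" "z \<in> X" "k z z \<noteq> 0"
  shows "k z z = of_real (Re (k z z))" "0 < Re (k z z)"
  using is_kernel_diag[OF assms(1,2)] assms(3) by (auto simp: less_eq_complex_def complex_eq_iff)

text \<open>Write \<open>l\<^sup>z\<close> and \<open>k\<^sup>z\<close> for the Schur complements at
  \<open>z\<close>. Multiplying the data kernel by \<open>p\<close> and adding the two defects
  in the certificate shows that \<open>l\<^sup>z \<langle>c, c'\<rangle> - k\<^sup>z \<langle>a,
  a'\<rangle>\<close> is positive on \<open>S\<close>, and it vanishes at the new triple.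
  Putting back the rank one part of \<open>l\<close> gives a kernel \<open>E\<close> that
  includes the new point; the rank one part of \<open>k\<close> is what remains to be
  subtracted, a contraction with values in \<open>\<complex>\<^sup>N\<close>, and
  \<open>contraction_extension\<close> determines its value at the new triple.\<close>

lemma triple_extend:
  assumes k: "is_kernel X k" and l: "is_kernel X l" and z: "z \<in> X" and nz: "k z z \<noteq> 0" "l z z \<noteq> 0"
    and p: "is_kernel X p"
    and pl: "kernel_le X (\<lambda>w v. p w v * l w v) (schur_kernel l z)"
    and pk: "kernel_le X (schur_kernel k z) (\<lambda>w v. p w v * k w v)"
    and S: "S \<subseteq> X \<times> UNIV" "is_kernel S (triple_kernel k l N)"
    and c: "\<And>a. (z, c, a) \<notin> S"
  shows "\<exists>y. is_kernel (insert (z, c, y) S) (triple_kernel k l N)"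
proof -
  define s :: "'a triple" where "s = (z, c, \<lambda>_. 0)"
  define \<kappa> where "\<kappa> = sqrt (Re (k z z))"
  have kzz: "k z z = of_real \<kappa> * of_real \<kappa>" "\<kappa> > 0"
    using is_kernel_diag_real[OF k z nz(1)] by (auto simp: \<kappa>_def complex_eq_iff)
  define E where "E = triple_kernel (schur_kernel k z) l N"
  define C :: "'a triple \<Rightarrow> 'a triple \<Rightarrow> complex" where "C = (\<lambda>t t'. \<Sum>m<N. fst (snd t) m * cnj (fst (snd t') m))"
  define A :: "'a triple \<Rightarrow> 'a triple \<Rightarrow> complex" where "A = (\<lambda>t t'. \<Sum>m<N. snd (snd t) m * cnj (snd (snd t') m))"
  have CA: "is_kernel Y C" "is_kernel Y A" for Y
    unfolding C_def A_def by (intro is_kernel_sum is_kernel_rank_one)+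
  have pb: "is_kernel S (\<lambda>t t'. h (fst t) (fst t'))" if "is_kernel X h" for h
    using that by (rule is_kernel_pullback) (use S in auto)
  define T where "T = (\<lambda>t t'. schur_kernel l z (fst t) (fst t') * C t t' - schur_kernel k z (fst t) (fst t') * A t t')"
  have "is_kernel S T"
  proof -
    have "is_kernel S (\<lambda>t t'. (schur_kernel l z (fst t) (fst t') - p (fst t) (fst t') * l (fst t) (fst t')) * C t t'
      + p (fst t) (fst t') * triple_kernel k l N t t'
      + (p (fst t) (fst t') * k (fst t) (fst t') - schur_kernel k z (fst t) (fst t')) * A t t')"
      using pb[OF pl[unfolded kernel_le_def]] pb[OF pk[unfolded kernel_le_def]] pb[OF p]
      by (intro is_kernel_add is_kernel_mult CA S)
    then show ?thesis
      by (rule iffD1[OF is_kernel_cong, rotated])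
        (auto simp: T_def triple_kernel_def C_def A_def algebra_simps)
  qed
  then have T: "is_kernel (insert s S) T"
  proof (rule is_kernel_supported)
    fix x y assume "x \<in> insert s S" "y \<in> insert s S" "x \<notin> S \<or> y \<notin> S"
    then have "fst x = z \<or> fst y = z" by (auto simp: s_def)
    then show "T x y = 0" using nz by (auto simp: T_def schur_kernel_zero)
  qed
  have E: "is_kernel (insert s S) E"
  proof -
    define \<mu> where "\<mu> = sqrt (Re (l z z))"
    have lzz: "l z z = of_real \<mu> * of_real \<mu>" "\<mu> > 0"
      using is_kernel_diag_real[OF l z nz(2)] by (auto simp: \<mu>_def complex_eq_iff)
    have "is_kernel (insert s S) (\<lambda>t t'. T t t' + (l (fst t) z / \<mu>) * cnj (l (fst t') z / \<mu>) * C t t')"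
      by (intro is_kernel_add T is_kernel_congruence CA)
    then show ?thesis
    proof (rule iffD1[OF is_kernel_cong, rotated])
      fix t t' assume "t \<in> insert s S" "t' \<in> insert s S"
      then have "fst t' \<in> X" using S z by (auto simp: s_def)
      then have "cnj (l (fst t') z) = l z (fst t')"
        using is_kernel_hermitian[OF l _ z] by metis
      then show "T t t' + (l (fst t) z / \<mu>) * cnj (l (fst t') z / \<mu>) * C t t' = E t t'"
        by (cases t; cases t') (simp add: T_def E_def triple_kernel_def C_def A_def schur_kernel_def lzz algebra_simps)
    qed
  qed
  define \<alpha> where "\<alpha> = (\<lambda>m (t :: 'a triple). k (fst t) z / \<kappa> * snd (snd t) m)"
  have ksz: "k x y = schur_kernel k z x y + (k x z / \<kappa>) * cnj (k y z / \<kappa>)" if "y \<in> X" for x y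
    using is_kernel_hermitian[OF k that z] by (simp add: schur_kernel_def kzz)
  have \<alpha>A: "(\<Sum>m<N. \<alpha> m t * cnj (\<alpha> m t')) = (k (fst t) z / \<kappa>) * cnj (k (fst t') z / \<kappa>) * A t t'" for t t'
    by (simp add: \<alpha>_def A_def sum_distrib_left sum_divide_distrib mult_ac)
  have "is_kernel S (\<lambda>x y. E x y - (\<Sum>m<N. \<alpha> m x * cnj (\<alpha> m y)))"
    using S(2)
  proof (rule iffD1[OF is_kernel_cong, rotated])
    fix x y assume "x \<in> S" "y \<in> S"
    then have "fst y \<in> X" using S by auto
    from ksz[OF this, of "fst x"]
    show "triple_kernel k l N x y = E x y - (\<Sum>m<N. \<alpha> m x * cnj (\<alpha> m y))"
      unfolding \<alpha>A by (cases x; cases y) (simp add: E_def triple_kernel_def A_def algebra_simps)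
  qed
  moreover have "s \<notin> S" using c by (simp add: s_def)
  ultimately obtain \<beta> where \<beta>: "is_kernel (insert s S)
      (\<lambda>x y. E x y - (\<Sum>m<N. ((\<alpha> m)(s := \<beta> m)) x * cnj (((\<alpha> m)(s := \<beta> m)) y)))"
    using contraction_extension[OF E] by blast
  define y where "y = (\<lambda>m. \<beta> m / of_real \<kappa>)"
  \<comment> \<open>The triple \<open>s\<close> has the placeholder value zero; \<open>E\<close> depends on this entry only through \<open>k\<^sup>z\<close>, which vanishes at \<open>z\<close>.\<close>
  define g where "g = (\<lambda>t. if t = (z, c, y) then s else t)"
  have "is_kernel (insert (z, c, y) S)
     (\<lambda>t t'. E (g t) (g t') - (\<Sum>m<N. ((\<alpha> m)(s := \<beta> m)) (g t) * cnj (((\<alpha> m)(s := \<beta> m)) (g t'))))"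
    using \<beta> by (rule is_kernel_pullback) (auto simp: g_def)
  then have "is_kernel (insert (z, c, y) S) (triple_kernel k l N)"
  proof (rule iffD1[OF is_kernel_cong, rotated])
    fix t t' assume t: "t \<in> insert (z, c, y) S" "t' \<in> insert (z, c, y) S"
    have ne: "x \<noteq> s" if "x \<in> S" for x using that c by (auto simp: s_def)
    have sk0: "schur_kernel k z z x = 0" "schur_kernel k z x z = 0" for x
      using nz by (simp_all add: schur_kernel_zero)
    have E': "E (g x) (g x') = l (fst x) (fst x') * C x x' - schur_kernel k z (fst x) (fst x') * A x x'"
      if "x \<in> insert (z, c, y) S" "x' \<in> insert (z, c, y) S" for x x'
      using that by (cases x; cases x') (auto simp: g_def E_def triple_kernel_def C_def A_def s_def sk0)
    have \<alpha>': "((\<alpha> m)(s := \<beta> m)) (g x) = k (fst x) z / \<kappa> * snd (snd x) m" if "x \<in> insert (z, c, y) S" for x m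
    proof (cases "x = (z, c, y)")
      case True
      then show ?thesis using kzz by (simp add: g_def y_def)
    next
      case False
      then show ?thesis using that ne[of x] by (simp add: g_def \<alpha>_def)
    qed
    have t'X: "fst t' \<in> X" using t S z by auto
    show "E (g t) (g t') - (\<Sum>m<N. ((\<alpha> m)(s := \<beta> m)) (g t) * cnj (((\<alpha> m)(s := \<beta> m)) (g t'))) = triple_kernel k l N t t'"
      unfolding \<alpha>'[OF t(1)] \<alpha>'[OF t(2)] E'[OF t] 
      using ksz[OF t'X, of "fst t"] \<alpha>A[of t t', unfolded \<alpha>_def]
      by (cases t; cases t') (simp add: triple_kernel_def C_def A_def algebra_simps)
  qed
  then show ?thesis by blast
qed

text \<open>In a maximal set of data, every row vector \<open>c\<close> has a value at every point. The
  values at unit vectors are the rows of \<open>\<Phi>\<close>. A prescribed value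
  \<open>a\<close> at \<open>(z, c)\<close> must then equal \<open>c \<Phi>(z)\<close>, because
  a linear relation between row vectors at one point, inserted into the form, leaves only the
  nonpositive term with \<open>k(z, z) > 0\<close>.\<close>

lemma total_extension:
  assumes k: "is_kernel X k" and l: "is_kernel X l"
    and nz: "\<And>z. z \<in> X \<Longrightarrow> k z z \<noteq> 0" "\<And>z. z \<in> X \<Longrightarrow> l z z \<noteq> 0"
    and p: "Shimorin_certificate X k l p"
    and S0: "S0 \<subseteq> X \<times> UNIV" "is_kernel S0 (triple_kernel k l N)"
  obtains \<Phi> where "is_kernel (X \<times> {..<N}) (mult_kernel k l N \<Phi>)"
    "\<And>z c a r. (z, c, a) \<in> S0 \<Longrightarrow> r < N \<Longrightarrow> a r = (\<Sum>m<N. c m * \<Phi> z m r)"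
proof -
  define \<A> where "\<A> = {S. S0 \<subseteq> S \<and> S \<subseteq> X \<times> UNIV \<and> is_kernel S (triple_kernel k l N)}"
  have "\<exists>M\<in>\<A>. \<forall>S\<in>\<A>. M \<subseteq> S \<longrightarrow> S = M"
  proof (rule subset_Zorn_nonempty)
    show "\<A> \<noteq> {}" using S0 by (auto simp: \<A>_def)
    fix \<C> assume C: "\<C> \<noteq> {}" "subset.chain \<A> \<C>"
    have sub: "\<C> \<subseteq> \<A>" using C(2) by (auto simp: subset.chain_def)
    have "is_kernel (\<Union>\<C>) (triple_kernel k l N)"
    proof (rule is_kernelI)
      fix F v assume F: "finite F" "F \<subseteq> \<Union>\<C>"
      obtain B where "B \<in> \<C>" "F \<subseteq> B"
        using finite_subset_Union_chain[OF F C] by blast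
      then show "0 \<le> kform F (triple_kernel k l N) v"
        using sub F by (intro is_kernelD[of B]) (auto simp: \<A>_def)
    qed
    then show "\<Union>\<C> \<in> \<A>" using sub C(1) by (auto simp: \<A>_def)
  qed
  then obtain M where M: "S0 \<subseteq> M" "M \<subseteq> X \<times> UNIV" "is_kernel M (triple_kernel k l N)"
    and max: "\<And>S. S \<in> \<A> \<Longrightarrow> M \<subseteq> S \<Longrightarrow> S = M" by (auto simp: \<A>_def)
  have total: "\<exists>y. (z, c, y) \<in> M" if z: "z \<in> X" for z c
  proof (rule ccontr)
    assume no: "\<nexists>y. (z, c, y) \<in> M"
    from p z have pz: "is_kernel X (p z)"
      "kernel_le X (\<lambda>w v. p z w v * l w v) (schur_kernel l z)"
      "kernel_le X (schur_kernel k z) (\<lambda>w v. p z w v * k w v)"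
      by (auto simp: Shimorin_certificate_def)
    obtain y where "is_kernel (insert (z, c, y) M) (triple_kernel k l N)"
      using triple_extend[OF k l z nz(1)[OF z] nz(2)[OF z] pz M(2,3)] no by blast
    then have "insert (z, c, y) M \<in> \<A>" using M z by (auto simp: \<A>_def)
    then have "insert (z, c, y) M = M" by (rule max) auto
    then show False using no by blast
  qed
  define e where "e = (\<lambda>p m :: nat. if m = p then 1 else 0 :: complex)"
  have "\<forall>z\<in>X. \<forall>q. \<exists>y. (z, e q, y) \<in> M" using total by blast
  then obtain \<Phi> where \<Phi>: "\<And>z q. z \<in> X \<Longrightarrow> (z, e q, \<Phi> z q) \<in> M" by metis
  have "is_kernel (X \<times> {..<N}) (\<lambda>x y. triple_kernel k l N (fst x, e (snd x), \<Phi> (fst x) (snd x)) (fst y, e (snd y), \<Phi> (fst y) (snd y)))"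
    using M(3) by (rule is_kernel_pullback) (use \<Phi> in auto)
  then have "is_kernel (X \<times> {..<N}) (mult_kernel k l N \<Phi>)"
  proof (rule iffD1[OF is_kernel_cong, rotated])
    fix x y :: "'a \<times> nat" assume xy: "x \<in> X \<times> {..<N}" "y \<in> X \<times> {..<N}"
    obtain z i w j where "x = (z, i)" "y = (w, j)" "i < N" "j < N" using xy by (cases x; cases y) auto
    moreover from this have "(\<Sum>m<N. e i m * cnj (e j m)) = (if i = j then 1 else 0)"
      by (auto simp: e_def if_distrib[of "\<lambda>x. x * _"] cong: if_cong)
    ultimately show "triple_kernel k l N (fst x, e (snd x), \<Phi> (fst x) (snd x)) (fst y, e (snd y), \<Phi> (fst y) (snd y))
      = mult_kernel k l N \<Phi> x y" by (simp add: triple_kernel_def mult_kernel_def)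
  qed
  moreover have "a r = (\<Sum>m<N. c m * \<Phi> z m r)" if t: "(z, c, a) \<in> S0" and r: "r < N" for z c a r
  proof -
    have z: "z \<in> X" and tM: "(z, c, a) \<in> M" using t S0 M by auto
    define ci where "ci = (\<lambda>i. if i < N then e i else c)"
    define ai where "ai = (\<lambda>i. if i < N then \<Phi> z i else a)"
    \<comment> \<open>Coefficients of the relation \<open>c - (\<Sum>i<N. c i \<cdot> e i) = 0\<close>.\<close>
    define v where "v = (\<lambda>i. if i < N then - cnj (c i) else 1)"
    have "0 \<le> kform {..N} (\<lambda>i j. triple_kernel k l N (z, ci i, ai i) (z, ci j, ai j)) v"
      using M(3) by (rule is_kernel_pullback_form) (use \<Phi>[OF z] tM in \<open>auto simp: ci_def ai_def\<close>)
    also have "kform {..N} (\<lambda>i j. triple_kernel k l N (z, ci i, ai i) (z, ci j, ai j)) v =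
        l z z * (\<Sum>m<N. of_real ((cmod (\<Sum>i\<le>N. v i * cnj (ci i m)))\<^sup>2)) -
        k z z * (\<Sum>m<N. of_real ((cmod (\<Sum>i\<le>N. v i * cnj (ai i m)))\<^sup>2))"
    proof -
      have *: "kform {..N} (\<lambda>i j. h * (\<Sum>m<N. b i m * cnj (b j m))) v
          = h * (\<Sum>m<N. of_real ((cmod (\<Sum>i\<le>N. v i * cnj (b i m)))\<^sup>2))" for h and b :: "nat \<Rightarrow> nat \<Rightarrow> complex"
        unfolding kform_rank_one'[symmetric] kform_sum[symmetric]
        by (simp add: kform_def sum_distrib_left mult_ac)
      show ?thesis unfolding triple_kernel_def prod.case kform_diff * ..
    qed
    also have "(\<Sum>m<N. of_real ((cmod (\<Sum>i\<le>N. v i * cnj (ci i m)))\<^sup>2)) = (0 :: complex)"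
    proof (rule sum.neutral, rule ballI)
      fix m assume m: "m \<in> {..<N}"
      have "(\<Sum>i\<le>N. v i * cnj (ci i m)) = (\<Sum>i<N. v i * cnj (ci i m)) + v N * cnj (ci N m)"
        by (simp add: lessThan_Suc_atMost[symmetric])
      also have "(\<Sum>i<N. v i * cnj (ci i m)) = (\<Sum>i<N. if i = m then - cnj (c i) else 0)"
        by (intro sum.cong) (auto simp: v_def ci_def e_def)
      finally have "(\<Sum>i\<le>N. v i * cnj (ci i m)) = 0" using m by (simp add: v_def ci_def)
      then show "of_real ((cmod (\<Sum>i\<le>N. v i * cnj (ci i m)))\<^sup>2) = (0 :: complex)" by simp
    qed
    also have "l z z * 0 - k z z * (\<Sum>m<N. of_real ((cmod (\<Sum>i\<le>N. v i * cnj (ai i m)))\<^sup>2))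
      = of_real (- (Re (k z z) * (\<Sum>m<N. (cmod (\<Sum>i\<le>N. v i * cnj (ai i m)))\<^sup>2)))"
      by (subst is_kernel_diag_real(1)[OF k z nz(1)[OF z]]) simp
    finally have "Re (k z z) * (\<Sum>m<N. (cmod (\<Sum>i\<le>N. v i * cnj (ai i m)))\<^sup>2) \<le> 0"
      unfolding nonneg_of_real_complex by simp
    then have "(\<Sum>m<N. (cmod (\<Sum>i\<le>N. v i * cnj (ai i m)))\<^sup>2) \<le> 0"
      using is_kernel_diag_real(2)[OF k z nz(1)[OF z]] by (simp add: mult_le_0_iff)
    then have "(\<Sum>m<N. (cmod (\<Sum>i\<le>N. v i * cnj (ai i m)))\<^sup>2) = 0"
      by (intro antisym sum_nonneg) auto
    then have "(cmod (\<Sum>i\<le>N. v i * cnj (ai i r)))\<^sup>2 = 0"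
      using r by (subst (asm) sum_nonneg_eq_0_iff) auto
    then have "(\<Sum>i\<le>N. v i * cnj (ai i r)) = 0" by simp
    moreover have "cnj (a r - (\<Sum>m<N. c m * \<Phi> z m r)) = (\<Sum>i\<le>N. v i * cnj (ai i r))"
      by (simp add: lessThan_Suc_atMost[symmetric] v_def ai_def sum_negf)
    ultimately have "cnj (a r - (\<Sum>m<N. c m * \<Phi> z m r)) = 0" by (rule trans[rotated])
    then show ?thesis unfolding complex_cnj_zero_iff by simp
  qed
  ultimately show ?thesis by (rule that)
qed

lemma is_kernel_finiteI:
  assumes "finite F" "\<And>v. 0 \<le> kform F k v"
  shows "is_kernel F k"
proof (rule is_kernelI)
  fix G v assume "G \<subseteq> F"
  then show "0 \<le> kform G k v" unfolding kform_extend[OF assms(1) \<open>G \<subseteq> F\<close>, of k v] by (intro assms(2))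
qed

lemma is_kernel_image:
  assumes "is_kernel I (\<lambda>i j. K (t i) (t j))"
  shows "is_kernel (t ` I) K"
proof -
  have "is_kernel (t ` I) (\<lambda>x y. K (t (inv_into I t x)) (t (inv_into I t y)))"
    using assms by (rule is_kernel_pullback) (auto intro: inv_into_into)
  then show ?thesis
    by (rule iffD1[OF is_kernel_cong, rotated]) (simp add: f_inv_into_f)
qed

lemma Pick_block_entry:
  assumes "W \<in> carrier_mat N N" "W' \<in> carrier_mat N N" "p < N" "q < N"
  shows "(c \<cdot>\<^sub>m 1\<^sub>m N - d \<cdot>\<^sub>m (W * mat_adjoint W')) $$ (p, q) =
    (if p = q then c else 0) - d * (\<Sum>r<N. W $$ (p, r) * cnj (W' $$ (q, r)))"
  using assms by (simp add: mat_adjoint_def mat_of_rows_def scalar_prod_def lessThan_atLeast0)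

text \<open>Translation between the numbering \<open>i N + p\<close> of the entries of a block matrix and
  pairs of indices.\<close>

lemma positive_semidefinite_block_iff:
  assumes "\<And>i. i < n \<Longrightarrow> W i \<in> carrier_mat N N"
  shows "positive_semidefinite (n * N) (block_matrix n N
      (\<lambda>i j. l (z i) (z j) \<cdot>\<^sub>m 1\<^sub>m N - k (z i) (z j) \<cdot>\<^sub>m (W i * mat_adjoint (W j)))) \<longleftrightarrow>
    is_kernel ({..<n} \<times> {..<N}) (\<lambda>(i, p) (j, q).
      (if p = q then l (z i) (z j) else 0) - k (z i) (z j) * (\<Sum>r<N. W i $$ (p, r) * cnj (W j $$ (q, r))))"
    (is "?L \<longleftrightarrow> is_kernel _ ?K")
proof -
  define B where "B = (\<lambda>i j. l (z i) (z j) \<cdot>\<^sub>m 1\<^sub>m N - k (z i) (z j) \<cdot>\<^sub>m (W i * mat_adjoint (W j)))"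
  define m where "m = (\<lambda>s t. B (s div N) (t div N) $$ (s mod N, t mod N))"
  have L: "?L \<longleftrightarrow> (\<forall>v. 0 \<le> kform {..<n * N} m v)"
    using positive_semidefinite_mat_iff[of "n * N" m] by (simp add: block_matrix_def B_def m_def)
  have B: "B i j $$ (p, q) = ?K (i, p) (j, q)" if "i < n" "j < n" "p < N" "q < N" for i j p q
    unfolding B_def prod.case using that assms by (intro Pick_block_entry) auto
  have dm: "s div N < n" "s mod N < N" if "s < n * N" for s
  proof -
    have "N > 0" using that by (cases N) auto
    then show "s div N < n" "s mod N < N" using that by (auto simp: less_mult_imp_div_less)
  qed
  show ?thesis
  proof
    assume ?L
    then have "is_kernel {..<n * N} m" unfolding L by (intro is_kernel_finiteI) auto
    then have "is_kernel ({..<n} \<times> {..<N}) (\<lambda>x y. m (fst x * N + snd x) (fst y * N + snd y))"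
    proof (rule is_kernel_pullback)
      fix x assume "x \<in> {..<n} \<times> {..<N}"
      then obtain i p where x: "x = (i, p)" "i < n" "p < N" by auto
      then have "i * N + p < Suc i * N" by simp
      also have "\<dots> \<le> n * N" using x by (intro mult_le_mono1) auto
      finally show "fst x * N + snd x \<in> {..<n * N}" using x by simp
    qed
    then show "is_kernel ({..<n} \<times> {..<N}) ?K"
      by (rule iffD1[OF is_kernel_cong, rotated]) (auto simp: m_def B)
  next
    assume K: "is_kernel ({..<n} \<times> {..<N}) ?K"
    have "is_kernel {..<n * N} (\<lambda>s t. ?K (s div N, s mod N) (t div N, t mod N))"
      using K by (rule is_kernel_pullback) (use dm in auto)
    then have "is_kernel {..<n * N} m"
      by (rule iffD1[OF is_kernel_cong, rotated]) (simp add: m_def B dm)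
    then show ?L unfolding L by (auto intro: is_kernelD)
  qed
qed

text \<open>Interpolation data are a positive set of triples with unit vectors \<open>c\<close>.\<close>

theorem complete_Pick_pair_of_Shimorin:
  assumes k: "is_kernel X k" and l: "is_kernel X l"
    and nz: "\<And>z. z \<in> X \<Longrightarrow> k z z \<noteq> 0" "\<And>z. z \<in> X \<Longrightarrow> l z z \<noteq> 0"
    and p: "Shimorin_certificate X k l p"
  shows "complete_Pick_pair X k l"
  unfolding complete_Pick_pair_def
proof (intro allI impI)
  fix n N :: nat and z :: "nat \<Rightarrow> 'a" and W
  assume z: "\<forall>i<n. z i \<in> X" and W: "\<forall>i<n. W i \<in> carrier_mat N N"
    and psd: "positive_semidefinite (n * N) (block_matrix n N
      (\<lambda>i j. l (z i) (z j) \<cdot>\<^sub>m 1\<^sub>m N - k (z i) (z j) \<cdot>\<^sub>m (W i * mat_adjoint (W j))))"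
  define e where "e = (\<lambda>p m :: nat. if m = p then 1 else 0 :: complex)"
  define t :: "nat \<times> nat \<Rightarrow> 'a triple" where "t = (\<lambda>(i, p). (z i, e p, \<lambda>r. W i $$ (p, r)))"
  have eN: "(\<Sum>m<N. e i m * cnj (e j m)) = (if i = j then 1 else 0)" if "i < N" for i j
    using that by (auto simp: e_def if_distrib[of "\<lambda>x. x * _"] cong: if_cong)
  have "is_kernel ({..<n} \<times> {..<N}) (\<lambda>x y. triple_kernel k l N (t x) (t y))"
    using iffD1[OF positive_semidefinite_block_iff[of n W N l z k, OF W[rule_format]] psd]
    by (rule iffD1[OF is_kernel_cong, rotated]) (auto simp: triple_kernel_def t_def eN)
  then have ker0: "is_kernel (t ` ({..<n} \<times> {..<N})) (triple_kernel k l N)" by (rule is_kernel_image)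
  have sub0: "t ` ({..<n} \<times> {..<N}) \<subseteq> X \<times> UNIV" using z by (auto simp: t_def)
  obtain \<Phi> where \<Phi>: "is_kernel (X \<times> {..<N}) (mult_kernel k l N \<Phi>)"
    "\<And>z c a r. (z, c, a) \<in> t ` ({..<n} \<times> {..<N}) \<Longrightarrow> r < N \<Longrightarrow> a r = (\<Sum>m<N. c m * \<Phi> z m r)"
    using total_extension[OF k l nz p sub0 ker0] by blast
  define \<Psi> where "\<Psi> = (\<lambda>x. mat N N (\<lambda>(p, r). \<Phi> x p r))"
  have ker: "is_kernel (X \<times> {..<N}) (mult_kernel k l N (\<lambda>z p r. \<Psi> z $$ (p, r)))"
    using \<Phi>(1) by (rule iffD1[OF is_kernel_cong, rotated]) (auto simp: mult_kernel_def \<Psi>_def)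
  have car: "\<Psi> x \<in> carrier_mat N N" for x by (simp add: \<Psi>_def)
  have "\<Psi> (z i) = W i" if i: "i < n" for i
  proof (rule eq_matI)
    fix p r assume "p < dim_row (W i)" "r < dim_col (W i)"
    then have pr: "p < N" "r < N" using W i by auto
    have "W i $$ (p, r) = (\<Sum>m<N. e p m * \<Phi> (z i) m r)"
      using i pr by (intro \<Phi>(2)) (force simp: t_def)+
    also have "\<dots> = \<Phi> (z i) p r"
      using pr by (auto simp: e_def if_distrib[of "\<lambda>x. x * _"] cong: if_cong)
    finally show "\<Psi> (z i) $$ (p, r) = W i $$ (p, r)" using pr by (simp add: \<Psi>_def)
  qed (use W i in \<open>auto simp: \<Psi>_def\<close>)
  then show "\<exists>\<Phi>\<in>multipliers X k l N. multiplier_norm X k l N \<Phi> \<le> 1 \<and> (\<forall>i<n. \<Phi> (z i) = W i)"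
    using contractive_multiplier_of_kernel[OF k l car ker] by blast
qed

text \<open>The Pick property restated for kernels: a contractive multiplier on a finite set extends to
  the whole set.\<close>

lemma complete_Pick_pair_extend:
  assumes cp: "complete_Pick_pair X k l" and k: "is_kernel X k" and l: "is_kernel X l"
    and F: "finite F" "F \<noteq> {}" "F \<subseteq> X" and N: "N \<ge> 1"
    and \<Phi>: "is_kernel (F \<times> {..<N}) (mult_kernel k l N \<Phi>)"
  obtains \<Psi> where "is_kernel (X \<times> {..<N}) (mult_kernel k l N \<Psi>)"
    "\<And>z p r. z \<in> F \<Longrightarrow> p < N \<Longrightarrow> r < N \<Longrightarrow> \<Psi> z p r = \<Phi> z p r"
proof -
  define n where "n = card F"
  obtain z where z: "bij_betw z {..<n} F"
    using ex_bij_betw_nat_finite[OF F(1)] by (auto simp: lessThan_atLeast0 n_def)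
  have n: "n \<ge> 1" using F by (simp add: n_def Suc_le_eq card_gt_0_iff)
  define W where "W = (\<lambda>i. mat N N (\<lambda>(p, r). \<Phi> (z i) p r))"
  have W: "W i \<in> carrier_mat N N" for i by (simp add: W_def)
  have zF: "z i \<in> F" if "i < n" for i using z that by (auto simp: bij_betw_def)
  have "is_kernel ({..<n} \<times> {..<N}) (\<lambda>x y. mult_kernel k l N \<Phi> (z (fst x), snd x) (z (fst y), snd y))"
    using \<Phi> by (rule is_kernel_pullback) (use zF in auto)
  then have "is_kernel ({..<n} \<times> {..<N}) (\<lambda>(i, p) (j, q).
      (if p = q then l (z i) (z j) else 0) - k (z i) (z j) * (\<Sum>r<N. W i $$ (p, r) * cnj (W j $$ (q, r))))"
    by (rule iffD1[OF is_kernel_cong, rotated]) (auto simp: mult_kernel_def W_def)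
  then have psd: "positive_semidefinite (n * N) (block_matrix n N
      (\<lambda>i j. l (z i) (z j) \<cdot>\<^sub>m 1\<^sub>m N - k (z i) (z j) \<cdot>\<^sub>m (W i * mat_adjoint (W j))))"
    by (rule iffD2[OF positive_semidefinite_block_iff[of n W N l z k, OF W]])
  have "\<forall>i<n. z i \<in> X" "\<forall>i<n. W i \<in> carrier_mat N N" using zF F(3) W by auto
  from cp[unfolded complete_Pick_pair_def, rule_format, OF n N this[rule_format] psd]
  have "\<exists>\<Psi>\<in>multipliers X k l N. multiplier_norm X k l N \<Psi> \<le> 1 \<and> (\<forall>i<n. \<Psi> (z i) = W i)" by blast
  then obtain \<Psi> where \<Psi>: "\<Psi> \<in> multipliers X k l N" "multiplier_norm X k l N \<Psi> \<le> 1" "\<forall>i<n. \<Psi> (z i) = W i"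
    by blast
  have "\<Psi> x $$ (p, r) = \<Phi> x p r" if "x \<in> F" "p < N" "r < N" for x p r
  proof -
    have "x \<in> z ` {..<n}" using z that(1) by (simp add: bij_betw_def)
    then obtain i where "i < n" "x = z i" by blast
    then show ?thesis using \<Psi>(3) that by (simp add: W_def)
  qed
  with kernel_of_contractive_multiplier[OF k l \<Psi>(1,2)] show ?thesis by (rule that)
qed

section \<open>Certificates on finite sets from the Pick property\<close>

lemma common_convergent_subsequence:
  fixes f :: "nat \<Rightarrow> 'i \<Rightarrow> 'a :: {heine_borel, real_normed_vector}"
  assumes "finite I" "\<And>i. i \<in> I \<Longrightarrow> bounded (range (\<lambda>n. f n i))"
  shows "\<exists>r g. strict_mono r \<and> (\<forall>i\<in>I. (\<lambda>n. f (r n) i) \<longlonglongrightarrow> g i)"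
  using assms
proof (induction I rule: finite_induct)
  case empty
  show ?case by (auto intro: exI[of _ id] strict_mono_id)
next
  case (insert i I)
  then obtain r g where r: "strict_mono r" "\<forall>i\<in>I. (\<lambda>n. f (r n) i) \<longlonglongrightarrow> g i" by auto
  have "bounded (range (\<lambda>n. f (r n) i))"
    by (rule bounded_subset[OF insert.prems[of i]]) auto
  from bounded_imp_convergent_subsequence[OF this]
  obtain l s where s: "strict_mono s" "((\<lambda>n. f (r n) i) \<circ> s) \<longlonglongrightarrow> l" by auto
  have "(\<lambda>n. f ((r \<circ> s) n) j) \<longlonglongrightarrow> (g(i := l)) j" if "j \<in> insert i I" for j
  proof (cases "j = i")
    case True
    then show ?thesis using s(2) by (simp add: o_def)
  next
    case False
    then have "(\<lambda>n. f (r n) j) \<longlonglongrightarrow> g j" using r(2) that by auto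
    from LIMSEQ_subseq_LIMSEQ[OF this s(1)] show ?thesis using False by (simp add: o_def)
  qed
  moreover have "strict_mono (r \<circ> s)" using r(1) s(1) by (rule strict_mono_o)
  ultimately show ?case by blast
qed

lemma complex_nonneg_limit:
  assumes "f \<longlonglongrightarrow> l" "\<And>n. 0 \<le> f n"
  shows "0 \<le> (l :: complex)"
proof -
  have "0 \<le> Re (f n)" "Im (f n) = 0" for n using assms(2)[of n] by (auto simp: less_eq_complex_def)
  then have "0 \<le> Re l" "(\<lambda>n. 0) \<longlonglongrightarrow> Im l"
    using LIMSEQ_le_const[OF tendsto_Re[OF assms(1)]] tendsto_Im[OF assms(1)] by auto
  then show ?thesis using LIMSEQ_unique[OF tendsto_const[of "0 :: real"]] by (auto simp: less_eq_complex_def)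
qed

lemma is_kernel_limit:
  assumes "\<And>n. is_kernel X (k n)" "\<And>x y. x \<in> X \<Longrightarrow> y \<in> X \<Longrightarrow> (\<lambda>n. k n x y) \<longlonglongrightarrow> k' x y"
  shows "is_kernel X k'"
proof (rule is_kernelI)
  fix F v assume F: "finite F" "F \<subseteq> X"
  show "0 \<le> kform F k' v"
  proof (rule complex_nonneg_limit)
    show "(\<lambda>n. kform F (k n) v) \<longlonglongrightarrow> kform F k' v"
      unfolding kform_def using F by (intro tendsto_intros assms(2)) auto
    show "0 \<le> kform F (k n) v" for n by (rule is_kernelD[OF assms(1) F])
  qed
qed

lemma kform_hermitian_real:
  assumes "\<And>x y. x \<in> F \<Longrightarrow> y \<in> F \<Longrightarrow> k y x = cnj (k x y)"
  shows "Im (kform F k v) = 0"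
proof -
  have "cnj (kform F k v) = (\<Sum>x\<in>F. \<Sum>y\<in>F. cnj (v y) * v x * k y x)"
    unfolding kform_def cnj_sum
  proof (intro sum.cong refl)
    fix x y assume "x \<in> F" "y \<in> F"
    then show "cnj (cnj (v x) * v y * k x y) = cnj (v y) * v x * k y x"
      using assms[of x y] by simp
  qed
  also have "\<dots> = kform F k v" unfolding kform_def by (rule sum.swap)
  finally show ?thesis by (simp add: complex_eq_iff)
qed

lemma is_kernel_of_Re:
  assumes "finite F" "\<And>x y. x \<in> F \<Longrightarrow> y \<in> F \<Longrightarrow> k y x = cnj (k x y)" "\<And>v. 0 \<le> Re (kform F k v)"
  shows "is_kernel F k"
  using assms kform_hermitian_real[OF assms(2)] by (intro is_kernel_finiteI) (auto simp: less_eq_complex_def)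

text \<open>Only \<open>t \<le> 1\<close> is assumed because one of the perturbations, scaling by \<open>1
  - t\<close>, stays in the cone only then.\<close>

lemma first_order_nonneg:
  fixes a b :: real
  assumes "\<And>t. 0 < t \<Longrightarrow> t \<le> 1 \<Longrightarrow> 0 \<le> 2 * t * a + t\<^sup>2 * b"
  shows "0 \<le> a"
proof (rule ccontr)
  assume "\<not> 0 \<le> a"
  define t where "t = min 1 (- a / (\<bar>b\<bar> + 1))"
  have "t \<le> - a / (\<bar>b\<bar> + 1)" unfolding t_def by (rule min.cobounded2)
  moreover have "0 < \<bar>b\<bar> + 1" by simp
  ultimately have "t * (\<bar>b\<bar> + 1) \<le> - a" by (simp only: pos_le_divide_eq)
  moreover have "0 < - a / (\<bar>b\<bar> + 1)" using \<open>\<not> 0 \<le> a\<close> by (intro divide_pos_pos) auto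
  ultimately have t: "0 < t" "t \<le> 1" "t * (\<bar>b\<bar> + 1) \<le> - a"
    unfolding t_def by simp_all
  have "t * b \<le> t * (\<bar>b\<bar> + 1)" using t by (intro mult_left_mono) auto
  then have "2 * a + t * b < 0" using t(3) \<open>\<not> 0 \<le> a\<close> by linarith
  then have "t * (2 * a + t * b) < 0" using t(1) by (simp add: mult_pos_neg)
  then show False using assms[OF t(1,2)] by (simp add: algebra_simps power2_eq_square)
qed

text \<open>The cone of all pairs \<open>(p L + u, v - p K)\<close> with positive \<open>p, u, v\<close>
  is closed, as \<open>L\<close> has positive diagonal and so \<open>p\<close> and
  \<open>u\<close> are bounded by the first component. Projecting \<open>(L', - K')\<close> to
  it leaves a residue \<open>(X, Y)\<close>; the first order conditions at the minimiser say
  that \<open>C = - cnj X\<close> and \<open>A = - cnj Y\<close> are admissible in the dual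
  condition, which then forces the residue to vanish.\<close>

lemma certificate_duality:
  assumes F: "finite F"
    and L: "\<And>x. x \<in> F \<Longrightarrow> 0 < Re (L x x)"
    and herm: "\<And>x y. x \<in> F \<Longrightarrow> y \<in> F \<Longrightarrow> L y x = cnj (L x y)"
      "\<And>x y. x \<in> F \<Longrightarrow> y \<in> F \<Longrightarrow> K y x = cnj (K x y)"
      "\<And>x y. x \<in> F \<Longrightarrow> y \<in> F \<Longrightarrow> L' y x = cnj (L' x y)"
      "\<And>x y. x \<in> F \<Longrightarrow> y \<in> F \<Longrightarrow> K' y x = cnj (K' x y)"
    and dual: "\<And>C A. is_kernel F C \<Longrightarrow> is_kernel F A \<Longrightarrow> is_kernel F (\<lambda>x y. L x y * C x y - K x y * A x y) \<Longrightarrow>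
      0 \<le> Re (\<Sum>x\<in>F. \<Sum>y\<in>F. L' x y * C x y - K' x y * A x y)"
  shows "\<exists>p. is_kernel F p \<and> is_kernel F (\<lambda>x y. L' x y - p x y * L x y) \<and>
    is_kernel F (\<lambda>x y. p x y * K x y - K' x y)"
proof -
  define \<xi> where "\<xi> = (\<lambda>p u x y. L' x y - p x y * L x y - u x y)"
  define \<eta> where "\<eta> = (\<lambda>p v x y. p x y * K x y - K' x y - v x y)"
  define I where "I = (\<lambda>X Y. \<Sum>x\<in>F. \<Sum>y\<in>F. Re (cnj (X x y) * Y x y))"
  define J where "J = (\<lambda>p u v. I (\<xi> p u) (\<xi> p u) + I (\<eta> p v) (\<eta> p v))"
  have Isq: "I X X = (\<Sum>x\<in>F. \<Sum>y\<in>F. (cmod (X x y))\<^sup>2)" for X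
    unfolding I_def cmod_power2 by (intro sum.cong refl) (simp add: power2_eq_square)
  have I0: "0 \<le> I X X" for X unfolding Isq by (intro sum_nonneg) auto
  have Ientry: "cmod (X x y) \<le> sqrt (I X X)" if "x \<in> F" "y \<in> F" for X x y
  proof (rule real_le_rsqrt)
    have "(cmod (X x y))\<^sup>2 \<le> (\<Sum>y\<in>F. (cmod (X x y))\<^sup>2)" using that F by (intro member_le_sum) auto
    also have "\<dots> \<le> I X X" unfolding Isq using that F
      by (intro member_le_sum[of x F "\<lambda>x. \<Sum>y\<in>F. (cmod (X x y))\<^sup>2"]) (auto intro: sum_nonneg)
    finally show "(cmod (X x y))\<^sup>2 \<le> I X X" .
  qed
  have Iexp: "I (\<lambda>x y. X x y + of_real t * Y x y) (\<lambda>x y. X x y + of_real t * Y x y)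
      = I X X + 2 * t * I X Y + t\<^sup>2 * I Y Y" for X Y t
    unfolding I_def sum_distrib_left sum.distrib[symmetric]
    by (intro sum.cong refl) (simp add: algebra_simps power2_eq_square)
  \<comment> \<open>\<open>J\<close> is the squared distance from a point of the cone to the target.\<close>
  define \<J> where "\<J> = {J p u v | p u v. is_kernel F p \<and> is_kernel F u \<and> is_kernel F v}"
  define d where "d = Inf \<J>"
  have J0: "0 \<le> J p u v" for p u v unfolding J_def using I0 by (intro add_nonneg_nonneg)
  have bdd: "bdd_below \<J>" using J0 by (auto simp: \<J>_def intro!: bdd_belowI[of _ 0])
  have low: "d \<le> J p u v" if "is_kernel F p" "is_kernel F u" "is_kernel F v" for p u v
    unfolding d_def using bdd that by (intro cInf_lower) (auto simp: \<J>_def)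
  have ne: "\<J> \<noteq> {}" using is_kernel_zero[of F] unfolding \<J>_def by blast
  have "\<exists>p u v. is_kernel F p \<and> is_kernel F u \<and> is_kernel F v \<and> J p u v < d + 1 / real (Suc n)" for n
    using cInf_lessD[OF ne, of "d + 1 / real (Suc n)"] unfolding d_def \<J>_def by auto
  then obtain P U V where PUV: "\<And>n. is_kernel F (P n)" "\<And>n. is_kernel F (U n)" "\<And>n. is_kernel F (V n)"
    "\<And>n. J (P n) (U n) (V n) < d + 1 / real (Suc n)" by metis
  define R where "R = sqrt (d + 1)"
  have JR: "J (P n) (U n) (V n) \<le> d + 1" for n
    using PUV(4)[of n] by (smt (verit) divide_le_eq_1 of_nat_Suc of_nat_0_le_iff)
  have \<xi>R: "cmod (\<xi> (P n) (U n) x y) \<le> R" if "x \<in> F" "y \<in> F" for n x y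
  proof -
    have "I (\<xi> (P n) (U n)) (\<xi> (P n) (U n)) \<le> d + 1" using JR[of n] I0[of "\<eta> (P n) (V n)"] by (simp add: J_def)
    then show ?thesis using Ientry[OF that, of "\<xi> (P n) (U n)"] unfolding R_def
      by (meson order_trans real_sqrt_le_mono)
  qed
  have \<eta>R: "cmod (\<eta> (P n) (V n) x y) \<le> R" if "x \<in> F" "y \<in> F" for n x y
  proof -
    have "I (\<eta> (P n) (V n)) (\<eta> (P n) (V n)) \<le> d + 1" using JR[of n] I0[of "\<xi> (P n) (U n)"] by (simp add: J_def)
    then show ?thesis using Ientry[OF that, of "\<eta> (P n) (V n)"] unfolding R_def
      by (meson order_trans real_sqrt_le_mono)
  qed
  have diag: "Re (P n x x) * Re (L x x) \<le> cmod (L' x x) + R" "Re (U n x x) \<le> cmod (L' x x) + R"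
    "0 \<le> Re (P n x x)" "0 \<le> Re (U n x x)" if x: "x \<in> F" for n x
  proof -
    have p: "0 \<le> P n x x" "0 \<le> U n x x" using is_kernel_diag PUV x by metis+
    have Lr: "Im (L x x) = 0" using herm(1)[OF x x] by (simp add: complex_eq_iff)
    have "Re (P n x x) * Re (L x x) + Re (U n x x) = Re (L' x x) - Re (\<xi> (P n) (U n) x x)"
      using p Lr by (simp add: \<xi>_def less_eq_complex_def)
    also have "\<dots> \<le> cmod (L' x x) + R"
      using \<xi>R[OF x x, of n] complex_Re_le_cmod[of "L' x x"] abs_Re_le_cmod[of "\<xi> (P n) (U n) x x"] by linarith
    finally have "Re (P n x x) * Re (L x x) + Re (U n x x) \<le> cmod (L' x x) + R" .
    moreover have "0 \<le> Re (P n x x)" "0 \<le> Re (U n x x)" using p by (auto simp: less_eq_complex_def)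
    moreover from this have "0 \<le> Re (P n x x) * Re (L x x)" using L[OF x] by simp
    ultimately show "Re (P n x x) * Re (L x x) \<le> cmod (L' x x) + R" "Re (U n x x) \<le> cmod (L' x x) + R"
      "0 \<le> Re (P n x x)" "0 \<le> Re (U n x x)" by linarith+
  qed
  have Pb: "cmod (P n x y) \<le> sqrt ((cmod (L' x x) + R) / Re (L x x) * ((cmod (L' y y) + R) / Re (L y y)))"
    if xy: "x \<in> F" "y \<in> F" for n x y
  proof (rule real_le_rsqrt)
    have "(cmod (P n x y))\<^sup>2 \<le> Re (P n x x) * Re (P n y y)"
      by (rule is_kernel_Cauchy_Schwarz[OF PUV(1) xy])
    also have "\<dots> \<le> (cmod (L' x x) + R) / Re (L x x) * ((cmod (L' y y) + R) / Re (L y y))"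
    proof -
      have *: "Re (P n x x) \<le> (cmod (L' x x) + R) / Re (L x x)" if "x \<in> F" for x
        using diag(1)[OF that, of n] L[OF that] by (simp add: field_simps)
      show ?thesis using *[OF xy(1)] *[OF xy(2)] diag(3)[OF xy(1), of n] diag(3)[OF xy(2), of n]
        by (intro mult_mono) auto
    qed
    finally show "(cmod (P n x y))\<^sup>2 \<le> (cmod (L' x x) + R) / Re (L x x) * ((cmod (L' y y) + R) / Re (L y y))" .
  qed
  have Ub: "cmod (U n x y) \<le> sqrt ((cmod (L' x x) + R) * (cmod (L' y y) + R))"
    if xy: "x \<in> F" "y \<in> F" for n x y
  proof (rule real_le_rsqrt)
    have "(cmod (U n x y))\<^sup>2 \<le> Re (U n x x) * Re (U n y y)"
      by (rule is_kernel_Cauchy_Schwarz[OF PUV(2) xy])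
    also have "\<dots> \<le> (cmod (L' x x) + R) * (cmod (L' y y) + R)"
      using diag(2,4)[OF xy(1), of n] diag(2,4)[OF xy(2), of n] by (intro mult_mono) auto
    finally show "(cmod (U n x y))\<^sup>2 \<le> (cmod (L' x x) + R) * (cmod (L' y y) + R)" .
  qed
  have Vb: "cmod (V n x y) \<le> sqrt ((cmod (L' x x) + R) / Re (L x x) * ((cmod (L' y y) + R) / Re (L y y))) * cmod (K x y)
      + cmod (K' x y) + R" if xy: "x \<in> F" "y \<in> F" for n x y
  proof -
    have "V n x y = P n x y * K x y - K' x y - \<eta> (P n) (V n) x y" by (simp add: \<eta>_def)
    then have "cmod (V n x y) \<le> cmod (P n x y * K x y) + cmod (K' x y) + cmod (\<eta> (P n) (V n) x y)"
      by (metis (no_types) norm_triangle_ineq4 add_right_mono order_trans)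
    moreover have "cmod (P n x y * K x y) \<le> sqrt ((cmod (L' x x) + R) / Re (L x x) * ((cmod (L' y y) + R) / Re (L y y))) * cmod (K x y)"
      unfolding norm_mult using Pb[OF xy, of n] by (intro mult_right_mono) auto
    ultimately show ?thesis using \<eta>R[OF xy, of n] by linarith
  qed
  define f where "f = (\<lambda>n (i, x, y). if i = (0::nat) then P n x y else if i = 1 then U n x y else V n x y)"
  have "bounded (range (\<lambda>n. f n j))" if "j \<in> {0,1,2} \<times> F \<times> F" for j
  proof -
    obtain i x y where j: "j = (i, x, y)" "x \<in> F" "y \<in> F" "i \<in> {0,1,2}" using \<open>j \<in> _\<close> by auto
    show ?thesis
      using j(4) Pb[OF j(2,3)] Ub[OF j(2,3)] Vb[OF j(2,3)] unfolding j(1)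
      by (auto simp: f_def bounded_iff)
  qed
  then obtain r g where r: "strict_mono r" "\<forall>j\<in>{0,1,2} \<times> F \<times> F. (\<lambda>n. f (r n) j) \<longlonglongrightarrow> g j"
    using common_convergent_subsequence[of "{0,1,2} \<times> F \<times> F" f] F by auto
  define p u v where puv: "p = (\<lambda>x y. g (0, x, y))" "u = (\<lambda>x y. g (1, x, y))" "v = (\<lambda>x y. g (2, x, y))"
  have lim: "(\<lambda>n. P (r n) x y) \<longlonglongrightarrow> p x y" "(\<lambda>n. U (r n) x y) \<longlonglongrightarrow> u x y" "(\<lambda>n. V (r n) x y) \<longlonglongrightarrow> v x y"
    if "x \<in> F" "y \<in> F" for x y
    using r(2)[rule_format, of "(0, x, y)"] r(2)[rule_format, of "(1, x, y)"] r(2)[rule_format, of "(2, x, y)"] that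
    by (auto simp: f_def puv)
  have ker: "is_kernel F p" "is_kernel F u" "is_kernel F v"
    using lim PUV(1,2,3) by (auto intro: is_kernel_limit[of F "\<lambda>n. P (r n)"] is_kernel_limit[of F "\<lambda>n. U (r n)"] is_kernel_limit[of F "\<lambda>n. V (r n)"])
  have Jd: "J p u v = d"
  proof (rule antisym)
    show "J p u v \<le> d"
    proof (rule LIMSEQ_le)
      show "(\<lambda>n. J (P (r n)) (U (r n)) (V (r n))) \<longlonglongrightarrow> J p u v"
        unfolding J_def I_def \<xi>_def \<eta>_def by (intro tendsto_intros lim) auto
      have "(\<lambda>n. d + 1 / real (Suc n)) \<longlonglongrightarrow> d"
        using LIMSEQ_inverse_real_of_nat_add[of d] by (simp add: inverse_eq_divide)
      from LIMSEQ_subseq_LIMSEQ[OF this r(1)] show "(\<lambda>n. d + 1 / real (Suc (r n))) \<longlonglongrightarrow> d" by (simp add: o_def)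
      show "\<exists>N. \<forall>n\<ge>N. J (P (r n)) (U (r n)) (V (r n)) \<le> d + 1 / real (Suc (r n))"
        using PUV(4) by (meson less_imp_le)
    qed
  qed (rule low[OF ker])
  define X where "X = \<xi> p u"
  define Y where "Y = \<eta> p v"
  \<comment> \<open>First order condition in every direction that stays in the cone for small \<open>t\<close>.\<close>
  have perturb: "0 \<le> I X X' + I Y Y'"
    if "\<And>t. 0 < t \<Longrightarrow> t \<le> 1 \<Longrightarrow> \<exists>p' u' v'. is_kernel F p' \<and> is_kernel F u' \<and> is_kernel F v' \<and>
       \<xi> p' u' = (\<lambda>x y. X x y + of_real t * X' x y) \<and> \<eta> p' v' = (\<lambda>x y. Y x y + of_real t * Y' x y)" for X' Y'
  proof (rule first_order_nonneg)
    fix t :: real assume t: "0 < t" "t \<le> 1"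
    from that[OF t] obtain p' u' v' where *: "is_kernel F p'" "is_kernel F u'" "is_kernel F v'"
       "\<xi> p' u' = (\<lambda>x y. X x y + of_real t * X' x y)" "\<eta> p' v' = (\<lambda>x y. Y x y + of_real t * Y' x y)" by blast
    have "J p' u' v' = J p u v + 2 * t * (I X X' + I Y Y') + t\<^sup>2 * (I X' X' + I Y' Y')"
      unfolding J_def *(4,5) Iexp by (simp add: X_def Y_def algebra_simps)
    then show "0 \<le> 2 * t * (I X X' + I Y Y') + t\<^sup>2 * (I X' X' + I Y' Y')"
      using low[OF *(1-3)] Jd by linarith
  qed
  have ext: "is_kernel F (\<lambda>x y. h x y + of_real t * (w x * cnj (w y)))" if "is_kernel F h" "0 < t" for h t w
    using that by (intro is_kernel_add is_kernel_scale is_kernel_rank_one) auto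
  define C where "C = (\<lambda>x y. - cnj (X x y))"
  define A where "A = (\<lambda>x y. - cnj (Y x y))"
  have hXY: "X y x = cnj (X x y)" "Y y x = cnj (Y x y)" if "x \<in> F" "y \<in> F" for x y
    using herm[OF that] is_kernel_hermitian[OF ker(1) that] is_kernel_hermitian[OF ker(2) that] is_kernel_hermitian[OF ker(3) that]
    by (auto simp: X_def Y_def \<xi>_def \<eta>_def)
  have hC: "C y x = cnj (C x y)" "A y x = cnj (A x y)"
    "L y x * C y x - K y x * A y x = cnj (L x y * C x y - K x y * A x y)" if "x \<in> F" "y \<in> F" for x y
    unfolding C_def A_def hXY(1)[OF that] hXY(2)[OF that] herm(1)[OF that] herm(2)[OF that] by simp_all
  have Iz: "I Z (\<lambda>x y. 0) = 0" for Z by (simp add: I_def)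
  have kI: "Re (kform F (\<lambda>x y. - cnj (Z x y) * M x y) w) = I Z (\<lambda>x y. - (cnj (w x) * cnj (cnj (w y)) * M x y))" for Z M w
    unfolding kform_def I_def Re_sum by (intro sum.cong refl) (simp add: algebra_simps)
  have Ck: "is_kernel F C"
  proof (rule is_kernel_of_Re[OF F])
    fix w
    have "0 \<le> I X (\<lambda>x y. - (cnj (w x) * cnj (cnj (w y)))) + I Y (\<lambda>x y. 0)"
    proof (rule perturb)
      fix t :: real assume t: "0 < t" "t \<le> 1"
      show "\<exists>p' u' v'. is_kernel F p' \<and> is_kernel F u' \<and> is_kernel F v' \<and>
       \<xi> p' u' = (\<lambda>x y. X x y + of_real t * - (cnj (w x) * cnj (cnj (w y)))) \<and> \<eta> p' v' = (\<lambda>x y. Y x y + of_real t * 0)"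
        by (rule exI[of _ p], rule exI[of _ "\<lambda>x y. u x y + of_real t * (cnj (w x) * cnj (cnj (w y)))"], rule exI[of _ v])
          (use ker ext[OF ker(2) t(1), of "\<lambda>x. cnj (w x)"] in \<open>auto simp del: complex_cnj_cnj simp: X_def Y_def \<xi>_def \<eta>_def fun_eq_iff algebra_simps\<close>)
    qed
    then show "0 \<le> Re (kform F C w)" using kI[of X "\<lambda>x y. 1" w] by (simp add: C_def Iz)
  qed (rule hC)
  have Ak: "is_kernel F A"
  proof (rule is_kernel_of_Re[OF F])
    fix w
    have "0 \<le> I X (\<lambda>x y. 0) + I Y (\<lambda>x y. - (cnj (w x) * cnj (cnj (w y))))"
    proof (rule perturb)
      fix t :: real assume t: "0 < t" "t \<le> 1"
      show "\<exists>p' u' v'. is_kernel F p' \<and> is_kernel F u' \<and> is_kernel F v' \<and>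
       \<xi> p' u' = (\<lambda>x y. X x y + of_real t * 0) \<and> \<eta> p' v' = (\<lambda>x y. Y x y + of_real t * - (cnj (w x) * cnj (cnj (w y))))"
        by (rule exI[of _ p], rule exI[of _ u], rule exI[of _ "\<lambda>x y. v x y + of_real t * (cnj (w x) * cnj (cnj (w y)))"])
          (use ker ext[OF ker(3) t(1), of "\<lambda>x. cnj (w x)"] in \<open>auto simp del: complex_cnj_cnj simp: X_def Y_def \<xi>_def \<eta>_def fun_eq_iff algebra_simps\<close>)
    qed
    then show "0 \<le> Re (kform F A w)" using kI[of Y "\<lambda>x y. 1" w] by (simp add: A_def Iz)
  qed (rule hC)
  have CAk: "is_kernel F (\<lambda>x y. L x y * C x y - K x y * A x y)"
  proof (rule is_kernel_of_Re[OF F])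
    fix w
    have "0 \<le> I X (\<lambda>x y. - (cnj (w x) * cnj (cnj (w y)) * L x y)) + I Y (\<lambda>x y. cnj (w x) * cnj (cnj (w y)) * K x y)"
    proof (rule perturb)
      fix t :: real assume t: "0 < t" "t \<le> 1"
      show "\<exists>p' u' v'. is_kernel F p' \<and> is_kernel F u' \<and> is_kernel F v' \<and>
       \<xi> p' u' = (\<lambda>x y. X x y + of_real t * - (cnj (w x) * cnj (cnj (w y)) * L x y)) \<and>
       \<eta> p' v' = (\<lambda>x y. Y x y + of_real t * (cnj (w x) * cnj (cnj (w y)) * K x y))"
        by (rule exI[of _ "\<lambda>x y. p x y + of_real t * (cnj (w x) * cnj (cnj (w y)))"], rule exI[of _ u], rule exI[of _ v])
          (use ker ext[OF ker(1) t(1), of "\<lambda>x. cnj (w x)"] in \<open>auto simp del: complex_cnj_cnj simp: X_def Y_def \<xi>_def \<eta>_def fun_eq_iff algebra_simps\<close>)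
    qed
    also have "I Y (\<lambda>x y. cnj (w x) * cnj (cnj (w y)) * K x y) = - I Y (\<lambda>x y. - (cnj (w x) * cnj (cnj (w y)) * K x y))"
      unfolding I_def sum_negf[symmetric] by (intro sum.cong refl) (simp del: complex_cnj_cnj)
    also have "I X (\<lambda>x y. - (cnj (w x) * cnj (cnj (w y)) * L x y)) + \<dots> = Re (kform F (\<lambda>x y. C x y * L x y) w) - Re (kform F (\<lambda>x y. A x y * K x y) w)"
      unfolding C_def A_def kI by simp
    also have "\<dots> = Re (kform F (\<lambda>x y. L x y * C x y - K x y * A x y) w)"
      unfolding kform_diff by (simp add: mult.commute)
    finally show "0 \<le> Re (kform F (\<lambda>x y. L x y * C x y - K x y * A x y) w)" .
  qed (rule hC)
  \<comment> \<open>Shrinking the minimiser towards the vertex of the cone.\<close>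
  have "0 \<le> I X (\<lambda>x y. p x y * L x y + u x y) + I Y (\<lambda>x y. v x y - p x y * K x y)"
  proof (rule perturb)
    fix t :: real assume t: "0 < t" "t \<le> 1"
    have sc: "is_kernel F (\<lambda>x y. of_real (1 - t) * h x y)" if "is_kernel F h" for h
      using that t by (intro is_kernel_scale) auto
    show "\<exists>p' u' v'. is_kernel F p' \<and> is_kernel F u' \<and> is_kernel F v' \<and>
     \<xi> p' u' = (\<lambda>x y. X x y + of_real t * (p x y * L x y + u x y)) \<and>
     \<eta> p' v' = (\<lambda>x y. Y x y + of_real t * (v x y - p x y * K x y))"
      by (rule exI[of _ "\<lambda>x y. of_real (1 - t) * p x y"], rule exI[of _ "\<lambda>x y. of_real (1 - t) * u x y"], rule exI[of _ "\<lambda>x y. of_real (1 - t) * v x y"])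
        (use sc[OF ker(1)] sc[OF ker(2)] sc[OF ker(3)] in \<open>auto simp: X_def Y_def \<xi>_def \<eta>_def fun_eq_iff algebra_simps\<close>)
  qed
  also have "\<dots> = - Re (\<Sum>x\<in>F. \<Sum>y\<in>F. L' x y * C x y - K' x y * A x y) - (I X X + I Y Y)"
    unfolding I_def Re_sum sum_negf[symmetric] sum.distrib[symmetric] sum_subtractf[symmetric]
    by (intro sum.cong refl) (simp add: X_def Y_def \<xi>_def \<eta>_def C_def A_def algebra_simps)
  finally have "I X X + I Y Y \<le> 0" using dual[OF Ck Ak CAk] by linarith
  then have I0: "I X X = 0" "I Y Y = 0" using I0[of X] I0[of Y] by linarith+
  have XY0: "X x y = 0" "Y x y = 0" if "x \<in> F" "y \<in> F" for x y
    using Ientry[OF that, of X] Ientry[OF that, of Y] I0 by auto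
  have "is_kernel F (\<lambda>x y. L' x y - p x y * L x y)"
    using ker(2) by (rule iffD1[OF is_kernel_cong, rotated]) (use XY0 in \<open>auto simp: X_def \<xi>_def\<close>)
  moreover have "is_kernel F (\<lambda>x y. p x y * K x y - K' x y)"
    using ker(3) by (rule iffD1[OF is_kernel_cong, rotated]) (use XY0 in \<open>auto simp: Y_def \<eta>_def\<close>)
  ultimately show ?thesis using ker(1) by blast
qed

text \<open>The Schur complement at \<open>z\<close> is the minimum of the form over the coefficient at
  \<open>z\<close>.\<close>

lemma kform_schur_le:
  assumes k: "is_kernel X k" and z: "z \<in> X" "k z z \<noteq> 0" and F: "finite F" "insert z F \<subseteq> X"
  shows "kform F (schur_kernel k z) v \<le> kform (insert z F) k v"
proof -
  define \<kappa> where "\<kappa> = sqrt (Re (k z z))"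
  have kzz: "k z z = of_real \<kappa> * of_real \<kappa>" "\<kappa> > 0"
    using is_kernel_diag_real[OF k z] by (auto simp: \<kappa>_def complex_eq_iff)
  have "kform (insert z F) k v = kform (insert z F) (\<lambda>x y. schur_kernel k z x y + (k x z / \<kappa>) * cnj (k y z / \<kappa>)) v"
  proof (rule kform_cong)
    fix x y assume "y \<in> insert z F"
    then have "k z y = cnj (k y z)" using F is_kernel_hermitian[OF k _ z(1), of y] by blast
    then show "k x y = schur_kernel k z x y + (k x z / \<kappa>) * cnj (k y z / \<kappa>)"
      by (simp add: schur_kernel_def kzz)
  qed auto
  also have "\<dots> = kform (insert z F) (schur_kernel k z) v + kform (insert z F) (\<lambda>x y. (k x z / \<kappa>) * cnj (k y z / \<kappa>)) v"
    by (rule kform_add)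
  also have "kform (insert z F) (schur_kernel k z) v = kform F (schur_kernel k z) v"
  proof (rule kform_supported)
    fix x y assume "x \<in> insert z F" "y \<in> insert z F" "x \<notin> F \<or> y \<notin> F"
    then have "x = z \<or> y = z" by auto
    then show "schur_kernel k z x y = 0" using z by (auto simp: schur_kernel_zero)
  qed (use F in auto)
  finally have *: "kform (insert z F) k v = kform F (schur_kernel k z) v
    + kform (insert z F) (\<lambda>x y. (k x z / \<kappa>) * cnj (k y z / \<kappa>)) v" .
  have "0 \<le> kform (insert z F) (\<lambda>x y. (k x z / \<kappa>) * cnj (k y z / \<kappa>)) v"
    unfolding kform_rank_one' nonneg_of_real_complex by simp
  then show ?thesis unfolding * by simp
qed

text \<open>Factor \<open>C\<close> and \<open>A\<close> into row vectors \<open>c(x)\<close> and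
  \<open>a(x)\<close>. The certificate on \<open>F\<close> yields a contractive multiplier with
  \<open>c(x) \<Phi>(x) = a(x)\<close> on \<open>F\<close>, which extends to \<open>z\<close> by
  the Pick property. Testing positivity of its kernel with the coefficient at \<open>z\<close>
  that is optimal for \<open>l\<close> produces \<open>l\<^sup>z\<close> exactly and
  \<open>k\<^sup>z\<close> as a lower bound.\<close>

lemma dual_of_Pick:
  assumes cp: "complete_Pick_pair X k l" and k: "is_kernel X k" and l: "is_kernel X l"
    and nz: "\<And>z. z \<in> X \<Longrightarrow> k z z \<noteq> 0" "\<And>z. z \<in> X \<Longrightarrow> l z z \<noteq> 0"
    and F: "finite F" "F \<noteq> {}" "F \<subseteq> X" and z: "z \<in> X" "z \<notin> F"
    and cert: "Shimorin_certificate F k l p"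
    and CA: "is_kernel F C" "is_kernel F A" "is_kernel F (\<lambda>x y. l x y * C x y - k x y * A x y)"
  shows "0 \<le> (\<Sum>x\<in>F. \<Sum>y\<in>F. schur_kernel l z x y * C x y - schur_kernel k z x y * A x y)"
proof -
  define N where "N = card F"
  have N: "N \<ge> 1" using F by (simp add: N_def Suc_le_eq card_gt_0_iff)
  obtain c where c: "\<And>x y. x \<in> F \<Longrightarrow> y \<in> F \<Longrightarrow> C x y = (\<Sum>m<N. c m x * cnj (c m y))"
    using finite_kernel_Gram[OF F(1) CA(1)] by (auto simp: N_def)
  obtain a where a: "\<And>x y. x \<in> F \<Longrightarrow> y \<in> F \<Longrightarrow> A x y = (\<Sum>m<N. a m x * cnj (a m y))"
    using finite_kernel_Gram[OF F(1) CA(2)] by (auto simp: N_def)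
  define t :: "'a \<Rightarrow> 'a triple" where "t = (\<lambda>x. (x, (\<lambda>m. c m x), (\<lambda>m. a m x)))"
  have "is_kernel F (\<lambda>x y. triple_kernel k l N (t x) (t y))"
    using CA(3) by (rule iffD1[OF is_kernel_cong, rotated]) (simp add: triple_kernel_def t_def c a)
  then have ker: "is_kernel (t ` F) (triple_kernel k l N)" by (rule is_kernel_image)
  have sub: "t ` F \<subseteq> F \<times> UNIV" by (auto simp: t_def)
  have kF: "is_kernel F k" "is_kernel F l" using k l F is_kernel_subset by metis+
  have nzF: "\<And>z. z \<in> F \<Longrightarrow> k z z \<noteq> 0" "\<And>z. z \<in> F \<Longrightarrow> l z z \<noteq> 0" using nz F by auto
  obtain \<Phi> where \<Phi>: "is_kernel (F \<times> {..<N}) (mult_kernel k l N \<Phi>)"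
    "\<And>z c a r. (z, c, a) \<in> t ` F \<Longrightarrow> r < N \<Longrightarrow> a r = (\<Sum>m<N. c m * \<Phi> z m r)"
    using total_extension[OF kF nzF cert sub ker] by blast
  have \<Phi>a: "a r x = (\<Sum>m<N. c m x * \<Phi> x m r)" if "x \<in> F" "r < N" for x r
    using \<Phi>(2)[of x "\<lambda>m. c m x" "\<lambda>m. a m x" r] that by (auto simp: t_def)
  obtain \<Psi> where \<Psi>: "is_kernel (X \<times> {..<N}) (mult_kernel k l N \<Psi>)"
    "\<And>z p r. z \<in> F \<Longrightarrow> p < N \<Longrightarrow> r < N \<Longrightarrow> \<Psi> z p r = \<Phi> z p r"
    using complete_Pick_pair_extend[OF cp k l F N \<Phi>(1)] by blast
  \<comment> \<open>The value at \<open>z\<close> is the minimiser in \<open>schur_kernel_form\<close>.\<close>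
  define w where "w = (\<lambda>p. (\<lambda>x. cnj (c p x))(z := - (\<Sum>x\<in>F. cnj (c p x) * l z x) / l z z))"
  define v where "v = (\<lambda>(x, p). w p x)"
  define g where "g = (\<lambda>r x. \<Sum>p<N. v (x, p) * cnj (\<Psi> x p r))"
  have "0 \<le> kform (insert z F \<times> {..<N}) (mult_kernel k l N \<Psi>) v"
    using \<Psi>(1) F z by (intro is_kernelD) auto
  also have "\<dots> = (\<Sum>p<N. kform (insert z F) l (w p)) - (\<Sum>r<N. kform (insert z F) k (g r))"
    using F(1) by (subst kform_mult_kernel) (auto simp: v_def g_def)
  also have "\<dots> \<le> (\<Sum>p<N. kform F (schur_kernel l z) (\<lambda>x. cnj (c p x))) - (\<Sum>r<N. kform F (schur_kernel k z) (\<lambda>x. cnj (a r x)))"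
  proof (rule diff_mono)
    have "kform (insert z F) l (w p) = kform F (schur_kernel l z) (\<lambda>x. cnj (c p x))" for p
      unfolding w_def using F z nz(2)[OF z(1)] is_kernel_hermitian[OF l _ z(1)]
      by (intro schur_kernel_form) blast+
    then show "(\<Sum>p<N. kform (insert z F) l (w p)) \<le> (\<Sum>p<N. kform F (schur_kernel l z) (\<lambda>x. cnj (c p x)))"
      by simp
    have "kform F (schur_kernel k z) (\<lambda>x. cnj (a r x)) \<le> kform (insert z F) k (g r)" if "r < N" for r
    proof -
      have "kform F (schur_kernel k z) (\<lambda>x. cnj (a r x)) = kform F (schur_kernel k z) (g r)"
      proof (rule kform_cong)
        fix x assume x: "x \<in> F"
        then have "x \<noteq> z" using z by auto
        then show "cnj (a r x) = g r x"
          using \<Psi>(2)[OF x _ that] by (simp add: g_def v_def w_def \<Phi>a[OF x that])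
      qed auto
      also have "\<dots> \<le> kform (insert z F) k (g r)"
        using F z nz by (intro kform_schur_le[OF k]) auto
      finally show ?thesis .
    qed
    then show "(\<Sum>r<N. kform F (schur_kernel k z) (\<lambda>x. cnj (a r x))) \<le> (\<Sum>r<N. kform (insert z F) k (g r))"
      by (intro sum_mono) auto
  qed
  also have "(\<Sum>p<N. kform F (schur_kernel l z) (\<lambda>x. cnj (c p x))) = (\<Sum>x\<in>F. \<Sum>y\<in>F. schur_kernel l z x y * C x y)"
  proof -
    have "(\<Sum>p<N. kform F (schur_kernel l z) (\<lambda>x. cnj (c p x))) = kform F (\<lambda>x y. \<Sum>p<N. c p x * cnj (c p y) * schur_kernel l z x y) (\<lambda>x. 1)"
      unfolding kform_sum kform_rank_one by simp
    also have "\<dots> = (\<Sum>x\<in>F. \<Sum>y\<in>F. schur_kernel l z x y * C x y)"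
      unfolding kform_def by (intro sum.cong refl) (simp add: c sum_distrib_left mult_ac)
    finally show ?thesis .
  qed
  also have "(\<Sum>p<N. kform F (schur_kernel k z) (\<lambda>x. cnj (a p x))) = (\<Sum>x\<in>F. \<Sum>y\<in>F. schur_kernel k z x y * A x y)"
  proof -
    have "(\<Sum>p<N. kform F (schur_kernel k z) (\<lambda>x. cnj (a p x))) = kform F (\<lambda>x y. \<Sum>p<N. a p x * cnj (a p y) * schur_kernel k z x y) (\<lambda>x. 1)"
      unfolding kform_sum kform_rank_one by simp
    also have "\<dots> = (\<Sum>x\<in>F. \<Sum>y\<in>F. schur_kernel k z x y * A x y)"
      unfolding kform_def by (intro sum.cong refl) (simp add: a sum_distrib_left mult_ac)
    finally show ?thesis .
  qed
  finally show ?thesis by (simp add: sum_subtractf)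
qed

text \<open>Induction on the number of points: a certificate at \<open>z\<close> on \<open>F - {z}\<close>
  comes from duality, whose hypothesis is \<open>dual_of_Pick\<close> and uses a certificate for
  the smaller set. It is extended by zero to \<open>z\<close>, where all Schur complements
  vanish.\<close>

theorem finite_Shimorin_of_Pick:
  assumes cp: "complete_Pick_pair X k l" and k: "is_kernel X k" and l: "is_kernel X l"
    and nz: "\<And>z. z \<in> X \<Longrightarrow> k z z \<noteq> 0" "\<And>z. z \<in> X \<Longrightarrow> l z z \<noteq> 0"
    and F: "finite F" "F \<subseteq> X"
  shows "\<exists>p. Shimorin_certificate F k l p"
  using F
proof (induction "card F" arbitrary: F rule: less_induct)
  case less
  have "\<exists>p. is_kernel F p \<and> kernel_le F (\<lambda>w v. p w v * l w v) (schur_kernel l z) \<and>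
      kernel_le F (schur_kernel k z) (\<lambda>w v. p w v * k w v)" if z: "z \<in> F" for z
  proof -
    define G where "G = F - {z}"
    have G: "finite G" "G \<subseteq> X" "z \<notin> G" "F = insert z G" using less.prems z by (auto simp: G_def)
    have zX: "z \<in> X" using z less.prems by auto
    have lk: "is_kernel X (schur_kernel l z)" "is_kernel X (schur_kernel k z)"
      using is_kernel_schur_kernel k l nz zX by metis+
    have "\<exists>p. is_kernel G p \<and> is_kernel G (\<lambda>x y. schur_kernel l z x y - p x y * l x y) \<and>
        is_kernel G (\<lambda>x y. p x y * k x y - schur_kernel k z x y)"
    proof (cases "G = {}")
      case True
      then show ?thesis by (auto simp: is_kernel_iff kform_def)
    next
      case False
      have "card G < card F" unfolding G_def using less.prems(1) z by (rule card_Diff1_less)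
      from less.hyps[OF this G(1,2)] obtain p where p: "Shimorin_certificate G k l p" by blast
      show ?thesis
      proof (rule certificate_duality[OF G(1)])
        fix C A assume CA: "is_kernel G C" "is_kernel G A" "is_kernel G (\<lambda>x y. l x y * C x y - k x y * A x y)"
        show "0 \<le> Re (\<Sum>x\<in>G. \<Sum>y\<in>G. schur_kernel l z x y * C x y - schur_kernel k z x y * A x y)"
          using dual_of_Pick[OF cp k l nz G(1) False G(2) zX G(3) p CA] by (simp add: less_eq_complex_def)
      next
        show "0 < Re (l x x)" if "x \<in> G" for x using is_kernel_diag_real(2)[OF l _ nz(2)] G that by auto
      next
        fix x y assume "x \<in> G" "y \<in> G"
        then have xy: "x \<in> X" "y \<in> X" using G by auto
        show "l y x = cnj (l x y)" "k y x = cnj (k x y)"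
          "schur_kernel l z y x = cnj (schur_kernel l z x y)" "schur_kernel k z y x = cnj (schur_kernel k z x y)"
          using is_kernel_hermitian[OF l xy] is_kernel_hermitian[OF k xy]
            is_kernel_hermitian[OF lk(1) xy] is_kernel_hermitian[OF lk(2) xy] by blast+
      qed
    qed
    then obtain p where p: "is_kernel G p" "is_kernel G (\<lambda>x y. schur_kernel l z x y - p x y * l x y)"
      "is_kernel G (\<lambda>x y. p x y * k x y - schur_kernel k z x y)" by blast
    define p' where "p' = (\<lambda>x y. if x \<in> G \<and> y \<in> G then p x y else 0)"
    have sup: "is_kernel F h" if "is_kernel G h'" "\<And>x y. x \<in> G \<Longrightarrow> y \<in> G \<Longrightarrow> h x y = h' x y"
      "\<And>x. h x z = 0" "\<And>x. h z x = 0" for h h'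
    proof (rule is_kernel_supported)
      show "is_kernel G h" using that(1) by (rule iffD1[OF is_kernel_cong, rotated]) (simp add: that(2))
      show "h x y = 0" if "x \<in> F" "y \<in> F" "x \<notin> G \<or> y \<notin> G" for x y
        using that \<open>\<And>x. h x z = 0\<close> \<open>\<And>x. h z x = 0\<close> G by auto
    qed
    have "is_kernel F p'" by (rule sup[OF p(1)]) (use G in \<open>auto simp: p'_def\<close>)
    moreover have "is_kernel F (\<lambda>x y. schur_kernel l z x y - p' x y * l x y)"
      by (rule sup[OF p(2)]) (use G nz(2)[OF zX] in \<open>auto simp: p'_def schur_kernel_zero\<close>)
    moreover have "is_kernel F (\<lambda>x y. p' x y * k x y - schur_kernel k z x y)"
      by (rule sup[OF p(3)]) (use G nz(1)[OF zX] in \<open>auto simp: p'_def schur_kernel_zero\<close>)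
    ultimately show ?thesis unfolding kernel_le_def by blast
  qed
  then have "\<forall>z\<in>F. \<exists>p. is_kernel F p \<and> kernel_le F (\<lambda>w v. p w v * l w v) (schur_kernel l z) \<and>
      kernel_le F (schur_kernel k z) (\<lambda>w v. p w v * k w v)" ..
  from bchoice[OF this] show ?case unfolding Shimorin_certificate_def .
qed

section \<open>Strong certificates\<close>

lemma is_kernel_eqI:
  assumes "is_kernel X (\<lambda>x y. k x y - k' x y)" "is_kernel X (\<lambda>x y. k' x y - k x y)" "x \<in> X" "y \<in> X"
  shows "k x y = k' x y"
proof -
  have "0 \<le> k x x - k' x x" "0 \<le> k' x x - k x x"
    using is_kernel_diag[OF assms(1,3)] is_kernel_diag[OF assms(2,3)] by auto
  then have "Re (k x x - k' x x) = 0" by (simp add: less_eq_complex_def)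
  then have "(cmod (k x y - k' x y))\<^sup>2 \<le> 0"
    using is_kernel_Cauchy_Schwarz[OF assms(1,3,4)] by simp
  then show ?thesis by simp
qed

text \<open>For a pair \<open>(s, s)\<close> the two inequalities of a certificate are opposite, so that
  \<open>p[z] s = s\<^sup>z\<close>. With \<open>z = x0\<close> this prevents zeros of
  \<open>s\<close>, as \<open>s x y = 0\<close> would give \<open>s x x0 \<cdot> s x0 y =
  0\<close>; and so \<open>s\<^sup>z / s\<close> coincides on finite sets with the kernel
  \<open>p[z]\<close>.\<close>

lemma complete_Pick_kernel_quotient:
  assumes s: "complete_Pick_kernel X s" and o: "x0 \<in> X" "\<And>x. x \<in> X \<Longrightarrow> s x x0 \<noteq> 0"
  shows "\<And>x y. x \<in> X \<Longrightarrow> y \<in> X \<Longrightarrow> s x y \<noteq> 0"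
    and "\<And>z. z \<in> X \<Longrightarrow> is_kernel X (\<lambda>x y. schur_kernel s z x y / s x y)"
proof -
  have sk: "is_kernel X s" and cp: "complete_Pick_pair X s s" using s by (auto simp: complete_Pick_kernel_def)
  have nz: "s z z \<noteq> 0" if "z \<in> X" for z
    using is_kernel_Cauchy_Schwarz[OF sk that o(1)] o(2)[OF that] by auto
  have fin: "\<exists>p. is_kernel F p \<and> (\<forall>x\<in>F. \<forall>y\<in>F. p x y * s x y = schur_kernel s z x y)"
    if F: "finite F" "F \<subseteq> X" "z \<in> F" for F z
  proof -
    obtain p where p: "Shimorin_certificate F s s p"
      using finite_Shimorin_of_Pick[OF cp sk sk nz nz F(1,2)] by blast
    then have p: "is_kernel F (p z)" "is_kernel F (\<lambda>x y. schur_kernel s z x y - p z x y * s x y)"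
      "is_kernel F (\<lambda>x y. p z x y * s x y - schur_kernel s z x y)"
      using F(3) by (auto simp: Shimorin_certificate_def kernel_le_def)
    then have "p z x y * s x y = schur_kernel s z x y" if "x \<in> F" "y \<in> F" for x y
      using is_kernel_eqI[of F "\<lambda>x y. p z x y * s x y" "schur_kernel s z" x y] that by blast
    with p(1) show ?thesis by blast
  qed
  show nonzero: "s x y \<noteq> 0" if xy: "x \<in> X" "y \<in> X" for x y
  proof
    assume "s x y = 0"
    obtain p where "p x y * s x y = schur_kernel s x0 x y"
      using fin[of "{x, y, x0}" x0] xy o(1) by auto
    then have "s x x0 * s x0 y = 0" using \<open>s x y = 0\<close> nz[OF o(1)] by (simp add: schur_kernel_def)
    then show False
      using o(2)[OF xy(1)] o(2)[OF xy(2)] is_kernel_hermitian[OF sk xy(2) o(1)] by simp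
  qed
  show "is_kernel X (\<lambda>x y. schur_kernel s z x y / s x y)" if z: "z \<in> X" for z
  proof (rule is_kernelI)
    fix F v assume F: "finite F" "F \<subseteq> X"
    obtain p where p: "is_kernel (insert z F) p"
      "\<forall>x\<in>insert z F. \<forall>y\<in>insert z F. p x y * s x y = schur_kernel s z x y"
      using fin[of "insert z F" z] F z by auto
    have "kform F (\<lambda>x y. schur_kernel s z x y / s x y) v = kform F p v"
    proof (rule kform_cong)
      fix x y assume xy: "x \<in> F" "y \<in> F"
      then have "p x y * s x y = schur_kernel s z x y" "s x y \<noteq> 0"
        using p(2) nonzero[of x y] F(2) by blast+
      then show "schur_kernel s z x y / s x y = p x y" by (simp add: field_simps)
    qed auto
    also have "0 \<le> kform F p v" using F by (intro is_kernelD[OF p(1)]) auto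
    finally show "0 \<le> kform F (\<lambda>x y. schur_kernel s z x y / s x y) v" .
  qed
qed

text \<open>The Schur complement of \<open>1 - h\<close> at \<open>z\<close>, with the opposite sign. It
  is that of \<open>h\<close> plus a positive rank one term built from \<open>h(x, z) - h(z,
  z)\<close>.\<close>

lemma is_kernel_one_minus_schur:
  assumes h: "is_kernel X h" and z: "z \<in> X" and lt: "Re (h z z) < 1"
  shows "is_kernel X (\<lambda>x y. h x y - 1 + (1 - h x z) * (1 - h z y) / (1 - h z z))"
proof (cases "h z z = 0")
  case True
  have 0: "h x z = 0" "h z x = 0" if "x \<in> X" for x
    using is_kernel_Cauchy_Schwarz[OF h that z] is_kernel_hermitian[OF h that z] True by auto
  show ?thesis
    using h by (rule iffD1[OF is_kernel_cong, rotated]) (simp add: 0 True)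
next
  case False
  define H where "H = Re (h z z)"
  have H: "h z z = of_real H" "0 < H" "H < 1"
    using is_kernel_diag_real[OF h z False] lt by (auto simp: H_def)
  have "is_kernel X (\<lambda>x y. schur_kernel h z x y + of_real (1 / (H * (1 - H))) * ((h x z - H) * cnj (h y z - H)))"
    using H by (intro is_kernel_add is_kernel_schur_kernel[OF h z False] is_kernel_scale is_kernel_rank_one) auto
  then show ?thesis
  proof (rule iffD1[OF is_kernel_cong, rotated])
    fix x y assume "x \<in> X" "y \<in> X"
    then have hy: "cnj (h y z) = h z y" using is_kernel_hermitian[OF h _ z, of y] by simp
    have nz: "complex_of_real H \<noteq> 0" "1 - complex_of_real H \<noteq> 0"
      using H(2,3) by (auto simp: complex_eq_iff)
    have id: "1 / (c * (1 - c)) * ((a - c) * (b - c)) = a * b / c - 1 + (1 - a) * (1 - b) / (1 - c)"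
      if "c \<noteq> 0" "1 - c \<noteq> 0" for a b c :: complex
      using that by (simp add: field_simps)
    show "schur_kernel h z x y + of_real (1 / (H * (1 - H))) * ((h x z - H) * cnj (h y z - H))
      = h x y - 1 + (1 - h x z) * (1 - h z y) / (1 - h z z)"
      using id[OF nz, of "h x z" "h z y"] by (simp add: schur_kernel_def H(1) hy)
  qed
qed

text \<open>Up to the congruence with \<open>s(\<cdot>, z)\<close>, the defect for \<open>l = s g\<close>
  is the Schur complement of \<open>g\<close>, and that for \<open>k = (1 - h) s\<close> is the
  negative Schur complement of \<open>1 - h\<close>.\<close>

lemma Shimorin_of_quotient:
  assumes s: "is_kernel X s" "\<And>x y. x \<in> X \<Longrightarrow> y \<in> X \<Longrightarrow> s x y \<noteq> 0"
    and quot: "\<And>z. z \<in> X \<Longrightarrow> is_kernel X (\<lambda>x y. schur_kernel s z x y / s x y)"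
    and h: "is_kernel X h" and g: "is_kernel X g"
    and k: "is_kernel X k" "\<And>x y. x \<in> X \<Longrightarrow> y \<in> X \<Longrightarrow> k x y = (1 - h x y) * s x y"
    and l: "\<And>x y. x \<in> X \<Longrightarrow> y \<in> X \<Longrightarrow> l x y = s x y * g x y"
    and nz: "\<And>z. z \<in> X \<Longrightarrow> k z z \<noteq> 0" "\<And>z. z \<in> X \<Longrightarrow> l z z \<noteq> 0"
  shows "Shimorin_certificate X k l (\<lambda>z x y. schur_kernel s z x y / s x y)"
  unfolding Shimorin_certificate_def kernel_le_def
proof (intro ballI conjI)
  fix z assume z: "z \<in> X"
  show "is_kernel X (\<lambda>x y. schur_kernel s z x y / s x y)" using quot[OF z] .
  define \<sigma> where "\<sigma> = sqrt (Re (s z z))"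
  have szz: "s z z = of_real \<sigma> * of_real \<sigma>" "\<sigma> > 0"
    using is_kernel_diag_real[OF s(1) z s(2)[OF z z]] by (auto simp: \<sigma>_def complex_eq_iff)
  have sz: "s z y = cnj (s y z)" if "y \<in> X" for y using is_kernel_hermitian[OF s(1) that z] .
  have gz: "g z z \<noteq> 0" using nz(2)[OF z] l[OF z z] by auto
  have cong: "is_kernel X (\<lambda>x y. (s x z / \<sigma>) * cnj (s y z / \<sigma>) * f x y)" if "is_kernel X f" for f
    using that by (rule is_kernel_congruence)
  show "is_kernel X (\<lambda>x y. schur_kernel l z x y - schur_kernel s z x y / s x y * l x y)"
    using cong[OF is_kernel_schur_kernel[OF g z gz]]
  proof (rule iffD1[OF is_kernel_cong, rotated])
    fix x y assume xy: "x \<in> X" "y \<in> X"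
    have n: "s x y \<noteq> 0" "s z z \<noteq> 0" using s(2) xy z by auto
    show "(s x z / \<sigma>) * cnj (s y z / \<sigma>) * schur_kernel g z x y = schur_kernel l z x y - schur_kernel s z x y / s x y * l x y"
      using n gz szz by (simp add: schur_kernel_def l xy z sz[OF xy(2)] field_simps)
  qed
  have Hlt: "Re (h z z) < 1"
  proof -
    have "Im (h z z) = 0" using is_kernel_diag[OF h z] by (simp add: less_eq_complex_def)
    then have "Re (k z z) = (1 - Re (h z z)) * Re (s z z)" using k(2)[OF z z] by simp
    moreover have "0 < Re (k z z)" "0 < Re (s z z)"
      using is_kernel_diag_real[OF k(1) z nz(1)[OF z]] is_kernel_diag_real[OF s(1) z s(2)[OF z z]] by auto
    ultimately show ?thesis by (simp add: zero_less_mult_iff)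
  qed
  have H1: "1 - h z z \<noteq> 0" using Hlt by (auto simp: complex_eq_iff)
  show "is_kernel X (\<lambda>x y. schur_kernel s z x y / s x y * k x y - schur_kernel k z x y)"
    using cong[OF is_kernel_one_minus_schur[OF h z Hlt]]
  proof (rule iffD1[OF is_kernel_cong, rotated])
    fix x y assume xy: "x \<in> X" "y \<in> X"
    have n: "s x y \<noteq> 0" "s z z \<noteq> 0" using s(2) xy z by auto
    define Q where "Q = s x z * s z y / s z z"
    define R where "R = (1 - h x z) * (1 - h z y) / (1 - h z z)"
    have 1: "schur_kernel s z x y / s x y * k x y = (s x y - Q) * (1 - h x y)"
      using n by (simp add: k xy schur_kernel_def Q_def)
    have 2: "schur_kernel k z x y = (1 - h x y) * s x y - Q * R"
      using n H1 by (simp add: schur_kernel_def k xy z Q_def R_def mult_ac)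
    have 3: "(s x z / \<sigma>) * cnj (s y z / \<sigma>) = Q" by (simp add: szz sz[OF xy(2)] Q_def)
    show "(s x z / \<sigma>) * cnj (s y z / \<sigma>) * (h x y - 1 + (1 - h x z) * (1 - h z y) / (1 - h z z))
      = schur_kernel s z x y / s x y * k x y - schur_kernel k z x y"
      unfolding 1 2 3 R_def[symmetric] by (simp add: algebra_simps)
  qed
qed

text \<open>The condition on \<open>x0\<close> passes from \<open>k\<close> to \<open>s\<close> and
  excludes zeros of \<open>s\<close>.\<close>

theorem Shimorin_of_strong:
  assumes "strong_Shimorin_certificate X k l s" and k: "is_kernel X k" and o: "x0 \<in> X" "\<And>x. x \<in> X \<Longrightarrow> k x x0 \<noteq> 0"
    and nz: "\<And>z. z \<in> X \<Longrightarrow> k z z \<noteq> 0" "\<And>z. z \<in> X \<Longrightarrow> l z z \<noteq> 0"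
  shows "\<exists>p. Shimorin_certificate X k l p"
proof -
  from assms(1) obtain h g where s: "complete_Pick_kernel X s" and hg: "is_kernel X h" "is_kernel X g"
    and kl: "\<And>x y. x \<in> X \<Longrightarrow> y \<in> X \<Longrightarrow> k x y = (1 - h x y) * s x y"
      "\<And>x y. x \<in> X \<Longrightarrow> y \<in> X \<Longrightarrow> l x y = s x y * g x y"
    unfolding strong_Shimorin_certificate_def by blast
  have so: "s x x0 \<noteq> 0" if "x \<in> X" for x using o(2)[OF that] kl(1)[OF that o(1)] by auto
  have sk: "is_kernel X s" using s by (simp add: complete_Pick_kernel_def)
  from Shimorin_of_quotient[OF sk complete_Pick_kernel_quotient[OF s o(1) so] hg k kl nz] show ?thesis by blast
qed

text \<open>With \<open>s = 1 / (1 - b)\<close> the quotient \<open>s\<^sup>z / s\<close> is, up to a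
  congruence and a positive factor, the kernel of \<open>is_kernel_one_minus_schur\<close> for
  \<open>b\<close>. So \<open>(s, s)\<close> has a certificate.\<close>

lemma geometric_complete_Pick_kernel:
  assumes b: "is_kernel X b" "\<And>x. x \<in> X \<Longrightarrow> Re (b x x) < 1"
  shows "complete_Pick_kernel X (\<lambda>x y. 1 / (1 - b x y))"
proof -
  let ?s = "\<lambda>x y. 1 / (1 - b x y)"
  have lt: "cmod (b x y) < 1" if "x \<in> X" "y \<in> X" for x y
  proof -
    have "0 \<le> Re (b x x)" "0 \<le> Re (b y y)" using is_kernel_diag[OF b(1)] that by (auto simp: less_eq_complex_def)
    then have "Re (b x x) * Re (b y y) \<le> Re (b x x) * 1"
      using b(2)[OF that(2)] by (intro mult_left_mono) auto
    then have "Re (b x x) * Re (b y y) < 1" using b(2)[OF that(1)] by simp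
    with is_kernel_Cauchy_Schwarz[OF b(1) that] have "(cmod (b x y))\<^sup>2 < 1" by linarith
    then show ?thesis by (simp add: power_less_one_iff)
  qed
  have n1: "1 - b x y \<noteq> 0" if "x \<in> X" "y \<in> X" for x y using lt[OF that] by auto
  have pow: "is_kernel X (\<lambda>x y. b x y ^ n)" for n
  proof (induction n)
    case 0
    show ?case using is_kernel_rank_one[of X "\<lambda>_. 1"] by simp
  next
    case (Suc n)
    show ?case using is_kernel_mult[OF b(1) Suc] by simp
  qed
  have s: "is_kernel X ?s"
  proof (rule is_kernel_limit)
    show "is_kernel X (\<lambda>x y. \<Sum>i<n. b x y ^ i)" for n by (intro is_kernel_sum pow)
    show "(\<lambda>n. \<Sum>i<n. b x y ^ i) \<longlonglongrightarrow> ?s x y" if "x \<in> X" "y \<in> X" for x y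
      using geometric_sums[OF lt[OF that]] by (simp add: sums_def)
  qed
  have nz: "?s x y \<noteq> 0" if "x \<in> X" "y \<in> X" for x y using n1[OF that] by simp
  have quot: "is_kernel X (\<lambda>x y. schur_kernel ?s z x y / ?s x y)" if z: "z \<in> X" for z
  proof -
    define B where "B = Re (b z z)"
    have B: "b z z = of_real B" "B < 1"
      using is_kernel_diag[OF b(1) z] b(2)[OF z] by (auto simp: B_def less_eq_complex_def complex_eq_iff)
    have "is_kernel X (\<lambda>x y. (1 / (1 - b x z)) * cnj (1 / (1 - b y z)) *
        (of_real (1 - B) * (b x y - 1 + (1 - b x z) * (1 - b z y) / (1 - b z z))))"
      using B(2) by (intro is_kernel_congruence is_kernel_scale is_kernel_one_minus_schur b z) auto
    then show ?thesis
    proof (rule iffD1[OF is_kernel_cong, rotated])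
      fix x y assume xy: "x \<in> X" "y \<in> X"
      have by': "cnj (b y z) = b z y" using is_kernel_hermitian[OF b(1) xy(2) z] by simp
      have n: "1 - b x z \<noteq> 0" "1 - b z y \<noteq> 0" "1 - b z z \<noteq> 0" "1 - b x y \<noteq> 0"
        using n1 xy z by auto
      have B': "complex_of_real (1 - B) = 1 - b z z" by (simp add: B(1))
      have "schur_kernel ?s z x y / ?s x y = 1 - (1 - b z z) * (1 - b x y) / ((1 - b x z) * (1 - b z y))"
      proof -
        have "(1 / e - 1 / a * (1 / c) / (1 / d)) / (1 / e) = 1 - d * e / (a * c)"
          if "a \<noteq> 0" "c \<noteq> 0" "d \<noteq> 0" "e \<noteq> 0" for a c d e :: complex
          using that by (simp add: field_simps)
        from this[OF n] show ?thesis by (simp only: schur_kernel_def)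
      qed
      moreover have "(1 / (1 - b x z)) * cnj (1 / (1 - b y z)) *
        (of_real (1 - B) * (b x y - 1 + (1 - b x z) * (1 - b z y) / (1 - b z z)))
        = 1 - (1 - b z z) * (1 - b x y) / ((1 - b x z) * (1 - b z y))"
      proof -
        have id: "(1 / a) * (1 / c) * (d * (e - 1 + a * c / d)) = 1 - d * (1 - e) / (a * c)"
          if "a \<noteq> 0" "c \<noteq> 0" "d \<noteq> 0" for a c d e :: complex
          using that by (simp add: field_simps)
        have "cnj (1 / (1 - b y z)) = 1 / (1 - b z y)" by (simp add: by')
        then show ?thesis using id[OF n(1-3), of "b x y"] by (simp only: B')
      qed
      ultimately show "(1 / (1 - b x z)) * cnj (1 / (1 - b y z)) *
        (of_real (1 - B) * (b x y - 1 + (1 - b x z) * (1 - b z y) / (1 - b z z))) = schur_kernel ?s z x y / ?s x y"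
        by simp
    qed
  qed
  have "Shimorin_certificate X ?s ?s (\<lambda>z x y. schur_kernel ?s z x y / ?s x y)"
    by (rule Shimorin_of_quotient[OF s nz quot is_kernel_zero[of X] is_kernel_rank_one[of X "\<lambda>_. 1"] s _ _ nz nz]) auto
  from complete_Pick_pair_of_Shimorin[OF s s nz nz this] s show ?thesis
    by (simp add: complete_Pick_kernel_def)
qed

section \<open>Convolution and the minimality of the master certificate\<close>

definition splits :: "nat ^ 'n \<Rightarrow> ((nat ^ 'n) \<times> (nat ^ 'n)) set" where
  "splits b = {(w, u). w + u = b}"

definition conv :: "(nat ^ 'n \<Rightarrow> real) \<Rightarrow> (nat ^ 'n \<Rightarrow> real) \<Rightarrow> nat ^ 'n \<Rightarrow> real" where
  "conv f g b = (\<Sum>(w, u)\<in>splits b. f w * g u)"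

text \<open>The coefficients of \<open>1 - f\<close> for the power series \<open>f\<close>.\<close>

definition unit_minus :: "(nat ^ 'n \<Rightarrow> real) \<Rightarrow> nat ^ 'n \<Rightarrow> real" where
  "unit_minus f b = (if b = 0 then 1 else 0) - f b"

lemma finite_splits [simp]: "finite (splits b)"
  using finite_multi_index_splits[of b] by (simp add: splits_def)

lemma multi_index_add_eq_0: "w + u = 0 \<longleftrightarrow> w = 0 \<and> u = (0 :: nat ^ 'n)"
  by (metis add_eq_0_iff_both_eq_0 mdeg_add mdeg_eq_0_iff)

lemma conv_comm: "conv f g b = conv g f b"
  unfolding conv_def
  by (rule sum.reindex_bij_witness[of _ prod.swap prod.swap]) (auto simp: splits_def add.commute mult.commute)

lemma conv_assoc: "conv (conv f g) h b = conv f (conv g h) b"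
proof -
  have "conv (conv f g) h b = (\<Sum>x\<in>splits b. \<Sum>y\<in>splits (fst x). f (fst y) * g (snd y) * h (snd x))"
    by (simp add: conv_def case_prod_beta sum_distrib_right)
  also have "\<dots> = (\<Sum>(x, y)\<in>(SIGMA x:splits b. splits (fst x)). f (fst y) * g (snd y) * h (snd x))"
    by (subst sum.Sigma) auto
  also have "\<dots> = (\<Sum>(x, y)\<in>(SIGMA x:splits b. splits (snd x)). f (fst x) * (g (fst y) * h (snd y)))"
    by (rule sum.reindex_bij_witness[of _ "\<lambda>((w, u), (v, t)). ((w + v, t), (w, v))" "\<lambda>((w, u), (v, t)). ((v, t + u), (t, u))"])
      (auto simp: splits_def add.assoc)
  also have "\<dots> = (\<Sum>x\<in>splits b. \<Sum>y\<in>splits (snd x). f (fst x) * (g (fst y) * h (snd y)))"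
    by (subst sum.Sigma) auto
  also have "\<dots> = conv f (conv g h) b"
    by (simp add: conv_def case_prod_beta sum_distrib_left)
  finally show ?thesis .
qed

lemma conv_cong:
  assumes "\<And>w. f w = f' w" "\<And>w. g w = g' w"
  shows "conv f g b = conv f' g' b"
  using assms by (simp add: conv_def)

lemma conv_diff_left: "conv (\<lambda>a. f a - f' a) g b = conv f g b - conv f' g b"
  by (simp add: conv_def case_prod_beta left_diff_distrib sum_subtractf)

lemma conv_unit: "conv (\<lambda>b. if b = 0 then 1 else 0) f b = f b"
proof -
  have "conv (\<lambda>b. if b = 0 then 1 else 0) f b = (\<Sum>x\<in>splits b. if x = (0, b) then f b else 0)"
    unfolding conv_def by (intro sum.cong) (auto simp: splits_def split: if_splits)
  also have "\<dots> = f b" by (subst sum.delta[OF finite_splits]) (simp add: splits_def)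
  finally show ?thesis .
qed

lemma conv_unit_minus: "conv (unit_minus f) g b = g b - conv f g b"
  unfolding unit_minus_def[abs_def] conv_diff_left conv_unit ..

lemma conv_zero:
  fixes f g :: "nat ^ 'n \<Rightarrow> real"
  shows "conv f g 0 = f 0 * g 0"
proof -
  have "splits (0 :: nat ^ 'n) = {(0, 0)}" by (auto simp: splits_def multi_index_add_eq_0)
  then show ?thesis by (simp add: conv_def)
qed

definition proper_splits :: "nat ^ 'n \<Rightarrow> ((nat ^ 'n) \<times> (nat ^ 'n)) set" where
  "proper_splits b = {(w, u). w + u = b \<and> w \<noteq> 0 \<and> u \<noteq> 0}"

lemma proper_splits_subset: "proper_splits b \<subseteq> splits b"
  by (auto simp: proper_splits_def splits_def)

lemma finite_proper_splits [simp]: "finite (proper_splits b)"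
  using proper_splits_subset finite_splits by (rule finite_subset)

lemma conv_left:
  "conv f g b = f 0 * g b + (\<Sum>(w, u)\<in>{(w, u). w + u = b \<and> w \<noteq> 0}. f w * g u)"
proof -
  have eq: "splits b = insert (0, b) {(w, u). w + u = b \<and> w \<noteq> 0}" by (auto simp: splits_def)
  have "finite {(w, u). w + u = b \<and> w \<noteq> 0}"
    by (rule finite_subset[OF _ finite_splits[of b]]) (auto simp: splits_def)
  then show ?thesis unfolding conv_def eq by (subst sum.insert) auto
qed

lemma conv_ends:
  assumes "b \<noteq> 0"
  shows "conv f g b = f 0 * g b + f b * g 0 + (\<Sum>(w, u)\<in>proper_splits b. f w * g u)"
proof -
  have eq: "splits b = insert (0, b) (insert (b, 0) (proper_splits b))"
    by (auto simp: splits_def proper_splits_def)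
  have "(0, b) \<notin> insert (b, 0) (proper_splits b)" "(b, 0) \<notin> proper_splits b"
    using assms by (auto simp: proper_splits_def)
  then show ?thesis unfolding conv_def eq by simp
qed

text \<open>The coefficients of \<open>t / (1 - p)\<close> when \<open>p\<close> has no constant term.\<close>

function deconv :: "(nat ^ 'n \<Rightarrow> real) \<Rightarrow> (nat ^ 'n \<Rightarrow> real) \<Rightarrow> nat ^ 'n \<Rightarrow> real" where
  "deconv p t b = t b + (\<Sum>(w, u)\<in>{(w, u). w + u = b \<and> w \<noteq> 0}. p w * deconv p t u)"
  by auto
termination
  by (relation "Wellfounded.measure (\<lambda>(p, t, b). mdeg b)")
    (auto simp: mdeg_add mdeg_eq_0_iff intro!: Nat.gr0I)

declare deconv.simps [simp del]

lemma conv_deconv: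
  assumes "p 0 = 0"
  shows "conv (unit_minus p) (deconv p t) b = t b"
  unfolding conv_unit_minus by (subst deconv.simps) (simp add: conv_left assms)

lemma mdeg_less_left: "w + u = b \<Longrightarrow> u \<noteq> 0 \<Longrightarrow> mdeg w < mdeg b"
  using mdeg_eq_0_iff[of u] by (auto simp: mdeg_add)

lemma mdeg_less_right: "w + u = b \<Longrightarrow> w \<noteq> 0 \<Longrightarrow> mdeg u < mdeg b"
  using mdeg_eq_0_iff[of w] by (auto simp: mdeg_add)

lemma master_certificate_0 [simp]: "master_certificate c 0 = 0"
  by (subst master_certificate.simps) simp

lemma proper_splits_axis: "proper_splits (axis j 1 :: nat ^ 'n) = {}"
proof -
  have *: "mdeg (axis j 1 :: nat ^ 'n) = 1" by (simp add: mdeg_def axis_def)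
  have False if "w + u = axis j 1" "w \<noteq> 0" "u \<noteq> 0" for w u :: "nat ^ 'n"
    using that mdeg_add[of w u] mdeg_eq_0_iff[of w] mdeg_eq_0_iff[of u] * by (cases "mdeg w"; cases "mdeg u") auto
  then show ?thesis by (auto simp: proper_splits_def)
qed

text \<open>The case of degree one in the recursion is the general one, as there are no proper splittings
  of a unit vector.\<close>

lemma master_certificate_eq:
  assumes "\<And>b. 0 \<le> c b" "b \<noteq> 0"
  shows "master_certificate c b = max 0 (c b - (\<Sum>(w, u)\<in>proper_splits b. master_certificate c w * c u))"
proof (cases "\<exists>j. b = axis j 1")
  case True
  then have "proper_splits b = {}" using proper_splits_axis by auto
  then show ?thesis using True assms(2) assms(1)[of b] by (subst master_certificate.simps) auto
next
  case False
  then show ?thesis using assms(2) by (subst master_certificate.simps) (simp add: proper_splits_def)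
qed

lemma master_certificate_nonneg:
  assumes "\<And>b. 0 \<le> c b"
  shows "0 \<le> master_certificate c b"
  using master_certificate_eq[OF assms, of b] by (cases "b = 0") auto

text \<open>At every nonzero \<open>b\<close> either the recursion is solved exactly or the coefficient of
  \<open>\<theta>\<close> is cut off at zero.\<close>

lemma conv_master_certificate:
  assumes "\<And>b. 0 \<le> c b" "c 0 = 1" "b \<noteq> 0"
  shows "c b \<le> conv (master_certificate c) c b"
    and "master_certificate c b \<noteq> 0 \<Longrightarrow> c b = conv (master_certificate c) c b"
  using master_certificate_eq[OF assms(1,3)] conv_ends[OF assms(3), of "master_certificate c" c] assms(2)
  by (auto simp: max_def split: if_splits)

text \<open>Set \<open>D = (1 - \<theta>) / (1 - p)\<close>. Then \<open>(1 - \<theta>) l = D (1 - p)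
  l\<close>, and \<open>(1 - p) l\<close> has nonnegative coefficients, so it remains to see
  that \<open>D\<close> has, by induction. Where \<open>\<theta>\<^sub>b = 0\<close>, the
  coefficient \<open>D\<^sub>b\<close> is given by nonnegative terms in \<open>D = (1 -
  \<theta>) + p D\<close>. Where \<open>\<theta>\<^sub>b \<noteq> 0\<close>, the recursion gives
  \<open>((1 - \<theta>) k)\<^sub>b = 0\<close>, that is \<open>(D q)\<^sub>b = 0\<close> for
  \<open>q = (1 - p) k\<close>, and the coefficients of \<open>q\<close> are nonpositive except
  \<open>q\<^sub>0 = 1\<close>.

  The set \<open>\<Lambda>\<close> will consist of the indices below \<open>b\<close>: the limit
  argument that supplies \<open>p\<close> works on finite sets of indices.\<close>

theorem master_certificate_minimal:
  fixes k l p :: "nat ^ 'n \<Rightarrow> real"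
  assumes k: "\<And>b. 0 \<le> k b" "k 0 = 1"
    and l0: "0 \<le> l 0"
    and lower: "\<And>w u. w + u \<in> \<Lambda> \<Longrightarrow> w \<in> \<Lambda>"
    and p: "\<And>b. 0 \<le> p b" "p 0 = 0"
    and pk: "\<And>b. b \<in> \<Lambda> \<Longrightarrow> b \<noteq> 0 \<Longrightarrow> k b \<le> conv p k b"
    and pl: "\<And>b. b \<in> \<Lambda> \<Longrightarrow> b \<noteq> 0 \<Longrightarrow> conv p l b \<le> l b"
    and b: "b \<in> \<Lambda>"
  shows "0 \<le> conv (unit_minus (master_certificate k)) l b"
proof -
  define \<theta> where "\<theta> = master_certificate k"
  define D where "D = deconv p (unit_minus \<theta>)"
  define q where "q = conv (unit_minus p) k"
  have \<theta>0: "\<theta> 0 = 0" by (simp add: \<theta>_def)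
  have D: "conv (unit_minus p) D c = unit_minus \<theta> c" for c
    unfolding D_def by (rule conv_deconv[of p, OF p(2)])
  have Dq: "conv D q c = k c - conv \<theta> k c" for c
  proof -
    have "conv D q c = conv (conv D (unit_minus p)) k c" unfolding q_def by (rule conv_assoc[symmetric])
    also have "\<dots> = conv (unit_minus \<theta>) k c" using D conv_comm[of D] by (intro conv_cong) auto
    finally show ?thesis by (simp add: conv_unit_minus)
  qed
  have q: "q 0 = 1" "\<And>b. b \<in> \<Lambda> \<Longrightarrow> b \<noteq> 0 \<Longrightarrow> q b \<le> 0"
    using pk k p by (auto simp: q_def conv_unit_minus) (simp add: conv_zero)
  have D0: "D 0 = 1" using D[of 0] p(2) \<theta>0 by (simp add: conv_zero unit_minus_def)
  have lower': "w \<in> \<Lambda>" "u \<in> \<Lambda>" if "w + u = c" "c \<in> \<Lambda>" for w u c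
    using lower[of w u] lower[of u w] that by (auto simp: add.commute)
  have Dpos: "0 \<le> D c" if "c \<in> \<Lambda>" for c
    using that
  proof (induction "mdeg c" arbitrary: c rule: less_induct)
    case less
    show ?case
    proof (cases "c = 0")
      case True
      then show ?thesis using D0 by simp
    next
      case False
      show ?thesis
      proof (cases "\<theta> c = 0")
        case True
        have "D c = unit_minus \<theta> c + (\<Sum>(w, u)\<in>{(w, u). w + u = c \<and> w \<noteq> 0}. p w * D u)"
          unfolding D_def by (rule deconv.simps)
        moreover have "unit_minus \<theta> c = 0" using True False by (simp add: unit_minus_def)
        moreover have "0 \<le> (\<Sum>(w, u)\<in>{(w, u). w + u = c \<and> w \<noteq> 0}. p w * D u)"
        proof (rule sum_nonneg)
          fix x assume "x \<in> {(w, u). w + u = c \<and> w \<noteq> 0}"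
          then obtain w u where x: "x = (w, u)" "w + u = c" "w \<noteq> 0" by auto
          have "0 \<le> D u" using less.hyps mdeg_less_right[OF x(2,3)] lower'[OF x(2) less.prems] by blast
          then show "0 \<le> (case x of (w, u) \<Rightarrow> p w * D u)" using p(1)[of w] by (simp add: x)
        qed
        ultimately show ?thesis by simp
      next
        case nz: False
        have "conv D q c = 0"
          unfolding Dq using conv_master_certificate(2)[of k, OF k False] nz by (simp add: \<theta>_def)
        then have "D c = - q c - (\<Sum>(w, u)\<in>proper_splits c. D w * q u)"
          using conv_ends[OF False, of D q] D0 q(1) by simp
        moreover have "(\<Sum>(w, u)\<in>proper_splits c. D w * q u) \<le> 0"
        proof (rule sum_nonpos)
          fix x assume "x \<in> proper_splits c"
          then obtain w u where x: "x = (w, u)" "w + u = c" "w \<noteq> 0" "u \<noteq> 0" by (auto simp: proper_splits_def)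
          have "0 \<le> D w" using less.hyps mdeg_less_left[OF x(2,4)] lower'[OF x(2) less.prems] by blast
          moreover have "q u \<le> 0" using q(2) lower'[OF x(2) less.prems] x(4) by blast
          ultimately show "(case x of (w, u) \<Rightarrow> D w * q u) \<le> 0" by (simp add: x mult_nonneg_nonpos)
        qed
        moreover have "q c \<le> 0" using q(2) less.prems False by blast
        ultimately show ?thesis by simp
      qed
    qed
  qed
  define e where "e = conv (unit_minus p) l"
  have e: "0 \<le> e c" if "c \<in> \<Lambda>" for c
    using pl[OF that] l0 p(2) by (cases "c = 0") (auto simp: e_def conv_unit_minus, auto simp: conv_zero)
  have "conv (unit_minus \<theta>) l b = conv (conv D (unit_minus p)) l b"
    using D conv_comm[of D] by (intro conv_cong) auto
  also have "\<dots> = conv D e b" unfolding e_def by (rule conv_assoc)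
  also have "0 \<le> conv D e b"
    unfolding conv_def
  proof (rule sum_nonneg)
    fix x assume "x \<in> splits b"
    then obtain w u where x: "x = (w, u)" "w + u = b" by (auto simp: splits_def)
    have "0 \<le> D w" "0 \<le> e u" using Dpos e lower'[OF x(2) b] by blast+
    then show "0 \<le> (case x of (w, u) \<Rightarrow> D w * e u)" by (simp add: x)
  qed
  finally show ?thesis by (simp add: \<theta>_def)
qed

section \<open>Fourier analysis on finite tori\<close>

lemma monom_eval_0 [simp]: "monom_eval z 0 = 1"
  by (simp add: monom_eval_def)

lemma monom_eval_add: "monom_eval z (a + b) = monom_eval z a * monom_eval z b"
  by (simp add: monom_eval_def power_add prod.distrib)

lemma norm_monom_eval: "cmod (monom_eval z a) = monom_eval (abs_vec z) a"
  by (simp add: monom_eval_def abs_vec_def norm_power flip: prod_norm)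

lemma monom_eval_nonneg: "(\<And>j. 0 \<le> x $ j) \<Longrightarrow> 0 \<le> (monom_eval x a :: real)"
  unfolding monom_eval_def by (intro prod_nonneg) auto

lemma monom_eval_abs_nonneg [simp]: "0 \<le> monom_eval (abs_vec z) a"
  by (rule monom_eval_nonneg) (simp add: abs_vec_def)

lemma monom_eval_mono:
  "(\<And>j. 0 \<le> x $ j) \<Longrightarrow> (\<And>j. x $ j \<le> y $ j) \<Longrightarrow> monom_eval x a \<le> (monom_eval y a :: real)"
  unfolding monom_eval_def by (intro prod_mono) (auto intro: power_mono)

lemma monom_eval_mult_cnj: "monom_eval (mult_cnj z w) a = monom_eval z a * cnj (monom_eval w a)"
  by (simp add: monom_eval_def mult_cnj_def power_mult_distrib prod.distrib)

lemma has_sum_finite_sum: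
  fixes f :: "'a \<Rightarrow> 'i \<Rightarrow> 'b :: topological_comm_monoid_add"
  assumes "\<And>i. i \<in> I \<Longrightarrow> ((\<lambda>x. f x i) has_sum s i) A"
  shows "((\<lambda>x. \<Sum>i\<in>I. f x i) has_sum (\<Sum>i\<in>I. s i)) A"
  using assms
  by (induction I rule: infinite_finite_induct) (auto intro: has_sum_add)


lemma cis_sum: "cis (\<Sum>j\<in>A. f j) = (\<Prod>j\<in>A. cis (f j))"
  by (induction A rule: infinite_finite_induct) (simp_all add: cis_mult [symmetric])

text \<open>The character with index \<open>c\<close>, at the point whose components are the
  \<open>m\<close>-th roots of unity with exponents \<open>i\<close>. Integer indices
  \<open>c\<close> are needed for differences of multi-indices.\<close>

definition torus_char :: "nat \<Rightarrow> int ^ 'n \<Rightarrow> ('n \<Rightarrow> nat) \<Rightarrow> complex" where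
  "torus_char m c i = cis (2 * pi * (\<Sum>j\<in>UNIV. real_of_int (c $ j) * real (i j)) / real m)"

definition torus_grid :: "nat \<Rightarrow> ('n::finite \<Rightarrow> nat) set" where
  "torus_grid m = PiE UNIV (\<lambda>_. {..<m})"

definition of_multi_index :: "nat ^ 'n \<Rightarrow> int ^ 'n" where
  "of_multi_index a = (\<chi> j. int (a $ j))"

text \<open>Fourier coefficients of the constant function one on the grid: aliasing identifies indices
  modulo \<open>m\<close>.\<close>

definition divides_all :: "nat \<Rightarrow> int ^ 'n \<Rightarrow> real" where
  "divides_all m c = (if \<forall>j. int m dvd c $ j then 1 else 0)"

lemma finite_torus_grid [simp]: "finite (torus_grid m)"
  unfolding torus_grid_def by (intro finite_PiE) auto

lemma torus_char_minus: "torus_char m (c - d) i = torus_char m c i * cnj (torus_char m d i)"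
  by (simp add: torus_char_def cis_mult cis_cnj left_diff_distrib sum_subtractf ring_distribs diff_divide_distrib)

lemma sum_roots_of_unity:
  assumes "m \<ge> 1"
  shows "(\<Sum>t<m. cis (2 * pi * (real_of_int c * real t) / real m)) = (if int m dvd c then of_nat m else 0)"
proof -
  define w where "w = cis (2 * pi * real_of_int c / real m)"
  have pw: "cis (2 * pi * (real_of_int c * real t) / real m) = w ^ t" for t
    unfolding w_def by (simp only: Complex.DeMoivre) (rule arg_cong[of _ _ cis], simp add: mult_ac)
  have w1: "w = 1 \<longleftrightarrow> int m dvd c"
  proof -
    have "w = 1 \<longleftrightarrow> (\<exists>n. 2 * pi * real_of_int c / real m = of_int n * (2 * pi))"
      unfolding w_def cis_eq_1_iff ..
    also have "\<dots> \<longleftrightarrow> (\<exists>n. real_of_int c = real_of_int (int m * n))"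
      using assms by (simp add: field_simps)
    also have "\<dots> \<longleftrightarrow> int m dvd c" unfolding of_int_eq_iff dvd_def ..
    finally show ?thesis .
  qed
  have wm: "w ^ m = 1" unfolding w_def Complex.DeMoivre using assms by (simp add: cis_multiple_2pi)
  show ?thesis
  proof (cases "w = 1")
    case True
    then show ?thesis unfolding pw using w1 by simp
  next
    case False
    then have "(\<Sum>t<m. w ^ t) = 0" using wm by (simp add: geometric_sum)
    then show ?thesis unfolding pw using w1 False by simp
  qed
qed

lemma sum_torus_char:
  assumes "m \<ge> 1"
  shows "(\<Sum>i\<in>torus_grid m. torus_char m c i) = of_real (real m ^ CARD('n) * divides_all m (c :: int ^ 'n))"
proof -
  have "torus_char m c i = (\<Prod>j\<in>UNIV. cis (2 * pi * (real_of_int (c $ j) * real (i j)) / real m))" for i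
    unfolding torus_char_def sum_distrib_left sum_divide_distrib cis_sum ..
  then have "(\<Sum>i\<in>torus_grid m. torus_char m c i) = (\<Sum>i\<in>PiE UNIV (\<lambda>_. {..<m}). \<Prod>j\<in>UNIV. cis (2 * pi * (real_of_int (c $ j) * real (i j)) / real m))"
    by (simp add: torus_grid_def)
  also have "\<dots> = (\<Prod>j\<in>UNIV. \<Sum>t<m. cis (2 * pi * (real_of_int (c $ j) * real t) / real m))"
    by (subst prod_sum_PiE) auto
  also have "\<dots> = (\<Prod>j\<in>UNIV. if int m dvd c $ j then of_nat m else 0)"
    unfolding sum_roots_of_unity[OF assms] ..
  also have "\<dots> = of_real (real m ^ CARD('n) * divides_all m c)"
    by (auto simp: divides_all_def)
  finally show ?thesis .
qed

definition grid_point :: "real \<Rightarrow> nat \<Rightarrow> ('n \<Rightarrow> nat) \<Rightarrow> complex ^ 'n" where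
  "grid_point r m i = (\<chi> j. of_real r * cis (2 * pi * real (i j) / real m))"

lemma monom_eval_grid_point:
  "monom_eval (grid_point r m i) a = of_real (r ^ mdeg a) * torus_char m (of_multi_index a) i"
proof -
  have "torus_char m (of_multi_index a) i = (\<Prod>j\<in>UNIV. cis (2 * pi * real (i j) / real m) ^ (a $ j))"
    unfolding torus_char_def of_multi_index_def sum_distrib_left sum_divide_distrib cis_sum
    by (intro prod.cong refl, simp only: Complex.DeMoivre) (rule arg_cong[of _ _ cis], simp add: mult_ac)
  then show ?thesis
    by (simp add: monom_eval_def grid_point_def power_mult_distrib prod.distrib mdeg_def power_sum)
qed

text \<open>On the level of Fourier coefficients multiplication by the kernel of the series is
  convolution.\<close>

lemma kform_torus_series:
  assumes "\<And>i i'. i \<in> torus_grid m \<Longrightarrow> i' \<in> torus_grid m \<Longrightarrow>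
    ((\<lambda>a. of_real (F a) * torus_char m (of_multi_index a) i * cnj (torus_char m (of_multi_index a) i')) has_sum f i i') UNIV"
  shows "((\<lambda>a. of_real (F a) * kform (torus_grid m) q (torus_char m (c - of_multi_index a)))
     has_sum kform (torus_grid m) (\<lambda>i i'. q i i' * f i i') (torus_char m c)) UNIV"
proof -
  have "((\<lambda>a. \<Sum>i\<in>torus_grid m. \<Sum>i'\<in>torus_grid m. cnj (torus_char m c i) * torus_char m c i' * q i i' *
        (of_real (F a) * torus_char m (of_multi_index a) i * cnj (torus_char m (of_multi_index a) i')))
     has_sum (\<Sum>i\<in>torus_grid m. \<Sum>i'\<in>torus_grid m. cnj (torus_char m c i) * torus_char m c i' * q i i' * f i i')) UNIV"
    by (intro has_sum_finite_sum has_sum_cmult_right assms)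
  moreover have "(\<Sum>i\<in>torus_grid m. \<Sum>i'\<in>torus_grid m. cnj (torus_char m c i) * torus_char m c i' * q i i' *
        (of_real (F a) * torus_char m (of_multi_index a) i * cnj (torus_char m (of_multi_index a) i')))
     = of_real (F a) * kform (torus_grid m) q (torus_char m (c - of_multi_index a))" for a
    by (simp add: kform_def torus_char_minus sum_distrib_left mult_ac)
  ultimately show ?thesis by (simp add: kform_def mult_ac)
qed

lemma kform_one_torus:
  assumes "m \<ge> 1"
  shows "kform (torus_grid m) (\<lambda>_ _. 1) (torus_char m (c :: int ^ 'n)) = of_real ((real m ^ CARD('n))\<^sup>2 * divides_all m c)"
  unfolding kform_one sum_torus_char[OF assms] norm_of_real by (simp add: divides_all_def)

text \<open>Evaluating the three positive kernels on a character \<open>c\<close> gives inequalities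
  between Fourier coefficients; \<open>P c\<close> is that of \<open>p\<close>. The terms with
  \<open>divides_all\<close> are the aliased coefficients of \<open>l\<close>, \<open>k\<close>
  and \<open>1\<close>.\<close>

lemma grid_certificate:
  fixes K L :: "nat ^ 'n \<Rightarrow> real"
  assumes m: "m \<ge> 1"
    and k: "\<And>i i'. i \<in> torus_grid m \<Longrightarrow> i' \<in> torus_grid m \<Longrightarrow>
      ((\<lambda>a. of_real (K a) * torus_char m (of_multi_index a) i * cnj (torus_char m (of_multi_index a) i')) has_sum k i i') UNIV"
    and l: "\<And>i i'. i \<in> torus_grid m \<Longrightarrow> i' \<in> torus_grid m \<Longrightarrow>
      ((\<lambda>a. of_real (L a) * torus_char m (of_multi_index a) i * cnj (torus_char m (of_multi_index a) i')) has_sum l i i') UNIV"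
    and p: "is_kernel (torus_grid m) p"
    and pl: "is_kernel (torus_grid m) (\<lambda>i i'. l i i' - 1 - p i i' * l i i')"
    and pk: "is_kernel (torus_grid m) (\<lambda>i i'. p i i' * k i i' - (k i i' - 1))"
  shows "\<exists>P. \<forall>c. 0 \<le> P c \<and>
    (\<exists>u v. ((\<lambda>a. L a * P (c - of_multi_index a)) has_sum u) UNIV \<and>
       ((\<lambda>a. L a * divides_all m (c - of_multi_index a)) has_sum v) UNIV \<and> u \<le> v - divides_all m c) \<and>
    (\<exists>u v. ((\<lambda>a. K a * P (c - of_multi_index a)) has_sum u) UNIV \<and>
       ((\<lambda>a. K a * divides_all m (c - of_multi_index a)) has_sum v) UNIV \<and> v - divides_all m c \<le> u)"
proof -
  define M where "M = (real m ^ CARD('n))\<^sup>2"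
  have M: "M > 0" using m by (simp add: M_def)
  define P where "P = (\<lambda>c :: int ^ 'n. Re (kform (torus_grid m) p (torus_char m c)) / M)"
  have form0: "0 \<le> kform (torus_grid m) q v" if "is_kernel (torus_grid m) q" for q v
    using that by (intro is_kernelD[of "torus_grid m"]) auto
  have P: "kform (torus_grid m) p (torus_char m c) = of_real (M * P c)" "0 \<le> P c" for c
    using form0[OF p, of "torus_char m c"] M by (auto simp: P_def less_eq_complex_def complex_eq_iff)
  have ser: "((\<lambda>a. M * (F a * P (c - of_multi_index a))) has_sum Re (kform (torus_grid m) (\<lambda>i i'. p i i' * f i i') (torus_char m c))) UNIV"
      "((\<lambda>a. M * (F a * divides_all m (c - of_multi_index a))) has_sum Re (kform (torus_grid m) f (torus_char m c))) UNIV"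
    if "\<And>i i'. i \<in> torus_grid m \<Longrightarrow> i' \<in> torus_grid m \<Longrightarrow>
      ((\<lambda>a. of_real (F a) * torus_char m (of_multi_index a) i * cnj (torus_char m (of_multi_index a) i')) has_sum f i i') UNIV"
    for F f and c :: "int ^ 'n"
    using has_sum_Re[OF kform_torus_series[OF that, of p c]] has_sum_Re[OF kform_torus_series[OF that, of "\<lambda>_ _. 1" c]]
    by (simp_all add: P kform_one_torus[OF m] M_def mult_ac)
  have ser': "((\<lambda>a. F a * P (c - of_multi_index a)) has_sum Re (kform (torus_grid m) (\<lambda>i i'. p i i' * f i i') (torus_char m c)) / M) UNIV"
      "((\<lambda>a. F a * divides_all m (c - of_multi_index a)) has_sum Re (kform (torus_grid m) f (torus_char m c)) / M) UNIV"
    if "\<And>i i'. i \<in> torus_grid m \<Longrightarrow> i' \<in> torus_grid m \<Longrightarrow>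
      ((\<lambda>a. of_real (F a) * torus_char m (of_multi_index a) i * cnj (torus_char m (of_multi_index a) i')) has_sum f i i') UNIV"
    for F f and c :: "int ^ 'n"
    using has_sum_cmult_right[OF ser(1)[OF that, of c], of "1 / M"] has_sum_cmult_right[OF ser(2)[OF that, of c], of "1 / M"] M
    by simp_all
  have one: "Re (kform (torus_grid m) (\<lambda>_ _. 1) (torus_char m c)) / M = divides_all m c" for c :: "int ^ 'n"
    unfolding kform_one_torus[OF m] M_def using m by simp
  have ineq1: "Re (kform (torus_grid m) (\<lambda>i i'. p i i' * l i i') (torus_char m c)) / M
      \<le> Re (kform (torus_grid m) l (torus_char m c)) / M - divides_all m c" for c
    using form0[OF pl, of "torus_char m c"] M unfolding kform_diff one[symmetric] diff_divide_distrib[symmetric]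
    by (intro divide_right_mono) (auto simp: less_eq_complex_def)
  have ineq2: "Re (kform (torus_grid m) k (torus_char m c)) / M - divides_all m c
      \<le> Re (kform (torus_grid m) (\<lambda>i i'. p i i' * k i i') (torus_char m c)) / M" for c
    using form0[OF pk, of "torus_char m c"] M unfolding kform_diff one[symmetric] diff_divide_distrib[symmetric]
    by (intro divide_right_mono) (auto simp: less_eq_complex_def)
  show ?thesis
    by (rule exI[of _ P]) (use P(2) ser'[OF l] ser'[OF k] ineq1 ineq2 in blast)
qed

text \<open>Tails are controlled uniformly in the bounded factor, which is what allows limits under the
  sum below.\<close>

lemma has_sum_tail_bound:
  fixes F g :: "'a \<Rightarrow> real"
  assumes F: "(F has_sum S) UNIV" "\<And>a. 0 \<le> F a"
    and g: "\<And>a. 0 \<le> g a" "\<And>a. g a \<le> C" and s: "((\<lambda>a. F a * g a) has_sum s) UNIV"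
    and A: "finite A" "S - e \<le> sum F A"
  shows "s \<le> (\<Sum>a\<in>A. F a * g a) + C * e"
  using s
proof (rule has_sum_le_finite_sums)
  fix B :: "'a set" assume B: "finite B"
  have C: "0 \<le> C" using g order_trans by blast
  have "(\<Sum>a\<in>B. F a * g a) \<le> (\<Sum>a\<in>A \<union> B. F a * g a)"
    using A B F(2) g by (intro sum_mono2) auto
  also have "\<dots> = (\<Sum>a\<in>A. F a * g a) + (\<Sum>a\<in>B - A. F a * g a)"
    using A B by (subst sum.union_disjoint[symmetric]) (auto intro: arg_cong[of _ _ "sum _"])
  also have "(\<Sum>a\<in>B - A. F a * g a) \<le> (\<Sum>a\<in>B - A. F a * C)"
    using F(2) g by (intro sum_mono mult_left_mono) auto
  also have "\<dots> = C * (\<Sum>a\<in>B - A. F a)" by (simp add: sum_distrib_left mult.commute)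
  also have "(\<Sum>a\<in>B - A. F a) \<le> e"
  proof -
    have "(\<Sum>a\<in>A. F a) + (\<Sum>a\<in>B - A. F a) = (\<Sum>a\<in>A \<union> B. F a)"
      using A B by (subst sum.union_disjoint[symmetric]) (auto intro: arg_cong[of _ _ "sum _"])
    also have "\<dots> \<le> S" using F A B by (intro finite_sum_le_has_sum[OF F(1)]) auto
    finally show ?thesis using A(2) by linarith
  qed
  finally show "(\<Sum>a\<in>B. F a * g a) \<le> (\<Sum>a\<in>A. F a * g a) + C * e"
    using C by (simp add: mult_left_mono)
qed

lemma has_sum_finite_tail:
  fixes F :: "'a \<Rightarrow> real"
  assumes F: "(F has_sum S) UNIV" "\<And>a. 0 \<le> F a" and e: "0 < e" and B: "finite B"
  obtains A where "finite A" "B \<subseteq> A" "S - e \<le> sum F A"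
proof -
  obtain A where A: "finite A" "dist (sum F A) S \<le> e"
    using has_sum_finite_approximation[OF F(1) e] by auto
  have "sum F A \<le> sum F (A \<union> B)" using A B F(2) by (intro sum_mono2) auto
  then show ?thesis using A B by (intro that[of "A \<union> B"]) (auto simp: dist_real_def)
qed

lemma of_multi_index_inj: "of_multi_index a = of_multi_index b \<longleftrightarrow> a = b"
  by (simp add: of_multi_index_def Finite_Cartesian_Product.vec_eq_iff)

lemma of_multi_index_add: "of_multi_index (a + b) = of_multi_index a + of_multi_index b"
  by (simp add: of_multi_index_def Finite_Cartesian_Product.vec_eq_iff)

lemma of_multi_index_0 [simp]: "of_multi_index 0 = 0"
  by (simp add: of_multi_index_def Finite_Cartesian_Product.vec_eq_iff)

lemma divides_all_eventually:
  fixes c :: "int ^ 'n"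
  assumes "c \<noteq> 0"
  shows "\<forall>\<^sub>F m in sequentially. divides_all m c = 0"
proof -
  obtain j where j: "c $ j \<noteq> 0" using assms by (metis Finite_Cartesian_Product.vec_eq_iff zero_index)
  have "divides_all m c = 0" if "m \<ge> Suc (nat \<bar>c $ j\<bar>)" for m
  proof -
    have "\<not> int m dvd c $ j" using that j dvd_imp_le_int[of "c $ j" "int m"] by auto
    then show ?thesis by (auto simp: divides_all_def)
  qed
  then show ?thesis using eventually_sequentially by blast
qed

section \<open>From certificates to coefficients\<close>

lemma inj_on_snd_splits: "inj_on snd (splits b)"
  by (auto simp: inj_on_def splits_def)

lemma conv_eq_sum_snd:
  assumes "\<And>w u. w + u = b \<Longrightarrow> f u = p w"
  shows "conv p L b = (\<Sum>a\<in>snd ` splits b. L a * f a)"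
  unfolding sum.reindex[OF inj_on_snd_splits] conv_def
  by (intro sum.cong refl) (use assms in \<open>auto simp: splits_def\<close>)

text \<open>As \<open>m\<close> grows, the aliased terms disappear. The inequality for \<open>L\<close>
  bounds \<open>P\<^sub>m\<close> uniformly and shows that it tends to zero at \<open>0\<close>
  and at indices with a negative component, since there the right hand side tends to zero. A
  subsequence converges on \<open>\<Lambda>\<close>, and only the splittings of \<open>b\<close>
  survive in the sums.\<close>

lemma limit_certificate:
  fixes K L :: "nat ^ 'n \<Rightarrow> real"
  assumes K: "(K has_sum SK) UNIV" "\<And>a. 0 \<le> K a"
    and L: "(L has_sum SL) UNIV" "\<And>a. 0 \<le> L a" "L 0 = 1"
    and cert: "\<And>m. m \<ge> 1 \<Longrightarrow> \<exists>P. \<forall>c. 0 \<le> P c \<and>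
    (\<exists>u v. ((\<lambda>a. L a * P (c - of_multi_index a)) has_sum u) UNIV \<and>
       ((\<lambda>a. L a * divides_all m (c - of_multi_index a)) has_sum v) UNIV \<and> u \<le> v - divides_all m c) \<and>
    (\<exists>u v. ((\<lambda>a. K a * P (c - of_multi_index a)) has_sum u) UNIV \<and>
       ((\<lambda>a. K a * divides_all m (c - of_multi_index a)) has_sum v) UNIV \<and> v - divides_all m c \<le> u)"
    and \<Lambda>: "finite \<Lambda>" "\<And>w u. w + u \<in> \<Lambda> \<Longrightarrow> w \<in> \<Lambda>"
  shows "\<exists>p. (\<forall>b. 0 \<le> p b) \<and> p 0 = 0 \<and> (\<forall>b\<in>\<Lambda>. b \<noteq> 0 \<longrightarrow> conv p L b \<le> L b \<and> K b \<le> conv p K b)"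
proof -
  define D where "D = (\<lambda>m. divides_all (Suc m) :: int ^ 'n \<Rightarrow> real)"
  define lower where "lower = (\<lambda>m P c. \<exists>u v. ((\<lambda>a. L a * P (c - of_multi_index a)) has_sum u) UNIV \<and>
       ((\<lambda>a. L a * D m (c - of_multi_index a)) has_sum v) UNIV \<and> u \<le> v - D m c)"
  define upper where "upper = (\<lambda>m P c. \<exists>u v. ((\<lambda>a. K a * P (c - of_multi_index a)) has_sum u) UNIV \<and>
       ((\<lambda>a. K a * D m (c - of_multi_index a)) has_sum v) UNIV \<and> v - D m c \<le> u)"
  have "\<exists>P. \<forall>c. 0 \<le> P c \<and> lower m P c \<and> upper m P c" for m
    using cert[of "Suc m"] by (simp add: D_def lower_def upper_def)
  then have "\<forall>m. \<exists>P. \<forall>c. 0 \<le> P c \<and> lower m P c \<and> upper m P c" ..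
  from choice[OF this] obtain P where P0: "\<forall>m c. 0 \<le> P m c \<and> lower m (P m) c \<and> upper m (P m) c" ..
  then have P: "0 \<le> P m c" "lower m (P m) c" "upper m (P m) c" for m c by blast+
  define U where "U = (\<lambda>m c. infsum (\<lambda>a. L a * P m (c - of_multi_index a)) UNIV)"
  define V where "V = (\<lambda>m c. infsum (\<lambda>a. L a * D m (c - of_multi_index a)) UNIV)"
  define U' where "U' = (\<lambda>m c. infsum (\<lambda>a. K a * P m (c - of_multi_index a)) UNIV)"
  define V' where "V' = (\<lambda>m c. infsum (\<lambda>a. K a * D m (c - of_multi_index a)) UNIV)"
  have UV: "((\<lambda>a. L a * P m (c - of_multi_index a)) has_sum U m c) UNIV"
    "((\<lambda>a. L a * D m (c - of_multi_index a)) has_sum V m c) UNIV" "U m c \<le> V m c - D m c" for m c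
    using P(2)[of m c] unfolding lower_def U_def V_def by (auto simp: infsumI)
  have UV': "((\<lambda>a. K a * P m (c - of_multi_index a)) has_sum U' m c) UNIV"
    "((\<lambda>a. K a * D m (c - of_multi_index a)) has_sum V' m c) UNIV" "V' m c - D m c \<le> U' m c" for m c
    using P(3)[of m c] unfolding upper_def U'_def V'_def by (auto simp: infsumI)
  have D01: "0 \<le> D m c" "D m c \<le> 1" "D m 0 = 1" for m c by (auto simp: D_def divides_all_def)
  have Dev: "\<forall>\<^sub>F m in sequentially. D m c = 0" if "c \<noteq> 0" for c
    using divides_all_eventually[OF that] unfolding D_def by (subst eventually_sequentially_Suc)
  have PU: "P m c \<le> U m c" for m c
    using finite_sum_le_has_sum[OF UV(1)[of m c], of "{0}"] L P(1) by simp
  have VS: "V m c \<le> SL" for m c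
    using L D01 by (intro has_sum_mono[OF UV(2) L(1)]) (simp add: mult_left_le)
  have PS: "P m c \<le> SL" for m c
    using PU[of m c] UV(3)[of m c] VS[of m c] D01(1)[of m c] by linarith
  have Vev: "\<forall>\<^sub>F m in sequentially. V m c \<le> (\<Sum>a\<in>A. if c = of_multi_index a then L a else 0) + e"
    if A: "finite A" "SL - e \<le> sum L A" for c A e
  proof -
    have "\<forall>\<^sub>F m in sequentially. \<forall>a\<in>A. c \<noteq> of_multi_index a \<longrightarrow> D m (c - of_multi_index a) = 0"
      unfolding eventually_ball_finite_distrib[OF A(1)] using Dev by (auto intro: eventually_mono)
    then show ?thesis
    proof eventually_elim
      case (elim m)
      have "V m c \<le> (\<Sum>a\<in>A. L a * D m (c - of_multi_index a)) + 1 * e"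
        by (rule has_sum_tail_bound[OF L(1,2) D01(1,2) UV(2) A])
      also have "(\<Sum>a\<in>A. L a * D m (c - of_multi_index a)) = (\<Sum>a\<in>A. if c = of_multi_index a then L a else 0)"
        using elim D01(3) by (intro sum.cong refl) auto
      finally show ?case by simp
    qed
  qed
  have V1: "\<forall>\<^sub>F m in sequentially. V m (of_multi_index b) \<le> L b + e" if e: "0 < e" for b e
  proof -
    obtain A where A: "finite A" "{b} \<subseteq> A" "SL - e \<le> sum L A"
      using has_sum_finite_tail[OF L(1,2) e, of "{b}"] by auto
    then show ?thesis using Vev[OF A(1,3), of "of_multi_index b"] by (simp add: of_multi_index_inj)
  qed
  have V2: "\<forall>\<^sub>F m in sequentially. V m c \<le> e" if e: "0 < e" and c: "c \<notin> range of_multi_index" for c e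
  proof -
    obtain A where A: "finite A" "{} \<subseteq> A" "SL - e \<le> sum L A"
      using has_sum_finite_tail[OF L(1,2) e, of "{}"] by auto
    have "(\<Sum>a\<in>A. if c = of_multi_index a then L a else 0) = 0" using c by (intro sum.neutral) auto
    then show ?thesis using Vev[OF A(1,3), of c] by simp
  qed
  \<comment> \<open>The bound tends to \<open>L 0 - 1 = 0\<close> at \<open>0\<close>, and to zero at indices with a negative component.\<close>
  have P0: "(\<lambda>m. P m c) \<longlonglongrightarrow> 0" if c: "c \<notin> range of_multi_index \<or> c = 0" for c
  proof (rule LIMSEQ_I)
    fix e :: real assume "0 < e"
    then have e: "0 < e / 2" by simp
    have "\<forall>\<^sub>F m in sequentially. P m c \<le> e / 2"
    proof (cases "c = 0")
      case True
      from V1[OF e, of 0] show ?thesis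
      proof eventually_elim
        case (elim m)
        then show ?case using PU[of m c] UV(3)[of m c] D01(3)[of m] L(3) True by simp
      qed
    next
      case False
      then have "c \<notin> range of_multi_index" using c by blast
      from V2[OF e this] show ?thesis
      proof eventually_elim
        case (elim m)
        then show ?case using PU[of m c] UV(3)[of m c] D01(1)[of m c] by linarith
      qed
    qed
    then obtain N where "\<And>m. m \<ge> N \<Longrightarrow> P m c \<le> e / 2" unfolding eventually_sequentially by blast
    then have "\<And>m. m \<ge> N \<Longrightarrow> norm (P m c - 0) < e" using P(1) \<open>0 < e\<close> by fastforce
    then show "\<exists>N. \<forall>m\<ge>N. norm (P m c - 0) < e" by blast
  qed
  have "bounded (range (\<lambda>m. P m (of_multi_index b)))" for b :: "nat ^ 'n"
    using P(1) PS by (intro boundedI[of _ SL]) auto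
  then obtain r g where r: "strict_mono r" "\<forall>b\<in>\<Lambda>. (\<lambda>n. P (r n) (of_multi_index b)) \<longlonglongrightarrow> g b"
    using common_convergent_subsequence[OF \<Lambda>(1), of "\<lambda>m b. P m (of_multi_index b)"] by auto
  have sub: "(\<lambda>n. f (r n)) \<longlonglongrightarrow> x" if "f \<longlonglongrightarrow> x" for f and x :: real
    using LIMSEQ_subseq_LIMSEQ[OF that r(1)] by (simp add: o_def)
  have evsub: "\<forall>\<^sub>F n in sequentially. Q (r n)" if "\<forall>\<^sub>F m in sequentially. Q m" for Q
    using that r(1) by (rule eventually_subseq[rotated])
  define p where "p = (\<lambda>b. if b \<in> \<Lambda> then g b else 0)"
  have pl: "(\<lambda>n. P (r n) (of_multi_index b)) \<longlonglongrightarrow> p b" if "b \<in> \<Lambda>" for b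
    using r(2) that by (simp add: p_def)
  have p0: "0 \<le> p b" for b
  proof (cases "b \<in> \<Lambda>")
    case True
    then show ?thesis using LIMSEQ_le_const[OF pl[OF True]] P(1) by blast
  qed (simp add: p_def)
  have pz: "p 0 = 0"
  proof (cases "0 \<in> \<Lambda>")
    case True
    then show ?thesis using LIMSEQ_unique[OF pl[OF True]] sub[OF P0[of 0]] by simp
  qed (simp add: p_def)
  have lowers: "w \<in> \<Lambda>" "u \<in> \<Lambda>" if "w + u = b" "b \<in> \<Lambda>" for w u b
    using \<Lambda>(2)[of w u] \<Lambda>(2)[of u w] that by (auto simp: add.commute)
  have convlim: "(\<lambda>n. \<Sum>a\<in>snd ` splits b. F a * P (r n) (of_multi_index b - of_multi_index a)) \<longlonglongrightarrow> conv p F b"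
    if b: "b \<in> \<Lambda>" for F b
  proof -
    have "conv p F b = (\<Sum>a\<in>snd ` splits b. F a * p (SOME w. w + a = b))"
    proof (rule conv_eq_sum_snd)
      fix w u assume "w + u = b"
      then have "(SOME w. w + u = b) = w" by (intro some_equality) auto
      then show "p (SOME w. w + u = b) = p w" by simp
    qed
    moreover have "(\<lambda>n. \<Sum>a\<in>snd ` splits b. F a * P (r n) (of_multi_index b - of_multi_index a))
        \<longlonglongrightarrow> (\<Sum>a\<in>snd ` splits b. F a * p (SOME w. w + a = b))"
    proof (intro tendsto_sum tendsto_mult tendsto_const)
      fix a assume "a \<in> snd ` splits b"
      then obtain w where w: "w + a = b" by (auto simp: splits_def)
      then have "(SOME w. w + a = b) = w" by (intro some_equality) auto
      moreover have "of_multi_index b - of_multi_index a = of_multi_index w" using w by (auto simp: of_multi_index_add)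
      ultimately show "(\<lambda>n. P (r n) (of_multi_index b - of_multi_index a)) \<longlonglongrightarrow> p (SOME w. w + a = b)"
        using pl lowers[OF w b] by simp
    qed
    ultimately show ?thesis by simp
  qed
  have fs: "finite (snd ` splits b)" for b :: "nat ^ 'n" by simp
  have c1: "conv p L b \<le> L b" if b: "b \<in> \<Lambda>" "b \<noteq> 0" for b
  proof (rule field_le_epsilon)
    fix e :: real assume e: "0 < e"
    show "conv p L b \<le> L b + e"
    proof (rule tendsto_upperbound[OF convlim[OF b(1)]])
      from evsub[OF V1[OF e, of b]]
      show "\<forall>\<^sub>F n in sequentially. (\<Sum>a\<in>snd ` splits b. L a * P (r n) (of_multi_index b - of_multi_index a)) \<le> L b + e"
      proof eventually_elim
        case (elim n)
        have "(\<Sum>a\<in>snd ` splits b. L a * P (r n) (of_multi_index b - of_multi_index a)) \<le> U (r n) (of_multi_index b)"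
          using L P(1) by (intro finite_sum_le_has_sum[OF UV(1)] fs) auto
        then show ?case using UV(3)[of "r n" "of_multi_index b"] D01(1)[of "r n" "of_multi_index b"] elim by linarith
      qed
    qed simp
  qed
  have SL0: "0 \<le> SL" using PS[of 0 0] P(1)[of 0 0] by linarith
  have c2: "K b \<le> conv p K b" if b: "b \<in> \<Lambda>" "b \<noteq> 0" for b
  proof (rule field_le_epsilon)
    fix e0 :: real assume e0: "0 < e0"
    \<comment> \<open>The factors \<open>P\<close> are bounded by \<open>SL\<close>, so this is the tail that they may multiply.\<close>
    define e where "e = e0 / (SL + 1)"
    have e: "0 < e" "SL * e \<le> e0" using e0 SL0 by (auto simp: e_def field_simps)
    obtain A where A: "finite A" "snd ` splits b \<subseteq> A" "SK - e \<le> sum K A"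
      using has_sum_finite_tail[OF K e(1) fs] by blast
    let ?t = "\<lambda>n a. K a * P (r n) (of_multi_index b - of_multi_index a)"
    have le: "K b - D (r n) (of_multi_index b) \<le> (\<Sum>a\<in>A. ?t n a) + SL * e" for n
    proof -
      have "K b \<le> V' (r n) (of_multi_index b)"
        using finite_sum_le_has_sum[OF UV'(2)[of "r n" "of_multi_index b"], of "{b}"] K(2) D01 by simp
      moreover have "U' (r n) (of_multi_index b) \<le> (\<Sum>a\<in>A. ?t n a) + SL * e"
        by (rule has_sum_tail_bound[OF K P(1) PS UV'(1) A(1,3)])
      ultimately show ?thesis using UV'(3)[of "r n" "of_multi_index b"] by linarith
    qed
    have "(\<lambda>n. \<Sum>a\<in>A - snd ` splits b. ?t n a) \<longlonglongrightarrow> (\<Sum>a\<in>A - snd ` splits b. K a * 0)"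
    proof (intro tendsto_sum tendsto_mult tendsto_const sub[OF P0])
      fix a assume a: "a \<in> A - snd ` splits b"
      have "of_multi_index b - of_multi_index a \<noteq> of_multi_index w" for w
      proof
        assume "of_multi_index b - of_multi_index a = of_multi_index w"
        then have "of_multi_index b = of_multi_index (w + a)" by (simp add: of_multi_index_add diff_eq_eq)
        then have "w + a = b" by (simp add: of_multi_index_inj)
        then have "(w, a) \<in> splits b" by (simp add: splits_def)
        then show False using a by force
      qed
      then show "of_multi_index b - of_multi_index a \<notin> range of_multi_index \<or> of_multi_index b - of_multi_index a = 0" by blast
    qed
    then have "(\<lambda>n. (\<Sum>a\<in>snd ` splits b. ?t n a) + (\<Sum>a\<in>A - snd ` splits b. ?t n a) + SL * e) \<longlonglongrightarrow> conv p K b + 0 + SL * e"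
      by (intro tendsto_add convlim b tendsto_const) simp
    moreover have "(\<Sum>a\<in>A. ?t n a) = (\<Sum>a\<in>snd ` splits b. ?t n a) + (\<Sum>a\<in>A - snd ` splits b. ?t n a)" for n
      by (subst add.commute, rule sum.subset_diff[OF A(2,1)])
    ultimately have lim: "(\<lambda>n. (\<Sum>a\<in>A. ?t n a) + SL * e) \<longlonglongrightarrow> conv p K b + SL * e" by simp
    have "of_multi_index b \<noteq> 0" using b(2) of_multi_index_inj[of b 0] by simp
    from evsub[OF Dev[OF this]] have "\<forall>\<^sub>F n in sequentially. K b - D (r n) (of_multi_index b) = K b"
      by eventually_elim simp
    then have "(\<lambda>n. K b - D (r n) (of_multi_index b)) \<longlonglongrightarrow> K b" by (rule tendsto_eventually)
    from LIMSEQ_le[OF this lim] le have "K b \<le> conv p K b + SL * e" by blast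
    then show "K b \<le> conv p K b + e0" using e(2) by linarith
  qed
  show ?thesis using p0 pz c1 c2 by blast
qed

lemma mdeg_add_splits: "x \<in> splits b \<Longrightarrow> mdeg b = mdeg (fst x) + mdeg (snd x)"
  by (auto simp: splits_def mdeg_add)

text \<open>The grid has radius \<open>r\<close>, and this removes it from the coefficients.\<close>

lemma conv_rescale:
  assumes "r > 0"
  shows "conv (\<lambda>a. p a / r ^ (2 * mdeg a)) f b = conv p (\<lambda>a. f a * r ^ (2 * mdeg a)) b / r ^ (2 * mdeg b)"
  unfolding conv_def sum_divide_distrib
proof (intro sum.cong refl)
  fix x assume x: "x \<in> splits b"
  have "r ^ (2 * mdeg b) = r ^ (2 * mdeg (fst x)) * r ^ (2 * mdeg (snd x))"
    by (simp add: mdeg_add_splits[OF x] distrib_left power_add)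
  then show "(case x of (w, u) \<Rightarrow> p w / r ^ (2 * mdeg w) * f u) = (case x of (w, u) \<Rightarrow> p w * (f u * r ^ (2 * mdeg u))) / r ^ (2 * mdeg b)"
    using assms by (simp add: case_prod_beta)
qed

lemma norm_le_CARD:
  assumes "\<And>j. cmod ((x :: complex ^ 'n) $ j) \<le> e"
  shows "norm x \<le> of_nat CARD('n) * e"
proof -
  have "norm x \<le> (\<Sum>j\<in>UNIV. cmod (x $ j))" unfolding norm_vec_def by (rule L2_set_le_sum) auto
  also have "\<dots> \<le> (\<Sum>j\<in>(UNIV :: 'n set). e)" by (intro sum_mono assms)
  finally show ?thesis by simp
qed

lemma norm_grid_point_le:
  assumes "0 \<le> r"
  shows "norm (grid_point r m i :: complex ^ 'n) \<le> real CARD('n) * r"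
  by (rule norm_le_CARD) (use assms in \<open>simp add: grid_point_def norm_mult\<close>)

lemma monom_eval_zero: "a \<noteq> 0 \<Longrightarrow> monom_eval (0 :: complex ^ 'n) a = 0"
  unfolding monom_eval_def by (auto simp: Finite_Cartesian_Product.vec_eq_iff)

text \<open>The certificate at the point \<open>0\<close> on the finite set \<open>{0} \<union>
  grid\<close>: the Schur complements at \<open>0\<close> are \<open>k - 1\<close> and \<open>l
  - 1\<close>, as \<open>k(z, 0) = l(z, 0) = 1\<close>.\<close>

lemma coefficient_certificate:
  fixes k l :: "complex ^ 'n \<Rightarrow> complex ^ 'n \<Rightarrow> complex"
  assumes cp: "complete_Pick_pair X k l" and ker: "is_kernel X k" "is_kernel X l"
    and nz: "\<And>z. z \<in> X \<Longrightarrow> k z z \<noteq> 0" "\<And>z. z \<in> X \<Longrightarrow> l z z \<noteq> 0"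
    and \<rho>: "0 < \<rho>" "\<And>z. norm z < \<rho> \<Longrightarrow> z \<in> X"
    and k: "\<And>z w. norm z < \<rho> \<Longrightarrow> norm w < \<rho> \<Longrightarrow>
       ((\<lambda>a. complex_of_real (kc a) * monom_eval z a * cnj (monom_eval w a)) has_sum k z w) UNIV"
    and l: "\<And>z w. norm z < \<rho> \<Longrightarrow> norm w < \<rho> \<Longrightarrow>
       ((\<lambda>a. complex_of_real (lc a) * monom_eval z a * cnj (monom_eval w a)) has_sum l z w) UNIV"
    and kc: "\<And>a. 0 \<le> kc a" "kc 0 = 1" and lc: "\<And>a. 0 \<le> lc a" "lc 0 = 1"
    and \<Lambda>: "finite \<Lambda>" "\<And>w u. w + u \<in> \<Lambda> \<Longrightarrow> w \<in> \<Lambda>"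
  shows "\<exists>p. (\<forall>b. 0 \<le> p b) \<and> p 0 = 0 \<and> (\<forall>b\<in>\<Lambda>. b \<noteq> 0 \<longrightarrow> conv p lc b \<le> lc b \<and> kc b \<le> conv p kc b)"
proof -
  \<comment> \<open>All grid points have norm less than \<open>\<rho>\<close>.\<close>
  define r where "r = \<rho> / (real CARD('n) + 1)"
  have r: "0 < r" using \<rho> by (simp add: r_def add_pos_nonneg)
  have gp: "norm (grid_point r m i :: complex ^ 'n) < \<rho>" for m i
  proof -
    have "real CARD('n) * r < \<rho>" using \<rho>(1) by (simp add: r_def field_simps)
    then show ?thesis using norm_grid_point_le[of r m i] r by linarith
  qed
  define K where "K = (\<lambda>a. kc a * r ^ (2 * mdeg a))"
  define L where "L = (\<lambda>a. lc a * r ^ (2 * mdeg a))"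
  have series: "((\<lambda>a. of_real (c a * r ^ (2 * mdeg a)) * torus_char m (of_multi_index a) i * cnj (torus_char m (of_multi_index a) i'))
      has_sum f (grid_point r m i) (grid_point r m i')) UNIV"
    if "\<And>z w. norm z < \<rho> \<Longrightarrow> norm w < \<rho> \<Longrightarrow>
       ((\<lambda>a. complex_of_real (c a) * monom_eval z a * cnj (monom_eval w a)) has_sum f z w) UNIV"
    for f c m i and i' :: "'n \<Rightarrow> nat"
  proof -
    have "of_real (c a * r ^ (2 * mdeg a)) * torus_char m (of_multi_index a) i * cnj (torus_char m (of_multi_index a) i')
      = complex_of_real (c a) * monom_eval (grid_point r m i) a * cnj (monom_eval (grid_point r m i') a)" for a
      by (simp add: monom_eval_grid_point mult_2 power_add)
    then show ?thesis using that[OF gp gp, of m i m i'] by (simp only:)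
  qed
  have total: "(\<lambda>a. c a * r ^ (2 * mdeg a)) summable_on UNIV"
    if "\<And>z w. norm z < \<rho> \<Longrightarrow> norm w < \<rho> \<Longrightarrow>
       ((\<lambda>a. complex_of_real (c a) * monom_eval z a * cnj (monom_eval w a)) has_sum f z w) UNIV"
    for f and c :: "nat ^ 'n \<Rightarrow> real"
    using has_sum_Re[OF series[OF that, of 1 "\<lambda>_. 0" "\<lambda>_. 0"]]
    by (auto simp: torus_char_def summable_on_def)
  have norm0: "f z 0 = 1" "f 0 z = 1" if "norm z < \<rho>" "c 0 = 1" "\<And>z w. norm z < \<rho> \<Longrightarrow> norm w < \<rho> \<Longrightarrow>
       ((\<lambda>a. complex_of_real (c a) * monom_eval z a * cnj (monom_eval w a)) has_sum f z w) UNIV"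
    for f c and z :: "complex ^ 'n"
  proof -
    have *: "((\<lambda>a. if a = (0 :: nat ^ 'n) then 1 else 0) has_sum (1 :: complex)) UNIV"
      using has_sum_finite_neutralI[of "{0}" UNIV "\<lambda>a. if a = (0 :: nat ^ 'n) then 1 else 0 :: complex"] by simp
    have "(\<lambda>a. complex_of_real (c a) * monom_eval z a * cnj (monom_eval 0 a)) = (\<lambda>a. if a = 0 then 1 else 0)"
      "(\<lambda>a. complex_of_real (c a) * monom_eval 0 a * cnj (monom_eval z a)) = (\<lambda>a. if a = 0 then 1 else 0)"
      using that(2) by (auto simp: fun_eq_iff monom_eval_zero)
    then show "f z 0 = 1" "f 0 z = 1"
      using that(3)[of z 0] that(3)[of 0 z] that(1) \<rho>(1) has_sum_unique[OF _ *] by auto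
  qed
  have cert: "\<exists>P. \<forall>c. 0 \<le> P c \<and>
    (\<exists>u v. ((\<lambda>a. L a * P (c - of_multi_index a)) has_sum u) UNIV \<and>
       ((\<lambda>a. L a * divides_all m (c - of_multi_index a)) has_sum v) UNIV \<and> u \<le> v - divides_all m c) \<and>
    (\<exists>u v. ((\<lambda>a. K a * P (c - of_multi_index a)) has_sum u) UNIV \<and>
       ((\<lambda>a. K a * divides_all m (c - of_multi_index a)) has_sum v) UNIV \<and> v - divides_all m c \<le> u)" if m: "m \<ge> 1" for m
  proof -
    let ?g = "grid_point r m :: _ \<Rightarrow> complex ^ 'n"
    define F where "F = insert 0 (?g ` torus_grid m)"
    have F: "finite F" "F \<subseteq> X" using \<rho> gp by (auto simp: F_def)
    obtain q where q: "Shimorin_certificate F k l q"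
      using finite_Shimorin_of_Pick[OF cp ker nz F] by blast
    have 0: "0 \<in> F" by (simp add: F_def)
    have pb: "is_kernel (torus_grid m) (\<lambda>i i'. h (?g i) (?g i'))" if "is_kernel F h" for h
      using that by (rule is_kernel_pullback) (simp add: F_def)
    have sk: "schur_kernel f 0 (?g i) (?g i') = f (?g i) (?g i') - 1"
      if "c 0 = 1" "\<And>z w. norm z < \<rho> \<Longrightarrow> norm w < \<rho> \<Longrightarrow>
       ((\<lambda>a. complex_of_real (c a) * monom_eval z a * cnj (monom_eval w a)) has_sum f z w) UNIV" for f c i i'
      unfolding schur_kernel_def using norm0[OF gp that] norm0[OF _ that, of 0] \<rho>(1) by simp
    note q0 = q[unfolded Shimorin_certificate_def kernel_le_def, rule_format, OF 0]
    show ?thesis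
    proof (rule grid_certificate[OF m])
      show "((\<lambda>a. of_real (K a) * torus_char m (of_multi_index a) i * cnj (torus_char m (of_multi_index a) i')) has_sum k (?g i) (?g i')) UNIV" for i i'
        unfolding K_def by (rule series[OF k])
      show "((\<lambda>a. of_real (L a) * torus_char m (of_multi_index a) i * cnj (torus_char m (of_multi_index a) i')) has_sum l (?g i) (?g i')) UNIV" for i i'
        unfolding L_def by (rule series[OF l])
      show "is_kernel (torus_grid m) (\<lambda>i i'. q 0 (?g i) (?g i'))" using pb q0 by blast
      show "is_kernel (torus_grid m) (\<lambda>i i'. l (?g i) (?g i') - 1 - q 0 (?g i) (?g i') * l (?g i) (?g i'))"
        using pb[of "\<lambda>w v. schur_kernel l 0 w v - q 0 w v * l w v"] q0 by (simp add: sk[of lc l, OF lc(2) l])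
      show "is_kernel (torus_grid m) (\<lambda>i i'. q 0 (?g i) (?g i') * k (?g i) (?g i') - (k (?g i) (?g i') - 1))"
        using pb[of "\<lambda>w v. q 0 w v * k w v - schur_kernel k 0 w v"] q0 by (simp add: sk[of kc k, OF kc(2) k])
    qed
  qed
  have KL0: "\<And>a. 0 \<le> K a" "\<And>a. 0 \<le> L a" "L 0 = 1" using kc lc r by (auto simp: K_def L_def mdeg_def)
  have KL: "(K has_sum infsum K UNIV) UNIV" "(L has_sum infsum L UNIV) UNIV"
    using total[OF k] total[OF l] by (auto simp: K_def L_def)
  have "\<exists>p. (\<forall>b. 0 \<le> p b) \<and> p 0 = 0 \<and> (\<forall>b\<in>\<Lambda>. b \<noteq> 0 \<longrightarrow> conv p L b \<le> L b \<and> K b \<le> conv p K b)"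
    by (rule limit_certificate[OF KL(1) KL0(1) KL(2) KL0(2,3) _ \<Lambda>]) (rule cert)
  then obtain p where "(\<forall>b. 0 \<le> p b) \<and> p 0 = 0 \<and> (\<forall>b\<in>\<Lambda>. b \<noteq> 0 \<longrightarrow> conv p L b \<le> L b \<and> K b \<le> conv p K b)" ..
  then have p: "0 \<le> p b" "p 0 = 0" "b \<in> \<Lambda> \<Longrightarrow> b \<noteq> 0 \<Longrightarrow> conv p L b \<le> L b \<and> K b \<le> conv p K b" for b
    by blast+
  define p' where "p' = (\<lambda>a. p a / r ^ (2 * mdeg a))"
  have "conv p' lc b \<le> lc b \<and> kc b \<le> conv p' kc b" if "b \<in> \<Lambda>" "b \<noteq> 0" for b
    using p(3)[OF that] r unfolding p'_def conv_rescale[OF r] K_def L_def by (simp add: field_simps)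
  moreover have "0 \<le> p' b" "p' 0 = 0" for b using p r by (auto simp: p'_def)
  ultimately show ?thesis by blast
qed

lemma finite_multi_index_below: "finite {a :: nat ^ 'n. \<exists>u. a + u = b}"
  by (rule finite_subset[OF _ finite_imageI[OF finite_splits[of b], of fst]]) (force simp: splits_def image_iff)

text \<open>The indices below \<open>b\<close> form a finite set, on which a coefficient certificate
  exists; then minimality of the master certificate applies.\<close>

theorem master_quotient_nonneg:
  fixes k l :: "complex ^ 'n \<Rightarrow> complex ^ 'n \<Rightarrow> complex"
  assumes cp: "complete_Pick_pair X k l" and ker: "is_kernel X k" "is_kernel X l"
    and nz: "\<And>z. z \<in> X \<Longrightarrow> k z z \<noteq> 0" "\<And>z. z \<in> X \<Longrightarrow> l z z \<noteq> 0"
    and \<rho>: "0 < \<rho>" "\<And>z. norm z < \<rho> \<Longrightarrow> z \<in> X"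
    and k: "\<And>z w. norm z < \<rho> \<Longrightarrow> norm w < \<rho> \<Longrightarrow>
       ((\<lambda>a. complex_of_real (kc a) * monom_eval z a * cnj (monom_eval w a)) has_sum k z w) UNIV"
    and l: "\<And>z w. norm z < \<rho> \<Longrightarrow> norm w < \<rho> \<Longrightarrow>
       ((\<lambda>a. complex_of_real (lc a) * monom_eval z a * cnj (monom_eval w a)) has_sum l z w) UNIV"
    and kc: "\<And>a. 0 \<le> kc a" "kc 0 = 1" and lc: "\<And>a. 0 \<le> lc a" "lc 0 = 1"
  shows "0 \<le> conv (unit_minus (master_certificate kc)) lc b"
proof -
  define \<Lambda> where "\<Lambda> = {a. \<exists>u. a + u = b}"
  have \<Lambda>: "finite \<Lambda>" "\<And>w u. w + u \<in> \<Lambda> \<Longrightarrow> w \<in> \<Lambda>" "b \<in> \<Lambda>"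
    using finite_multi_index_below[of b] by (auto simp: \<Lambda>_def add.assoc intro: exI[of _ 0])
  have "\<exists>p. (\<forall>b. 0 \<le> p b) \<and> p 0 = 0 \<and> (\<forall>b\<in>\<Lambda>. b \<noteq> 0 \<longrightarrow> conv p lc b \<le> lc b \<and> kc b \<le> conv p kc b)"
    by (rule coefficient_certificate[OF cp ker nz \<rho> k l kc lc \<Lambda>(1,2)])
  then obtain p where "(\<forall>b. 0 \<le> p b) \<and> p 0 = 0 \<and> (\<forall>b\<in>\<Lambda>. b \<noteq> 0 \<longrightarrow> conv p lc b \<le> lc b \<and> kc b \<le> conv p kc b)" ..
  then have p: "0 \<le> p b" "p 0 = 0" "b \<in> \<Lambda> \<Longrightarrow> b \<noteq> 0 \<Longrightarrow> kc b \<le> conv p kc b"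
    "b \<in> \<Lambda> \<Longrightarrow> b \<noteq> 0 \<Longrightarrow> conv p lc b \<le> lc b" for b
    by blast+
  have l0: "0 \<le> lc 0" using lc(1) .
  show ?thesis
    by (rule master_certificate_minimal[where k = kc and l = lc, OF kc l0 \<Lambda>(2) p \<Lambda>(3)])
qed

section \<open>Landau's theorem for positive shifts of power series\<close>

lemma series_holomorphic:
  fixes g :: "'a \<Rightarrow> complex \<Rightarrow> complex"
  assumes g: "\<And>a. g a holomorphic_on UNIV"
    and dom: "\<And>z. z \<in> T \<Longrightarrow> \<exists>\<delta>>0. \<exists>M. M summable_on UNIV \<and> (\<forall>a. \<forall>w\<in>cball z \<delta>. cmod (g a w) \<le> M a)"
  shows "(\<lambda>z. infsum (\<lambda>a. g a z) UNIV) holomorphic_on T"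
proof -
  have "(\<lambda>z. infsum (\<lambda>a. g a z) UNIV) field_differentiable at z" if z: "z \<in> T" for z
  proof -
    from dom[OF z] obtain \<delta> M where M: "\<delta> > 0" "M summable_on UNIV" "\<And>a w. w \<in> cball z \<delta> \<Longrightarrow> cmod (g a w) \<le> M a"
      by blast
    have ul: "uniform_limit (cball z \<delta>) (\<lambda>X w. \<Sum>a\<in>X. g a w) (\<lambda>w. infsum (\<lambda>a. g a w) UNIV) (finite_subsets_at_top UNIV)"
      by (rule Weierstrass_m_test_general[where M = M]) (use M in blast)+
    have "(\<lambda>w. \<Sum>a\<in>X. g a w) holomorphic_on S" for X S
      using g by (intro holomorphic_intros) (rule holomorphic_on_subset, auto)
    then have "\<forall>\<^sub>F X in finite_subsets_at_top UNIV. continuous_on (cball z \<delta>) (\<lambda>w. \<Sum>a\<in>X. g a w) \<and>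
        (\<lambda>w. \<Sum>a\<in>X. g a w) holomorphic_on ball z \<delta>"
      using holomorphic_on_imp_continuous_on by (intro always_eventually) blast
    from holomorphic_uniform_limit[OF this ul] have "(\<lambda>w. infsum (\<lambda>a. g a w) UNIV) holomorphic_on ball z \<delta>" by auto
    then show ?thesis
      using M(1) by (intro holomorphic_on_imp_differentiable_at[of _ "ball z \<delta>"]) auto
  qed
  then show ?thesis by (simp add: holomorphic_on_def field_differentiable_at_within)
qed

text \<open>The point \<open>t + (x, \<dots>, x)\<close>. Shifting all components at once reduces
  questions about several variables to one variable.\<close>

definition shift_vec :: "real ^ 'n \<Rightarrow> 'a::real_algebra_1 \<Rightarrow> 'a ^ 'n" where
  "shift_vec t x = (\<chi> j. of_real (t $ j) + x)"

lemma shift_poly: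
  fixes t :: "real ^ 'n"
  assumes "\<And>j. 0 \<le> t $ j"
  shows "\<exists>p :: complex poly. (\<forall>n. 0 \<le> coeff p n) \<and> (\<forall>z. monom_eval (shift_vec t z) a = poly p z)"
proof -
  have mult: "\<exists>p :: complex poly. (\<forall>n. 0 \<le> coeff p n) \<and> (\<forall>z. f z * g z = poly p z)"
    if "\<exists>p :: complex poly. (\<forall>n. 0 \<le> coeff p n) \<and> (\<forall>z. f z = poly p z)"
      "\<exists>p :: complex poly. (\<forall>n. 0 \<le> coeff p n) \<and> (\<forall>z. g z = poly p z)" for f g :: "complex \<Rightarrow> complex"
  proof -
    from that obtain p q :: "complex poly" where "\<forall>n. 0 \<le> coeff p n" "\<forall>z. f z = poly p z" "\<forall>n. 0 \<le> coeff q n" "\<forall>z. g z = poly q z" by blast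
    then show ?thesis by (intro exI[of _ "p * q"]) (auto simp: coeff_mult intro!: sum_nonneg mult_nonneg_nonneg)
  qed
  have one: "\<exists>p :: complex poly. (\<forall>n. 0 \<le> coeff p n) \<and> (\<forall>z. 1 = poly p z)"
    by (intro exI[of _ 1]) (auto simp: coeff_1 less_eq_complex_def)
  have lin: "\<exists>p :: complex poly. (\<forall>n. 0 \<le> coeff p n) \<and> (\<forall>z. of_real (t $ j) + z = poly p z)" for j
    using assms[of j] by (intro exI[of _ "[:of_real (t $ j), 1:]"])
      (auto simp: coeff_pCons less_eq_complex_def split: nat.split)
  have pow: "\<exists>p :: complex poly. (\<forall>n. 0 \<le> coeff p n) \<and> (\<forall>z. (of_real (t $ j) + z) ^ m = poly p z)" for j m
  proof (induction m)
    case 0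
    then show ?case using one by simp
  next
    case (Suc m)
    show ?case unfolding power_Suc by (rule mult[OF lin Suc])
  qed
  have "\<exists>p :: complex poly. (\<forall>n. 0 \<le> coeff p n) \<and> (\<forall>z. (\<Prod>j\<in>A. (of_real (t $ j) + z) ^ (a $ j)) = poly p z)"
    if "finite A" for A
    using that
  proof (induction A rule: finite_induct)
    case empty
    show ?case using one by simp
  next
    case (insert x A)
    show ?case unfolding prod.insert[OF insert.hyps] by (rule mult[OF pow insert.IH])
  qed
  from this[OF finite[of UNIV]] show ?thesis by (simp add: monom_eval_def shift_vec_def)
qed

lemma monom_eval_shift_of_real:
  "monom_eval (shift_vec t (of_real x :: complex)) a = of_real (monom_eval (shift_vec t x) a)"
  by (simp add: monom_eval_def shift_vec_def)

text \<open>The Taylor coefficients of a shifted monomial are nonnegative because the centre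
  \<open>t\<close> is. The sums are finite, but stating them as infinite sums fits the
  rearrangement below.\<close>

lemma shift_coeffs:
  fixes t :: "real ^ 'n"
  assumes "\<And>j. 0 \<le> t $ j"
  obtains c :: "nat ^ 'n \<Rightarrow> nat \<Rightarrow> real" where "\<And>a n. 0 \<le> c a n"
    "\<And>a z. ((\<lambda>n. of_real (c a n) * z ^ n) has_sum monom_eval (shift_vec t (z :: complex)) a) (UNIV :: nat set)"
    "\<And>a x. ((\<lambda>n. c a n * x ^ n) has_sum monom_eval (shift_vec t x) a) (UNIV :: nat set)"
proof -
  have "\<forall>a. \<exists>p :: complex poly. (\<forall>n. 0 \<le> coeff p n) \<and> (\<forall>z. monom_eval (shift_vec t z) a = poly p z)"
    using shift_poly[OF assms] by blast
  from choice[OF this] obtain p :: "nat ^ 'n \<Rightarrow> complex poly"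
    where p: "\<And>a n. 0 \<le> coeff (p a) n" "\<And>a z. monom_eval (shift_vec t z) a = poly (p a) z" by blast
  define c where "c = (\<lambda>a n. Re (coeff (p a) n))"
  have c: "coeff (p a) n = of_real (c a n)" "0 \<le> c a n" for a n
    using p(1)[of a n] by (auto simp: c_def less_eq_complex_def complex_eq_iff)
  have s: "((\<lambda>n. of_real (c a n) * z ^ n) has_sum monom_eval (shift_vec t z) a) UNIV" for a and z :: complex
  proof -
    have "((\<lambda>n. coeff (p a) n * z ^ n) has_sum (\<Sum>n\<le>degree (p a). coeff (p a) n * z ^ n)) UNIV"
      by (rule has_sum_finite_neutralI) (auto simp: coeff_eq_0)
    then show ?thesis by (simp add: c p(2) poly_altdef)
  qed
  have "((\<lambda>n. c a n * x ^ n) has_sum monom_eval (shift_vec t x) a) UNIV" for a and x :: real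
    using has_sum_Re[OF s[of a "of_real x"]] unfolding monom_eval_shift_of_real
    by (simp flip: of_real_power of_real_mult)
  with c(2) s show ?thesis by (rule that)
qed

text \<open>Landau--Pringsheim: expanding every monomial around \<open>t\<close> gives a power series in
  one variable with nonnegative coefficients \<open>E n\<close>, the Taylor series of
  \<open>G\<close>. It converges in the whole disc where \<open>G\<close> is holomorphic, and at
  positive points nonnegativity permits to rearrange the double series back.\<close>

lemma Landau_shift:
  fixes t :: "real ^ 'n" and d :: "nat ^ 'n \<Rightarrow> real"
  assumes d: "\<And>a. 0 \<le> d a" and t: "\<And>j. 0 \<le> t $ j" and \<epsilon>: "0 < \<epsilon>"
    and G: "G holomorphic_on ball 0 \<rho>"
    and sum: "\<And>z. cmod z < \<epsilon> \<Longrightarrow> ((\<lambda>a. of_real (d a) * monom_eval (shift_vec t z) a) has_sum G z) UNIV"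
    and x: "0 \<le> x" "x < \<rho>"
  shows "(\<lambda>a. d a * monom_eval (shift_vec t x) a) summable_on UNIV"
proof -
  obtain c where c: "\<And>a n. 0 \<le> c a n"
    "\<And>a z. ((\<lambda>n. of_real (c a n) * z ^ n) has_sum monom_eval (shift_vec t (z :: complex)) a) (UNIV :: nat set)"
    "\<And>a x. ((\<lambda>n. c a n * x ^ n) has_sum monom_eval (shift_vec t x) a) (UNIV :: nat set)"
    using shift_coeffs[OF t] by blast
  define R where "R = (\<lambda>x (a, n). d a * (c a n * x ^ n))"
  have R0: "0 \<le> R x p" if "0 \<le> x" for x p using d c(1) that by (auto simp: R_def split: prod.split)
  have Rsum: "R y summable_on (UNIV \<times> UNIV)" if y: "0 \<le> y" "y < \<epsilon>" for y
  proof -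
    have "(\<lambda>a. d a * monom_eval (shift_vec t y) a) summable_on UNIV"
      using has_sum_Re[OF sum[of "of_real y"]] y unfolding monom_eval_shift_of_real
      by (auto simp: summable_on_def simp flip: of_real_mult)
    then show ?thesis
      by (intro summable_on_SigmaI[where g = "\<lambda>a. d a * monom_eval (shift_vec t y) a"])
        (use R0 y(1) in \<open>auto simp: R_def intro!: has_sum_cmult_right c(3)\<close>)
  qed
  have swap: "R y summable_on (UNIV \<times> UNIV) \<longleftrightarrow> (\<lambda>(n, a). R y (a, n)) summable_on (UNIV \<times> UNIV)" for y
    by (rule summable_on_swap)
  define E where "E = (\<lambda>n. infsum (\<lambda>a. d a * c a n) UNIV)"
  have Esum: "((\<lambda>a. d a * c a n) has_sum E n) UNIV" for n
  proof -
    have "(\<lambda>(n, a). R (\<epsilon> / 2) (a, n)) summable_on (UNIV \<times> UNIV)"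
      using Rsum[of "\<epsilon> / 2"] swap \<epsilon> by simp
    from summable_on_SigmaD1[OF this, of n] have "(\<lambda>a. d a * (c a n * (\<epsilon> / 2) ^ n)) summable_on UNIV"
      by (simp add: R_def)
    then have "(\<lambda>a. d a * (c a n * (\<epsilon> / 2) ^ n) * (1 / (\<epsilon> / 2) ^ n)) summable_on UNIV"
      by (rule summable_on_cmult_left)
    then have "(\<lambda>a. d a * c a n) summable_on UNIV" using \<epsilon> by simp
    then show ?thesis by (simp add: E_def)
  qed
  have E0: "0 \<le> E n" for n using has_sum_nonneg[OF Esum] d c(1) by simp
  have ser: "((\<lambda>n. of_real (E n) * z ^ n) has_sum G z) UNIV" if z: "cmod z < \<epsilon>" for z
  proof -
    \<comment> \<open>The double series converges absolutely by comparison with the modulus of \<open>z\<close> in place of \<open>z\<close>; it is summed in both orders.\<close>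
    define H where "H = (\<lambda>(a, n). of_real (d a) * (of_real (c a n) * z ^ n) :: complex)"
    have H: "cmod (H p) \<le> R (cmod z) p" for p
      using d c(1) by (cases p) (simp add: R_def H_def norm_mult norm_power)
    have "(\<lambda>p. cmod (H p)) summable_on (UNIV \<times> UNIV)"
      by (rule Infinite_Sum.abs_summable_on_comparison_test'[OF Rsum H]) (use z in auto)
    then have "H summable_on (UNIV \<times> UNIV)" by (rule abs_summable_summable)
    then obtain S where S: "(H has_sum S) (UNIV \<times> UNIV)" by (auto simp: summable_on_def)
    have "((\<lambda>n. H (a, n)) has_sum of_real (d a) * monom_eval (shift_vec t z) a) UNIV" for a
      using has_sum_cmult_right[OF c(2), of "of_real (d a)" a z] by (simp only: H_def prod.case)
    from has_sum_SigmaD[OF S this] have "((\<lambda>a. of_real (d a) * monom_eval (shift_vec t z) a) has_sum S) UNIV"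
      by simp
    from has_sum_unique[OF this sum[OF z]] have SG: "S = G z" .
    have S': "((\<lambda>(n, a). H (a, n)) has_sum S) (UNIV \<times> UNIV)" using S by (rule iffD1[OF has_sum_swap])
    have "((\<lambda>a. case (n, a) of (n, a) \<Rightarrow> H (a, n)) has_sum of_real (E n) * z ^ n) UNIV" for n
    proof -
      have "((\<lambda>a. of_real (d a * c a n)) has_sum (of_real (E n) :: complex)) UNIV"
        using Esum by (rule has_sum_of_real)
      from has_sum_cmult_left[OF this, of "z ^ n"] show ?thesis
        by (simp add: mult.assoc H_def)
    qed
    from has_sum_SigmaD[OF S' this] show ?thesis unfolding SG by simp
  qed
  define F where "F = Abs_fps (\<lambda>n. complex_of_real (E n))"
  have radius: "fps_conv_radius F \<ge> ereal (\<epsilon> / 2)"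
  proof -
    have "summable (\<lambda>n. of_real (E n) * complex_of_real (\<epsilon> / 2) ^ n)"
      using has_sum_imp_sums[OF ser[of "of_real (\<epsilon> / 2)"]] \<epsilon> by (auto simp: sums_iff)
    from conv_radius_geI[OF this] show ?thesis using \<epsilon> by (simp add: fps_conv_radius_def F_def)
  qed
  \<comment> \<open>By uniqueness of Taylor coefficients the radius of convergence is at least \<open>\<rho>\<close>.\<close>
  have "G has_fps_expansion F"
    unfolding has_fps_expansion_def
  proof
    show "0 < fps_conv_radius F" using radius \<epsilon> by (auto intro: less_le_trans[rotated])
    have "eval_fps F z = G z" if "z \<in> ball 0 \<epsilon>" for z
      using has_sum_imp_sums[OF ser[of z]] that by (simp add: eval_fps_def F_def sums_iff)
    then show "\<forall>\<^sub>F z in nhds 0. eval_fps F z = G z"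
      using \<epsilon> by (intro eventually_nhds_in_open[THEN eventually_mono, of "ball 0 \<epsilon>"]) auto
  qed
  moreover have "G has_fps_expansion fps_expansion G 0"
    using G x by (intro has_fps_expansion_fps_expansion[of "ball 0 \<rho>"]) auto
  ultimately have "F = fps_expansion G 0" by (rule fps_expansion_unique_complex)
  moreover have "fps_conv_radius (fps_expansion G 0) \<ge> ereal \<rho>"
    using G by (intro conv_radius_fps_expansion) (simp add: eball_def ball_def)
  ultimately have "norm (complex_of_real x) < fps_conv_radius F"
    using x by (auto intro: less_le_trans[rotated])
  from norm_summable_fps[OF this] have "summable (\<lambda>n. E n * x ^ n)"
    using E0 x by (simp add: F_def norm_mult norm_power)
  then have "(\<lambda>n. E n * x ^ n) summable_on UNIV"
    using E0 x by (intro summable_nonneg_imp_summable_on) auto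
  then have "(\<lambda>(n, a). R x (a, n)) summable_on (UNIV \<times> UNIV)"
  proof (rule summable_on_SigmaI[rotated])
    show "((\<lambda>a. case (n, a) of (n, a) \<Rightarrow> R x (a, n)) has_sum E n * x ^ n) UNIV" for n
      using has_sum_cmult_left[OF Esum, of n "x ^ n"] by (simp add: R_def mult_ac)
  qed (use R0 x in auto)
  then have "(\<lambda>(a, n). d a * (c a n * x ^ n)) summable_on (UNIV \<times> UNIV)"
    using swap[of x] by (simp add: R_def)
  from summable_on_Sigma_banach[OF this] show ?thesis
    by (simp add: infsumI[OF has_sum_cmult_right[OF c(3)]])
qed

section \<open>Convergence of diagonal series on connected domains\<close>

text \<open>Holomorphy on complex lines is what the identity theorem and Landau's theorem use, and it is
  checked for series by the theory of one variable.\<close>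

definition slice_holomorphic :: "(complex ^ 'n \<Rightarrow> complex) \<Rightarrow> (complex ^ 'n) set \<Rightarrow> bool" where
  "slice_holomorphic \<phi> U \<longleftrightarrow> (\<forall>z u. (\<lambda>h. \<phi> (z + h *s u)) holomorphic_on {h. z + h *s u \<in> U})"

lemma bounded_linear_line: "bounded_linear (\<lambda>h :: complex. h *s (u :: complex ^ 'n))"
proof -
  have "linear (\<lambda>h :: complex. h *s u)"
    by (rule linearI) (auto simp: Finite_Cartesian_Product.vec_eq_iff algebra_simps)
  then show ?thesis by (simp add: linear_conv_bounded_linear)
qed

lemma continuous_on_line: "continuous_on S (\<lambda>h :: complex. z + h *s (u :: complex ^ 'n))"
  by (intro continuous_intros bounded_linear.continuous_on[OF bounded_linear_line])

lemma open_line: "open U \<Longrightarrow> open {h :: complex. z + h *s (u :: complex ^ 'n) \<in> U}"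
  using open_vimage[OF _ continuous_on_line[of UNIV z u], of U] by (simp add: vimage_def)

lemma convex_line:
  assumes "convex U"
  shows "convex {h :: complex. z + h *s (u :: complex ^ 'n) \<in> U}"
proof (rule convexI, clarify)
  fix x y and a b :: real
  assume *: "z + x *s u \<in> U" "z + y *s u \<in> U" "0 \<le> a" "0 \<le> b" "a + b = 1"
  have "a *\<^sub>R (z + x *s u) + b *\<^sub>R (z + y *s u) = (a + b) *\<^sub>R z + (a *\<^sub>R x + b *\<^sub>R y) *s u"
    by (simp add: Finite_Cartesian_Product.vec_eq_iff algebra_simps)
  then show "z + (a *\<^sub>R x + b *\<^sub>R y) *s u \<in> U"
    using convexD[OF assms *] * by simp
qed

lemma slice_holomorphic_Cd:
  assumes "holomorphic_Cd f U"
  shows "slice_holomorphic f U"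
  unfolding slice_holomorphic_def holomorphic_on_def
proof (intro allI ballI)
  fix z u x
  assume "x \<in> {h. z + h *s u \<in> U}"
  then obtain D where D: "(f has_derivative D) (at (z + x *s u))" "\<And>c v. D (c *s v) = c * D v"
    using assms unfolding holomorphic_Cd_def by blast
  have "((\<lambda>h. z + h *s u) has_derivative (\<lambda>h. h *s u)) (at x)"
    by (rule has_derivative_eq_rhs, rule has_derivative_add[OF has_derivative_const
        bounded_linear_imp_has_derivative[OF bounded_linear_line]]) simp
  from has_derivative_compose[OF this D(1)] have "((\<lambda>h. f (z + h *s u)) has_field_derivative D u) (at x)"
    unfolding has_field_derivative_def by (rule has_derivative_eq_rhs) (simp add: D(2) fun_eq_iff mult.commute)
  then show "(\<lambda>h. f (z + h *s u)) field_differentiable at x within {h. z + h *s u \<in> U}"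
    using field_differentiable_at_within field_differentiable_def by blast
qed

lemma slice_holomorphic_diff:
  "slice_holomorphic f U \<Longrightarrow> slice_holomorphic g U \<Longrightarrow> slice_holomorphic (\<lambda>z. f z - g z) U"
  unfolding slice_holomorphic_def by (auto intro: holomorphic_on_diff)

lemma slice_holomorphic_subset:
  "slice_holomorphic f U \<Longrightarrow> V \<subseteq> U \<Longrightarrow> slice_holomorphic f V"
  unfolding slice_holomorphic_def by (meson Collect_mono holomorphic_on_subset subsetD)

text \<open>On the line through \<open>x\<close> and a point of \<open>V\<close>, the parameters of points
  in \<open>U\<close> form a convex open set.\<close>

lemma identity_convex:
  assumes h: "slice_holomorphic \<phi> U" and U: "open U" "convex U" and V: "open V" "V \<subseteq> U" "V \<noteq> {}"
    and zero: "\<And>z. z \<in> V \<Longrightarrow> \<phi> z = 0" and x: "x \<in> U"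
  shows "\<phi> x = 0"
proof -
  from V obtain v where v: "v \<in> V" by blast
  let ?l = "\<lambda>h :: complex. v + h *s (x - v)"
  have "\<phi> (?l 1) = 0"
  proof (rule analytic_continuation_open[of "{h. ?l h \<in> V}" "{h. ?l h \<in> U}" "\<lambda>h. \<phi> (?l h)" "\<lambda>h. 0"])
    show "open {h. ?l h \<in> V}" "open {h. ?l h \<in> U}" by (rule open_line, fact)+
    show "connected {h. ?l h \<in> U}" using U by (intro convex_connected convex_line)
    have "0 \<in> {h. ?l h \<in> V}" using v by (simp add: Finite_Cartesian_Product.vec_eq_iff)
    then show "{h. ?l h \<in> V} \<noteq> {}" by blast
    show "(\<lambda>h. \<phi> (?l h)) holomorphic_on {h. ?l h \<in> U}" using h unfolding slice_holomorphic_def by blast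
  qed (use V x zero in auto)
  then show ?thesis by simp
qed

text \<open>The hypothesis says that \<open>A\<close> is relatively closed, with a radius that does not
  depend on the point of \<open>A\<close>.\<close>

lemma connected_propagation:
  fixes \<Omega> :: "'a::metric_space set"
  assumes "connected \<Omega>" "A \<subseteq> \<Omega>" "A \<noteq> {}" "open A"
    and near: "\<And>z. z \<in> \<Omega> \<Longrightarrow> \<exists>r>0. \<forall>z1\<in>A. dist z z1 < r \<longrightarrow> z \<in> A"
  shows "A = \<Omega>"
proof (rule ccontr)
  assume "A \<noteq> \<Omega>"
  define V where "V = \<Union> {ball z r |z r. z \<in> \<Omega> - A \<and> (\<forall>z1\<in>A. \<not> dist z z1 < r)}"
  have "open V" by (auto simp: V_def)
  have cov: "\<Omega> - A \<subseteq> V"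
  proof
    fix z assume z: "z \<in> \<Omega> - A"
    then obtain r where r: "r > 0" "\<forall>z1\<in>A. dist z z1 < r \<longrightarrow> z \<in> A" using near by blast
    then have "ball z r \<subseteq> V" unfolding V_def using z by blast
    then show "z \<in> V" using r(1) by auto
  qed
  have "A \<inter> V \<inter> \<Omega> = {}" unfolding V_def by auto
  moreover have "\<Omega> \<subseteq> A \<union> V" using cov by blast
  ultimately have "A \<inter> \<Omega> = {} \<or> V \<inter> \<Omega> = {}"
    using connectedD[OF assms(1) \<open>open A\<close> \<open>open V\<close>] by blast
  then show False using assms(2,3) \<open>A \<noteq> \<Omega>\<close> cov by blast
qed

lemma identity_connected:
  assumes h: "slice_holomorphic \<phi> \<Omega>" and O: "open \<Omega>" "connected \<Omega>" and V: "open V" "V \<subseteq> \<Omega>" "V \<noteq> {}"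
    and zero: "\<And>z. z \<in> V \<Longrightarrow> \<phi> z = 0" and x: "x \<in> \<Omega>"
  shows "\<phi> x = 0"
proof -
  define A where "A = \<Union> {B. open B \<and> B \<subseteq> \<Omega> \<and> (\<forall>z\<in>B. \<phi> z = 0)}"
  have "A = \<Omega>"
  proof (rule connected_propagation)
    show "connected \<Omega>" "A \<subseteq> \<Omega>" "open A" using O by (auto simp: A_def)
    show "A \<noteq> {}" using V zero by (auto simp: A_def)
    fix z assume "z \<in> \<Omega>"
    then obtain R where R: "R > 0" "ball z R \<subseteq> \<Omega>" using O(1) openE by blast
    show "\<exists>r>0. \<forall>z1\<in>A. dist z z1 < r \<longrightarrow> z \<in> A"
    proof (intro exI conjI ballI impI)
      fix z1 assume z1: "z1 \<in> A" "dist z z1 < R"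
      then obtain B where B: "open B" "B \<subseteq> \<Omega>" "\<And>y. y \<in> B \<Longrightarrow> \<phi> y = 0" "z1 \<in> B" by (auto simp: A_def)
      have "\<phi> y = 0" if "y \<in> ball z R" for y
        by (rule identity_convex[OF slice_holomorphic_subset[OF h R(2)] _ _ _ _ _ _ that, of "B \<inter> ball z R"])
          (use B z1 in auto)
      then have "ball z R \<subseteq> A" using R(2) unfolding A_def by blast
      then show "z \<in> A" using R(1) by auto
    qed fact
  qed
  then show ?thesis using x by (auto simp: A_def)
qed

definition summable_at :: "(nat ^ 'n \<Rightarrow> real) \<Rightarrow> complex ^ 'n \<Rightarrow> bool" where
  "summable_at c z \<longleftrightarrow> (\<lambda>a. c a * (monom_eval (abs_vec z) a)\<^sup>2) summable_on UNIV"

lemma summable_at_mono: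
  assumes c: "\<And>a. 0 \<le> c a" and "summable_at c w" and le: "\<And>j. cmod (z $ j) \<le> cmod (w $ j)"
  shows "summable_at c z"
  using assms(2) unfolding summable_at_def
proof (rule summable_on_comparison_test)
  fix a
  have "monom_eval (abs_vec z) a \<le> monom_eval (abs_vec w) a"
    by (rule monom_eval_mono) (use le in \<open>auto simp: abs_vec_def\<close>)
  then show "c a * (monom_eval (abs_vec z) a)\<^sup>2 \<le> c a * (monom_eval (abs_vec w) a)\<^sup>2"
    using c by (intro mult_left_mono power_mono) auto
qed (use c in auto)

lemma summable_at_pair:
  assumes c: "\<And>a. 0 \<le> c a" and z: "summable_at c z" and w: "summable_at c w"
  shows "(\<lambda>a. c a * (monom_eval (abs_vec z) a * monom_eval (abs_vec w) a)) summable_on UNIV"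
proof (rule summable_on_comparison_test)
  show "(\<lambda>a. c a * (monom_eval (abs_vec z) a)\<^sup>2 + c a * (monom_eval (abs_vec w) a)\<^sup>2) summable_on UNIV"
    using z w unfolding summable_at_def by (rule summable_on_add)
  fix a
  have "monom_eval (abs_vec z) a * monom_eval (abs_vec w) a \<le> (monom_eval (abs_vec z) a)\<^sup>2 + (monom_eval (abs_vec w) a)\<^sup>2"
    using sum_squares_bound[of "monom_eval (abs_vec z) a" "monom_eval (abs_vec w) a"]
      mult_nonneg_nonneg[OF monom_eval_abs_nonneg[of z a] monom_eval_abs_nonneg[of w a]] by linarith
  then show "c a * (monom_eval (abs_vec z) a * monom_eval (abs_vec w) a)
      \<le> c a * (monom_eval (abs_vec z) a)\<^sup>2 + c a * (monom_eval (abs_vec w) a)\<^sup>2"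
    using c by (simp add: mult_left_mono flip: distrib_left)
qed (use c in auto)

definition diagonal_series :: "(nat ^ 'n \<Rightarrow> real) \<Rightarrow> complex ^ 'n \<Rightarrow> complex ^ 'n \<Rightarrow> complex" where
  "diagonal_series c z w = infsum (\<lambda>a. complex_of_real (c a) * monom_eval z a * cnj (monom_eval w a)) UNIV"

lemma has_sum_diagonal_series:
  assumes c: "\<And>a. 0 \<le> c a" and z: "summable_at c z" and w: "summable_at c w"
  shows "((\<lambda>a. complex_of_real (c a) * monom_eval z a * cnj (monom_eval w a)) has_sum diagonal_series c z w) UNIV"
proof -
  have "(\<lambda>a. cmod (complex_of_real (c a) * monom_eval z a * cnj (monom_eval w a))) summable_on UNIV"
    using summable_at_pair[OF assms] by (simp add: norm_mult norm_monom_eval c mult.assoc)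
  from has_sum_infsum[OF abs_summable_summable[OF this]] show ?thesis unfolding diagonal_series_def .
qed

lemma cnj_diagonal_series: "cnj (diagonal_series c z w) = diagonal_series c w z"
  unfolding diagonal_series_def infsum_cnj[symmetric] by (simp add: mult_ac)

text \<open>All moduli are increased by \<open>\<eta>\<close>. A diagonal series with nonnegative
  coefficients that converges at \<open>y'\<close> then converges uniformly near
  \<open>y\<close>.\<close>

lemma dominating_point:
  fixes y :: "complex ^ 'n"
  assumes "open U" "y \<in> U"
  obtains \<eta> y' where "\<eta> > 0" "\<And>j. cmod (y' $ j) = cmod (y $ j) + \<eta>" "y' \<in> U"
proof -
  from assms obtain R where R: "R > 0" "cball y R \<subseteq> U" using open_contains_cball by blast
  define \<eta> where "\<eta> = R / of_nat CARD('n)"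
  have \<eta>: "\<eta> > 0" using R by (simp add: \<eta>_def)
  define y' where "y' = (\<chi> j. y $ j + of_real \<eta> * (if y $ j = 0 then 1 else sgn (y $ j)))"
  have y'n: "cmod (y' $ j) = cmod (y $ j) + \<eta>" for j
  proof (cases "y $ j = 0")
    case False
    then have "y' $ j = of_real (cmod (y $ j) + \<eta>) * sgn (y $ j)"
      by (simp add: y'_def sgn_eq field_simps)
    then show ?thesis using False \<eta> by (simp only: norm_mult norm_sgn norm_of_real) auto
  qed (use \<eta> in \<open>simp add: y'_def\<close>)
  have "norm (y' - y) \<le> of_nat CARD('n) * \<eta>"
    by (rule norm_le_CARD) (use \<eta> in \<open>auto simp: y'_def norm_mult norm_sgn\<close>)
  also have "\<dots> = R" by (simp add: \<eta>_def)
  finally have "y' \<in> U" using R(2) by (auto simp: dist_norm norm_minus_commute)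
  with \<eta> y'n show ?thesis by (rule that)
qed

lemma slice_holomorphic_diagonal_series:
  fixes U :: "(complex ^ 'n) set"
  assumes c: "\<And>a. 0 \<le> c a" and U: "open U" "\<And>z. z \<in> U \<Longrightarrow> summable_at c z" and w: "summable_at c w"
  shows "slice_holomorphic (\<lambda>z. diagonal_series c z w) U"
  unfolding slice_holomorphic_def diagonal_series_def
proof (intro allI series_holomorphic)
  fix z u :: "complex ^ 'n" and a
  show "(\<lambda>h. complex_of_real (c a) * monom_eval (z + h *s u) a * cnj (monom_eval w a)) holomorphic_on UNIV"
    unfolding monom_eval_def by (auto intro!: holomorphic_intros)
next
  fix z u :: "complex ^ 'n" and x
  assume "x \<in> {h. z + h *s u \<in> U}"
  then have xU: "z + x *s u \<in> U" (is "?y \<in> U") by simp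
  from dominating_point[OF U(1) this] obtain \<eta> y' where \<eta>: "\<eta> > 0" and y'n: "\<And>j. cmod (y' $ j) = cmod (?y $ j) + \<eta>"
    and "y' \<in> U" by metis
  then have s: "(\<lambda>a. c a * (monom_eval (abs_vec y') a * monom_eval (abs_vec w) a)) summable_on UNIV"
    using U(2) w by (intro summable_at_pair c)
  define \<delta> where "\<delta> = \<eta> / (norm u + 1)"
  have "0 < norm u + 1" using norm_ge_zero[of u] by linarith
  then have \<delta>: "\<delta> > 0" "\<delta> * norm u \<le> \<eta>" using \<eta>
    by (simp_all add: \<delta>_def divide_simps algebra_simps)
  have "cmod (complex_of_real (c a) * monom_eval (z + v *s u) a * cnj (monom_eval w a))
      \<le> c a * (monom_eval (abs_vec y') a * monom_eval (abs_vec w) a)" if v: "v \<in> cball x \<delta>" for a v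
  proof -
    have "cmod ((z + v *s u) $ j) \<le> cmod (y' $ j)" for j
    proof -
      have "(z + v *s u) $ j = ?y $ j + (v - x) * u $ j" by (simp add: algebra_simps)
      then have "cmod ((z + v *s u) $ j) \<le> cmod (?y $ j) + cmod (v - x) * cmod (u $ j)"
        by (metis norm_mult norm_triangle_ineq)
      also have "cmod (v - x) * cmod (u $ j) \<le> \<delta> * norm u"
        using v \<delta>(1) by (intro mult_mono Finite_Cartesian_Product.norm_nth_le) (auto simp: dist_norm norm_minus_commute)
      finally show ?thesis using y'n \<delta>(2) by auto
    qed
    then have "monom_eval (abs_vec (z + v *s u)) a \<le> monom_eval (abs_vec y') a"
      by (intro monom_eval_mono) (auto simp: abs_vec_def)
    then show ?thesis
      using c[of a] by (simp add: norm_mult norm_monom_eval mult.assoc mult_left_mono mult_right_mono)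
  qed
  then show "\<exists>\<delta>>0. \<exists>M. M summable_on UNIV \<and> (\<forall>a. \<forall>v\<in>cball x \<delta>.
      cmod (complex_of_real (c a) * monom_eval (z + v *s u) a * cnj (monom_eval w a)) \<le> M a)"
    using \<delta>(1) s by blast
qed

text \<open>The direction in which all moduli of \<open>z\<close> increase at the same rate.\<close>

lemma unimodular_phase:
  obtains u :: "complex ^ 'n" where "\<And>j. cmod (u $ j) = 1" "\<And>j. z $ j = of_real (cmod (z $ j)) * u $ j"
proof -
  let ?u = "\<chi> j. if z $ j = 0 then 1 else sgn (z $ j)"
  show ?thesis
  proof (rule that[of ?u])
    show "cmod (?u $ j) = 1" for j by (simp add: norm_sgn)
    show "z $ j = of_real (cmod (z $ j)) * ?u $ j" for j by (simp add: sgn_eq)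
  qed
qed

lemma shift_vec_mono:
  fixes t :: "real ^ 'n"
  assumes "\<And>j. 0 \<le> t $ j" "cmod z \<le> x"
  shows "cmod (monom_eval (shift_vec t z) a) \<le> monom_eval (shift_vec t x) a"
  unfolding norm_monom_eval
proof (rule monom_eval_mono)
  fix j
  show "0 \<le> abs_vec (shift_vec t z) $ j" by (simp add: abs_vec_def)
  have "cmod (of_real (t $ j) + z) \<le> t $ j + cmod z"
    using norm_triangle_ineq[of "of_real (t $ j)" z] assms(1)[of j] by simp
  then show "abs_vec (shift_vec t z) $ j \<le> shift_vec t x $ j"
    using assms(2) by (simp add: abs_vec_def shift_vec_def)
qed

definition series_on_ball ::
  "(complex ^ 'n \<Rightarrow> complex ^ 'n \<Rightarrow> complex) \<Rightarrow> (nat ^ 'n \<Rightarrow> real) \<Rightarrow> complex ^ 'n \<Rightarrow> real \<Rightarrow> bool" where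
  "series_on_ball f c x r \<longleftrightarrow> (\<forall>z\<in>ball x r. summable_at c z) \<and>
     (\<forall>z\<in>ball x r. \<forall>w\<in>ball x r. f z w = diagonal_series c z w)"

text \<open>Let \<open>u\<close> be the phases of the centre \<open>x\<close>. At \<open>z = x + \<xi>
  u\<close> and \<open>w = x + \<mu> u\<close> the phases cancel in \<open>z\<^sup>a
  cnj(w\<^sup>a)\<close>, and the series is one in the shifts \<open>\<xi>\<close> and
  \<open>\<mu>\<close> of the moduli of \<open>x\<close>. Landau's theorem in
  \<open>\<xi>\<close> for small \<open>\<mu>\<close>, and then in \<open>\<mu>\<close> for the
  real \<open>\<xi>\<close> reached in this way, yields convergence for \<open>\<xi> =
  \<mu>\<close> up to \<open>\<rho>\<close>. Such points dominate the ball of radius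
  \<open>\<rho>\<close>. The factor \<open>CARD('n)\<close> bounds the norm of \<open>u\<close>;
  what matters is that \<open>\<rho>\<close> depends on the domain only and not on
  \<open>r\<close>.\<close>

lemma series_on_larger_ball:
  fixes f :: "complex ^ 'n \<Rightarrow> complex ^ 'n \<Rightarrow> complex"
  assumes c: "\<And>a. 0 \<le> c a"
    and f1: "\<And>w. w \<in> ball x R \<Longrightarrow> slice_holomorphic (\<lambda>z. f z w) (ball x R)"
    and f2: "\<And>z. z \<in> ball x R \<Longrightarrow> slice_holomorphic (\<lambda>w. cnj (f z w)) (ball x R)"
    and r: "0 < r" "series_on_ball f c x r" and \<rho>: "0 < \<rho>" "of_nat CARD('n) * \<rho> \<le> R"
  shows "series_on_ball f c x \<rho>"
proof -
  obtain u :: "complex ^ 'n" where u: "\<And>j. cmod (u $ j) = 1" "\<And>j. x $ j = of_real (cmod (x $ j)) * u $ j"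
    using unimodular_phase by blast
  define t where "t = abs_vec x"
  have t0: "0 \<le> t $ j" for j by (simp add: t_def abs_vec_def)
  have pt: "x + z *s u = (\<chi> j. u $ j * shift_vec t z $ j)" for z
    using u(2) by (simp add: Finite_Cartesian_Product.vec_eq_iff shift_vec_def t_def abs_vec_def algebra_simps)
  have mon: "monom_eval (x + z *s u) a = monom_eval u a * monom_eval (shift_vec t z) a" for z a
    unfolding pt by (simp add: monom_eval_def power_mult_distrib prod.distrib)
  have "monom_eval (abs_vec u) a = 1" for a by (simp add: monom_eval_def abs_vec_def u)
  then have unit: "monom_eval u a * cnj (monom_eval u a) = 1" for a
    unfolding complex_norm_square[symmetric] norm_monom_eval by simp
  have pair: "of_real (c a) * monom_eval (x + z *s u) a * cnj (monom_eval (x + w *s u) a) =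
      of_real (c a) * monom_eval (shift_vec t z) a * cnj (monom_eval (shift_vec t w) a)" for z w a
  proof -
    have "of_real (c a) * monom_eval (x + z *s u) a * cnj (monom_eval (x + w *s u) a) =
      (monom_eval u a * cnj (monom_eval u a)) * (of_real (c a) * monom_eval (shift_vec t z) a * cnj (monom_eval (shift_vec t w) a))"
      by (simp add: mon mult_ac)
    then show ?thesis by (simp add: unit)
  qed
  \<comment> \<open>Shifts by less than \<open>r'\<close> stay in the ball where the expansion is known.\<close>
  define r' where "r' = min (r / of_nat CARD('n)) \<rho>"
  have r': "0 < r'" "r' \<le> \<rho>" "of_nat CARD('n) * r' \<le> r" using r \<rho> by (auto simp: r'_def min_def field_simps)
  have inball: "x + z *s u \<in> ball x q" if "of_nat CARD('n) * s \<le> q" "cmod z < s" for z q s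
  proof -
    have "norm (z *s u) \<le> of_nat CARD('n) * cmod z" by (rule norm_le_CARD) (simp add: norm_mult u)
    also have "\<dots> < of_nat CARD('n) * s" using that by simp
    finally show ?thesis using that by (simp add: dist_norm)
  qed
  have R1: "x + z *s u \<in> ball x R" if "cmod z < \<rho>" for z using inball[OF \<rho>(2) that] .
  have r1: "x + z *s u \<in> ball x r" if "cmod z < r'" for z using inball[OF r'(3) that] .
  have Rsub: "ball 0 \<rho> \<subseteq> {h. x + h *s u \<in> ball x R}" using R1 by auto
  have G1: "(\<lambda>z. f (x + z *s u) w) holomorphic_on ball 0 \<rho>" if "w \<in> ball x R" for w
    using f1[OF that] unfolding slice_holomorphic_def by (blast intro: holomorphic_on_subset[OF _ Rsub])
  have G2: "(\<lambda>w. cnj (f z (x + w *s u))) holomorphic_on ball 0 \<rho>" if "z \<in> ball x R" for z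
    using f2[OF that] unfolding slice_holomorphic_def by (blast intro: holomorphic_on_subset[OF _ Rsub])
  have good: "((\<lambda>a. of_real (c a) * monom_eval (shift_vec t z) a * cnj (monom_eval (shift_vec t w) a))
      has_sum f (x + z *s u) (x + w *s u)) UNIV" if "cmod z < r'" "cmod w < r'" for z w
    using has_sum_diagonal_series[of c "x + z *s u" "x + w *s u", OF c] r(2) r1[OF that(1)] r1[OF that(2)]
    unfolding series_on_ball_def pair by simp
  \<comment> \<open>Landau's theorem in the first variable, for a small real shift \<open>\<mu>\<close> of the second.\<close>
  have step1: "(\<lambda>a. c a * monom_eval (shift_vec t \<mu>) a * monom_eval (shift_vec t y) a) summable_on UNIV"
    if y: "0 \<le> y" "y < \<rho>" and \<mu>: "0 \<le> \<mu>" "\<mu> < r'" for y \<mu> :: real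
  proof (rule Landau_shift[where \<epsilon> = r' and \<rho> = \<rho> and G = "\<lambda>z. f (x + z *s u) (x + of_real \<mu> *s u)"])
    show "0 \<le> c a * monom_eval (shift_vec t \<mu>) a" for a
      using c t0 \<mu> by (intro mult_nonneg_nonneg monom_eval_nonneg) (auto simp: shift_vec_def)
    show "(\<lambda>z. f (x + z *s u) (x + of_real \<mu> *s u)) holomorphic_on ball 0 \<rho>"
      using R1[of "of_real \<mu>"] \<mu> r' by (intro G1) auto
    show "((\<lambda>a. of_real (c a * monom_eval (shift_vec t \<mu>) a) * monom_eval (shift_vec t z) a) has_sum
         f (x + z *s u) (x + of_real \<mu> *s u)) UNIV" if "cmod z < r'" for z
      using good[OF that, of "of_real \<mu>"] \<mu> by (simp add: monom_eval_shift_of_real mult_ac)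
  qed (use t0 y r' in auto)
  \<comment> \<open>The expansion is needed for complex \<open>w\<close> before the roles of the variables can be exchanged.\<close>
  have step1': "((\<lambda>a. of_real (c a) * monom_eval (shift_vec t z) a * cnj (monom_eval (shift_vec t w) a))
      has_sum f (x + z *s u) (x + w *s u)) UNIV" if z: "cmod z < \<rho>" and w: "cmod w < r'" for z w
  proof -
    let ?g = "\<lambda>a z. of_real (c a) * monom_eval (shift_vec t z) a * cnj (monom_eval (shift_vec t w) a)"
    have bound: "cmod (?g a v) \<le> c a * monom_eval (shift_vec t (cmod w)) a * monom_eval (shift_vec t y) a"
      if "cmod v \<le> y" for a v y
    proof -
      have "cmod (?g a v) = c a * (cmod (monom_eval (shift_vec t w) a) * cmod (monom_eval (shift_vec t v) a))"
        by (simp add: norm_mult c)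
      also have "\<dots> \<le> c a * (monom_eval (shift_vec t (cmod w)) a * monom_eval (shift_vec t y) a)"
        using that t0 by (intro mult_left_mono mult_mono shift_vec_mono c monom_eval_nonneg) (auto simp: shift_vec_def)
      finally show ?thesis by (simp add: mult.assoc)
    qed
    have sm: "(\<lambda>a. ?g a v) summable_on UNIV" if "cmod v < \<rho>" for v
      by (rule abs_summable_summable,
          rule Infinite_Sum.abs_summable_on_comparison_test'[OF step1[of "cmod v" "cmod w"] bound]) (use that w in auto)
    have "infsum (\<lambda>a. ?g a z) UNIV = f (x + z *s u) (x + w *s u)"
    proof (rule analytic_continuation_open[of "ball 0 r'" "ball 0 \<rho>" "\<lambda>z. infsum (\<lambda>a. ?g a z) UNIV"
          "\<lambda>z. f (x + z *s u) (x + w *s u)"])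
      show "(\<lambda>z. infsum (\<lambda>a. ?g a z) UNIV) holomorphic_on ball 0 \<rho>"
      proof (rule series_holomorphic)
        show "?g a holomorphic_on UNIV" for a
          unfolding monom_eval_def shift_vec_def by (auto intro!: holomorphic_intros)
        fix v :: complex assume "v \<in> ball 0 \<rho>"
        then have v: "cmod v < \<rho>" by simp
        define y where "y = (cmod v + \<rho>) / 2"
        have "cmod p \<le> y" if "p \<in> cball v ((\<rho> - cmod v) / 2)" for p
          using that norm_triangle_sub[of p v] by (simp add: y_def dist_norm norm_minus_commute field_simps)
        then have "\<forall>a. \<forall>p\<in>cball v ((\<rho> - cmod v) / 2). cmod (?g a p) \<le>
            c a * monom_eval (shift_vec t (cmod w)) a * monom_eval (shift_vec t y) a" using bound by blast
        moreover have "(\<lambda>a. c a * monom_eval (shift_vec t (cmod w)) a * monom_eval (shift_vec t y) a) summable_on UNIV"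
        proof (rule step1)
          show "0 \<le> y" "y < \<rho>" using v norm_ge_zero[of v] \<rho>(1) by (simp_all add: y_def)
        qed (use w in auto)
        ultimately show "\<exists>\<delta>>0. \<exists>M. M summable_on UNIV \<and> (\<forall>a. \<forall>p\<in>cball v \<delta>. cmod (?g a p) \<le> M a)"
          using v by (intro exI[of _ "(\<rho> - cmod v) / 2"] conjI exI) auto
      qed
      show "(\<lambda>z. f (x + z *s u) (x + w *s u)) holomorphic_on ball 0 \<rho>"
        using w r' by (intro G1 R1) auto
      show "infsum (\<lambda>a. ?g a v) UNIV = f (x + v *s u) (x + w *s u)" if "v \<in> ball 0 r'" for v
        using that w by (intro infsumI good) auto
    qed (use r' \<rho> z in auto)
    with has_sum_infsum[OF sm[OF z]] show ?thesis by simp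
  qed
  \<comment> \<open>Landau's theorem in the second variable, which enters through its conjugate.\<close>
  have step2: "(\<lambda>a. c a * monom_eval (shift_vec t y) a * monom_eval (shift_vec t \<mu>) a) summable_on UNIV"
    if y: "0 \<le> y" "y < \<rho>" and \<mu>: "0 \<le> \<mu>" "\<mu> < \<rho>" for y \<mu> :: real
  proof (rule Landau_shift[where \<epsilon> = r' and \<rho> = \<rho> and G = "\<lambda>w. cnj (f (x + of_real y *s u) (x + w *s u))"])
    show "0 \<le> c a * monom_eval (shift_vec t y) a" for a
      using c t0 y by (intro mult_nonneg_nonneg monom_eval_nonneg) (auto simp: shift_vec_def)
    show "(\<lambda>w. cnj (f (x + of_real y *s u) (x + w *s u))) holomorphic_on ball 0 \<rho>"
      using y by (intro G2 R1) auto
    show "((\<lambda>a. of_real (c a * monom_eval (shift_vec t y) a) * monom_eval (shift_vec t z) a) has_sum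
         cnj (f (x + of_real y *s u) (x + z *s u))) UNIV" if "cmod z < r'" for z
    proof -
      have "((\<lambda>a. cnj (of_real (c a) * monom_eval (shift_vec t (of_real y)) a * cnj (monom_eval (shift_vec t z) a))) has_sum
         cnj (f (x + of_real y *s u) (x + z *s u))) UNIV"
        using step1'[of "of_real y" z] that y by (simp only: has_sum_cnj_iff) auto
      then show ?thesis by (simp add: monom_eval_shift_of_real mult_ac)
    qed
  qed (use t0 \<mu> r' in auto)
  have sum: "summable_at c z" if z: "z \<in> ball x \<rho>" for z
  proof -
    define y where "y = norm (z - x)"
    have y: "0 \<le> y" "y < \<rho>" using z by (auto simp: y_def dist_norm norm_minus_commute)
    have nn: "0 \<le> shift_vec t y $ j" for j using t0 y by (simp add: shift_vec_def)
    have "cmod (z $ j) \<le> cmod ((x + of_real y *s u) $ j)" for j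
    proof -
      have "cmod (z $ j) \<le> cmod (x $ j) + cmod ((z - x) $ j)"
        using norm_triangle_ineq[of "x $ j" "(z - x) $ j"] by simp
      also have "\<dots> \<le> shift_vec t y $ j"
        using Finite_Cartesian_Product.norm_nth_le[of "z - x" j] by (simp add: shift_vec_def t_def abs_vec_def y_def)
      also have "\<dots> = cmod ((x + of_real y *s u) $ j)"
        using nn[of j] unfolding pt by (simp add: norm_mult u shift_vec_def flip: of_real_add)
      finally show ?thesis .
    qed
    moreover have "summable_at c (x + of_real y *s u)"
    proof -
      have "monom_eval (abs_vec (x + of_real y *s u)) a = monom_eval (shift_vec t y) a" for a
        using nn unfolding pt by (simp add: monom_eval_def abs_vec_def norm_mult u shift_vec_def flip: of_real_add)
      then show ?thesis
        using step2[OF y y] by (simp add: summable_at_def power2_eq_square mult.assoc)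
    qed
    ultimately show ?thesis
      using summable_at_mono[of c "x + of_real y *s u" z] c by simp
  qed
  have sub: "ball x \<rho> \<subseteq> ball x R"
  proof -
    have "\<rho> \<le> of_nat CARD('n) * \<rho>" using \<rho>(1) by (simp add: Suc_leI)
    then have "\<rho> \<le> R" using \<rho>(2) by linarith
    then show ?thesis by auto
  qed
  define s where "s = min r \<rho>"
  have s: "0 < s" "ball x s \<subseteq> ball x \<rho>" "ball x s \<subseteq> ball x r" "ball x s \<noteq> {}" using r \<rho> by (auto simp: s_def)
  \<comment> \<open>The identity theorem in the first variable and then in the conjugate of the second.\<close>
  have eq1: "f z w - diagonal_series c z w = 0" if z: "z \<in> ball x \<rho>" and w: "w \<in> ball x s" for z w
  proof (rule identity_convex[OF _ open_ball convex_ball open_ball s(2) s(4) _ z])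
    show "slice_holomorphic (\<lambda>z. f z w - diagonal_series c z w) (ball x \<rho>)"
    proof (intro slice_holomorphic_diff slice_holomorphic_diagonal_series c sum slice_holomorphic_subset[OF f1 sub])
      show "w \<in> ball x \<rho>" "w \<in> ball x R" using w s(2) sub by blast+
    qed auto
    show "f z w - diagonal_series c z w = 0" if "z \<in> ball x s" for z
    proof -
      have "z \<in> ball x r" "w \<in> ball x r" using that w s(3) by blast+
      then show ?thesis using r(2) unfolding series_on_ball_def by simp
    qed
  qed
  have eq2: "cnj (f z w) - diagonal_series c w z = 0" if z: "z \<in> ball x \<rho>" and w: "w \<in> ball x \<rho>" for z w
  proof (rule identity_convex[OF _ open_ball convex_ball open_ball s(2) s(4) _ w])
    show "slice_holomorphic (\<lambda>w. cnj (f z w) - diagonal_series c w z) (ball x \<rho>)"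
    proof (intro slice_holomorphic_diff slice_holomorphic_diagonal_series c sum slice_holomorphic_subset[OF f2 sub])
      show "z \<in> ball x \<rho>" "z \<in> ball x R" using z sub by blast+
    qed auto
    show "cnj (f z w) - diagonal_series c w z = 0" if "w \<in> ball x s" for w
      using eq1[OF z that] cnj_diagonal_series[of c z w] by simp
  qed
  have "f z w = diagonal_series c z w" if "z \<in> ball x \<rho>" "w \<in> ball x \<rho>" for z w
    using eq2[OF that] cnj_diagonal_series[of c z w] by (metis complex_cnj_cnj right_minus_eq)
  with sum show ?thesis unfolding series_on_ball_def by blast
qed

text \<open>The set of centres of balls on which the expansion holds is open, contains \<open>0\<close>,
  and is relatively closed by \<open>series_on_larger_ball\<close>. This gives convergence on
  \<open>\<Omega>\<close>, but the identity only near the diagonal; the identity theorem in one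
  variable after the other extends it to \<open>\<Omega> \<times> \<Omega>\<close>.\<close>

theorem diagonal_kernel_series:
  fixes \<Omega> :: "(complex ^ 'n) set"
  assumes O: "open \<Omega>" "connected \<Omega>" "0 \<in> \<Omega>" and f: "normalized_diagonal_holomorphic_kernel \<Omega> f c"
  shows "\<forall>z\<in>\<Omega>. summable_at c z" "\<forall>z\<in>\<Omega>. \<forall>w\<in>\<Omega>. f z w = diagonal_series c z w"
proof -
  from f obtain r0 where r0: "r0 > 0"
    "\<And>z w. norm z < r0 \<Longrightarrow> norm w < r0 \<Longrightarrow>
        ((\<lambda>a. complex_of_real (c a) * monom_eval z a * cnj (monom_eval w a)) has_sum f z w) UNIV"
    unfolding normalized_diagonal_holomorphic_kernel_def by blast
  have c: "0 \<le> c a" for a using f unfolding normalized_diagonal_holomorphic_kernel_def by (simp add: less_imp_le)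
  have f1: "slice_holomorphic (\<lambda>z. f z w) \<Omega>" if "w \<in> \<Omega>" for w
    using f that unfolding normalized_diagonal_holomorphic_kernel_def by (blast intro: slice_holomorphic_Cd)
  have f2: "slice_holomorphic (\<lambda>w. cnj (f z w)) \<Omega>" if "z \<in> \<Omega>" for z
    using f that unfolding normalized_diagonal_holomorphic_kernel_def by (blast intro: slice_holomorphic_Cd)
  obtain R0 where R0: "R0 > 0" "ball 0 R0 \<subseteq> \<Omega>" using O openE by blast
  define r where "r = min r0 R0"
  have r: "r > 0" "ball 0 r \<subseteq> \<Omega>" using r0 R0 by (auto simp: r_def)
  have init: "series_on_ball f c 0 r"
    unfolding series_on_ball_def
  proof (intro conjI ballI)
    fix z :: "complex ^ 'n" assume z: "z \<in> ball 0 r"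
    have *: "((\<lambda>a. complex_of_real (c a) * monom_eval z a * cnj (monom_eval z a)) has_sum f z z) UNIV"
      using z by (intro r0) (auto simp: r_def)
    have "complex_of_real (c a) * monom_eval z a * cnj (monom_eval z a) =
        of_real (c a * (monom_eval (abs_vec z) a)\<^sup>2)" for a
      by (simp add: mult.assoc norm_monom_eval flip: complex_norm_square)
    then have "((\<lambda>a. complex_of_real (c a * (monom_eval (abs_vec z) a)\<^sup>2)) has_sum f z z) UNIV"
      using * by (simp only:)
    from has_sum_Re[OF this] show "summable_at c z"
      unfolding summable_at_def summable_on_def by (simp only: Re_complex_of_real) blast
    fix w :: "complex ^ 'n" assume w: "w \<in> ball 0 r"
    show "f z w = diagonal_series c z w"
      unfolding diagonal_series_def using z w by (intro infsumI[symmetric] r0) (auto simp: r_def)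
  qed
  define N where "N = real CARD('n)"
  have N: "N \<ge> 1" unfolding N_def by (simp add: Suc_leI)
  define A where "A = {x\<in>\<Omega>. \<exists>s>0. ball x s \<subseteq> \<Omega> \<and> series_on_ball f c x s}"
  have "A = \<Omega>"
  proof (rule connected_propagation)
    show "connected \<Omega>" "A \<subseteq> \<Omega>" using O by (auto simp: A_def)
    have "0 \<in> A" unfolding A_def using O(3) r init by blast
    then show "A \<noteq> {}" by blast
    show "open A"
      unfolding open_contains_ball
    proof
      fix x assume "x \<in> A"
      then obtain s where s: "s > 0" "ball x s \<subseteq> \<Omega>" "series_on_ball f c x s" by (auto simp: A_def)
      have "y \<in> A" if y: "y \<in> ball x s" for y
      proof -
        have *: "ball y (s - dist x y) \<subseteq> ball x s" using ball_subset_ball_iff[of y "s - dist x y" x s]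
          by (simp add: dist_commute)
        then have "series_on_ball f c y (s - dist x y)" using s(3) unfolding series_on_ball_def by blast
        moreover have "0 < s - dist x y" using y by simp
        ultimately show ?thesis unfolding A_def using * s(2) y by blast
      qed
      then show "\<exists>e>0. ball x e \<subseteq> A" using s(1) by blast
    qed
    fix z assume "z \<in> \<Omega>"
    then obtain R where R: "R > 0" "ball z R \<subseteq> \<Omega>" using O(1) openE by blast
    \<comment> \<open>Balls of radius \<open>R / 2\<close> around points near \<open>z\<close> stay in \<open>\<Omega>\<close>, and so the expansion holds on balls of the fixed radius \<open>\<rho>\<close>.\<close>
    define \<rho> where "\<rho> = R / 2 / N"
    have \<rho>: "0 < \<rho>" "N * \<rho> = R / 2" "\<rho> \<le> R / 2" using R N by (auto simp: \<rho>_def field_simps)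
    show "\<exists>\<delta>>0. \<forall>x\<in>A. dist z x < \<delta> \<longrightarrow> z \<in> A"
    proof (intro exI conjI ballI impI)
      fix x assume x: "x \<in> A" "dist z x < \<rho>"
      then obtain s where s: "s > 0" "series_on_ball f c x s" by (auto simp: A_def)
      have *: "ball x (R / 2) \<subseteq> ball z R" using ball_subset_ball_iff[of x "R/2" z R] x(2) \<rho>
        by (simp add: dist_commute)
      with R(2) have sub: "ball x (R / 2) \<subseteq> \<Omega>" by blast
      have "series_on_ball f c x \<rho>"
      proof (rule series_on_larger_ball[OF c _ _ s])
        show "slice_holomorphic (\<lambda>z. f z w) (ball x (R / 2))" if "w \<in> ball x (R / 2)" for w
          using that sub by (intro slice_holomorphic_subset[OF f1 sub]) auto
        show "slice_holomorphic (\<lambda>w. cnj (f z w)) (ball x (R / 2))" if "z \<in> ball x (R / 2)" for z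
          using that sub by (intro slice_holomorphic_subset[OF f2 sub]) auto
      qed (use \<rho> in \<open>auto simp: N_def\<close>)
      moreover have **: "ball z (\<rho> - dist z x) \<subseteq> ball x \<rho>"
        using ball_subset_ball_iff[of z "\<rho> - dist z x" x \<rho>] by simp
      ultimately have "series_on_ball f c z (\<rho> - dist z x)" unfolding series_on_ball_def by blast
      moreover have "ball z (\<rho> - dist z x) \<subseteq> \<Omega>"
      proof -
        have "ball x \<rho> \<subseteq> ball x (R / 2)" using \<rho>(3) by auto
        with ** sub show ?thesis by blast
      qed
      moreover have "0 < \<rho> - dist z x" using x by simp
      ultimately show "z \<in> A" unfolding A_def using \<open>z \<in> \<Omega>\<close> by blast
    qed (rule \<rho>)
  qed
  then show sum: "\<forall>z\<in>\<Omega>. summable_at c z"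
    unfolding A_def series_on_ball_def using centre_in_ball by blast
  have ne: "ball 0 r \<noteq> ({} :: (complex ^ 'n) set)" using r by auto
  have eq1: "f z w - diagonal_series c z w = 0" if z: "z \<in> \<Omega>" and w: "w \<in> ball 0 r" for z w
  proof (rule identity_connected[OF _ O(1,2) open_ball r(2) ne _ z])
    show "slice_holomorphic (\<lambda>z. f z w - diagonal_series c z w) \<Omega>"
      using w r sum O by (intro slice_holomorphic_diff slice_holomorphic_diagonal_series c f1) auto
    show "f z w - diagonal_series c z w = 0" if "z \<in> ball 0 r" for z
      using that w init unfolding series_on_ball_def by auto
  qed
  have eq2: "cnj (f z w) - diagonal_series c w z = 0" if z: "z \<in> \<Omega>" and w: "w \<in> \<Omega>" for z w
  proof (rule identity_connected[OF _ O(1,2) open_ball r(2) ne _ w])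
    show "slice_holomorphic (\<lambda>w. cnj (f z w) - diagonal_series c w z) \<Omega>"
      using z sum O by (intro slice_holomorphic_diff slice_holomorphic_diagonal_series c f2) auto
    show "cnj (f z w) - diagonal_series c w z = 0" if "w \<in> ball 0 r" for w
      using eq1[OF z that] cnj_diagonal_series[of c z w] by simp
  qed
  have "f z w = diagonal_series c z w" if "z \<in> \<Omega>" "w \<in> \<Omega>" for z w
    using eq2[OF that] cnj_diagonal_series[of c z w] by (metis complex_cnj_cnj right_minus_eq)
  then show "\<forall>z\<in>\<Omega>. \<forall>w\<in>\<Omega>. f z w = diagonal_series c z w" by blast
qed

section \<open>Calculus of diagonal series\<close>

text \<open>Cauchy products: the double series converges absolutely and is regrouped by the sum of the two
  indices.\<close>

lemma has_sum_convolution: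
  fixes F G :: "nat ^ 'n \<Rightarrow> 'a :: {banach, real_normed_field}"
  assumes F: "(F has_sum s) UNIV" "(\<lambda>a. norm (F a)) summable_on UNIV"
    and G: "(G has_sum t) UNIV" "(\<lambda>a. norm (G a)) summable_on UNIV"
  shows "((\<lambda>b. \<Sum>(w, u)\<in>splits b. F w * G u) has_sum s * t) UNIV"
proof -
  define H where "H = (\<lambda>(w, u). F w * G u)"
  have "(\<lambda>p. norm (H p)) summable_on (UNIV \<times> UNIV)"
  proof (rule summable_on_SigmaI)
    show "((\<lambda>u. norm (H (w, u))) has_sum norm (F w) * infsum (\<lambda>u. norm (G u)) UNIV) UNIV" for w
      using has_sum_cmult_right[OF has_sum_infsum[OF G(2)], of "norm (F w)"] by (simp add: H_def norm_mult)
    show "(\<lambda>w. norm (F w) * infsum (\<lambda>u. norm (G u)) UNIV) summable_on UNIV"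
      by (rule summable_on_cmult_left[OF F(2)])
  qed auto
  from abs_summable_summable[OF this] obtain S where S: "(H has_sum S) (UNIV \<times> UNIV)"
    by (auto simp: summable_on_def)
  have row: "((\<lambda>u. H (w, u)) has_sum F w * t) UNIV" for w
    using has_sum_cmult_right[OF G(1), of "F w"] by (simp add: H_def)
  have "((\<lambda>w. F w * t) has_sum S) UNIV" by (rule has_sum_SigmaD[OF S row])
  from has_sum_unique[OF this has_sum_cmult_left[OF F(1), of t]] have St: "S = s * t" .
  have bij: "bij_betw snd (SIGMA b:UNIV. splits b) (UNIV \<times> UNIV :: ((nat ^ 'n) \<times> (nat ^ 'n)) set)"
    by (rule bij_betwI[of _ _ _ "\<lambda>(w, u). (w + u, (w, u))"]) (auto simp: splits_def)
  have "((\<lambda>p. H (snd p)) has_sum S) (SIGMA b:UNIV. splits b)"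
    using S by (simp only: has_sum_reindex_bij_betw[OF bij])
  then have "((\<lambda>b. \<Sum>p\<in>splits b. H p) has_sum S) UNIV"
    by (rule has_sum_SigmaD) (simp add: has_sum_finite)
  then show ?thesis by (simp add: H_def St)
qed

lemma monom_eval_splits: "p \<in> splits b \<Longrightarrow> monom_eval z b = monom_eval z (fst p) * monom_eval z (snd p)"
  by (auto simp: splits_def monom_eval_add)

definition diagonal_term :: "(nat ^ 'n \<Rightarrow> real) \<Rightarrow> complex ^ 'n \<Rightarrow> complex ^ 'n \<Rightarrow> nat ^ 'n \<Rightarrow> complex" where
  "diagonal_term c z w a = complex_of_real (c a) * monom_eval z a * cnj (monom_eval w a)"

lemma diagonal_term_conv:
  "diagonal_term (conv f g) z w b = (\<Sum>(v, u)\<in>splits b. diagonal_term f z w v * diagonal_term g z w u)"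
  unfolding diagonal_term_def conv_def case_prod_beta of_real_sum of_real_mult sum_distrib_right
  by (intro sum.cong refl) (simp add: monom_eval_splits[of _ b] mult_ac)

lemma diagonal_term_self: "diagonal_term c z z a = of_real (c a * (monom_eval (abs_vec z) a)\<^sup>2)"
  by (simp add: diagonal_term_def mult.assoc norm_monom_eval flip: complex_norm_square)

lemma norm_diagonal_term: "cmod (diagonal_term c z w a) = \<bar>c a\<bar> * (monom_eval (abs_vec z) a * monom_eval (abs_vec w) a)"
  by (simp add: diagonal_term_def norm_mult norm_monom_eval)

text \<open>Absolute convergence, for coefficients of arbitrary sign: it is used for \<open>1 -
  \<theta>\<close>.\<close>

definition diagonally_summable :: "(nat ^ 'n \<Rightarrow> real) \<Rightarrow> complex ^ 'n \<Rightarrow> complex ^ 'n \<Rightarrow> bool" where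
  "diagonally_summable c z w \<longleftrightarrow> (\<lambda>a. cmod (diagonal_term c z w a)) summable_on UNIV"

lemma diagonal_series_eq: "diagonal_series c z w = infsum (diagonal_term c z w) UNIV"
  by (simp add: diagonal_series_def diagonal_term_def[abs_def])

lemma diagonally_summable_has_sum:
  "diagonally_summable c z w \<Longrightarrow> (diagonal_term c z w has_sum diagonal_series c z w) UNIV"
  unfolding diagonally_summable_def diagonal_series_eq by (rule has_sum_infsum[OF abs_summable_summable])

lemma diagonally_summable_pair:
  assumes "\<And>a. 0 \<le> c a" "summable_at c z" "summable_at c w"
  shows "diagonally_summable c z w"
  using summable_at_pair[OF assms] by (simp add: diagonally_summable_def norm_diagonal_term assms(1))

lemma diagonally_summable_conv:
  assumes "diagonally_summable f z w" "diagonally_summable g z w"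
  shows "diagonally_summable (conv f g) z w"
    and "diagonal_series (conv f g) z w = diagonal_series f z w * diagonal_series g z w"
proof -
  let ?f = "diagonal_term f z w" and ?g = "diagonal_term g z w"
  have "(diagonal_term (conv f g) z w has_sum diagonal_series f z w * diagonal_series g z w) UNIV"
    using has_sum_convolution[OF diagonally_summable_has_sum[OF assms(1)] _ diagonally_summable_has_sum[OF assms(2)]] assms
    by (simp add: diagonally_summable_def flip: diagonal_term_conv)
  then show "diagonal_series (conv f g) z w = diagonal_series f z w * diagonal_series g z w"
    unfolding diagonal_series_eq[of "conv f g"] by (rule infsumI)
  have "((\<lambda>b. \<Sum>(v, u)\<in>splits b. cmod (?f v) * cmod (?g u)) has_sum
      infsum (\<lambda>a. cmod (?f a)) UNIV * infsum (\<lambda>a. cmod (?g a)) UNIV) UNIV"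
    using assms unfolding diagonally_summable_def by (intro has_sum_convolution has_sum_infsum) simp_all
  then have s: "(\<lambda>b. \<Sum>(v, u)\<in>splits b. cmod (?f v) * cmod (?g u)) summable_on UNIV"
    unfolding summable_on_def by blast
  show "diagonally_summable (conv f g) z w"
    unfolding diagonally_summable_def diagonal_term_conv
  proof (rule Infinite_Sum.abs_summable_on_comparison_test'[OF s])
    show "cmod (\<Sum>(v, u)\<in>splits b. ?f v * ?g u) \<le> (\<Sum>(v, u)\<in>splits b. cmod (?f v) * cmod (?g u))" for b
      by (rule order_trans[OF norm_sum]) (simp add: case_prod_beta norm_mult)
  qed
qed

lemma diagonally_summable_unit_minus:
  assumes "diagonally_summable c z w"
  shows "diagonally_summable (unit_minus c) z w"
    and "diagonal_series (unit_minus c) z w = 1 - diagonal_series c z w"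
proof -
  let ?e = "\<lambda>a :: nat ^ 'n. if a = 0 then 1 else 0 :: complex"
  have unit_term: "diagonal_term (unit_minus c) z w a = ?e a - diagonal_term c z w a" for a
    by (simp add: diagonal_term_def unit_minus_def algebra_simps)
  have e: "(?e has_sum 1) UNIV" by (rule has_sum_finite_neutralI[of "{0}"]) auto
  have "(diagonal_term (unit_minus c) z w has_sum 1 - diagonal_series c z w) UNIV"
    using has_sum_add[OF e has_sum_uminusI[OF diagonally_summable_has_sum[OF assms]]] by (simp add: unit_term[abs_def])
  then show "diagonal_series (unit_minus c) z w = 1 - diagonal_series c z w"
    unfolding diagonal_series_eq[of "unit_minus c"] by (rule infsumI)
  have "(\<lambda>a :: nat ^ 'n. if a = 0 then 1 else 0 :: real) summable_on UNIV"
    by (rule has_sum_imp_summable[OF has_sum_finite_neutralI[of "{0}"]]) auto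
  from summable_on_add[OF this assms[unfolded diagonally_summable_def]]
  show "diagonally_summable (unit_minus c) z w"
    unfolding diagonally_summable_def
  proof (rule Infinite_Sum.abs_summable_on_comparison_test')
    show "cmod (diagonal_term (unit_minus c) z w a) \<le> (if a = 0 then 1 else 0) + cmod (diagonal_term c z w a)" for a
      unfolding unit_term using norm_triangle_ineq4[of "?e a" "diagonal_term c z w a"] by (simp split: if_splits)
  qed
qed

lemma diagonally_summable_self: "(\<And>a. 0 \<le> c a) \<Longrightarrow> diagonally_summable c z z \<longleftrightarrow> summable_at c z"
  by (simp add: diagonally_summable_def norm_diagonal_term summable_at_def power2_eq_square)

text \<open>The value of the diagonal series at a pair of equal points, as a real number.\<close>

definition square_series :: "(nat ^ 'n \<Rightarrow> real) \<Rightarrow> complex ^ 'n \<Rightarrow> real" where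
  "square_series c z = infsum (\<lambda>a. c a * (monom_eval (abs_vec z) a)\<^sup>2) UNIV"

lemma square_series_has_sum: "summable_at c z \<Longrightarrow> ((\<lambda>a. c a * (monom_eval (abs_vec z) a)\<^sup>2) has_sum square_series c z) UNIV"
  by (simp add: summable_at_def square_series_def)

lemma diagonal_series_self:
  assumes "summable_at c z"
  shows "diagonal_series c z z = of_real (square_series c z)"
proof -
  have "diagonal_term c z z = (\<lambda>a. of_real (c a * (monom_eval (abs_vec z) a)\<^sup>2))"
    by (simp add: fun_eq_iff diagonal_term_self)
  then show ?thesis
    unfolding diagonal_series_eq by (simp only: infsumI[OF has_sum_of_real[OF square_series_has_sum[OF assms]]])
qed

lemma square_series_ge:
  assumes "\<And>a. 0 \<le> c a" "summable_at c z"
  shows "c 0 \<le> square_series c z"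
  using has_sum_mono_neutral[OF has_sum_finite[of "{0}" "\<lambda>a. c a * (monom_eval (abs_vec z) a)\<^sup>2"]
      square_series_has_sum[OF assms(2)]] assms(1) by simp

lemma norm_diagonal_series_le:
  assumes c: "\<And>a. 0 \<le> c a" and z: "summable_at c z" and w: "summable_at c w"
  shows "cmod (diagonal_series c z w) \<le> (square_series c z + square_series c w) / 2"
proof -
  have s: "((\<lambda>a. c a * (monom_eval (abs_vec z) a)\<^sup>2 / 2 + c a * (monom_eval (abs_vec w) a)\<^sup>2 / 2) has_sum
      square_series c z / 2 + square_series c w / 2) UNIV"
    by (intro has_sum_add has_sum_divide_const square_series_has_sum z w)
  have "cmod (diagonal_term c z w a) \<le> c a * (monom_eval (abs_vec z) a)\<^sup>2 / 2 + c a * (monom_eval (abs_vec w) a)\<^sup>2 / 2" for a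
  proof -
    have "c a * (2 * monom_eval (abs_vec z) a * monom_eval (abs_vec w) a) \<le>
        c a * ((monom_eval (abs_vec z) a)\<^sup>2 + (monom_eval (abs_vec w) a)\<^sup>2)"
      by (intro mult_left_mono sum_squares_bound c)
    then show ?thesis by (simp add: norm_diagonal_term c algebra_simps)
  qed
  then have "cmod (diagonal_series c z w) \<le> square_series c z / 2 + square_series c w / 2"
    by (rule norm_infsum_le[OF diagonally_summable_has_sum[OF diagonally_summable_pair] s, OF c z w])
  then show ?thesis by (simp add: add_divide_distrib)
qed

text \<open>Each term is a nonnegative multiple of a rank one kernel.\<close>

lemma is_kernel_diagonal_series:
  assumes c: "\<And>a. 0 \<le> c a" and X: "\<And>z. z \<in> X \<Longrightarrow> summable_at c z"
  shows "is_kernel X (diagonal_series c)"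
proof (rule is_kernelI)
  fix F v assume F: "finite F" "F \<subseteq> X"
  let ?t = "\<lambda>a. c a * (cmod (\<Sum>x\<in>F. v x * cnj (monom_eval x a)))\<^sup>2"
  have "kform F (\<lambda>z w. diagonal_term c z w a) v = of_real (?t a)" for a
  proof -
    have "kform F (\<lambda>z w. diagonal_term c z w a) v =
        of_real (c a) * kform F (\<lambda>z w. monom_eval z a * cnj (monom_eval w a)) v"
      by (simp add: kform_def diagonal_term_def sum_distrib_left mult_ac)
    then show ?thesis by (simp add: kform_rank_one')
  qed
  moreover have "((\<lambda>a. kform F (\<lambda>z w. diagonal_term c z w a) v) has_sum kform F (diagonal_series c) v) UNIV"
    unfolding kform_def
    using F X by (intro has_sum_finite_sum has_sum_cmult_right diagonally_summable_has_sum diagonally_summable_pair c) auto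
  ultimately have s: "((\<lambda>a. complex_of_real (?t a)) has_sum kform F (diagonal_series c) v) UNIV" by simp
  have "0 \<le> Re (kform F (diagonal_series c) v)"
    using has_sum_Re[OF s] by (rule has_sum_nonneg) (simp add: c)
  moreover have "Im (kform F (diagonal_series c) v) = 0"
    using has_sum_Im[OF s] has_sum_0 has_sum_unique by (metis (no_types, lifting) Im_complex_of_real has_sum_0 has_sum_unique)
  ultimately show "0 \<le> kform F (diagonal_series c) v" by (simp add: less_eq_complex_def)
qed

section \<open>Domains of convergence and the characterization\<close>

lemma power_series_mult_cnj: "power_series c (mult_cnj z w) = diagonal_series c z w"
  by (simp add: power_series_def diagonal_series_def monom_eval_mult_cnj mult.assoc)

lemma one_minus_series_invertible_iff:
  assumes c: "\<And>a. 0 \<le> c a"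
  shows "one_minus_series_invertible \<Omega> c \<longleftrightarrow>
    (\<forall>z\<in>\<Omega>. summable_at c z) \<and> (\<forall>z\<in>\<Omega>. \<forall>w\<in>\<Omega>. 1 - diagonal_series c z w \<noteq> 0)"
proof -
  have term_eq: "complex_of_real (c a) * monom_eval (mult_cnj z w) a = diagonal_term c z w a" for z w a
    by (simp add: diagonal_term_def monom_eval_mult_cnj mult.assoc)
  have "diagonal_term c z z summable_on UNIV \<longleftrightarrow> summable_at c z" for z
    unfolding diagonally_summable_self[of c, OF c, symmetric] diagonally_summable_def
    by (rule summable_on_iff_abs_summable_on_complex)
  moreover have "diagonal_term c z w summable_on UNIV" if "summable_at c z" "summable_at c w" for z w
    using diagonally_summable_pair[of c, OF c that] unfolding diagonally_summable_def by (rule abs_summable_summable)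
  ultimately show ?thesis
    unfolding one_minus_series_invertible_def term_eq power_series_mult_cnj by blast
qed

lemma conv_domain_iff: "x \<in> conv_domain c \<longleftrightarrow> (\<exists>r>0. \<forall>y\<in>ball x r. summable_at c y)"
  unfolding conv_domain_def summable_at_def by (fastforce simp: dist_norm)

lemma conv_domain_lt1_iff:
  assumes "c 0 = 0"
  shows "x \<in> conv_domain_lt1 c \<longleftrightarrow> x \<in> conv_domain c \<and> square_series c x < 1"
proof -
  have "(\<Sum>\<^sub>\<infinity>a\<in>-{0}. c a * (monom_eval (abs_vec x) a)\<^sup>2) = square_series c x"
    unfolding square_series_def by (rule infsum_cong_neutral) (auto simp: assms)
  then show ?thesis by (simp add: conv_domain_lt1_def)
qed

lemma continuous_on_square_series:
  assumes c: "\<And>a. 0 \<le> c a" and U: "open U" "\<And>z. z \<in> U \<Longrightarrow> summable_at c z"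
  shows "continuous_on U (square_series c)"
proof -
  have "continuous (at x) (square_series c)" if x: "x \<in> U" for x
  proof -
    from dominating_point[OF U(1) x] obtain \<eta> y' where \<eta>: "\<eta> > 0"
      and y': "\<And>j. cmod (y' $ j) = cmod (x $ j) + \<eta>" "y' \<in> U" by metis
    let ?f = "\<lambda>A z. \<Sum>a\<in>A. c a * (monom_eval (abs_vec z) a)\<^sup>2"
    have bound: "norm (c a * (monom_eval (abs_vec z) a)\<^sup>2) \<le> c a * (monom_eval (abs_vec y') a)\<^sup>2"
      if z: "z \<in> ball x \<eta>" for a z
    proof -
      have "cmod (z $ j) \<le> cmod (y' $ j)" for j
      proof -
        have "cmod (z $ j) \<le> cmod (x $ j) + cmod ((z - x) $ j)"
          using norm_triangle_ineq[of "x $ j" "(z - x) $ j"] by simp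
        moreover have "cmod ((z - x) $ j) \<le> \<eta>"
          using Finite_Cartesian_Product.norm_nth_le[of "z - x" j] z by (simp add: dist_norm norm_minus_commute)
        ultimately show ?thesis unfolding y' by linarith
      qed
      then have "monom_eval (abs_vec z) a \<le> monom_eval (abs_vec y') a"
        by (intro monom_eval_mono) (auto simp: abs_vec_def)
      then show ?thesis using c[of a] by (simp add: abs_mult mult_left_mono power_mono)
    qed
    have ul: "uniform_limit (ball x \<eta>) ?f (\<lambda>z. infsum (\<lambda>a. c a * (monom_eval (abs_vec z) a)\<^sup>2) UNIV) (finite_subsets_at_top UNIV)"
      by (rule Weierstrass_m_test_general[OF bound U(2)[OF y'(2), unfolded summable_at_def]])
    have cont: "\<forall>\<^sub>F A in finite_subsets_at_top UNIV. continuous_on (ball x \<eta>) (?f A)"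
      unfolding monom_eval_def abs_vec_def by (intro always_eventually allI) (auto intro!: continuous_intros)
    have "continuous_on (ball x \<eta>) (square_series c)"
      unfolding square_series_def[abs_def]
      by (rule uniform_limit_theorem[OF cont ul finite_subsets_at_top_neq_bot])
    then show ?thesis using \<eta> by (simp add: continuous_on_eq_continuous_at)
  qed
  then show ?thesis by (simp add: continuous_at_imp_continuous_on)
qed

lemma finite_mdeg_le: "finite {a :: nat ^ 'n. mdeg a \<le> n}"
proof (rule finite_subset[OF _ finite_multi_index_below[of "\<chi> j. n"]], clarify)
  fix a :: "nat ^ 'n" assume "mdeg a \<le> n"
  moreover have "a $ j \<le> mdeg a" for j unfolding mdeg_def by (rule member_le_sum) auto
  ultimately have "a + (\<chi> j. n - a $ j) = (\<chi> j. n)"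
    by (auto simp: Finite_Cartesian_Product.vec_eq_iff intro!: le_add_diff_inverse intro: order_trans)
  then show "\<exists>u. a + u = (\<chi> j. n)" ..
qed

text \<open>For the sums \<open>K\<close> of \<open>c\<close> over multi-indices of degree at most
  \<open>n\<close> the hypothesis gives \<open>K \<le> 1 + \<theta>(y) K\<close>, because both
  parts of a splitting have degree at most \<open>n\<close>.\<close>

lemma summable_at_renewal:
  assumes c: "\<And>a. 0 \<le> c a" "c 0 = 1" and \<theta>: "\<And>a. 0 \<le> \<theta> a"
    and le: "\<And>b. b \<noteq> 0 \<Longrightarrow> c b \<le> conv \<theta> c b"
    and y: "summable_at \<theta> y" "square_series \<theta> y < 1"
  shows "summable_at c y"
  unfolding summable_at_def
proof (rule nonneg_bounded_partial_sums_imp_summable_on)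
  let ?M = "\<lambda>a. (monom_eval (abs_vec y) a)\<^sup>2"
  let ?X = "\<lambda>a. c a * ?M a" and ?T = "\<lambda>a. \<theta> a * ?M a"
  show "0 \<le> ?X a" for a using c by simp
  have X0: "0 \<le> ?X a" "0 \<le> ?T a" for a using c \<theta> by simp_all
  have le': "?X b \<le> (if b = 0 then 1 else 0) + (\<Sum>(w, u)\<in>splits b. ?T w * ?X u)" for b
  proof -
    have conv: "(\<Sum>(w, u)\<in>splits b. ?T w * ?X u) = conv \<theta> c b * ?M b"
      unfolding conv_def sum_distrib_right case_prod_beta
      by (intro sum.cong refl) (simp add: monom_eval_splits[of _ b] power_mult_distrib mult_ac)
    show ?thesis
    proof (cases "b = 0")
      case True
      have "0 \<le> (\<Sum>(w, u)\<in>splits b. ?T w * ?X u)" using X0 by (intro sum_nonneg) auto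
      then show ?thesis using True c(2) by simp
    next
      case False
      then show ?thesis unfolding conv using le[OF False] by (simp add: mult_right_mono)
    qed
  qed
  have bound: "sum ?X A \<le> 1 / (1 - square_series \<theta> y)" if A: "finite A" for A
  proof -
    define n where "n = (\<Sum>a\<in>A. mdeg a)"
    let ?L = "{a :: nat ^ 'n. mdeg a \<le> n}"
    have AL: "A \<subseteq> ?L" using A by (auto simp: n_def intro: member_le_sum)
    have L0: "0 \<in> ?L" by (simp add: mdeg_def)
    have "sum ?X ?L \<le> (\<Sum>b\<in>?L. (if b = 0 then 1 else 0) + (\<Sum>(w, u)\<in>splits b. ?T w * ?X u))"
      by (intro sum_mono le')
    also have "\<dots> = 1 + (\<Sum>b\<in>?L. \<Sum>(w, u)\<in>splits b. ?T w * ?X u)"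
      using L0 by (simp add: sum.distrib finite_mdeg_le)
    also have "(\<Sum>b\<in>?L. \<Sum>(w, u)\<in>splits b. ?T w * ?X u) = (\<Sum>(b, p)\<in>Sigma ?L splits. ?T (fst p) * ?X (snd p))"
      by (subst sum.Sigma) (auto simp: finite_mdeg_le case_prod_beta)
    also have "\<dots> \<le> (\<Sum>(w, u)\<in>?L \<times> ?L. ?T w * ?X u)"
    proof -
      have "(\<Sum>(b, p)\<in>Sigma ?L splits. ?T (fst p) * ?X (snd p)) = (\<Sum>(w, u)\<in>snd ` Sigma ?L splits. ?T w * ?X u)"
        by (subst sum.reindex) (auto simp: inj_on_def splits_def case_prod_beta)
      also have "\<dots> \<le> (\<Sum>(w, u)\<in>?L \<times> ?L. ?T w * ?X u)"
        using X0 by (intro sum_mono2) (auto simp: finite_mdeg_le splits_def mdeg_add)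
      finally show ?thesis .
    qed
    also have "\<dots> = sum ?T ?L * sum ?X ?L"
      by (simp only: sum_product sum.cartesian_product)
    also have "\<dots> \<le> square_series \<theta> y * sum ?X ?L"
      using X0 finite_mdeg_le has_sum_mono_neutral[OF has_sum_finite[of ?L ?T] square_series_has_sum[OF y(1)]]
      by (intro mult_right_mono sum_nonneg) auto
    finally have "sum ?X ?L \<le> 1 / (1 - square_series \<theta> y)" using y(2) by (simp add: field_simps)
    moreover have "sum ?X A \<le> sum ?X ?L" using AL X0 by (intro sum_mono2 finite_mdeg_le) auto
    ultimately show ?thesis by simp
  qed
  show "\<forall>\<^sub>F A in finite_subsets_at_top UNIV. sum ?X A \<le> 1 / (1 - square_series \<theta> y)"
    using bound by (auto intro: eventually_finite_subsets_at_top_weakI)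
qed

text \<open>From \<open>\<theta>\<^sub>b c\<^sub>0 \<le> (\<theta> c)\<^sub>b \<le> c\<^sub>b\<close> the
  series \<open>\<theta>\<close> converges where \<open>c\<close> does. There, \<open>(1 -
  \<theta>) c\<close> is at least its constant term one, and \<open>c \<ge> 1\<close>, so that
  \<open>1 - \<theta> > 0\<close>.\<close>

lemma certificate_below:
  assumes \<theta>: "\<And>a. 0 \<le> \<theta> a" "\<theta> 0 = 0" and c: "\<And>a. 0 \<le> c a" "c 0 = 1"
    and G: "\<And>b. 0 \<le> conv (unit_minus \<theta>) c b" and y: "summable_at c y"
  shows "summable_at \<theta> y" "square_series \<theta> y < 1"
proof -
  have le: "\<theta> b \<le> c b" for b
  proof -
    have "\<theta> b * c 0 \<le> conv \<theta> c b"
      unfolding conv_def using member_le_sum[of "(b, 0)" "splits b" "\<lambda>(w, u). \<theta> w * c u"] \<theta> c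
      using finite_splits[of b] by (auto simp: splits_def simp del: finite_splits)
    then show ?thesis using G[of b] by (simp add: conv_unit_minus c)
  qed
  show s: "summable_at \<theta> y"
    using y unfolding summable_at_def
    by (rule summable_on_comparison_test) (auto simp: \<theta> intro!: mult_right_mono le)
  have d: "diagonally_summable c y y" "diagonally_summable \<theta> y y"
    using y s \<theta> c by (auto intro: diagonally_summable_pair)
  note u = diagonally_summable_unit_minus[OF d(2)]
  note p = diagonally_summable_conv[OF u(1) d(1)]
  have sG: "summable_at (conv (unit_minus \<theta>) c) y"
    using diagonally_summable_self[of "conv (unit_minus \<theta>) c", OF G] p(1) by blast
  have "complex_of_real (square_series (conv (unit_minus \<theta>) c) y) =
      of_real ((1 - square_series \<theta> y) * square_series c y)"
    using p(2) unfolding u(2) diagonal_series_self[OF sG] diagonal_series_self[OF s] diagonal_series_self[OF y] by simp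
  then have "square_series (conv (unit_minus \<theta>) c) y = (1 - square_series \<theta> y) * square_series c y"
    by (simp only: of_real_eq_iff)
  moreover have "1 \<le> square_series (conv (unit_minus \<theta>) c) y"
    using square_series_ge[of "conv (unit_minus \<theta>) c", OF G sG] by (simp add: conv_zero unit_minus_def \<theta> c)
  moreover have "1 \<le> square_series c y" using square_series_ge[of c, OF c(1) y] c(2) by simp
  ultimately show "square_series \<theta> y < 1" by (smt (verit) mult_nonpos_nonneg)
qed

theorem theorem1p6:
  fixes \<Omega> :: "(complex ^ 'n) set"
    and k l :: "complex ^ 'n \<Rightarrow> complex ^ 'n \<Rightarrow> complex"
    and kc lc \<theta> :: "nat ^ 'n \<Rightarrow> real"
  assumes "open \<Omega>" and "connected \<Omega>" and "0 \<in> \<Omega>"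
    and "normalized_diagonal_holomorphic_kernel \<Omega> k kc"
    and "normalized_diagonal_holomorphic_kernel \<Omega> l lc"
    and "\<theta> = master_certificate kc"
  shows "(complete_Pick_pair \<Omega> k l \<longrightarrow>
            \<Omega> \<subseteq> conv_domain lc \<and> conv_domain lc \<subseteq> conv_domain_lt1 \<theta> \<and>
            conv_domain_lt1 \<theta> \<subseteq> conv_domain kc) \<and>
         (complete_Pick_pair \<Omega> k l \<longleftrightarrow> (\<exists>p. Shimorin_certificate \<Omega> k l p)) \<and>
         (complete_Pick_pair \<Omega> k l \<longleftrightarrow> (\<exists>s. strong_Shimorin_certificate \<Omega> k l s)) \<and>
         (complete_Pick_pair \<Omega> k l \<longleftrightarrow>
            one_minus_series_invertible \<Omega> \<theta> \<and>
            strong_Shimorin_certificate \<Omega> k l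
              (\<lambda>z w. 1 / (1 - power_series \<theta> (mult_cnj z w)))) \<and>
         (complete_Pick_pair \<Omega> k l \<longleftrightarrow>
            one_minus_series_invertible \<Omega> \<theta> \<and>
            (\<exists>g. is_kernel \<Omega> g \<and>
               (\<forall>z\<in>\<Omega>. \<forall>w\<in>\<Omega>. l z w = g z w / (1 - power_series \<theta> (mult_cnj z w)))))"
proof -
  have ker: "is_kernel \<Omega> k" "is_kernel \<Omega> l"
    and kc: "0 \<le> kc a" "kc 0 = 1" and lc: "0 \<le> lc a" "lc 0 = 1" for a
    using assms(4,5) by (auto simp: normalized_diagonal_holomorphic_kernel_def less_imp_le)
  have \<theta>: "0 \<le> \<theta> a" "\<theta> 0 = 0" for a
    using master_certificate_nonneg[of kc a] kc(1) by (simp_all add: assms(6))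
  note k_series = diagonal_kernel_series[OF assms(1-3,4)]
  note l_series = diagonal_kernel_series[OF assms(1-3,5)]
  have k_diag: "k z z = of_real (square_series kc z)" "1 \<le> square_series kc z" if "z \<in> \<Omega>" for z
    using that k_series square_series_ge[of kc z] by (auto simp: diagonal_series_self kc)
  have l_diag: "l z z = of_real (square_series lc z)" "1 \<le> square_series lc z" if "z \<in> \<Omega>" for z
    using that l_series square_series_ge[of lc z] by (auto simp: diagonal_series_self lc)
  have nz: "k z z \<noteq> 0" "l z z \<noteq> 0" if "z \<in> \<Omega>" for z
    using k_diag[OF that] l_diag[OF that] by auto
  have k0: "k z 0 = 1" if "z \<in> \<Omega>" for z
  proof -
    have "(diagonal_term kc z 0 has_sum 1) UNIV"
      by (rule has_sum_finite_neutralI[of "{0}"]) (auto simp: diagonal_term_def kc monom_eval_zero)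
    then show ?thesis using k_series(2) that assms(3) by (simp add: diagonal_series_eq infsumI)
  qed
  \<comment> \<open>The coefficients of \<open>g = (1 - \<theta>) l\<close> and of \<open>h = 1 - (1 - \<theta>) k\<close>.\<close>
  let ?G = "conv (unit_minus \<theta>) lc"
  let ?H = "\<lambda>b. if b = 0 then 0 else - conv (unit_minus \<theta>) kc b"
  have le: "kc b \<le> conv \<theta> kc b" if "b \<noteq> 0" for b
    using conv_master_certificate(1)[of kc b] kc that by (simp add: assms(6))
  let ?s = "\<lambda>z w. 1 / (1 - power_series \<theta> (mult_cnj z w))"
  let ?v = "one_minus_series_invertible \<Omega> \<theta> \<and>
            (\<exists>g. is_kernel \<Omega> g \<and> (\<forall>z\<in>\<Omega>. \<forall>w\<in>\<Omega>. l z w = g z w / (1 - power_series \<theta> (mult_cnj z w))))"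
  let ?iv = "one_minus_series_invertible \<Omega> \<theta> \<and> strong_Shimorin_certificate \<Omega> k l ?s"

  have G: "0 \<le> ?G b" if cp: "complete_Pick_pair \<Omega> k l" for b
  proof -
    obtain \<rho> where \<rho>: "0 < \<rho>" "ball 0 \<rho> \<subseteq> \<Omega>" using assms(1,3) openE by blast
    show ?thesis
      unfolding assms(6)
    proof (rule master_quotient_nonneg[OF cp ker nz \<rho>(1)])
      show in\<Omega>: "z \<in> \<Omega>" if "norm z < \<rho>" for z using that \<rho>(2) by auto
      show "((\<lambda>a. complex_of_real (kc a) * monom_eval z a * cnj (monom_eval w a)) has_sum k z w) UNIV"
        if "norm z < \<rho>" "norm w < \<rho>" for z w
        using has_sum_diagonal_series[of kc z w] k_series in\<Omega>[OF that(1)] in\<Omega>[OF that(2)] kc by simp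
      show "((\<lambda>a. complex_of_real (lc a) * monom_eval z a * cnj (monom_eval w a)) has_sum l z w) UNIV"
        if "norm z < \<rho>" "norm w < \<rho>" for z w
        using has_sum_diagonal_series[of lc z w] l_series in\<Omega>[OF that(1)] in\<Omega>[OF that(2)] lc by simp
    qed (use kc lc in auto)
  qed

  have inclusions: "\<Omega> \<subseteq> conv_domain lc \<and> conv_domain lc \<subseteq> conv_domain_lt1 \<theta> \<and> conv_domain_lt1 \<theta> \<subseteq> conv_domain kc"
    if cp: "complete_Pick_pair \<Omega> k l"
  proof (intro conjI subsetI)
    fix x assume "x \<in> \<Omega>"
    then obtain r where "r > 0" "ball x r \<subseteq> \<Omega>" using assms(1) openE by blast
    then show "x \<in> conv_domain lc" unfolding conv_domain_iff using l_series(1) by blast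
  next
    fix x assume "x \<in> conv_domain lc"
    then obtain r where r: "r > 0" "\<And>y. y \<in> ball x r \<Longrightarrow> summable_at lc y" unfolding conv_domain_iff by blast
    have "summable_at \<theta> y" "square_series \<theta> y < 1" if "y \<in> ball x r" for y
      using certificate_below[of \<theta> lc y] \<theta> lc G[OF cp] r(2)[OF that] by auto
    then show "x \<in> conv_domain_lt1 \<theta>"
      unfolding conv_domain_lt1_iff[of \<theta>, OF \<theta>(2)] conv_domain_iff using r(1) centre_in_ball by blast
  next
    fix x assume "x \<in> conv_domain_lt1 \<theta>"
    then obtain r where r: "r > 0" "\<And>y. y \<in> ball x r \<Longrightarrow> summable_at \<theta> y" and lt: "square_series \<theta> x < 1"
      unfolding conv_domain_lt1_iff[of \<theta>, OF \<theta>(2)] conv_domain_iff by blast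
    \<comment> \<open>By continuity \<open>\<theta> < 1\<close> persists near \<open>x\<close>, where the renewal inequality bounds the series of \<open>k\<close>.\<close>
    have "continuous_on (ball x r) (square_series \<theta>)"
      using \<theta> r by (intro continuous_on_square_series) auto
    from continuous_open_preimage[OF this open_ball open_lessThan[of 1]]
    have "open (ball x r \<inter> square_series \<theta> -` {..<1})" .
    moreover have "x \<in> ball x r \<inter> square_series \<theta> -` {..<1}" using lt r(1) by simp
    ultimately have "\<exists>e>0. ball x e \<subseteq> ball x r \<inter> square_series \<theta> -` {..<1}"
      unfolding open_contains_ball by blast
    then obtain e where e: "e > 0" "ball x e \<subseteq> ball x r \<inter> square_series \<theta> -` {..<1}" by blast
    have "summable_at kc y" if "y \<in> ball x e" for y
      using that e(2) r(2) kc \<theta> le by (intro summable_at_renewal[of kc \<theta>]) auto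
    then show "x \<in> conv_domain kc" unfolding conv_domain_iff using e(1) by blast
  qed

  have i_v: ?v if cp: "complete_Pick_pair \<Omega> k l"
  proof -
    have \<theta>lt: "summable_at \<theta> z" "square_series \<theta> z < 1" if "z \<in> \<Omega>" for z
      using certificate_below[of \<theta> lc z] \<theta> lc G[OF cp] l_series(1) that by auto
    have ne: "1 - diagonal_series \<theta> z w \<noteq> 0" if "z \<in> \<Omega>" "w \<in> \<Omega>" for z w
    proof -
      have "cmod (diagonal_series \<theta> z w) \<le> (square_series \<theta> z + square_series \<theta> w) / 2"
        by (rule norm_diagonal_series_le[of \<theta>, OF \<theta>(1) \<theta>lt(1)[OF that(1)] \<theta>lt(1)[OF that(2)]])
      also have "\<dots> < 1" using add_strict_mono[OF \<theta>lt(2)[OF that(1)] \<theta>lt(2)[OF that(2)]] by simp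
      finally have "cmod (diagonal_series \<theta> z w) < 1" .
      then show ?thesis by auto
    qed
    have lG: "diagonally_summable ?G z w" "diagonal_series ?G z w = (1 - diagonal_series \<theta> z w) * l z w"
      if "z \<in> \<Omega>" "w \<in> \<Omega>" for z w
    proof -
      have d: "diagonally_summable \<theta> z w" "diagonally_summable lc z w"
        using that \<theta> lc \<theta>lt l_series(1) by (auto intro: diagonally_summable_pair)
      note u = diagonally_summable_unit_minus[OF d(1)]
      show "diagonally_summable ?G z w" "diagonal_series ?G z w = (1 - diagonal_series \<theta> z w) * l z w"
        using diagonally_summable_conv[OF u(1) d(2)] u(2) l_series(2) that by auto
    qed
    have "is_kernel \<Omega> (diagonal_series ?G)"
      using lG(1) G[OF cp] diagonally_summable_self[of ?G] by (intro is_kernel_diagonal_series) auto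
    moreover have "l z w = diagonal_series ?G z w / (1 - power_series \<theta> (mult_cnj z w))" if "z \<in> \<Omega>" "w \<in> \<Omega>" for z w
      unfolding power_series_mult_cnj lG(2)[OF that] using ne[OF that] by simp
    moreover have "one_minus_series_invertible \<Omega> \<theta>"
      using one_minus_series_invertible_iff[of \<theta>] \<theta> \<theta>lt ne by blast
    ultimately show ?thesis by blast
  qed

  have v_iv: ?iv if v: ?v
  proof -
    from v obtain g where g: "is_kernel \<Omega> g"
      "\<And>z w. z \<in> \<Omega> \<Longrightarrow> w \<in> \<Omega> \<Longrightarrow> l z w = g z w / (1 - diagonal_series \<theta> z w)"
      unfolding power_series_mult_cnj by blast
    have inv: "summable_at \<theta> z" "w \<in> \<Omega> \<Longrightarrow> 1 - diagonal_series \<theta> z w \<noteq> 0" if "z \<in> \<Omega>" for z w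
      using v one_minus_series_invertible_iff[of \<theta> \<Omega>] \<theta> that by blast+
    \<comment> \<open>The value one is excluded by invertibility, and beyond it \<open>g(z, z) = (1 - \<theta>(|z|\<^sup>2)) l(z, z)\<close> would be negative.\<close>
    have lt: "square_series \<theta> z < 1" if z: "z \<in> \<Omega>" for z
    proof (rule ccontr)
      assume "\<not> square_series \<theta> z < 1"
      moreover have "g z z = l z z * (1 - diagonal_series \<theta> z z)"
        using g(2)[OF z z] inv(2)[OF z z] by (simp add: nonzero_divide_eq_eq)
      then have "g z z = of_real (square_series lc z * (1 - square_series \<theta> z))"
        unfolding l_diag(1)[OF z] diagonal_series_self[OF inv(1)[OF z]] by simp
      then have "0 \<le> square_series lc z * (1 - square_series \<theta> z)"
        using is_kernel_diag[OF g(1) z] by (simp only: nonneg_of_real_complex)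
      moreover have "square_series \<theta> z \<noteq> 1" using inv(2)[OF z z] by (auto simp: diagonal_series_self[OF inv(1)[OF z]])
      ultimately show False using l_diag(2)[OF z] by (simp add: zero_le_mult_iff)
    qed
    have "is_kernel \<Omega> (diagonal_series \<theta>)" using \<theta> inv by (intro is_kernel_diagonal_series) auto
    moreover have "Re (diagonal_series \<theta> z z) < 1" if "z \<in> \<Omega>" for z
      using inv(1)[OF that] lt[OF that] by (simp add: diagonal_series_self)
    ultimately have s: "complete_Pick_kernel \<Omega> ?s"
      unfolding power_series_mult_cnj by (rule geometric_complete_Pick_kernel)
    have H0: "0 \<le> ?H b" for b using le[of b] by (simp add: conv_unit_minus)
    have H: "diagonally_summable ?H z w" "diagonal_series ?H z w = 1 - (1 - diagonal_series \<theta> z w) * k z w"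
      if "z \<in> \<Omega>" "w \<in> \<Omega>" for z w
    proof -
      have d: "diagonally_summable \<theta> z w" "diagonally_summable kc z w"
        using that \<theta> kc inv k_series(1) by (auto intro: diagonally_summable_pair)
      note u = diagonally_summable_unit_minus[OF d(1)]
      note p = diagonally_summable_conv[OF u(1) d(2)]
      have eq: "?H = unit_minus (conv (unit_minus \<theta>) kc)"
        by (auto simp: fun_eq_iff unit_minus_def conv_zero \<theta> kc)
      show "diagonally_summable ?H z w" "diagonal_series ?H z w = 1 - (1 - diagonal_series \<theta> z w) * k z w"
        unfolding eq using diagonally_summable_unit_minus[OF p(1)] p(2) u(2) k_series(2) that by auto
    qed
    have "is_kernel \<Omega> (diagonal_series ?H)"
      using H(1) H0 diagonally_summable_self[of ?H] by (intro is_kernel_diagonal_series) auto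
    moreover have "k z w = (1 - diagonal_series ?H z w) * ?s z w \<and> l z w = ?s z w * g z w" if "z \<in> \<Omega>" "w \<in> \<Omega>" for z w
      unfolding power_series_mult_cnj H(2)[OF that] using inv(2)[OF that] g(2)[OF that] by simp
    ultimately show ?thesis
      using v s g(1) unfolding strong_Shimorin_certificate_def by blast
  qed

  have iii_ii: "\<exists>p. Shimorin_certificate \<Omega> k l p" if "strong_Shimorin_certificate \<Omega> k l s" for s
    by (rule Shimorin_of_strong[OF that ker(1) assms(3)]) (use k0 nz in auto)
  have ii_i: "complete_Pick_pair \<Omega> k l" if "Shimorin_certificate \<Omega> k l p" for p
    by (rule complete_Pick_pair_of_Shimorin[OF ker nz that])

  have "complete_Pick_pair \<Omega> k l \<Longrightarrow> ?iv" using i_v v_iv by blast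
  moreover have "?iv \<Longrightarrow> complete_Pick_pair \<Omega> k l" using iii_ii ii_i by blast
  moreover have "?v \<Longrightarrow> complete_Pick_pair \<Omega> k l" using v_iv iii_ii ii_i by blast
  ultimately show ?thesis using inclusions i_v iii_ii ii_i by blast
qed

end
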